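(* Let $\mathbf{U}(\widetilde{B},\mathrm{inv})$ be an upper cluster algebra over $\mathbb{C}$ which is a finitely generated $\mathbb{C}$-algebra, and assume that the exchange matrix $\widetilde{B}$ admits a compatible skew-symmetric integer matrix $\Lambda$. Let $Y(\widetilde{B}) = \mathrm{MaxSpec}\, \mathbf{U}(\widetilde{B},\mathrm{inv})$ with the Poisson structure $\pi$ given by the Gekhtman--Shapiro--Vainshtein bracket associated to $\Lambda$. Then the affine Poisson variety $(Y(\widetilde{B}),\pi)$ has a Zariski open $T(\widetilde{B})$-orbit of symplectic leaves, which equals \[ Y(\widetilde{B})^{\mathrm{reg}} \setminus \bigcup_{i\in \mathrm{ninv}} \mathcal{V}(x_i). \]
   Context: Notation: $[1,N]=\{1,\dots,N\}$; $e_1,\dots,e_N$ is the standard basis of $\mathbb{Z}^N$; for a complex variety $Y$, $Y^{\mathrm{reg}}$ and $Y^{\mathrm{sing}}$ are its smooth and singular parts; $\mathcal{V}(f)$ is the zero locus of a regular function $f$. Cluster algebras. Let $N$ be a positive integer, $\mathrm{ex}\subseteq[1,N]$ (mutable indices) and fix a partition $[1,N]\setminus \mathrm{ex}=\mathrm{inv}\sqcup\mathrm{ninv}$ (inverted and non-inverted frozen indices). An exchange matrix is $\widetilde{B}=(b_{ij})\in M_{N\times \mathrm{ex}}(\mathbb{Z})$ whose $\mathrm{ex}\times\mathrm{ex}$ submatrix $B$ (principal part) is skew-symmetrizable: $DB$ is skew-symmetric for some $D=\mathrm{diag}(d_j,\ j\in\mathrm{ex})$ with positive integers $d_j$. Let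 $\mathcal{F}$ be a purely transcendental extension of $\mathbb{C}$ of transcendence degree $N$. A seed is a pair $(\widetilde{\mathbf{x}},\widetilde{B})$ with $\widetilde{\mathbf{x}}=\{x_1,\dots,x_N\}$ a transcendence basis of $\mathcal{F}$ over $\mathbb{C}$ (with $\mathcal F=\mathbb C(x_1,\dots,x_N)$) and $\widetilde{B}$ an exchange matrix. For $k\in\mathrm{ex}$, the mutation $\mu_k(\widetilde{\mathbf{x}},\widetilde{B})$ replaces $x_k$ by $x_k'$ with $x_kx_k'=\prod_{b_{ik}>0}x_i^{b_{ik}}+\prod_{b_{ik}<0}x_i^{-b_{ik}}$, and $\widetilde{B}$ by $(b'_{ij})$, where $b'_{ij}=-b_{ij}$ if $i=k$ or $j=k$, and $b'_{ij}=b_{ij}+\frac{|b_{ik}|b_{kj}+b_{ik}|b_{kj}|}{2}$ otherwise. Write $\sim$ for the equivalence relation generated by mutations. Fix an initial seed $(\widetilde{\mathbf{x}},\widetilde{B})$; the frozen variables $x_i$, $i\notin \mathrm{ex}$, belong to all seeds equivalent to it. The upper cluster algebra is \[ \mathbf{U}(\widetilde{B},\mathrm{inv})=\bigcap_{(\widetilde{\mathbf{x}}',\widetilde{B}')\sim(\widetilde{\mathbf{x}},\widetilde{B})}\mathbb{C}[(x_k')^{\pm1},x_i';\ k\in\mathrm{ex}\sqcup\mathrm{inv},\ i\in\mathrm{ninv}]\subset\mathcal{F}. \] Compatibility and Poisson structure. A skew-symmetric matrix $\Lambda=(\lambda_{ij})\in M_N(\mathbb{Z})$ is compatible with $\widetilde{B}$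 if $\widetilde{B}^\top\Lambda=[D\ 0]$ for some diagonal matrix $D=\mathrm{diag}(d_j,\ j\in\mathrm{ex})$ with positive integer entries, where $0$ is the zero block of size $\mathrm{ex}\times([1,N]\setminus\mathrm{ex})$. The Gekhtman--Shapiro--Vainshtein (GSV) bracket associated to $\Lambda$ is the restriction to $\mathbf{U}(\widetilde{B},\mathrm{inv})$ of the Poisson bracket on $\mathcal{F}$ with $\{x_k,x_i\}=\lambda_{ki}x_kx_i$ for all $k,i\in[1,N]$; it is known that it preserves $\mathbf{U}(\widetilde{B},\mathrm{inv})$ and that the variables of every equivalent seed satisfy $\{x'_k,x'_i\}=\lambda'_{ki}x'_kx'_i$ for some integers $\lambda'_{ki}$. Torus action. Let $n(\widetilde{B})$ be the rank of $\mathrm{Ker}(\widetilde{B}^\top)=\{\nu\in\mathbb{Z}^N:\widetilde{B}^\top\nu=0\}$, fix a $\mathbb{Z}$-basis $\nu^1,\dots,\nu^{n(\widetilde{B})}$ of it, and set $T(\widetilde{B})=(\mathbb{C}^\times)^{n(\widetilde{B})}$. This torus acts on $\mathbf{U}(\widetilde{B},\mathrm{inv})$ by Poisson automorphisms determined by $(t_1,\dots,t_{n(\widetilde{B})})\cdot x_k=\prod_i t_i^{\ell\,\nu^i\cdot e_k}\,x_k$, $k\in[1,N]$, where $\ell$ is a fixed positive integer (its choice does not affect the orbits); hence it acts on $Y(\widetilde{B})$. Symplectic leaves. For a complex affine Poisson variety $X$, $X^{\mathrm{sing}}$ is a Poisson subvariety, and the symplectic leaves of $X$ are defined recursively as the symplectic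 leaves of the complex Poisson manifold $X^{\mathrm{reg}}$ together with those of $X^{\mathrm{sing}}$. A $T(\widetilde{B})$-orbit of symplectic leaves is a set $T(\widetilde{B})\cdot\mathcal{S}=\bigcup_{t}t\cdot\mathcal{S}$ for a symplectic leaf $\mathcal{S}$. *)

theory Defs
  imports
    "HOL-Analysis.Analysis"
    "HOL-Algebra.Embedded_Algebras"
    "HOL-Algebra.QuotRing"
    "HOL-Algebra.Ideal_Product"
begin

section \<open>Algebras over the complex numbers inside a field\<close>

text \<open>
  The ambient field \<open>\<F>\<close> is a type \<open>'f::field\<close>; its structure of a field extension of the
  complex numbers is a unital ring homomorphism \<open>\<iota>\<close>. Algebras over the complex
  numbers occur as subsets of \<open>'f\<close>.
\<close>

definition unital_ring_hom :: "('a::ring_1 \<Rightarrow> 'b::ring_1) \<Rightarrow> bool" where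
  "unital_ring_hom h \<longleftrightarrow>
     h 1 = 1 \<and> (\<forall>a b. h (a + b) = h a + h b) \<and> (\<forall>a b. h (a * b) = h a * h b)"

inductive_set generated_algebra :: "(complex \<Rightarrow> 'f::field) \<Rightarrow> 'f set \<Rightarrow> 'f set"
  for \<iota> S where
    scalar: "\<iota> c \<in> generated_algebra \<iota> S"
  | gen: "s \<in> S \<Longrightarrow> s \<in> generated_algebra \<iota> S"
  | add: "\<lbrakk>f \<in> generated_algebra \<iota> S; g \<in> generated_algebra \<iota> S\<rbrakk>
           \<Longrightarrow> f + g \<in> generated_algebra \<iota> S"
  | mult: "\<lbrakk>f \<in> generated_algebra \<iota> S; g \<in> generated_algebra \<iota> S\<rbrakk>
            \<Longrightarrow> f * g \<in> generated_algebra \<iota> S"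

definition finitely_generated_algebra :: "(complex \<Rightarrow> 'f::field) \<Rightarrow> 'f set \<Rightarrow> bool" where
  "finitely_generated_algebra \<iota> A \<longleftrightarrow> (\<exists>S. finite S \<and> generated_algebra \<iota> S = A)"

definition ring_on :: "'f::field set \<Rightarrow> 'f ring" where
  "ring_on A = \<lparr>carrier = A, monoid.mult = (*), one = 1, zero = 0, add = (+)\<rparr>"


section \<open>Seeds, mutations and upper cluster algebras\<close>

text \<open>
  Only the values \<open>x i\<close> with \<open>i \<in> {1..N}\<close> and \<open>b i j\<close> with \<open>i \<in> {1..N}\<close>, \<open>j \<in> ex\<close> are
  meaningful.
\<close>

type_synonym exmatrix = "nat \<Rightarrow> nat \<Rightarrow> int"

definition skew_symmetrizable :: "nat set \<Rightarrow> exmatrix \<Rightarrow> bool" where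
  "skew_symmetrizable ex b \<longleftrightarrow>
     (\<exists>d :: nat \<Rightarrow> int. (\<forall>j\<in>ex. d j > 0) \<and> (\<forall>i\<in>ex. \<forall>j\<in>ex. d i * b i j = - (d j * b j i)))"

definition algebraically_independent ::
  "(complex \<Rightarrow> 'f::field) \<Rightarrow> nat \<Rightarrow> (nat \<Rightarrow> 'f) \<Rightarrow> bool" where
  "algebraically_independent \<iota> N x \<longleftrightarrow>
     (\<forall>M c. finite M \<and> M \<subseteq> ({1..N} \<rightarrow>\<^sub>E (UNIV :: nat set)) \<and>
            (\<Sum>a\<in>M. \<iota> (c a) * (\<Prod>i\<in>{1..N}. x i ^ a i)) = 0
        \<longrightarrow> (\<forall>a\<in>M. c a = 0))"

definition generates_field ::
  "(complex \<Rightarrow> 'f::field) \<Rightarrow> nat \<Rightarrow> (nat \<Rightarrow> 'f) \<Rightarrow> bool" where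
  "generates_field \<iota> N x \<longleftrightarrow>
     (\<forall>f. \<exists>p\<in>generated_algebra \<iota> (x ` {1..N}).
          \<exists>q\<in>generated_algebra \<iota> (x ` {1..N}). q \<noteq> 0 \<and> f = p / q)"

definition is_seed ::
  "(complex \<Rightarrow> 'f::field) \<Rightarrow> nat \<Rightarrow> nat set \<Rightarrow> (nat \<Rightarrow> 'f) \<times> exmatrix \<Rightarrow> bool" where
  "is_seed \<iota> N ex s \<longleftrightarrow>
     algebraically_independent \<iota> N (fst s) \<and> generates_field \<iota> N (fst s) \<and>
     skew_symmetrizable ex (snd s)"

text \<open>The integer \<open>\<bar>b i k\<bar> * b k j + b i k * \<bar>b k j\<bar>\<close> is always even, so \<open>div\<close> is exact.\<close>

definition mutate_matrix :: "nat \<Rightarrow> exmatrix \<Rightarrow> exmatrix" where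
  "mutate_matrix k b =
     (\<lambda>i j. if i = k \<or> j = k then - b i j
            else b i j + (\<bar>b i k\<bar> * b k j + b i k * \<bar>b k j\<bar>) div 2)"

definition mutate_variables ::
  "nat \<Rightarrow> nat \<Rightarrow> exmatrix \<Rightarrow> (nat \<Rightarrow> 'f::field) \<Rightarrow> nat \<Rightarrow> 'f" where
  "mutate_variables N k b x =
     x(k := ((\<Prod>i | i \<in> {1..N} \<and> b i k > 0. x i ^ nat (b i k)) +
             (\<Prod>i | i \<in> {1..N} \<and> b i k < 0. x i ^ nat (- b i k))) / x k)"

definition mutation_step ::
  "(complex \<Rightarrow> 'f::field) \<Rightarrow> nat \<Rightarrow> nat set \<Rightarrow>
   (nat \<Rightarrow> 'f) \<times> exmatrix \<Rightarrow> (nat \<Rightarrow> 'f) \<times> exmatrix \<Rightarrow> bool" where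
  "mutation_step \<iota> N ex s s' \<longleftrightarrow>
     is_seed \<iota> N ex s \<and>
     (\<exists>k\<in>ex. s' = (mutate_variables N k (snd s) (fst s), mutate_matrix k (snd s)))"

definition mutation_equivalent ::
  "(complex \<Rightarrow> 'f::field) \<Rightarrow> nat \<Rightarrow> nat set \<Rightarrow>
   (nat \<Rightarrow> 'f) \<times> exmatrix \<Rightarrow> (nat \<Rightarrow> 'f) \<times> exmatrix \<Rightarrow> bool" where
  "mutation_equivalent \<iota> N ex = equivclp (mutation_step \<iota> N ex)"

definition mixed_laurent_ring ::
  "(complex \<Rightarrow> 'f::field) \<Rightarrow> nat set \<Rightarrow> nat set \<Rightarrow> nat set \<Rightarrow> (nat \<Rightarrow> 'f) \<Rightarrow> 'f set" where
  "mixed_laurent_ring \<iota> ex Inv Ninv x =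
     generated_algebra \<iota> (x ` (ex \<union> Inv) \<union> (\<lambda>k. inverse (x k)) ` (ex \<union> Inv) \<union> x ` Ninv)"

definition upper_cluster_algebra ::
  "(complex \<Rightarrow> 'f::field) \<Rightarrow> nat \<Rightarrow> nat set \<Rightarrow> nat set \<Rightarrow> nat set \<Rightarrow>
   (nat \<Rightarrow> 'f) \<times> exmatrix \<Rightarrow> 'f set" where
  "upper_cluster_algebra \<iota> N ex Inv Ninv s =
     (\<Inter>s' \<in> {s'. mutation_equivalent \<iota> N ex s s'}.
        mixed_laurent_ring \<iota> ex Inv Ninv (fst s'))"


section \<open>Compatible matrices, the GSV bracket and the torus action\<close>

definition compatible :: "nat \<Rightarrow> nat set \<Rightarrow> exmatrix \<Rightarrow> (nat \<Rightarrow> nat \<Rightarrow> int) \<Rightarrow> bool" where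
  "compatible N ex b \<Lambda> \<longleftrightarrow>
     (\<forall>i\<in>{1..N}. \<forall>j\<in>{1..N}. \<Lambda> i j = - \<Lambda> j i) \<and>
     (\<exists>d :: nat \<Rightarrow> int. (\<forall>j\<in>ex. d j > 0) \<and>
        (\<forall>j\<in>ex. \<forall>k\<in>{1..N}. (\<Sum>i\<in>{1..N}. b i j * \<Lambda> i k) = (if k = j then d j else 0)))"

definition poisson_bracket ::
  "(complex \<Rightarrow> 'f::field) \<Rightarrow> ('f \<Rightarrow> 'f \<Rightarrow> 'f) \<Rightarrow> bool" where
  "poisson_bracket \<iota> br \<longleftrightarrow>
     (\<forall>f g h. br (f + g) h = br f h + br g h) \<and>
     (\<forall>c f g. br (\<iota> c * f) g = \<iota> c * br f g) \<and>
     (\<forall>f g. br f g = - br g f) \<and>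
     (\<forall>f g h. br f (g * h) = br f g * h + g * br f h) \<and>
     (\<forall>f g h. br f (br g h) + br g (br h f) + br h (br f g) = 0)"

text \<open>
  When \<open>x\<close> is a transcendence basis generating the field and \<open>\<Lambda>\<close> is skew-symmetric, there
  is exactly one such bracket on the field.
\<close>

definition gsv_bracket ::
  "(complex \<Rightarrow> 'f::field) \<Rightarrow> nat \<Rightarrow> (nat \<Rightarrow> 'f) \<Rightarrow> (nat \<Rightarrow> nat \<Rightarrow> int) \<Rightarrow> 'f \<Rightarrow> 'f \<Rightarrow> 'f" where
  "gsv_bracket \<iota> N x \<Lambda> =
     (THE br. poisson_bracket \<iota> br \<and>
        (\<forall>k\<in>{1..N}. \<forall>i\<in>{1..N}. br (x k) (x i) = of_int (\<Lambda> k i) * x k * x i))"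

definition kernel_lattice :: "nat \<Rightarrow> nat set \<Rightarrow> exmatrix \<Rightarrow> (nat \<Rightarrow> int) set" where
  "kernel_lattice N ex b =
     {v \<in> {1..N} \<rightarrow>\<^sub>E UNIV. \<forall>j\<in>ex. (\<Sum>i\<in>{1..N}. b i j * v i) = 0}"

definition kernel_basis ::
  "nat \<Rightarrow> nat set \<Rightarrow> exmatrix \<Rightarrow> nat \<Rightarrow> (nat \<Rightarrow> nat \<Rightarrow> int) \<Rightarrow> bool" where
  "kernel_basis N ex b n \<nu> \<longleftrightarrow>
     (\<forall>i\<in>{1..n}. \<nu> i \<in> kernel_lattice N ex b) \<and>
     (\<forall>v\<in>kernel_lattice N ex b.
        \<exists>!c. c \<in> {1..n} \<rightarrow>\<^sub>E (UNIV :: int set) \<and>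
             (\<forall>k\<in>{1..N}. v k = (\<Sum>i\<in>{1..n}. c i * \<nu> i k)))"

definition torus :: "nat \<Rightarrow> (nat \<Rightarrow> complex) set" where
  "torus n = {1..n} \<rightarrow>\<^sub>E - {0}"

text \<open>
  The action of \<open>t\<close> is the unique automorphism of the field over the complex numbers with the
  prescribed values on the initial cluster; the action on the upper cluster algebra is its
  restriction.
\<close>

definition torus_act ::
  "(complex \<Rightarrow> 'f::field) \<Rightarrow> nat \<Rightarrow> (nat \<Rightarrow> 'f) \<Rightarrow> nat \<Rightarrow> (nat \<Rightarrow> nat \<Rightarrow> int) \<Rightarrow> nat \<Rightarrow>
   (nat \<Rightarrow> complex) \<Rightarrow> 'f \<Rightarrow> 'f" where
  "torus_act \<iota> N x n \<nu> l t =
     (THE \<theta>. unital_ring_hom \<theta> \<and> (\<forall>c. \<theta> (\<iota> c) = \<iota> c) \<and>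
        (\<forall>k\<in>{1..N}. \<theta> (x k) = \<iota> (\<Prod>i\<in>{1..n}. t i powi (int l * \<nu> i k)) * x k))"


section \<open>Affine varieties\<close>

text \<open>
  A finitely generated algebra \<open>A\<close> over the complex numbers defines the affine variety
  \<open>max_spec A\<close>. A closed subvariety is given by its set \<open>Z\<close> of points; its coordinate ring is
  \<open>A\<close> modulo \<open>vanishing_ideal A Z\<close>.
\<close>

definition max_spec :: "'f::field set \<Rightarrow> 'f set set" where
  "max_spec A = {m. maximalideal m (ring_on A)}"

definition value_at :: "(complex \<Rightarrow> 'f::field) \<Rightarrow> 'f set \<Rightarrow> 'f \<Rightarrow> complex" where
  "value_at \<iota> m f = (THE c. f - \<iota> c \<in> m)"

definition zero_locus :: "'f::field set \<Rightarrow> 'f \<Rightarrow> 'f set set" where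
  "zero_locus A f = {m \<in> max_spec A. f \<in> m}"

definition zariski_open :: "'f::field set \<Rightarrow> 'f set set \<Rightarrow> bool" where
  "zariski_open A W \<longleftrightarrow> (\<exists>S \<subseteq> A. W = max_spec A - (\<Inter>f\<in>S. zero_locus A f))"

definition vanishing_ideal :: "'f::field set \<Rightarrow> 'f set set \<Rightarrow> 'f set" where
  "vanishing_ideal A Z = {f \<in> A. \<forall>m\<in>Z. f \<in> m}"

text \<open>The Krull dimension of the local ring of \<open>Z\<close> at \<open>m\<close>.\<close>

definition local_dim :: "'f::field set \<Rightarrow> 'f set set \<Rightarrow> 'f set \<Rightarrow> enat" where
  "local_dim A Z m =
     Sup {enat d | d. \<exists>p :: nat \<Rightarrow> 'f set.
            (\<forall>i\<le>d. primeideal (p i) (ring_on A) \<and> vanishing_ideal A Z \<subseteq> p i \<and> p i \<subseteq> m) \<and>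
            (\<forall>i<d. p i \<subset> p (Suc i))}"

text \<open>
  With \<open>I = vanishing_ideal A Z\<close>, the Zariski cotangent space of \<open>Z\<close> at \<open>m\<close> is
  \<open>m / (m\<^sup>2 + I)\<close>. It is viewed inside the ring \<open>A / (m\<^sup>2 + I)\<close> as a vector space over the
  image of the complex numbers.
\<close>

definition cotangent_dim ::
  "(complex \<Rightarrow> 'f::field) \<Rightarrow> 'f set \<Rightarrow> 'f set set \<Rightarrow> 'f set \<Rightarrow> nat \<Rightarrow> bool" where
  "cotangent_dim \<iota> A Z m d \<longleftrightarrow>
     (let R = ring_on A;
          J = ideal_prod R m m <+>\<^bsub>R\<^esub> vanishing_ideal A Z
      in ring.dimension (R Quot J) d (range (\<lambda>c. J +>\<^bsub>R\<^esub> \<iota> c)) ((\<lambda>f. J +>\<^bsub>R\<^esub> f) ` m))"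

text \<open>A point is smooth if its local ring is regular.\<close>

definition regular_part ::
  "(complex \<Rightarrow> 'f::field) \<Rightarrow> 'f set \<Rightarrow> 'f set set \<Rightarrow> 'f set set" where
  "regular_part \<iota> A Z = {m \<in> Z. \<exists>d. cotangent_dim \<iota> A Z m d \<and> local_dim A Z m = enat d}"

definition singular_part ::
  "(complex \<Rightarrow> 'f::field) \<Rightarrow> 'f set \<Rightarrow> 'f set set \<Rightarrow> 'f set set" where
  "singular_part \<iota> A Z = Z - regular_part \<iota> A Z"


section \<open>Symplectic leaves\<close>

text \<open>
  Points of complex \<open>n\<close>-space are extensional functions on \<open>{..<n}\<close>. A function of several
  complex variables is holomorphic if it is continuous and holomorphic in each variable.
\<close>

abbreviation cspace :: "nat \<Rightarrow> (nat \<Rightarrow> complex) topology" where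
  "cspace n \<equiv> product_topology (\<lambda>_. euclidean) {..<n}"

definition holomorphic_several ::
  "nat \<Rightarrow> (nat \<Rightarrow> complex) set \<Rightarrow> ((nat \<Rightarrow> complex) \<Rightarrow> complex) \<Rightarrow> bool" where
  "holomorphic_several n \<Omega> H \<longleftrightarrow>
     openin (cspace n) \<Omega> \<and>
     continuous_map (subtopology (cspace n) \<Omega>) euclidean H \<and>
     (\<forall>p\<in>\<Omega>. \<forall>i<n. (\<lambda>z. H (p(i := z))) field_differentiable (at (p i)))"

definition partial_deriv ::
  "nat \<Rightarrow> ((nat \<Rightarrow> complex) \<Rightarrow> complex) \<Rightarrow> (nat \<Rightarrow> complex) \<Rightarrow> complex" where
  "partial_deriv i H p = deriv (\<lambda>z. H (p(i := z))) (p i)"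

text \<open>
  \<open>\<gamma>\<close> is a trajectory in the complex manifold \<open>regular_part \<iota> A Z\<close> of the Hamiltonian vector
  field of a locally defined holomorphic function \<open>h\<close>. Holomorphic functions on the manifold
  are locally of the form \<open>h = H \<circ> (F\<^sub>0, \<dots>, F\<^sub>n\<^sub>-\<^sub>1)\<close> with regular functions \<open>F\<^sub>i\<close> and \<open>H\<close>
  holomorphic on an open subset of complex \<open>n\<close>-space, and then
  \<open>{h, f} = (\<Sum>i<n. \<partial>\<^sub>iH(F\<^sub>0, \<dots>, F\<^sub>n\<^sub>-\<^sub>1) {F\<^sub>i, f})\<close>. When \<open>Z\<close> is a Poisson subvariety, that is,
  the bracket descends to the coordinate ring of \<open>Z\<close>, the values of \<open>{F\<^sub>i, f}\<close> on \<open>Z\<close> are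
  those of the bracket of the restrictions of \<open>F\<^sub>i\<close> and \<open>f\<close>. The manifold is embedded in an affine
  space by finitely many generators of \<open>A\<close>, so a curve in it is differentiable iff its
  compositions with all regular functions are.
\<close>

definition hamiltonian_trajectory ::
  "(complex \<Rightarrow> 'f::field) \<Rightarrow> 'f set \<Rightarrow> ('f \<Rightarrow> 'f \<Rightarrow> 'f) \<Rightarrow> 'f set set \<Rightarrow>
   (real \<Rightarrow> 'f set) \<Rightarrow> bool" where
  "hamiltonian_trajectory \<iota> A br Z \<gamma> \<longleftrightarrow>
     \<gamma> ` {0..1} \<subseteq> regular_part \<iota> A Z \<and>
     (\<exists>n F \<Omega> H.
        F ` {..<n} \<subseteq> A \<and> holomorphic_several n \<Omega> H \<and>
        (\<forall>t\<in>{0..1}.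
           (let p = (\<lambda>i\<in>{..<n}. value_at \<iota> (\<gamma> t) (F i)) in
              p \<in> \<Omega> \<and>
              (\<forall>f\<in>A.
                 ((\<lambda>s. value_at \<iota> (\<gamma> s) f) has_vector_derivative
                    (\<Sum>i<n. partial_deriv i H p * value_at \<iota> (\<gamma> t) (br (F i) f)))
                 (at t within {0..1})))))"

definition hamiltonian_connected ::
  "(complex \<Rightarrow> 'f::field) \<Rightarrow> 'f set \<Rightarrow> ('f \<Rightarrow> 'f \<Rightarrow> 'f) \<Rightarrow> 'f set set \<Rightarrow>
   'f set \<Rightarrow> 'f set \<Rightarrow> bool" where
  "hamiltonian_connected \<iota> A br Z =
     (\<lambda>m m'. \<exists>\<gamma>. hamiltonian_trajectory \<iota> A br Z \<gamma> \<and> \<gamma> 0 = m \<and> \<gamma> 1 = m')\<^sup>*\<^sup>*"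

text \<open>
  The symplectic leaves of a complex Poisson manifold are the classes of points that can be joined
  by piecewise smooth curves all of whose pieces are trajectories of locally defined Hamiltonian
  vector fields.
\<close>

inductive symplectic_leaf ::
  "(complex \<Rightarrow> 'f::field) \<Rightarrow> 'f set \<Rightarrow> ('f \<Rightarrow> 'f \<Rightarrow> 'f) \<Rightarrow> 'f set set \<Rightarrow> 'f set set \<Rightarrow> bool"
  for \<iota> A br where
    regular: "m \<in> regular_part \<iota> A Z \<Longrightarrow>
       symplectic_leaf \<iota> A br Z {m'. hamiltonian_connected \<iota> A br Z m m'}"
  | singular: "symplectic_leaf \<iota> A br (singular_part \<iota> A Z) S \<Longrightarrow> symplectic_leaf \<iota> A br Z S"

text \<open>
  An automorphism \<open>\<theta>\<close> of \<open>A\<close> sends the point \<open>m\<close> to \<open>\<theta> ` m\<close>, so that the value of \<open>f\<close> at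
  \<open>\<theta> ` m\<close> is the value of the inverse image of \<open>f\<close> under \<open>\<theta>\<close> at \<open>m\<close>.
\<close>

definition torus_orbit ::
  "(complex \<Rightarrow> 'f::field) \<Rightarrow> nat \<Rightarrow> (nat \<Rightarrow> 'f) \<Rightarrow> nat \<Rightarrow> (nat \<Rightarrow> nat \<Rightarrow> int) \<Rightarrow> nat \<Rightarrow>
   'f set set \<Rightarrow> 'f set set" where
  "torus_orbit \<iota> N x n \<nu> l S =
     (\<Union>t\<in>torus n. (\<lambda>m. torus_act \<iota> N x n \<nu> l t ` m) ` S)"

end

theory Submission
  imports
    Defs
    "Jordan_Normal_Form.Determinant"
    "HOL-Complex_Analysis.Complex_Analysis"
    "HOL-Computational_Algebra.Formal_Laurent_Series"
    "HOL-Computational_Algebra.Fundamental_Theorem_Algebra"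
begin

text \<open>By the upper bound theorem, \<open>U\<close> is the intersection of the Laurent rings of the initial cluster and
  of its one-step mutations. The matrix of the form
  \<open>Th f g = {f, g} + (\<Sum>p. Ed p f * Ed p g)\<close>, where \<open>Ed p\<close> is the infinitesimal action of the
  \<open>p\<close>-th factor of the torus, is nonsingular on each cluster. Its Gram determinant in local
  coordinates at a smooth point off the divisors \<open>x i = 0\<close> with \<open>i \<in> Ninv\<close> divides, up to
  a function that is nonzero at this point, the Gram determinant of every cluster, a monomial. It
  therefore divides such a function in each of these Laurent rings, hence in \<open>U\<close>, and does not
  vanish at the point.

  The derivations \<open>Th f\<close> therefore produce a chain of primes of maximal length \<open>N\<close> between any ideal
  invariant under the bracket and the torus and any maximal ideal of such a point containing it, so
  that the invariant ideal is zero. Applied to the functions vanishing on all points from which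
  a given such point can be reached along Hamiltonian trajectories and torus translations, this gives
  a point inside the cluster torus. There the flows of the \<open>x j\<close> and the torus connect any two
  points. Conversely the leaves stay off the divisors, because a frozen variable satisfies a linear
  differential equation along every Hamiltonian trajectory.\<close>

text \<open>The expected route is to show that torus orbits of leaves are open in the classical
  topology and to conclude by connectedness of the smooth locus. Here the ideal argument takes the
  place of connectedness: it rests on the fact that a chain of primes has length at most the
  transcendence degree \<open>N\<close>. This is why smoothness enters as the existence of
  \<open>N\<close> functions spanning the cotangent space, and why reachability is followed in one
  direction only.

  The bracket may be degenerate, and the torus directions have to be combined with it into one
  nonsingular form. Adding squares achieves this because a skew form vanishes on the diagonal: over
  the integers, a vector in the kernel of the sum is killed by both parts, and compatibility says
  that the rows of \<Lambda> and the \<nu> p together span.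

  The upper bound theorem makes divisibility in \<open>U\<close> checkable: for the initial cluster
  and its neighbours a single exchange relation shows that bracket and torus are diagonal on the
  cluster, whereas an arbitrary cluster would require following both through all mutations.\<close>

no_notation Finite_Cartesian_Product.vec_nth (infixl "$" 90)
no_notation index_mat (infixl "$$" 100)
notation fls_nth (infixl "$$" 75)
hide_const (open) Determinants.det Finite_Cartesian_Product.mat Finite_Cartesian_Product.row
  Coset.order

section \<open>Complex algebras inside a field\<close>

lemma equivclp_invariant:
  assumes "equivclp r a b" "P a" "\<And>x y. r x y \<Longrightarrow> P x \<longleftrightarrow> P y"
  shows "P b" using assms(1) by (induction rule: equivclp_induct) (use assms in blast)+

locale complex_algebra =
  fixes \<iota> :: "complex \<Rightarrow> 'f::field"
  assumes unital: "unital_ring_hom \<iota>"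
begin

abbreviation "alg \<equiv> generated_algebra \<iota>"

lemma \<iota>_1 [simp]: "\<iota> 1 = 1"
  and \<iota>_add: "\<iota> (a + b) = \<iota> a + \<iota> b"
  and \<iota>_mult: "\<iota> (a * b) = \<iota> a * \<iota> b" using unital unfolding unital_ring_hom_def by auto

lemma \<iota>_0 [simp]: "\<iota> 0 = 0"
proof -
  have "\<iota> 0 + \<iota> 0 = \<iota> 0 + 0" using \<iota>_add[of 0 0] by simp
  thus ?thesis by (rule add_left_imp_eq)
qed

sublocale \<iota>: field_hom \<iota> by unfold_locales (auto simp: \<iota>_add \<iota>_mult)

sublocale V: vector_space "\<lambda>c f. \<iota> c * f" by unfold_locales (auto simp: algebra_simps \<iota>_add \<iota>_mult)

text \<open>Characteristic zero is inherited from the complex numbers through \<iota>; the divisions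
  by factorials and by 2 below rely on it.\<close>

lemma of_int_eq_0_F [simp]: "(of_int n :: 'f) = 0 \<longleftrightarrow> n = 0"
proof -
  have "(of_int n :: 'f) = \<iota> (of_int n)" by (simp add: \<iota>.hom_of_int)
  thus ?thesis by (simp del: \<iota>.hom_of_int)
qed

lemma of_nat_eq_0_F [simp]: "(of_nat n :: 'f) = 0 \<longleftrightarrow> n = 0" using of_int_eq_0_F[of "int n"] by simp

definition subalg :: "'f set \<Rightarrow> bool" where
  "subalg A \<longleftrightarrow> range \<iota> \<subseteq> A \<and> (\<forall>f\<in>A. \<forall>g\<in>A. f + g \<in> A \<and> f * g \<in> A)"

lemma subalgI:
  assumes "\<And>c. \<iota> c \<in> A" "\<And>f g. f \<in> A \<Longrightarrow> g \<in> A \<Longrightarrow> f + g \<in> A"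
    "\<And>f g. f \<in> A \<Longrightarrow> g \<in> A \<Longrightarrow> f * g \<in> A"
  shows "subalg A" using assms unfolding subalg_def by auto

context
  fixes A assumes A: "subalg A"
begin

lemma sub_const: "\<iota> c \<in> A"
  and sub_add: "f \<in> A \<Longrightarrow> g \<in> A \<Longrightarrow> f + g \<in> A"
  and sub_mult: "f \<in> A \<Longrightarrow> g \<in> A \<Longrightarrow> f * g \<in> A" using A unfolding subalg_def by auto

lemma sub_0: "0 \<in> A" using sub_const[of 0] by simp
lemma sub_1: "1 \<in> A" using sub_const[of 1] by simp

lemma sub_uminus: assumes "f \<in> A" shows "- f \<in> A"
proof -
  have "\<iota> (-1) * f \<in> A" by (intro sub_mult sub_const assms)
  thus ?thesis by (simp add: \<iota>.hom_uminus)
qed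

lemma sub_diff: "f \<in> A \<Longrightarrow> g \<in> A \<Longrightarrow> f - g \<in> A" using sub_add[of f "- g"] sub_uminus by simp

lemma sub_of_int: "of_int n \<in> A" using sub_const[of "of_int n"] by (simp add: \<iota>.hom_of_int)

lemma sub_of_nat: "of_nat n \<in> A" using sub_of_int[of "int n"] by simp

lemma sub_sum: "(\<And>i. i \<in> I \<Longrightarrow> f i \<in> A) \<Longrightarrow> sum f I \<in> A"
  by (induction I rule: infinite_finite_induct) (auto intro: sub_0 sub_add)

lemma sub_prod: "(\<And>i. i \<in> I \<Longrightarrow> f i \<in> A) \<Longrightarrow> prod f I \<in> A"
  by (induction I rule: infinite_finite_induct) (auto intro: sub_1 sub_mult)

lemma sub_power: "f \<in> A \<Longrightarrow> f ^ n \<in> A" by (induction n) (auto intro: sub_1 sub_mult)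

lemma sub_generated: "S \<subseteq> A \<Longrightarrow> alg S \<subseteq> A"
proof
  fix f assume "S \<subseteq> A" "f \<in> alg S"
  from this(2,1) show "f \<in> A" by induction (auto intro: sub_const sub_add sub_mult)
qed

end

lemma subalg_generated: "subalg (alg S)" by (rule subalgI) (auto intro: generated_algebra.intros)

lemma subalg_Inter: "(\<And>A. A \<in> \<A> \<Longrightarrow> subalg A) \<Longrightarrow> subalg (\<Inter>\<A>)" unfolding subalg_def by blast

lemma span_subset_subalg:
  assumes "subalg A" "S \<subseteq> A" shows "V.span S \<subseteq> A"
proof
  fix f assume "f \<in> V.span S"
  thus "f \<in> A" by (induction rule: V.span_induct_alt)
       (use assms in \<open>auto intro!: sub_0 sub_add sub_mult sub_const\<close>)
qed

lemma subalg_span: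
  assumes "1 \<in> V.span S" "\<And>f g. f \<in> S \<Longrightarrow> g \<in> S \<Longrightarrow> f * g \<in> V.span S"
  shows "subalg (V.span S)"
proof (rule subalgI)
  show "\<iota> c \<in> V.span S" for c using V.span_scale[OF assms(1), of c] by simp
  have 1: "f * g \<in> V.span S" if "f \<in> S" "g \<in> V.span S" for f g using that(2)
  proof (induction rule: V.span_induct_alt)
    case base thus ?case by (simp add: V.span_zero)
  next
    case (step c x y)
    have "f * (\<iota> c * x + y) = \<iota> c * (f * x) + f * y" by (simp add: algebra_simps)
    thus ?case using step assms(2) that by (auto intro!: V.span_add V.span_scale)
  qed
  show "f * g \<in> V.span S" if "f \<in> V.span S" "g \<in> V.span S" for f g using that(1)
  proof (induction rule: V.span_induct_alt)
    case base thus ?case by (simp add: V.span_zero)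
  next
    case (step c x y)
    have "(\<iota> c * x + y) * g = \<iota> c * (x * g) + y * g" by (simp add: algebra_simps)
    thus ?case using step 1 that by (auto intro!: V.span_add V.span_scale)
  qed
qed (auto intro: V.span_add)

end

section \<open>Laurent monomials\<close>

text \<open>Exponent vectors are arbitrary functions, so that they add and negate pointwise; only
  the extensional ones in \<open>exps N\<close> index the monomials without repetition.\<close>

definition lmon :: "nat \<Rightarrow> (nat \<Rightarrow> 'f::field) \<Rightarrow> (nat \<Rightarrow> int) \<Rightarrow> 'f" where
  "lmon N x a = (\<Prod>i=1..N. x i powi a i)"

lemma lmon_cong:
  assumes "\<And>i. i \<in> {1..N} \<Longrightarrow> x i = y i" "\<And>i. i \<in> {1..N} \<Longrightarrow> a i = b i"
  shows "lmon N x a = lmon N y b" unfolding lmon_def using assms by (intro prod.cong) auto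

lemma lmon_restrict [simp]: "lmon N x (restrict a {1..N}) = lmon N x a"
  and lmon_restrict' [simp]: "lmon N x (restrict a {Suc 0..N}) = lmon N x a" by (rule lmon_cong; auto)+

lemma lmon_0 [simp]: "lmon N x (\<lambda>_. 0) = 1" by (simp add: lmon_def)

lemma lmon_nz: "(\<And>i. i \<in> {1..N} \<Longrightarrow> x i \<noteq> 0) \<Longrightarrow> lmon N x a \<noteq> 0" by (auto simp: lmon_def)

lemma lmon_add:
  assumes "\<And>i. i \<in> {1..N} \<Longrightarrow> x i \<noteq> 0"
  shows "lmon N x (\<lambda>i. a i + b i) = lmon N x a * lmon N x b"
  unfolding lmon_def prod.distrib[symmetric] using assms by (intro prod.cong) (auto simp: power_int_add)

lemma lmon_uminus: "lmon N x (\<lambda>i. - a i) = inverse (lmon N x a)"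
  unfolding lmon_def prod_inversef[symmetric] by (simp add: power_int_minus)

lemma lmon_single:
  assumes "k \<in> {1..N}" shows "lmon N x (\<lambda>i. if i = k then n else 0) = x k powi n"
proof -
  have "lmon N x (\<lambda>i. if i = k then n else 0) = (\<Prod>i=1..N. if i = k then x k powi n else 1)"
    unfolding lmon_def by (intro prod.cong) auto
  thus ?thesis using assms by simp
qed

lemma lmon_map_mult:
  "lmon N (\<lambda>i. x i * y i) a = lmon N x a * lmon N y a"
  unfolding lmon_def by (simp add: power_int_mult_distrib prod.distrib)

text \<open>The target carries its own scalars, because it is the field itself for derivations, its
  Laurent series for gradings and the complex numbers for evaluations.\<close>

definition scalar_linear :: "(complex \<Rightarrow> 'f::field) \<Rightarrow> (complex \<Rightarrow> 'k::field) \<Rightarrow> ('f \<Rightarrow> 'k) \<Rightarrow> bool" where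
  "scalar_linear \<iota> \<iota>' T \<longleftrightarrow> (\<forall>f g. T (f + g) = T f + T g) \<and> (\<forall>c f. T (\<iota> c * f) = \<iota>' c * T f)"

lemma scalar_linear_add: "scalar_linear \<iota> \<iota>' T \<Longrightarrow> T (f + g) = T f + T g"
  and scalar_linear_scale: "scalar_linear \<iota> \<iota>' T \<Longrightarrow> T (\<iota> c * f) = \<iota>' c * T f"
  by (auto simp: scalar_linear_def)

lemma scalar_linear_0: "scalar_linear \<iota> \<iota>' T \<Longrightarrow> T 0 = 0"
  using scalar_linear_add[of \<iota> \<iota>' T 0 0] by (metis add_0 add_left_imp_eq add.right_neutral)

lemma scalar_linear_uminus: assumes "scalar_linear \<iota> \<iota>' T" shows "T (- f) = - T f"
proof -
  have "T f + T (- f) = 0"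
    using scalar_linear_add[OF assms, of f "- f"] scalar_linear_0[OF assms] by simp
  thus ?thesis by (metis add.inverse_unique)
qed

lemma scalar_linear_diff: assumes "scalar_linear \<iota> \<iota>' T" shows "T (f - g) = T f - T g"
  using scalar_linear_add[OF assms, of f "- g"] scalar_linear_uminus[OF assms, of g] by simp

lemma scalar_linear_sum: assumes "scalar_linear \<iota> \<iota>' T" shows "T (sum f I) = (\<Sum>i\<in>I. T (f i))"
  by (induction I rule: infinite_finite_induct)
     (auto simp: scalar_linear_0[OF assms] scalar_linear_add[OF assms])

lemma complex_algebra_id: "complex_algebra (\<lambda>c. c)" by unfold_locales (simp add: unital_ring_hom_def)

context complex_algebra
begin

lemma complex_algebra_fls: "complex_algebra (\<lambda>c. fls_const (\<iota> c))" by unfold_locales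
     (simp add: unital_ring_hom_def \<iota>_add \<iota>_mult fls_plus_const fls_const_mult_const)

lemma mult_on_span:
  assumes T: "scalar_linear \<iota> \<iota>' T"
    and S: "\<And>f g. f \<in> S \<Longrightarrow> g \<in> S \<Longrightarrow> T (f * g) = T f * T g"
    and fg: "f \<in> V.span S" "g \<in> V.span S"
  shows "T (f * g) = T f * T g"
proof -
  note [simp] = scalar_linear_add[OF T] scalar_linear_scale[OF T] scalar_linear_0[OF T]
  have 1: "T (f * g) = T f * T g" if f: "f \<in> S" and g: "g \<in> V.span S" for f g using g
  proof (induction rule: V.span_induct_alt)
    case (step c u v)
    have "T (f * (\<iota> c * u + v)) = T (\<iota> c * (f * u) + f * v)" by (simp add: algebra_simps)
    also have "\<dots> = \<iota>' c * T (f * u) + T (f * v)" by simp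
    also have "\<dots> = T f * (\<iota>' c * T u + T v)" using step S f by (simp add: algebra_simps)
    also have "\<dots> = T f * T (\<iota> c * u + v)" by simp
    finally show ?case .
  qed simp
  show ?thesis using fg(1)
  proof (induction rule: V.span_induct_alt)
    case (step c u v)
    have "T ((\<iota> c * u + v) * g) = T (\<iota> c * (u * g) + v * g)" by (simp add: algebra_simps)
    also have "\<dots> = \<iota>' c * T (u * g) + T (v * g)" by simp
    also have "\<dots> = (\<iota>' c * T u + T v) * T g" using step 1[OF step(1) fg(2)] by (simp add: algebra_simps)
    also have "\<dots> = T (\<iota> c * u + v) * T g" by simp
    finally show ?case .
  qed simp
qed

lemma deriv_on_span:
  assumes T: "scalar_linear \<iota> \<iota> T"
    and S: "\<And>f g. f \<in> S \<Longrightarrow> g \<in> S \<Longrightarrow> T (f * g) = f * T g + g * T f"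
    and fg: "f \<in> V.span S" "g \<in> V.span S"
  shows "T (f * g) = f * T g + g * T f"
proof -
  note [simp] = scalar_linear_add[OF T] scalar_linear_scale[OF T] scalar_linear_0[OF T]
  have 1: "T (f * g) = f * T g + g * T f" if f: "f \<in> S" and g: "g \<in> V.span S" for f g using g
  proof (induction rule: V.span_induct_alt)
    case (step c u v)
    have "T (f * (\<iota> c * u + v)) = T (\<iota> c * (f * u) + f * v)" by (simp add: algebra_simps)
    also have "\<dots> = \<iota> c * T (f * u) + T (f * v)" by simp
    also have "\<dots> = f * (\<iota> c * T u + T v) + (\<iota> c * u + v) * T f" using step S f by (simp add: algebra_simps)
    also have "\<dots> = f * T (\<iota> c * u + v) + (\<iota> c * u + v) * T f" by simp
    finally show ?case .
  qed simp
  show ?thesis using fg(1)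
  proof (induction rule: V.span_induct_alt)
    case (step c u v)
    have "T ((\<iota> c * u + v) * g) = T (\<iota> c * (u * g) + v * g)" by (simp add: algebra_simps)
    also have "\<dots> = \<iota> c * T (u * g) + T (v * g)" by simp
    also have "\<dots> = (\<iota> c * u + v) * T g + g * (\<iota> c * T u + T v)" using step 1[OF step(1) fg(2)] by (simp add: algebra_simps)
    also have "\<dots> = (\<iota> c * u + v) * T g + g * T (\<iota> c * u + v)" by simp
    finally show ?case .
  qed simp
qed

end

abbreviation exps :: "nat \<Rightarrow> (nat \<Rightarrow> int) set" where
  "exps N \<equiv> {1..N} \<rightarrow>\<^sub>E UNIV"

locale laurent = complex_algebra \<iota> for \<iota> :: "complex \<Rightarrow> 'f::field" +
  fixes N :: nat and x :: "nat \<Rightarrow> 'f"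
  assumes indep: "algebraically_independent \<iota> N x"
begin

lemma x_nz: assumes "i \<in> {1..N}" shows "x i \<noteq> 0"
proof
  assume 0: "x i = 0"
  define a :: "nat \<Rightarrow> nat" where "a = restrict (\<lambda>j. if j = i then 1 else 0) {1..N}"
  have "(\<Prod>j=1..N. x j ^ a j) = 0" using assms 0 by (auto simp: a_def intro!: bexI[of _ i])
  hence "(\<Sum>a\<in>{a}. \<iota> ((\<lambda>_. 1) a) * (\<Prod>i=1..N. x i ^ a i)) = 0" by simp
  moreover have "{a} \<subseteq> {1..N} \<rightarrow>\<^sub>E UNIV" by (auto simp: a_def)
  ultimately show False
    using indep[unfolded algebraically_independent_def, rule_format, of "{a}" "\<lambda>_. 1"] by auto
qed

lemma lmon_nz': "lmon N x a \<noteq> 0" using x_nz by (rule lmon_nz)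

lemma lmon_add': "lmon N x (\<lambda>i. a i + b i) = lmon N x a * lmon N x b" using x_nz by (rule lmon_add)

lemma lmon_indep:
  assumes M: "finite M" "M \<subseteq> exps N" and 0: "(\<Sum>a\<in>M. \<iota> (c a) * lmon N x a) = 0"
  shows "\<forall>a\<in>M. c a = 0"
proof -
  \<comment> \<open>Multiplication by the monomial with all exponents \<open>k\<close> makes every
    exponent in \<open>M\<close> a natural number, where algebraic independence applies.\<close>
  define k where "k = Max (insert 0 ((\<lambda>(a,i). - a i) ` (M \<times> {1..N})))"
  have k: "a i + k \<ge> 0" if "a \<in> M" "i \<in> {1..N}" for a i
  proof -
    have "- a i \<in> (\<lambda>(a,i). - a i) ` (M \<times> {1..N})" using that by (intro image_eqI[of _ _ "(a, i)"]) auto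
    hence "- a i \<le> k" unfolding k_def using M(1) by (intro Max_ge) simp_all
    thus ?thesis by simp
  qed
  define sh where "sh = (\<lambda>a :: nat \<Rightarrow> int. restrict (\<lambda>i. nat (a i + k)) {1..N})"
  have inj: "inj_on sh M"
  proof (rule inj_onI)
    fix a b assume ab: "a \<in> M" "b \<in> M" "sh a = sh b"
    have "a i = b i" if "i \<in> {1..N}" for i
      using fun_cong[OF ab(3), of i] k[OF ab(1) that] k[OF ab(2) that] that by (simp add: sh_def)
    moreover have "a \<in> exps N" "b \<in> exps N" using ab M(2) by auto
    ultimately show "a = b" by (intro PiE_ext)
  qed
  have sh: "(\<Prod>i=1..N. x i ^ sh a i) = lmon N x a * lmon N x (\<lambda>_. k)" if "a \<in> M" for a
    unfolding lmon_add'[symmetric] unfolding lmon_def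
    by (intro prod.cong refl) (use k[OF that] in \<open>auto simp: sh_def power_int_def\<close>)
  have "(\<Sum>a\<in>sh ` M. \<iota> (c (inv_into M sh a)) * (\<Prod>i=1..N. x i ^ a i)) =
        (\<Sum>a\<in>M. \<iota> (c a) * (\<Prod>i=1..N. x i ^ sh a i))" using inj by (simp add: sum.reindex)
  also have "\<dots> = (\<Sum>a\<in>M. \<iota> (c a) * lmon N x a * lmon N x (\<lambda>_. k))"
    by (intro sum.cong refl) (simp only: sh mult.assoc)
  also have "\<dots> = (\<Sum>a\<in>M. \<iota> (c a) * lmon N x a) * lmon N x (\<lambda>_. k)" by (rule sum_distrib_right[symmetric])
  also have "\<dots> = 0" using 0 by simp
  finally have "(\<Sum>a\<in>sh ` M. \<iota> (c (inv_into M sh a)) * (\<Prod>i=1..N. x i ^ a i)) = 0" .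
  moreover have "sh ` M \<subseteq> {1..N} \<rightarrow>\<^sub>E UNIV" by (auto simp: sh_def)
  ultimately have "\<forall>a\<in>sh ` M. c (inv_into M sh a) = 0"
    using indep[unfolded algebraically_independent_def, rule_format,
        of "sh ` M" "\<lambda>a. c (inv_into M sh a)"] M(1) by (metis finite_imageI)
  thus ?thesis using inj by (metis image_eqI inv_into_f_f)
qed

lemma inj_lmon: "inj_on (lmon N x) (exps N)"
proof (rule inj_onI, rule ccontr)
  fix a b assume ab: "a \<in> exps N" "b \<in> exps N" "lmon N x a = lmon N x b" "a \<noteq> b"
  have "(\<Sum>d\<in>{a,b}. \<iota> ((\<lambda>d. if d = a then 1 else -1) d) * lmon N x d) = 0"
    using ab by (simp add: \<iota>.hom_uminus)
  thus False using lmon_indep[of "{a,b}" "\<lambda>d. if d = a then 1 else -1"] ab by auto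
qed

lemma independent_lmon: "V.independent (lmon N x ` exps N)"
proof
  assume "V.dependent (lmon N x ` exps N)"
  then obtain t u v where t: "finite t" "t \<subseteq> lmon N x ` exps N"
    "(\<Sum>v\<in>t. \<iota> (u v) * v) = 0" "v \<in> t" "u v \<noteq> 0" unfolding V.dependent_explicit by blast
  from t(1,2) obtain M where M: "M \<subseteq> exps N" "finite M" "t = lmon N x ` M" by (meson finite_subset_image)
  have "(\<Sum>a\<in>M. \<iota> (u (lmon N x a)) * lmon N x a) = 0"
    using t(3) inj_on_subset[OF inj_lmon M(1)] by (simp add: M(3) sum.reindex)
  from lmon_indep[OF M(2,1) this] t(4,5) M(3) show False by auto
qed

text \<open>The map is defined on the whole field by extension from an independent set, but it is
  controlled only on Laurent polynomials. Multiplicativity and the Leibniz rule are therefore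
  claimed only there, and fractions are treated separately.\<close>

lemma linear_on_monomials:
  fixes \<iota>' :: "complex \<Rightarrow> 'k::field" and \<kappa> :: "(nat \<Rightarrow> int) \<Rightarrow> 'k"
  assumes "complex_algebra \<iota>'"
  shows "\<exists>T. scalar_linear \<iota> \<iota>' T \<and> (\<forall>a\<in>exps N. T (lmon N x a) = \<kappa> a)"
proof -
  interpret W: complex_algebra \<iota>' by fact
  interpret VP: vector_space_pair "\<lambda>c f. \<iota> c * f" "\<lambda>c f. \<iota>' c * f" ..
  obtain T where T: "Vector_Spaces.linear (\<lambda>c f. \<iota> c * f) (\<lambda>c f. \<iota>' c * f) T"
    "\<forall>v\<in>lmon N x ` exps N. T v = (\<kappa> \<circ> inv_into (exps N) (lmon N x)) v"
    using VP.linear_independent_extend[OF independent_lmon] by blast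
  interpret T: Vector_Spaces.linear "\<lambda>c f. \<iota> c * f" "\<lambda>c f. \<iota>' c * f" T by fact
  show ?thesis by (intro exI[of _ T]) (use T(2) inj_lmon in \<open>auto simp: scalar_linear_def T.add T.scale\<close>)
qed

definition Lau :: "(nat \<Rightarrow> int) set \<Rightarrow> 'f set" where
  "Lau C = V.span (lmon N x ` C)"

lemma lmon_Lau: "a \<in> C \<Longrightarrow> lmon N x a \<in> Lau C" unfolding Lau_def by (auto intro: V.span_base)

lemma subalg_Lau:
  assumes "(\<lambda>_. 0) \<in> C" "\<And>a b. a \<in> C \<Longrightarrow> b \<in> C \<Longrightarrow> (\<lambda>i. a i + b i) \<in> C"
  shows "subalg (Lau C)" unfolding Lau_def
proof (rule subalg_span)
  have "lmon N x (\<lambda>_. 0) \<in> V.span (lmon N x ` C)" by (intro V.span_base imageI assms(1))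
  thus "1 \<in> V.span (lmon N x ` C)" by simp
  fix f g assume "f \<in> lmon N x ` C" "g \<in> lmon N x ` C"
  then obtain a b where ab: "a \<in> C" "b \<in> C" "f = lmon N x a" "g = lmon N x b" by auto
  show "f * g \<in> V.span (lmon N x ` C)"
    unfolding ab lmon_add'[symmetric] by (intro V.span_base imageI assms(2) ab)
qed

lemma subalg_L: "subalg (Lau UNIV)" by (rule subalg_Lau) auto

lemma hom_exists:
  fixes \<iota>' :: "complex \<Rightarrow> 'k::field" and y :: "nat \<Rightarrow> 'k"
  assumes "complex_algebra \<iota>'" and y: "\<And>i. i \<in> {1..N} \<Longrightarrow> y i \<noteq> 0"
  shows "\<exists>T. scalar_linear \<iota> \<iota>' T \<and> (\<forall>a. T (lmon N x a) = lmon N y a) \<and>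
           (\<forall>f\<in>Lau UNIV. \<forall>g\<in>Lau UNIV. T (f * g) = T f * T g)"
proof -
  from linear_on_monomials[OF assms(1), of "lmon N y"] obtain T where
    T: "scalar_linear \<iota> \<iota>' T" "\<forall>a\<in>exps N. T (lmon N x a) = lmon N y a" by blast
  have T2: "T (lmon N x a) = lmon N y a" for a using T(2)[rule_format, of "restrict a {1..N}"] by simp
  have "T (f * g) = T f * T g" if "f \<in> Lau UNIV" "g \<in> Lau UNIV" for f g
    using T(1) _ that[unfolded Lau_def]
  proof (rule mult_on_span)
    fix f g assume "f \<in> lmon N x ` UNIV" "g \<in> lmon N x ` UNIV"
    then obtain a b where [simp]: "f = lmon N x a" "g = lmon N x b" by blast
    show "T (f * g) = T f * T g"
      using T2[of "\<lambda>i. a i + b i"] lmon_add[where x = y, OF y] by (simp add: lmon_add' T2)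
  qed
  with T T2 show ?thesis by blast
qed

lemma log_derivation_exists:
  fixes w :: "nat \<Rightarrow> 'f"
  shows "\<exists>T. scalar_linear \<iota> \<iota> T \<and> (\<forall>a. T (lmon N x a) = (\<Sum>i=1..N. of_int (a i) * w i) * lmon N x a) \<and>
           (\<forall>f\<in>Lau UNIV. \<forall>g\<in>Lau UNIV. T (f * g) = f * T g + g * T f)"
proof -
  let ?w = "\<lambda>a. (\<Sum>i=1..N. of_int (a i) * w i)"
  from linear_on_monomials[OF complex_algebra_axioms, of "\<lambda>a. ?w a * lmon N x a"]
  obtain T where
    T: "scalar_linear \<iota> \<iota> T" "\<forall>a\<in>exps N. T (lmon N x a) = ?w a * lmon N x a" by blast
  have T2: "T (lmon N x a) = ?w a * lmon N x a" for a
    using T(2)[rule_format, of "restrict a {1..N}"] by simp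
  have "T (f * g) = f * T g + g * T f" if "f \<in> Lau UNIV" "g \<in> Lau UNIV" for f g
    using T(1) _ that[unfolded Lau_def]
  proof (rule deriv_on_span)
    fix f g assume "f \<in> lmon N x ` UNIV" "g \<in> lmon N x ` UNIV"
    then obtain a b where [simp]: "f = lmon N x a" "g = lmon N x b" by blast
    show "T (f * g) = f * T g + g * T f"
      using T2[of "\<lambda>i. a i + b i"] by (simp add: lmon_add' T2 algebra_simps sum.distrib)
  qed
  with T T2 show ?thesis by blast
qed

end

section \<open>Gradings of Laurent polynomial rings\<close>

definition wt :: "nat \<Rightarrow> (nat \<Rightarrow> int) \<Rightarrow> (nat \<Rightarrow> int) \<Rightarrow> int" where
  "wt N w a = (\<Sum>i=1..N. w i * a i)"

definition cone :: "nat set \<Rightarrow> (nat \<Rightarrow> int) set" where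
  "cone S = {a. \<forall>i\<in>S. a i \<ge> 0}"

abbreviation unit_vec :: "exmatrix" where
  "unit_vec i \<equiv> (\<lambda>j. if j = i then 1 else 0)"

lemma fls_X_intpow_times_nth: "(fls_X_intpow n * f) $$ m = f $$ (m - n)" for f :: "'a::comm_ring_1 fls"
  by (simp add: fls_X_intpow_times_conv_shift)

lemma prod_fls_X_intpow:
  "(\<Prod>i\<in>A. fls_X_intpow (f i)) = (fls_X_intpow (sum f A) :: 'a::comm_ring_1 fls)"
  by (induction A rule: infinite_finite_induct) (auto simp: fls_X_intpow_times_fls_X_intpow)

text \<open>\<open>h\<close> is not a zero divisor modulo \<open>Q\<close> in \<open>R\<close>. In a
  factorial ring and for nonzero \<open>Q\<close> this is coprimality; in this form it can be
  checked by gradings, without unique factorization.\<close>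

definition nzd :: "'f::field set \<Rightarrow> 'f \<Rightarrow> 'f \<Rightarrow> bool" where
  "nzd R Q h \<longleftrightarrow> (\<forall>p\<in>R. \<forall>r\<in>R. h * p = Q * r \<longrightarrow> (\<exists>q\<in>R. p = Q * q))"

context complex_algebra
begin

lemma nzd_mult:
  assumes "subalg R" "g \<in> R" "h \<in> R" "nzd R Q g" "nzd R Q h" shows "nzd R Q (g * h)"
  using assms sub_mult[OF assms(1)] unfolding nzd_def by (metis mult.assoc)

lemma nzd_power:
  assumes "subalg R" "h \<in> R" "nzd R Q h" shows "nzd R Q (h ^ n)"
proof (induction n)
  case (Suc n)
  show ?case unfolding power_Suc by (intro nzd_mult Suc assms sub_power[OF assms(1)])
qed (auto simp: nzd_def)

lemma nzd_unit:
  assumes "subalg R" "inverse u \<in> R" "u \<noteq> 0" shows "nzd R Q u" unfolding nzd_def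
proof safe
  fix p r assume "p \<in> R" "r \<in> R" "u * p = Q * r"
  thus "\<exists>q\<in>R. p = Q * q" using assms
    by (intro bexI[of _ "inverse u * r"] sub_mult[OF assms(1)]) (auto simp: field_simps)
qed

text \<open>An element whose denominator can be chosen as a power of \<open>Q\<close> and also as a
  power of \<open>h\<close> has no denominator: the factors \<open>Q\<close> are cancelled one at a
  time.\<close>

lemma nzd_localization:
  assumes R: "subalg R" and Q: "Q \<in> R" "Q \<noteq> 0" and h: "h \<in> R" "nzd R Q h"
    and "Q ^ n * f \<in> R" "h ^ m * f \<in> R"
  shows "f \<in> R" using assms(6)
proof (induction n)
  case (Suc n)
  have "h ^ m * (Q ^ Suc n * f) = Q * (Q ^ n * (h ^ m * f))" by (simp add: algebra_simps)
  moreover have "Q ^ n * (h ^ m * f) \<in> R" by (intro sub_mult[OF R] sub_power[OF R] Q assms)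
  ultimately obtain q where "q \<in> R" "Q ^ Suc n * f = Q * q"
    using nzd_power[OF R h, of m] Suc.prems unfolding nzd_def by blast
  thus ?case using Suc.IH Q(2) by simp
qed simp

end

context laurent
begin

text \<open>The homomorphism that multiplies each \<open>x i\<close> by the power \<open>w i\<close>
  of an auxiliary variable. The coefficients of the resulting series are the homogeneous components,
  so that lowest components become leading terms and degrees become subdegrees.\<close>

definition grade :: "(nat \<Rightarrow> int) \<Rightarrow> 'f \<Rightarrow> 'f fls" where
  "grade w = (SOME T. scalar_linear \<iota> (\<lambda>c. fls_const (\<iota> c)) T \<and>
      (\<forall>a. T (lmon N x a) = lmon N (\<lambda>i. fls_const (x i) * fls_X_intpow (w i)) a) \<and>
      (\<forall>f\<in>Lau UNIV. \<forall>g\<in>Lau UNIV. T (f * g) = T f * T g))"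

lemma fls_const_prod: "fls_const (prod f A) = (\<Prod>i\<in>A. fls_const (f i :: 'f))"
  by (induction A rule: infinite_finite_induct) (auto simp flip: fls_const_mult_const)

lemma fls_const_powi: "fls_const (y :: 'f) powi n = fls_const (y powi n)"
  by (simp add: power_int_def fls_const_power fls_inverse_const)

lemma lmon_fls:
  "lmon N (\<lambda>i. fls_const (x i) * fls_X_intpow (w i)) a =
     (fls_const (lmon N x a) * fls_X_intpow (wt N w a) :: 'f fls)"
proof -
  have "(fls_X_intpow n :: 'f fls) powi m = fls_X_intpow (n * m)" for n m
    by (metis fls_X_power_int power_int_mult)
  hence "lmon N (\<lambda>i. fls_X_intpow (w i)) a = (fls_X_intpow (wt N w a) :: 'f fls)"
    unfolding lmon_def wt_def prod_fls_X_intpow[symmetric] by simp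
  moreover have "lmon N (\<lambda>i. fls_const (x i)) a = fls_const (lmon N x a)"
    by (simp add: lmon_def fls_const_powi fls_const_prod)
  ultimately show ?thesis by (simp add: lmon_map_mult)
qed

lemma
  shows grade_linear: "scalar_linear \<iota> (\<lambda>c. fls_const (\<iota> c)) (grade w)"
    and grade_lmon: "grade w (lmon N x a) = fls_const (lmon N x a) * fls_X_intpow (wt N w a)"
    and grade_mult: "f \<in> Lau UNIV \<Longrightarrow> g \<in> Lau UNIV \<Longrightarrow> grade w (f * g) = grade w f * grade w g"
proof -
  have "\<exists>T. scalar_linear \<iota> (\<lambda>c. fls_const (\<iota> c)) T \<and>
      (\<forall>a. T (lmon N x a) = lmon N (\<lambda>i. fls_const (x i) * fls_X_intpow (w i)) a) \<and>
      (\<forall>f\<in>Lau UNIV. \<forall>g\<in>Lau UNIV. T (f * g) = T f * T g)"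
    by (intro hom_exists complex_algebra_fls) (use x_nz in auto)
  from someI_ex[OF this, folded grade_def]
  show "scalar_linear \<iota> (\<lambda>c. fls_const (\<iota> c)) (grade w)"
    "grade w (lmon N x a) = fls_const (lmon N x a) * fls_X_intpow (wt N w a)"
    "f \<in> Lau UNIV \<Longrightarrow> g \<in> Lau UNIV \<Longrightarrow> grade w (f * g) = grade w f * grade w g" by (auto simp: lmon_fls)
qed

definition hcomp :: "(nat \<Rightarrow> int) \<Rightarrow> int \<Rightarrow> 'f \<Rightarrow> 'f" where
  "hcomp w n f = grade w f $$ n"

lemma hcomp_linear: "scalar_linear \<iota> \<iota> (hcomp w n)"
  using grade_linear[of w] unfolding scalar_linear_def hcomp_def by auto

lemma hcomp_lmon: "hcomp w n (lmon N x a) = (if wt N w a = n then lmon N x a else 0)"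
  by (simp add: hcomp_def grade_lmon)

lemma Lau_mono: "C \<subseteq> D \<Longrightarrow> Lau C \<subseteq> Lau D" unfolding Lau_def by (intro V.span_mono image_mono)

lemma Lau_UNIV: "f \<in> Lau C \<Longrightarrow> f \<in> Lau UNIV" using Lau_mono[of C UNIV] by auto

lemma Lau_induct [consumes 1, case_names zero step]:
  assumes "f \<in> Lau C" "P 0"
    "\<And>c a g. a \<in> C \<Longrightarrow> g \<in> Lau C \<Longrightarrow> P g \<Longrightarrow> P (\<iota> c * lmon N x a + g)"
  shows "P f"
proof -
  have "f \<in> Lau C \<and> P f" using assms(1) unfolding Lau_def
  proof (induction rule: V.span_induct_alt)
    case base thus ?case using assms(2) by (simp add: V.span_zero)
  next
    case (step c u v)
    thus ?case using assms(3)[folded Lau_def]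
      by (auto simp: Lau_def intro!: V.span_add V.span_scale intro: V.span_base)
  qed
  thus ?thesis ..
qed

lemma Lau_add: "f \<in> Lau C \<Longrightarrow> g \<in> Lau C \<Longrightarrow> f + g \<in> Lau C"
  and Lau_scale: "f \<in> Lau C \<Longrightarrow> \<iota> c * f \<in> Lau C"
  and Lau_0: "0 \<in> Lau C" by (auto simp: Lau_def intro: V.span_add V.span_scale V.span_zero)

lemma hcomp_Lau: "f \<in> Lau C \<Longrightarrow> hcomp w n f \<in> Lau C"
proof (induction rule: Lau_induct)
  case zero thus ?case by (simp add: scalar_linear_0[OF hcomp_linear] Lau_0)
next
  case (step c a g)
  thus ?case
    by (auto simp: scalar_linear_add[OF hcomp_linear] scalar_linear_scale[OF hcomp_linear] hcomp_lmon
      intro!: Lau_add Lau_scale lmon_Lau)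
qed

lemma hcomp_comp: "f \<in> Lau C \<Longrightarrow> hcomp w m (hcomp w n f) = (if m = n then hcomp w n f else 0)"
proof (induction rule: Lau_induct)
  case zero thus ?case by (simp add: scalar_linear_0[OF hcomp_linear])
next
  case (step c a g)
  thus ?case
    by (auto simp: scalar_linear_add[OF hcomp_linear] scalar_linear_scale[OF hcomp_linear] hcomp_lmon
        scalar_linear_0[OF hcomp_linear])
qed

text \<open>Any finite set containing the support is allowed as index set, because components may
  cancel in the inductive step.\<close>

lemma hcomp_sum: "f \<in> Lau C \<Longrightarrow> \<exists>M. finite M \<and> {n. hcomp w n f \<noteq> 0} \<subseteq> M \<and> f = (\<Sum>n\<in>M. hcomp w n f)"
proof (induction rule: Lau_induct)
  case zero thus ?case by (intro exI[of _ "{}"]) (simp add: scalar_linear_0[OF hcomp_linear])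
next
  case (step c a g)
  note [simp] = scalar_linear_add[OF hcomp_linear] scalar_linear_scale[OF hcomp_linear]
    hcomp_lmon scalar_linear_0[OF hcomp_linear]
  from step obtain M where M: "finite M" "{n. hcomp w n g \<noteq> 0} \<subseteq> M" "g = (\<Sum>n\<in>M. hcomp w n g)" by blast
  let ?M = "insert (wt N w a) M"
  have hadd: "hcomp w n (\<iota> c * lmon N x a + g) = (if wt N w a = n then \<iota> c * lmon N x a else 0) + hcomp w n g" for n
    by simp
  have "(\<Sum>n\<in>?M. hcomp w n g) = (\<Sum>n\<in>M. hcomp w n g)" using M by (intro sum.mono_neutral_right) auto
  hence g: "(\<Sum>n\<in>?M. hcomp w n g) = g" using M(3) by simp
  have "(\<Sum>n\<in>?M. hcomp w n (\<iota> c * lmon N x a + g)) =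
      (\<Sum>n\<in>?M. if wt N w a = n then \<iota> c * lmon N x a else 0) + g" by (simp only: hadd sum.distrib g)
  also have "\<dots> = \<iota> c * lmon N x a + g" using M(1) by (simp del: sum.insert)
  finally have "\<iota> c * lmon N x a + g = (\<Sum>n\<in>?M. hcomp w n (\<iota> c * lmon N x a + g))" by simp
  moreover have "{n. hcomp w n (\<iota> c * lmon N x a + g) \<noteq> 0} \<subseteq> ?M" using M(2) by auto
  moreover have "finite ?M" using M(1) by simp
  ultimately show ?case by blast
qed

lemma grade_eq_0: assumes "f \<in> Lau UNIV" "grade w f = 0" shows "f = 0"
proof -
  have "hcomp w n f = 0" for n using assms(2) by (simp add: hcomp_def)
  with hcomp_sum[OF assms(1), of w] show ?thesis by auto
qed

lemma finite_comp: assumes "f \<in> Lau C" shows "finite {n. hcomp w n f \<noteq> 0}"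
  using hcomp_sum[OF assms, of w] finite_subset by blast

text \<open>Compare the lowest homogeneous components on both sides of \<open>P * p = Q * r\<close>
  and remove the lowest component of \<open>p\<close>.\<close>

lemma nzd_homogeneous:
  assumes P: "P \<in> Lau UNIV" "\<And>n. n < d \<Longrightarrow> hcomp w n P = 0" "hcomp w d P = u"
    and u: "u \<noteq> 0" "inverse u \<in> Lau UNIV"
    and Q: "Q \<in> Lau UNIV" "grade w Q = fls_const Q * fls_X_intpow \<omega>"
  shows "nzd (Lau UNIV) Q P" unfolding nzd_def
proof safe
  fix p r assume "p \<in> Lau UNIV" "r \<in> Lau UNIV" "P * p = Q * r"
  thus "\<exists>q\<in>Lau UNIV. p = Q * q"
  proof (induction "card {n. hcomp w n p \<noteq> 0}" arbitrary: p r rule: less_induct)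
    case less
    show ?case
    proof (cases "p = 0")
      case True thus ?thesis using Lau_0 by (intro bexI[of _ 0]) auto
    next
      case False
      hence gp: "grade w p \<noteq> 0" using grade_eq_0 less.prems by blast
      have gP: "fls_subdegree (grade w P) = d"
        using P u unfolding hcomp_def by (intro fls_subdegree_eqI) auto
      define e where "e = fls_subdegree (grade w p)"
      have "grade w P * grade w p = grade w Q * grade w r"
        using grade_mult[OF P(1) less.prems(1), of w] grade_mult[OF Q(1) less.prems(2), of w] less.prems(3) by simp
      hence "(grade w P * grade w p) $$ (d + e) = (grade w Q * grade w r) $$ (d + e)" by simp
      moreover have "(grade w P * grade w p) $$ (d + e) = u * hcomp w e p"
        using fls_times_base[of "grade w P" "grade w p"] P(3) by (simp add: gP e_def hcomp_def)
      moreover have "(grade w Q * grade w r) $$ (d + e) = Q * hcomp w (d + e - \<omega>) r"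
        unfolding Q(2) mult.assoc fls_mult_const_nth fls_X_intpow_times_nth by (simp add: hcomp_def)
      ultimately have eq: "u * hcomp w e p = Q * hcomp w (d + e - \<omega>) r" by simp
      \<comment> \<open>The lowest component \<open>u\<close> of \<open>P\<close> is a unit, so the
        lowest component of \<open>p\<close> is \<open>Q\<close> times the Laurent polynomial
        \<open>s\<close>.\<close>
      define s where "s = inverse u * hcomp w (d + e - \<omega>) r"
      have s: "s \<in> Lau UNIV" unfolding s_def by (intro sub_mult[OF subalg_L] hcomp_Lau less.prems u)
      have pe: "hcomp w e p = Q * s" using eq u(1) by (simp add: s_def field_simps)
      have pe_nz: "hcomp w e p \<noteq> 0" using gp by (simp add: hcomp_def e_def)
      let ?p = "p - hcomp w e p" and ?r = "r - P * s"
      have pL: "?p \<in> Lau UNIV" "?r \<in> Lau UNIV"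
        by (intro sub_diff[OF subalg_L] sub_mult[OF subalg_L] hcomp_Lau s P less.prems)+
      have "P * ?p = Q * ?r" using less.prems(3) pe by (simp add: algebra_simps)
      moreover have "{n. hcomp w n ?p \<noteq> 0} \<subset> {n. hcomp w n p \<noteq> 0}"
        using pe_nz by (auto simp: scalar_linear_diff[OF hcomp_linear] hcomp_comp[OF less.prems(1)] split: if_splits)
      hence "card {n. hcomp w n ?p \<noteq> 0} < card {n. hcomp w n p \<noteq> 0}"
        by (intro psubset_card_mono finite_comp[OF less.prems(1)])
      ultimately obtain q where q: "q \<in> Lau UNIV" "?p = Q * q" using less.hyps pL by blast
      hence "p = Q * (q + s)" using pe by (simp add: algebra_simps)
      thus ?thesis using q s Lau_add by blast
    qed
  qed
qed

lemma subalg_cone: "subalg (Lau (cone S))" by (rule subalg_Lau) (auto simp: cone_def)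

lemma wt_unit_vec: "i \<in> {1..N} \<Longrightarrow> wt N (unit_vec i) a = a i"
  unfolding wt_def by (simp add: if_distrib[of "\<lambda>x. x * _"] cong: if_cong)

lemma Lau_UNIV_expand:
  assumes "f \<in> Lau C"
  shows "\<exists>M c. finite M \<and> M \<subseteq> exps N \<and> f = (\<Sum>a\<in>M. \<iota> (c a) * lmon N x a)" using assms
proof (induction rule: Lau_induct)
  case zero thus ?case by (intro exI[of _ "{}"]) simp
next
  case (step d a g)
  then obtain M c where M: "finite M" "M \<subseteq> exps N" "g = (\<Sum>a\<in>M. \<iota> (c a) * lmon N x a)" by blast
  let ?a = "restrict a {1..N}"
  define c' where "c' = (\<lambda>b. (if b = ?a then d else 0) + (if b \<in> M then c b else 0))"
  have "(\<Sum>b\<in>insert ?a M. \<iota> (c' b) * lmon N x b) =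
     (\<Sum>b\<in>insert ?a M. if b = ?a then \<iota> d * lmon N x b else 0) +
     (\<Sum>b\<in>insert ?a M. if b \<in> M then \<iota> (c b) * lmon N x b else 0)"
    unfolding sum.distrib[symmetric] by (intro sum.cong) (auto simp: c'_def \<iota>_add algebra_simps)
  also have "(\<Sum>b\<in>insert ?a M. if b = ?a then \<iota> d * lmon N x b else 0) = \<iota> d * lmon N x a"
    using M(1) by (subst sum.delta) auto
  also have "(\<Sum>b\<in>insert ?a M. if b \<in> M then \<iota> (c b) * lmon N x b else 0) = g"
    unfolding M(3) using M(1) by (intro sum.mono_neutral_cong_right) auto
  finally have "\<iota> d * lmon N x a + g = (\<Sum>b\<in>insert ?a M. \<iota> (c' b) * lmon N x b)" ..
  moreover have "finite (insert ?a M)" "insert ?a M \<subseteq> exps N" using M(1,2) by auto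
  ultimately show ?case by blast
qed

lemma Lau_cone:
  assumes f: "f \<in> Lau UNIV" and S: "S \<subseteq> {1..N}"
    and hc: "\<And>i n. i \<in> S \<Longrightarrow> n < 0 \<Longrightarrow> hcomp (unit_vec i) n f = 0"
  shows "f \<in> Lau (cone S)"
proof -
  obtain M c where M: "finite M" "M \<subseteq> exps N" "f = (\<Sum>a\<in>M. \<iota> (c a) * lmon N x a)"
    using Lau_UNIV_expand[OF f] by blast
  have "c a = 0" if "a \<in> M" "a \<notin> cone S" for a
  proof -
    obtain i where i: "i \<in> S" "a i < 0" using \<open>a \<notin> cone S\<close> unfolding cone_def by force
    hence iN: "i \<in> {1..N}" using S by auto
    have "0 = hcomp (unit_vec i) (a i) f" using hc i by simp
    also have "\<dots> = (\<Sum>b\<in>M. \<iota> (c b) * (if b i = a i then lmon N x b else 0))"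
      unfolding M(3) by (simp add: scalar_linear_sum[OF hcomp_linear] scalar_linear_scale[OF hcomp_linear]
        hcomp_lmon wt_unit_vec[OF iN])
    also have "\<dots> = (\<Sum>b\<in>{b\<in>M. b i = a i}. \<iota> (c b) * lmon N x b)"
      using M(1) by (intro sum.mono_neutral_cong_right) auto
    finally show ?thesis using lmon_indep[of "{b\<in>M. b i = a i}" c] M(1,2) that by auto
  qed
  hence "f = (\<Sum>a\<in>M \<inter> cone S. \<iota> (c a) * lmon N x a)"
    unfolding M(3) using M(1) by (intro sum.mono_neutral_right) auto
  also have "\<dots> \<in> Lau (cone S)" by (intro sub_sum[OF subalg_cone]) (auto intro!: Lau_scale lmon_Lau)
  finally show ?thesis .
qed

lemma hcomp_cone:
  assumes "f \<in> Lau (cone S)" "i \<in> S" "S \<subseteq> {1..N}" "n < 0"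
  shows "hcomp (unit_vec i) n f = 0" using assms(1)
proof (induction rule: Lau_induct)
  case (step c a g)
  have "wt N (unit_vec i) a \<ge> 0" using assms step(1) wt_unit_vec[of i a] by (auto simp: cone_def)
  thus ?case using assms(4) step by (simp add: scalar_linear_add[OF hcomp_linear]
    scalar_linear_scale[OF hcomp_linear] hcomp_lmon)
qed (simp add: scalar_linear_0[OF hcomp_linear])

text \<open>For \<open>i\<close> in \<open>S\<close>, the order in \<open>x i\<close> is additive on
  products and the order of \<open>Q\<close> is zero. Division by \<open>Q\<close> therefore creates
  no negative powers of these variables.\<close>

lemma Lau_cone_divide:
  assumes f: "f \<in> Lau UNIV" and S: "S \<subseteq> {1..N}"
    and Q: "Q \<in> Lau (cone S)" "\<And>i. i \<in> S \<Longrightarrow> hcomp (unit_vec i) 0 Q \<noteq> 0"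
    and Qf: "Q ^ n * f \<in> Lau (cone S)"
  shows "f \<in> Lau (cone S)" using Qf
proof (induction n)
  case (Suc n)
  define g where "g = Q ^ n * f"
  have g: "g \<in> Lau UNIV" "Q * g \<in> Lau (cone S)"
    unfolding g_def using Suc.prems by (auto simp: mult.assoc intro!: sub_mult[OF subalg_L] sub_power[OF subalg_L] f Lau_UNIV[OF Q(1)])
  have "g \<in> Lau (cone S)"
  proof (cases "g = 0")
    case True thus ?thesis using Lau_0 by simp
  next
    case False
    show ?thesis
    proof (rule Lau_cone[OF g(1) S])
      fix i m assume i: "i \<in> S" and m: "m < (0::int)"
      have gQ: "fls_subdegree (grade (unit_vec i) Q) = 0"
        using Q(2)[OF i] hcomp_cone[OF Q(1) i S] unfolding hcomp_def by (intro fls_subdegree_eqI)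
      have nz: "grade (unit_vec i) g \<noteq> 0" "grade (unit_vec i) Q \<noteq> 0"
        using grade_eq_0[OF g(1)] False Q(2)[OF i] by (auto simp: hcomp_def)
      have "grade (unit_vec i) (Q * g) = grade (unit_vec i) Q * grade (unit_vec i) g"
        by (intro grade_mult g Lau_UNIV[OF Q(1)])
      moreover have "fls_subdegree (grade (unit_vec i) (Q * g)) \<ge> 0"
        using hcomp_cone[OF g(2) i S] nz calculation by (intro fls_subdegree_geI) (auto simp: hcomp_def)
      ultimately have "fls_subdegree (grade (unit_vec i) g) \<ge> 0" using nz gQ by simp
      thus "hcomp (unit_vec i) m g = 0" using m by (simp add: hcomp_def)
    qed
  qed
  thus ?case using Suc.IH g_def by simp
qed simp

lemma lmon_in_subalg:
  assumes A: "subalg A" and "\<And>i. i \<in> {1..N} \<Longrightarrow> y i \<in> A"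
    and "\<And>i. i \<in> {1..N} \<Longrightarrow> a i < 0 \<Longrightarrow> inverse (y i) \<in> A"
  shows "lmon N y a \<in> A" unfolding lmon_def
proof (intro sub_prod[OF A])
  fix i assume i: "i \<in> {1..N}"
  show "y i powi a i \<in> A" unfolding power_int_def using assms(2,3)[OF i]
    by (auto intro!: sub_power[OF A])
qed

lemma Lau_subset_subalg:
  assumes A: "subalg A" and "\<And>i. i \<in> {1..N} \<Longrightarrow> x i \<in> A"
    and "\<And>a i. a \<in> C \<Longrightarrow> i \<in> {1..N} \<Longrightarrow> a i < 0 \<Longrightarrow> inverse (x i) \<in> A"
  shows "Lau C \<subseteq> A" unfolding Lau_def using assms
  by (intro span_subset_subalg) (auto intro!: lmon_in_subalg)

lemma x_in_Lau: "i \<in> {1..N} \<Longrightarrow> x i \<in> Lau (cone S)"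
  using lmon_Lau[of "unit_vec i" "cone S"] lmon_single[of i N x 1] by (auto simp: cone_def)

lemma inverse_x_in_Lau: "i \<in> {1..N} \<Longrightarrow> i \<notin> S \<Longrightarrow> inverse (x i) \<in> Lau (cone S)"
proof -
  assume i: "i \<in> {1..N}" "i \<notin> S"
  have "lmon N x (\<lambda>j. if j = i then -1 else 0) \<in> Lau (cone S)"
    using i by (intro lmon_Lau) (auto simp: cone_def)
  thus ?thesis using lmon_single[OF i(1), of x "-1"] by (simp add: power_int_minus)
qed

lemma mixed_laurent_ring_eq:
  assumes "ex \<union> Inv \<union> Ninv = {1..N}" "(ex \<union> Inv) \<inter> Ninv = {}"
  shows "mixed_laurent_ring \<iota> ex Inv Ninv x = Lau (cone Ninv)"
proof
  show "mixed_laurent_ring \<iota> ex Inv Ninv x \<subseteq> Lau (cone Ninv)" unfolding mixed_laurent_ring_def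
    by (intro sub_generated subalg_cone) (use assms in \<open>auto intro!: x_in_Lau inverse_x_in_Lau\<close>)
  show "Lau (cone Ninv) \<subseteq> mixed_laurent_ring \<iota> ex Inv Ninv x" unfolding mixed_laurent_ring_def
  proof (intro Lau_subset_subalg subalg_generated)
    fix i assume i: "i \<in> {1..N}"
    thus "x i \<in> alg (x ` (ex \<union> Inv) \<union> (\<lambda>k. inverse (x k)) ` (ex \<union> Inv) \<union> x ` Ninv)"
      using assms by (intro generated_algebra.gen) auto
    fix a assume "a \<in> cone Ninv" "a i < 0"
    hence "i \<notin> Ninv" by (auto simp: cone_def)
    hence "i \<in> ex \<union> Inv" using i assms by blast
    thus "inverse (x i) \<in> alg (x ` (ex \<union> Inv) \<union> (\<lambda>k. inverse (x k)) ` (ex \<union> Inv) \<union> x ` Ninv)"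
      by (intro generated_algebra.gen) auto
  qed
qed

end

lemma (in complex_algebra) subalg_localization:
  assumes R: "subalg R" and h: "h \<in> R"
  shows "subalg {f. \<exists>n. h ^ n * f \<in> R}"
proof (rule subalgI)
  show "\<iota> c \<in> {f. \<exists>n. h ^ n * f \<in> R}" for c by (auto intro!: exI[of _ 0] sub_const[OF R])
  fix f g assume "f \<in> {f. \<exists>n. h ^ n * f \<in> R}" "g \<in> {f. \<exists>n. h ^ n * f \<in> R}"
  then obtain m n where mn: "h ^ m * f \<in> R" "h ^ n * g \<in> R" by auto
  have "h ^ n * (h ^ m * f) + h ^ m * (h ^ n * g) \<in> R"
    by (intro sub_add[OF R] sub_mult[OF R] sub_power[OF R] h mn)
  hence "h ^ (m + n) * (f + g) \<in> R" by (simp add: algebra_simps power_add)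
  thus "f + g \<in> {f. \<exists>n. h ^ n * f \<in> R}" by blast
  have "(h ^ m * f) * (h ^ n * g) \<in> R" by (intro sub_mult[OF R] mn)
  hence "h ^ (m + n) * (f * g) \<in> R" by (simp add: algebra_simps power_add)
  thus "f * g \<in> {f. \<exists>n. h ^ n * f \<in> R}" by blast
qed

section \<open>Mutation of seeds\<close>

definition posp :: "(exmatrix) \<Rightarrow> exmatrix" where
  "posp b k = (\<lambda>i. max (b i k) 0)"

definition negp :: "(exmatrix) \<Rightarrow> exmatrix" where
  "negp b k = (\<lambda>i. max (- b i k) 0)"

definition exch :: "nat \<Rightarrow> (exmatrix) \<Rightarrow> (nat \<Rightarrow> 'f::field) \<Rightarrow> nat \<Rightarrow> 'f" where
  "exch N b x k = lmon N x (posp b k) + lmon N x (negp b k)"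

lemma mutate_variables_eq: "mutate_variables N k b x = x(k := exch N b x k / x k)"
proof -
  have *: "(\<Prod>i | i \<in> {1..N} \<and> c i > 0. x i ^ nat (c i)) = lmon N x (\<lambda>i. max (c i) 0)" for c :: "nat \<Rightarrow> int"
    unfolding lmon_def by (rule prod.mono_neutral_cong_left) (auto simp: power_int_def max_def)
  show ?thesis unfolding mutate_variables_def exch_def posp_def negp_def
    using *[of "\<lambda>i. b i k"] *[of "\<lambda>i. - b i k"] by simp
qed

lemma exch_cong:
  assumes "\<And>i. i \<in> {1..N} \<Longrightarrow> b i k = 0 \<or> x i = y i"
  shows "exch N b x k = exch N b y k"
proof -
  have "lmon N x a = lmon N y a" if "\<And>i. b i k = 0 \<Longrightarrow> a i = 0" for a
    unfolding lmon_def using assms that by (intro prod.cong) fastforce+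
  thus ?thesis unfolding exch_def posp_def negp_def by simp
qed

lemma exch_uminus: "exch N (\<lambda>i j. - b i j) x k = exch N b x k" by (simp add: exch_def posp_def negp_def)

lemma mutate_matrix_uminus: "mutate_matrix k (\<lambda>i j. - b i j) = (\<lambda>i j. - mutate_matrix k b i j)"
proof -
  have "(- (\<bar>p\<bar> * q) - p * \<bar>q\<bar>) div 2 = - ((\<bar>p\<bar> * q + p * \<bar>q\<bar>) div 2)" for p q :: int
  proof -
    have "even (\<bar>p\<bar> * q + p * \<bar>q\<bar>)" by auto
    then obtain r where r: "\<bar>p\<bar> * q + p * \<bar>q\<bar> = 2 * r" by (elim evenE)
    hence r': "- (\<bar>p\<bar> * q) - p * \<bar>q\<bar> = 2 * (- r)" by simp
    show ?thesis unfolding r r' by (simp del: mult_minus_right)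
  qed
  thus ?thesis unfolding mutate_matrix_def by (intro ext) simp
qed

lemma mutate_matrix_pos:
  assumes "i \<noteq> k" "j \<noteq> k" "b k j \<ge> 0"
  shows "mutate_matrix k b i j = b i j + b k j * max (b i k) 0"
  using assms by (cases "b i k \<ge> 0") (auto simp: mutate_matrix_def max_def abs_if algebra_simps)

lemma mutate_matrix_neg:
  assumes "i \<noteq> k" "j \<noteq> k" "b k j \<le> 0"
  shows "mutate_matrix k b i j = b i j + b k j * max (- b i k) 0"
  using assms by (cases "b i k \<ge> 0"; cases "b k j = 0") (auto simp: mutate_matrix_def max_def abs_if algebra_simps)

lemma mutate_matrix_k: "mutate_matrix k b i k = - b i k" "mutate_matrix k b k j = - b k j"
  by (auto simp: mutate_matrix_def)

text \<open>A uniform formula for the mutation rule in which only the third summand depends on the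
  row \<open>i\<close> through more than a factor \<open>b i k\<close>.\<close>

lemma mutate_matrix_alt:
  assumes "i \<noteq> k" "j \<noteq> k"
  shows "mutate_matrix k b i j = b i j + b i k * max (b k j) 0 + max (- b i k) 0 * b k j" using assms
  by (cases "b k j \<ge> 0"; cases "b i k \<ge> 0")
     (auto simp: mutate_matrix_pos mutate_matrix_neg max_def algebra_simps)

lemma mutate_matrix_involution: "mutate_matrix k (mutate_matrix k b) = b"
proof (intro ext)
  fix i j
  show "mutate_matrix k (mutate_matrix k b) i j = b i j"
  proof (cases "i = k \<or> j = k")
    case True thus ?thesis by (auto simp: mutate_matrix_k)
  next
    case False
    thus ?thesis by (cases "b k j \<ge> 0") (auto simp: mutate_matrix_pos mutate_matrix_neg mutate_matrix_k)
  qed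
qed

text \<open>The two-step mutation argument sees only the signs of the entries, so the symmetrizer is
  dropped here.\<close>

definition sign_skew :: "nat set \<Rightarrow> (exmatrix) \<Rightarrow> bool" where
  "sign_skew ex b \<longleftrightarrow> (\<forall>i\<in>ex. \<forall>j\<in>ex. (b i j > 0 \<longleftrightarrow> b j i < 0))"

lemma sign_skew_diag: "sign_skew ex b \<Longrightarrow> i \<in> ex \<Longrightarrow> b i i = 0"
  unfolding sign_skew_def by (metis linorder_cases order_less_asym)

lemma skew_symmetrizable_sign_skew: "skew_symmetrizable ex b \<Longrightarrow> sign_skew ex b"
proof -
  assume "skew_symmetrizable ex b"
  then obtain d where d: "\<forall>j\<in>ex. d j > 0" "\<forall>i\<in>ex. \<forall>j\<in>ex. d i * b i j = - (d j * b j i)"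
    unfolding skew_symmetrizable_def by blast
  show ?thesis unfolding sign_skew_def
  proof (intro ballI)
    fix i j assume ij: "i \<in> ex" "j \<in> ex"
    hence dpos: "d i > 0" "d j > 0" using d(1) by auto
    have "0 < b i j \<longleftrightarrow> 0 < d i * b i j" using dpos by (simp add: zero_less_mult_iff)
    also have "d i * b i j = - (d j * b j i)" using d(2) ij by blast
    also have "0 < - (d j * b j i) \<longleftrightarrow> b j i < 0" using dpos by (simp add: mult_less_0_iff)
    finally show "0 < b i j \<longleftrightarrow> b j i < 0" .
  qed
qed

text \<open>The same symmetrizer \<open>d\<close> works after the mutation: it exchanges positive
  parts in column \<open>k\<close> with negative parts in row \<open>k\<close>.\<close>

lemma skew_symmetrizable_mutate:
  assumes "skew_symmetrizable ex b" "k \<in> ex"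
  shows "skew_symmetrizable ex (mutate_matrix k b)"
proof -
  obtain d where d: "\<forall>j\<in>ex. d j > 0" "\<forall>i\<in>ex. \<forall>j\<in>ex. d i * b i j = - (d j * b j i)"
    using assms unfolding skew_symmetrizable_def by blast
  have ss: "sign_skew ex b" using assms by (intro skew_symmetrizable_sign_skew)
  have "d i * mutate_matrix k b i j = - (d j * mutate_matrix k b j i)" if ij: "i \<in> ex" "j \<in> ex" for i j
  proof (cases "i = k \<or> j = k")
    case True
    moreover have "d i * b i j = - (d j * b j i)" using d(2) ij by blast
    ultimately show ?thesis by (elim disjE) (simp_all add: mutate_matrix_k)
  next
    case False
    have e: "d i * b i k = - (d k * b k i)" "d j * b j k = - (d k * b k j)" "d i * b i j = - (d j * b j i)"
      using d(2) ij assms(2) by blast+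
    have dpos: "d i > 0" "d j > 0" "d k > 0" using d(1) ij assms(2) by auto
    have p: "d i * max (b i k) 0 = d k * max (- b k i) 0" "d j * max (b j k) 0 = d k * max (- b k j) 0"
      "d i * max (- b i k) 0 = d k * max (b k i) 0" "d j * max (- b j k) 0 = d k * max (b k j) 0"
    proof -
      have m: "c * max r 0 = c' * max s 0" if "c > 0" "c' > 0" "c * r = c' * s" for c c' r s :: int
      proof -
        have "r \<ge> 0 \<longleftrightarrow> c * r \<ge> 0" using that(1) by (simp add: zero_le_mult_iff)
        also have "\<dots> \<longleftrightarrow> s \<ge> 0" unfolding that(3) using that(2) by (simp add: zero_le_mult_iff)
        finally have "r \<ge> 0 \<longleftrightarrow> s \<ge> 0" .
        thus ?thesis using that(3) by (auto simp: max_def)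
      qed
      show "d i * max (b i k) 0 = d k * max (- b k i) 0" "d j * max (b j k) 0 = d k * max (- b k j) 0"
        "d i * max (- b i k) 0 = d k * max (b k i) 0" "d j * max (- b j k) 0 = d k * max (b k j) 0"
        by (rule m; use e(1,2) dpos in simp)+
    qed
    have "d i * mutate_matrix k b i j = d i * b i j + (d i * b i k) * max (b k j) 0 + d i * max (- b i k) 0 * b k j"
      using False by (simp add: mutate_matrix_alt algebra_simps)
    also have "\<dots> = - (d j * b j i) - d k * b k i * max (b k j) 0 + d k * max (b k i) 0 * b k j"
      unfolding e(1,3) p(3) by simp
    also have "\<dots> = - (d j * b j i + (d j * b j k) * max (b k i) 0 + d j * max (- b j k) 0 * b k i)"
      unfolding e(2) p(4) by (simp add: algebra_simps)
    also have "\<dots> = - (d j * mutate_matrix k b j i)"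
      using False by (simp add: mutate_matrix_alt algebra_simps)
    finally show ?thesis .
  qed
  thus ?thesis unfolding skew_symmetrizable_def using d(1) by blast
qed

definition full_rank :: "nat \<Rightarrow> nat set \<Rightarrow> (exmatrix) \<Rightarrow> bool" where
  "full_rank N ex b \<longleftrightarrow>
     (\<forall>c. (\<forall>i\<in>{1..N}. (\<Sum>j\<in>ex. c j * b i j) = 0) \<longrightarrow> (\<forall>j\<in>ex. c j = 0))"

text \<open>Pairing a linear relation between the columns with column \<open>k\<close> of \<Lambda>
  leaves only the term \<open>c k * d k\<close>.\<close>

lemma compatible_full_rank:
  assumes "compatible N ex b \<Lambda>" "ex \<subseteq> {1..N}"
  shows "full_rank N ex b" unfolding full_rank_def
proof (intro allI impI ballI)
  fix c k assume c: "\<forall>i\<in>{1..N}. (\<Sum>j\<in>ex. c j * b i j) = 0" and k: "k \<in> ex"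
  have fin: "finite ex" using assms(2) finite_subset by blast
  obtain d where d: "\<forall>j\<in>ex. d j > 0"
    "\<forall>j\<in>ex. \<forall>k\<in>{1..N}. (\<Sum>i=1..N. b i j * \<Lambda> i k) = (if k = j then d j else 0)"
    using assms(1) unfolding compatible_def by blast
  have "0 = (\<Sum>i=1..N. (\<Sum>j\<in>ex. c j * b i j) * \<Lambda> i k)" using c by simp
  also have "\<dots> = (\<Sum>j\<in>ex. c j * (\<Sum>i=1..N. b i j * \<Lambda> i k))"
    unfolding sum_distrib_left sum_distrib_right by (subst sum.swap) (simp add: mult.assoc)
  also have "\<dots> = (\<Sum>j\<in>ex. c j * (if k = j then d j else 0))"
    using d(2) k assms(2) by (intro sum.cong) auto
  also have "\<dots> = c k * d k" using k fin by (simp add: if_distrib cong: if_cong)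
  finally show "c k = 0" using d(1) k by auto
qed

lemma full_rank_mutate:
  assumes fr: "full_rank N ex b" and ex: "ex \<subseteq> {1..N}" and k: "k \<in> ex" and kk: "b k k = 0"
  shows "full_rank N ex (mutate_matrix k b)" unfolding full_rank_def
proof (intro allI impI)
  fix c assume c: "\<forall>i\<in>{1..N}. (\<Sum>j\<in>ex. c j * mutate_matrix k b i j) = 0"
  have fin: "finite ex" using ex finite_subset by blast
  \<comment> \<open>By \<open>mutate_matrix_alt\<close>, a relation \<open>c\<close> between the new
    columns is a relation \<open>c'\<close> between the old ones: the third summand cancels by the
    relation in row \<open>k\<close>, and the second one is absorbed into the coefficient of column
    \<open>k\<close>.\<close>
  define s where "s = (\<Sum>j\<in>ex - {k}. c j * max (b k j) 0)"
  define c' where "c' = c(k := s - c k)"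
  have rowk: "(\<Sum>j\<in>ex - {k}. c j * b k j) = 0"
  proof -
    have "0 = (\<Sum>j\<in>ex. c j * mutate_matrix k b k j)" using c k ex by auto
    also have "\<dots> = - (\<Sum>j\<in>ex. c j * b k j)" by (simp add: mutate_matrix_k sum_negf)
    also have "\<dots> = - (\<Sum>j\<in>ex - {k}. c j * b k j)" using k fin kk by (simp add: sum.remove)
    finally show ?thesis by simp
  qed
  have "(\<Sum>j\<in>ex. c' j * b i j) = 0" if i: "i \<in> {1..N}" for i
  proof (cases "i = k")
    case True
    thus ?thesis using rowk k fin kk by (simp add: sum.remove c'_def)
  next
    case False
    have "0 = (\<Sum>j\<in>ex. c j * mutate_matrix k b i j)" using c i by simp
    also have "\<dots> = - c k * b i k + (\<Sum>j\<in>ex - {k}. c j * mutate_matrix k b i j)"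
      using k fin by (simp add: sum.remove mutate_matrix_k)
    also have "(\<Sum>j\<in>ex - {k}. c j * mutate_matrix k b i j) =
      (\<Sum>j\<in>ex - {k}. c j * b i j + b i k * (c j * max (b k j) 0) + max (- b i k) 0 * (c j * b k j))"
      using False by (intro sum.cong) (auto simp: mutate_matrix_alt algebra_simps)
    also have "\<dots> = (\<Sum>j\<in>ex - {k}. c j * b i j) + b i k * s"
      unfolding sum.distrib sum_distrib_left[symmetric] rowk s_def by simp
    finally have "(\<Sum>j\<in>ex - {k}. c j * b i j) + (s - c k) * b i k = 0" by (simp add: algebra_simps)
    thus ?thesis using k fin by (simp add: sum.remove c'_def)
  qed
  hence c'0: "\<forall>j\<in>ex. c' j = 0" using fr unfolding full_rank_def by blast
  hence c0: "c j = 0" if "j \<in> ex - {k}" for j using that by (auto simp: c'_def)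
  hence "s = 0" unfolding s_def by simp
  with c'0 k have "c k = 0" by (auto simp: c'_def)
  with c0 show "\<forall>j\<in>ex. c j = 0" by blast
qed

text \<open>\<open>w\<close> is the projection of column \<open>k\<close> onto the complement of
  column \<open>j\<close>, scaled by the squared length of column \<open>j\<close> to stay integral.
  Its pairing with column \<open>k\<close> is positive because otherwise \<open>w\<close> would be
  zero, a relation between the two columns.\<close>

lemma full_rank_separating_weight:
  assumes fr: "full_rank N ex b" and ex: "finite ex" and jk: "j \<in> ex" "k \<in> ex" "j \<noteq> k"
  obtains w where "(\<Sum>i=1..N. w i * b i j) = 0" "(\<Sum>i=1..N. w i * b i k) > 0"
proof -
  define dot where "dot u v = (\<Sum>i=1..N. b i u * b i v)" for u v
  define w where "w i = dot j j * b i k - dot j k * b i j" for i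
  have dot_sym: "dot u v = dot v u" for u v unfolding dot_def by (simp add: mult.commute)
  have wdot: "(\<Sum>i=1..N. w i * b i u) = dot j j * dot k u - dot j k * dot j u" for u
    unfolding w_def dot_def by (simp add: left_diff_distrib sum_subtractf sum_distrib_left mult.assoc)
  have djj: "dot j j > 0"
  proof (rule ccontr)
    assume "\<not> dot j j > 0"
    moreover have "dot j j \<ge> 0" unfolding dot_def by (intro sum_nonneg) simp
    ultimately have "dot j j = 0" by simp
    hence 0: "\<forall>i\<in>{1..N}. b i j = 0" unfolding dot_def by (subst (asm) sum_nonneg_eq_0_iff) auto
    have "\<forall>i\<in>{1..N}. (\<Sum>u\<in>ex. (if u = j then 1 else 0) * b i u) = 0"
      using 0 ex jk by (simp add: if_distrib[of "\<lambda>x. x * _"] cong: if_cong)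
    from fr[unfolded full_rank_def, rule_format, OF this[rule_format], of j] jk show False by simp
  qed
  have ww: "(\<Sum>i=1..N. w i * w i) = dot j j * (\<Sum>i=1..N. w i * b i k) - dot j k * (\<Sum>i=1..N. w i * b i j)"
    by (simp add: w_def[of "_"] algebra_simps sum_subtractf sum_distrib_left sum.distrib)
  have wj: "(\<Sum>i=1..N. w i * b i j) = 0" using wdot[of j] dot_sym[of k j] by simp
  have "(\<Sum>i=1..N. w i * b i k) > 0"
  proof (rule ccontr)
    assume "\<not> (\<Sum>i=1..N. w i * b i k) > 0"
    hence "(\<Sum>i=1..N. w i * w i) \<le> 0" using ww wj djj by (simp add: mult_le_0_iff)
    moreover have "(\<Sum>i=1..N. w i * w i) \<ge> 0" by (intro sum_nonneg) simp
    ultimately have "(\<Sum>i=1..N. w i * w i) = 0" by simp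
    hence w0: "\<forall>i\<in>{1..N}. w i = 0" by (subst (asm) sum_nonneg_eq_0_iff) auto
    have "(\<Sum>u\<in>ex. (if u = k then dot j j else if u = j then - dot j k else 0) * b i u) = w i" for i
    proof -
      have "(\<Sum>u\<in>ex. (if u = k then dot j j else if u = j then - dot j k else 0) * b i u) =
         (\<Sum>u\<in>ex. (if u = k then dot j j * b i u else 0) + (if u = j then - dot j k * b i u else 0))"
        using jk by (intro sum.cong) auto
      thus ?thesis using ex jk by (simp add: sum.distrib w_def)
    qed
    hence "\<forall>i\<in>{1..N}. (\<Sum>u\<in>ex. (if u = k then dot j j else if u = j then - dot j k else 0) * b i u) = 0"
      using w0 by simp
    from fr[unfolded full_rank_def, rule_format, OF this[rule_format], of k] jk djj show False by simp
  qed
  with wj show thesis by (rule that)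
qed

section \<open>Exchange polynomials: homogeneity and independence after one mutation\<close>

context laurent
begin

lemma grade_power:
  assumes "f \<in> Lau UNIV" shows "grade w (f ^ n) = grade w f ^ n"
proof (induction n)
  case 0
  show ?case using grade_lmon[of w "\<lambda>_. 0"] by (simp add: wt_def)
next
  case (Suc n)
  thus ?case by (simp add: grade_mult assms sub_power[OF subalg_L])
qed

lemma grade_exch:
  assumes "wt N w (posp b k) = d" "wt N w (negp b k) = d"
  shows "grade w (exch N b x k) = fls_const (exch N b x k) * fls_X_intpow d"
  unfolding exch_def scalar_linear_add[OF grade_linear] grade_lmon assms
  by (simp add: distrib_right fls_plus_const[symmetric] del: fls_plus_const)

text \<open>If column \<open>k\<close> is zero the two monomials coincide and their sum is twice a
  monomial; otherwise they are linearly independent.\<close>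

lemma exch_nz: "exch N b x k \<noteq> 0"
proof
  assume 0: "exch N b x k = 0"
  show False
  proof (cases "restrict (posp b k) {1..N} = restrict (negp b k) {1..N}")
    case True
    hence "lmon N x (posp b k) = lmon N x (negp b k)"
      using lmon_restrict[of N x "posp b k"] lmon_restrict[of N x "negp b k"] by metis
    hence "of_nat 2 * lmon N x (negp b k) = 0" using 0 by (simp add: exch_def)
    thus False using lmon_nz' by (simp del: of_nat_numeral)
  next
    case False
    let ?p = "restrict (posp b k) {1..N}" and ?n = "restrict (negp b k) {1..N}"
    have "(\<Sum>a\<in>{?p, ?n}. \<iota> 1 * lmon N x a) = 0" using 0 False by (simp add: exch_def)
    thus False using lmon_indep[of "{?p, ?n}" "\<lambda>_. 1"] by auto
  qed
qed

lemma exch_in_Lau: "exch N b x k \<in> Lau (cone S)" unfolding exch_def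
  by (intro Lau_add lmon_Lau) (auto simp: cone_def posp_def negp_def)

text \<open>In the new variables a monomial is \<open>P ^ a k\<close> times a Laurent monomial of
  degree \<open>- a k\<close> in \<open>x k\<close>, and \<open>P\<close> has degree 0 in
  \<open>x k\<close>. The component of a given degree carries one fixed power of \<open>P\<close>,
  which cancels and leaves a relation between Laurent monomials.\<close>

lemma indep_mutate:
  assumes k: "k \<in> {1..N}" and P: "P \<in> Lau UNIV" "P \<noteq> 0" "grade (unit_vec k) P = fls_const P"
  shows "algebraically_independent \<iota> N (x(k := P / x k))" unfolding algebraically_independent_def
proof (intro allI impI, elim conjE)
  fix M c assume M: "finite M" "M \<subseteq> {1..N} \<rightarrow>\<^sub>E (UNIV :: nat set)"
    and 0: "(\<Sum>a\<in>M. \<iota> (c a) * (\<Prod>i=1..N. (x(k := P / x k)) i ^ a i)) = 0"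
  define g :: "(nat \<Rightarrow> nat) \<Rightarrow> nat \<Rightarrow> int"
    where "g a = restrict (\<lambda>i. if i = k then - int (a i) else int (a i)) {1..N}" for a
  have mon: "(\<Prod>i=1..N. (x(k := P / x k)) i ^ a i) = P ^ a k * lmon N x (g a)" for a
  proof -
    have "(\<Prod>i=1..N. (x(k := P / x k)) i ^ a i) =
       (\<Prod>i=1..N. (if i = k then P ^ a k else 1) * x i powi g a i)"
      using x_nz by (intro prod.cong) (auto simp: g_def power_divide power_int_minus field_simps)
    thus ?thesis using k by (simp add: prod.distrib lmon_def)
  qed
  have comp: "hcomp (unit_vec k) (- int n) (P ^ a k * lmon N x (g a)) =
      (if a k = n then P ^ a k * lmon N x (g a) else 0)" for a n
  proof -
    have "grade (unit_vec k) (P ^ a k * lmon N x (g a)) =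
      fls_const (P ^ a k * lmon N x (g a)) * fls_X_intpow (- int (a k))" using k P by (subst grade_mult)
        (auto simp: sub_power[OF subalg_L] lmon_Lau grade_power grade_lmon wt_unit_vec g_def
          fls_const_power mult.assoc[symmetric] simp flip: fls_const_mult_const)
    thus ?thesis by (auto simp: hcomp_def)
  qed
  have inj: "inj_on g M"
  proof (rule inj_onI)
    fix a a' assume *: "a \<in> M" "a' \<in> M" "g a = g a'"
    have "a i = a' i" if "i \<in> {1..N}" for i
      using fun_cong[OF *(3), of i] that by (auto simp: g_def split: if_splits)
    moreover have "a \<in> {1..N} \<rightarrow>\<^sub>E UNIV" "a' \<in> {1..N} \<rightarrow>\<^sub>E UNIV" using * M(2) by auto
    ultimately show "a = a'" by (intro PiE_ext)
  qed
  show "\<forall>a\<in>M. c a = 0"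
  proof
    fix a0 assume a0: "a0 \<in> M"
    define n where "n = a0 k"
    define Mn where "Mn = {a\<in>M. a k = n}"
    have injn: "inj_on g Mn" using inj by (rule inj_on_subset) (auto simp: Mn_def)
    have "0 = hcomp (unit_vec k) (- int n) (\<Sum>a\<in>M. \<iota> (c a) * (P ^ a k * lmon N x (g a)))"
      using 0 unfolding mon by (simp add: scalar_linear_0[OF hcomp_linear])
    also have "\<dots> = (\<Sum>a\<in>M. \<iota> (c a) * (if a k = n then P ^ a k * lmon N x (g a) else 0))"
      by (simp add: scalar_linear_sum[OF hcomp_linear] scalar_linear_scale[OF hcomp_linear] comp)
    also have "\<dots> = (\<Sum>a\<in>Mn. P ^ n * (\<iota> (c a) * lmon N x (g a)))"
      unfolding Mn_def using M(1) by (intro sum.mono_neutral_cong_right) auto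
    also have "\<dots> = P ^ n * (\<Sum>a\<in>Mn. \<iota> (c a) * lmon N x (g a))" by (simp add: sum_distrib_left)
    finally have "(\<Sum>a\<in>Mn. \<iota> (c a) * lmon N x (g a)) = 0" using P(2) by simp
    hence "(\<Sum>a\<in>g ` Mn. \<iota> (c (inv_into Mn g a)) * lmon N x a) = 0" using injn by (simp add: sum.reindex)
    moreover have "finite (g ` Mn)" "g ` Mn \<subseteq> exps N" using M(1) by (auto simp: Mn_def g_def)
    ultimately have "\<forall>a\<in>g ` Mn. c (inv_into Mn g a) = 0"
      by (intro lmon_indep[of "g ` Mn" "\<lambda>a. c (inv_into Mn g a)"])
    moreover have "a0 \<in> Mn" using a0 by (simp add: Mn_def n_def)
    ultimately show "c a0 = 0" using injn by (simp add: inv_into_f_f)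
  qed
qed

lemma indep_exch:
  assumes k: "k \<in> {1..N}" and "b k k = 0"
  shows "algebraically_independent \<iota> N (x(k := exch N b x k / x k))"
proof (rule indep_mutate[OF k _ exch_nz])
  show "exch N b x k \<in> Lau UNIV" using exch_in_Lau[of b k "{}"] Lau_UNIV by blast
  show "grade (unit_vec k) (exch N b x k) = fls_const (exch N b x k)"
    using grade_exch[of "unit_vec k" b k 0] assms by (simp add: wt_unit_vec posp_def negp_def)
qed

end

lemma lmon_split:
  assumes "j \<in> {1..N}"
  shows "lmon N x a = x j powi a j * lmon N x (a(j := 0))"
proof -
  have "lmon N x (a(j := 0)) = (\<Prod>i\<in>{1..N} - {j}. x i powi a i)"
    unfolding lmon_def using assms by (subst prod.remove[of _ j]) (auto intro!: prod.cong)
  thus ?thesis unfolding lmon_def using assms by (subst prod.remove[of _ j]) auto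
qed

lemma lmon_power: "lmon N x a ^ n = lmon N x (\<lambda>i. int n * a i)"
  unfolding lmon_def prod_power_distrib by (intro prod.cong) (simp_all add: power_int_mult mult.commute[of "int n"])

section \<open>Coprimality of the denominators of two successive mutations\<close>

context laurent
begin

lemma hcomp_homogeneous_mult:
  assumes "h \<in> Lau UNIV" "grade w h = fls_const h * fls_X_intpow d" "f \<in> Lau UNIV"
  shows "hcomp w n (h * f) = h * hcomp w (n - d) f"
  unfolding hcomp_def grade_mult[OF assms(1,3)] assms(2) mult.assoc fls_mult_const_nth
    fls_X_intpow_times_nth ..

lemma subalg_nonneg: "subalg {f \<in> Lau UNIV. \<forall>n<0. hcomp w n f = 0}"
proof (rule subalgI)
  show "\<iota> c \<in> {f \<in> Lau UNIV. \<forall>n<0. hcomp w n f = 0}" for c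
    using scalar_linear_scale[OF hcomp_linear, of w _ c 1] hcomp_lmon[of w _ "\<lambda>_. 0"]
    by (simp add: sub_const[OF subalg_L] wt_def)
  fix f g assume "f \<in> {f \<in> Lau UNIV. \<forall>n<0. hcomp w n f = 0}" "g \<in> {f \<in> Lau UNIV. \<forall>n<0. hcomp w n f = 0}"
  hence fg: "f \<in> Lau UNIV" "g \<in> Lau UNIV" "\<forall>n<0. hcomp w n f = 0" "\<forall>n<0. hcomp w n g = 0" by auto
  thus "f + g \<in> {f \<in> Lau UNIV. \<forall>n<0. hcomp w n f = 0}"
    by (auto simp: scalar_linear_add[OF hcomp_linear] intro: Lau_add)
  have sd: "fls_subdegree F \<ge> 0" if "\<forall>n<0. F $$ n = 0" for F :: "'f fls"
    using that by (cases "F = 0") (auto intro!: fls_subdegree_geI)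
  have "hcomp w n (f * g) = 0" if "n < 0" for n unfolding hcomp_def grade_mult[OF fg(1,2)]
    using sd[of "grade w f"] sd[of "grade w g"] fg that
    by (intro fls_times_nth_eq0) (auto simp: hcomp_def)
  thus "f * g \<in> {f \<in> Lau UNIV. \<forall>n<0. hcomp w n f = 0}" using fg by (auto intro: sub_mult[OF subalg_L])
qed

lemma lmon_inverse_Lau: "inverse (lmon N x a) \<in> Lau UNIV"
  unfolding lmon_uminus[symmetric] by (intro lmon_Lau) simp

text \<open>Here \<open>x\<close> is the cluster obtained by mutating first at \<open>k\<close> and then at \<open>j\<close>; the elements \<open>xk\<close>
  and \<open>x2j\<close> are the \<open>k\<close>-th variable of the original cluster and the \<open>j\<close>-th variable of
  its mutation at \<open>j\<close>.\<close>

lemma mutation_nzd: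
  fixes b :: "exmatrix" and k j :: nat
  defines "Q \<equiv> exch N (mutate_matrix k b) x j"
  defines "A \<equiv> lmon N x (posp b k)" and "B \<equiv> lmon N x ((negp b k)(j := 0))"
    and "C \<equiv> lmon N x ((posp b j)(k := 0))" and "D \<equiv> lmon N x (negp b j)"
  defines "e \<equiv> nat (b k j)" and "c \<equiv> nat (- b j k)"
  defines "xj \<equiv> Q / x j"
  defines "xk \<equiv> (A + xj ^ c * B) / x k"
  defines "x2j \<equiv> (C * xk ^ e + D) / xj"
  assumes kj: "k \<in> {1..N}" "j \<in> {1..N}" "k \<noteq> j"
    and b: "b k j > 0" "b j k < 0" "b k k = 0" "b j j = 0"
  shows "xk \<in> Lau UNIV" "x2j \<in> Lau UNIV" "nzd (Lau UNIV) Q xk" "nzd (Lau UNIV) Q x2j"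
proof -
  define b1 where "b1 = mutate_matrix k b"
  \<comment> \<open>With this weight \<open>Q\<close>, which is free of \<open>x j\<close>, has
    weight 0 and \<open>xj\<close> has weight 1, so that lowest components are obtained by setting
    \<open>xj\<close> to zero.\<close>
  define w where "w = (\<lambda>i. if i = j then -1 else (0::int))"
  define M where "M = lmon N x (\<lambda>i. negp b j i - negp b1 j i)"
  define zk where "zk = lmon N x (\<lambda>i. if i = k then - int e else 0)"
  have wt_w: "wt N w a = - a j" for a
    unfolding wt_def w_def using kj by (simp add: if_distrib[of "\<lambda>x. x * _"] cong: if_cong)
  have e: "int e = b k j" using b by (simp add: e_def)
  have c: "c > 0" using b by (simp add: c_def)
  have b1: "b1 i j = b i j + int e * posp b k i" if "i \<noteq> k" for i
    using mutate_matrix_pos[OF that, of j b] b kj e by (simp add: b1_def posp_def)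
  have b1k: "b1 k j = - int e" using e by (simp add: b1_def mutate_matrix_k)
  have b1j: "b1 j j = 0" using b1[of j] kj b by (simp add: posp_def)
  have Q_nz: "Q \<noteq> 0" unfolding Q_def by (rule exch_nz)
  have xj_nz: "xj \<noteq> 0" using Q_nz x_nz[OF kj(2)] by (simp add: xj_def)
  have xkn: "x k \<noteq> 0" "x j \<noteq> 0" using x_nz kj by auto
  have xkinv: "inverse (x k) = lmon N x (\<lambda>i. if i = k then - 1 else 0)"
    using kj(1) by (simp add: lmon_single power_int_minus)
  have xjinv: "inverse (x j) = lmon N x (\<lambda>i. if i = j then - 1 else 0)"
    using kj(2) by (simp add: lmon_single power_int_minus)
  \<comment> \<open>The right-hand side is what remains of \<open>C * xk ^ e + D\<close> when
    \<open>xj\<close> is set to zero. It is a monomial times \<open>Q\<close>, hence divisible by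
    \<open>xj\<close>, which makes \<open>x2j\<close> a Laurent polynomial.\<close>
  have MQ: "M * Q = C * A ^ e * zk + D"
  proof -
    have "M * lmon N x (posp b1 j) = C * A ^ e * zk"
      unfolding M_def C_def A_def zk_def lmon_power lmon_add'[symmetric]
    proof (rule lmon_cong)
      fix i show "negp b j i - negp b1 j i + posp b1 j i =
          ((posp b j)(k := 0)) i + int e * posp b k i + (if i = k then - int e else 0)"
      proof (cases "i = k")
        case True thus ?thesis using b b1k by (simp add: negp_def posp_def)
      next
        case False
        have "posp b1 j i - negp b1 j i = b1 i j" "posp b j i - negp b j i = b i j"
          by (auto simp: posp_def negp_def)
        thus ?thesis using False b1[OF False] by simp
      qed
    qed simp
    moreover have "M * lmon N x (negp b1 j) = D" unfolding M_def D_def lmon_add'[symmetric] by simp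
    ultimately show ?thesis unfolding Q_def exch_def b1_def[symmetric] by (simp add: distrib_left)
  qed
  have gQ: "grade w Q = fls_const Q * fls_X_intpow 0"
    unfolding Q_def b1_def[symmetric] using b1j by (intro grade_exch) (auto simp: wt_w posp_def negp_def)
  have QL: "Q \<in> Lau UNIV" unfolding Q_def using exch_in_Lau[of "mutate_matrix k b" j "{}"] Lau_UNIV by blast
  have xjL: "xj \<in> Lau UNIV"
    unfolding xj_def divide_inverse xjinv by (intro sub_mult[OF subalg_L] QL lmon_Lau) simp
  have gxj: "grade w xj = fls_const xj * fls_X_intpow 1" unfolding xj_def divide_inverse xjinv
    by (simp add: grade_mult QL lmon_Lau gQ grade_lmon wt_w mult.assoc[symmetric])
  define NN where "NN = {f \<in> Lau UNIV. \<forall>n<0. hcomp w n f = 0}"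
  have NN: "subalg NN" unfolding NN_def by (rule subalg_nonneg)
  have lmonNN: "lmon N x a \<in> NN" if "a j \<le> 0" for a
    using that by (auto simp: NN_def hcomp_lmon wt_w lmon_Lau)
  have xjNN: "xj \<in> NN" using hcomp_homogeneous_mult[OF xjL gxj, of 1] hcomp_lmon[of w _ "\<lambda>_. 0"]
    by (auto simp: NN_def xjL sub_1[OF subalg_L] wt_def)
  have NNL: "f \<in> NN \<Longrightarrow> f \<in> Lau UNIV" for f by (simp add: NN_def)
  have ABCD: "A \<in> NN" "B \<in> NN" "C \<in> NN" "D \<in> NN" "zk \<in> NN" "inverse (x k) \<in> NN"
    unfolding A_def B_def C_def D_def zk_def xkinv
    using b kj by (auto intro!: lmonNN simp: posp_def negp_def)
  have xk_eq: "xk = A * inverse (x k) + xj * (xj ^ (c - 1) * B * inverse (x k))"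
    unfolding xk_def using c by (cases c) (auto simp: field_simps add_divide_distrib)
  define t where "t = xj ^ (c - 1) * B * inverse (x k)"
  have t: "t \<in> NN" unfolding t_def by (intro sub_mult[OF NN] sub_power[OF NN] xjNN ABCD)
  have hxjt: "hcomp w n (xj * t) = 0" if "n \<le> 0" for n
    using hcomp_homogeneous_mult[OF xjL gxj NNL[OF t], of n] t that by (simp add: NN_def)
  have Ak: "A * inverse (x k) = lmon N x (\<lambda>i. posp b k i + (if i = k then - 1 else 0))"
    unfolding A_def xkinv lmon_add' ..
  have hAk: "hcomp w n (A * inverse (x k)) = (if n = 0 then A * inverse (x k) else 0)" for n
    unfolding Ak hcomp_lmon wt_w using kj b by (simp add: posp_def)
  have xkNN: "xk \<in> NN" unfolding xk_eq t_def[symmetric]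
    by (intro sub_add[OF NN] sub_mult[OF NN] ABCD xjNN t)
  thus xkL: "xk \<in> Lau UNIV" by (rule NNL)
  show "nzd (Lau UNIV) Q xk"
  proof (rule nzd_homogeneous[OF xkL _ _ _ _ QL gQ])
    show "hcomp w n xk = 0" if "n < 0" for n using xkNN that by (simp add: NN_def)
    show "hcomp w 0 xk = A * inverse (x k)"
      unfolding xk_eq t_def[symmetric] scalar_linear_add[OF hcomp_linear] hAk using hxjt[of 0] by simp
    show "A * inverse (x k) \<noteq> 0" "inverse (A * inverse (x k)) \<in> Lau UNIV"
      unfolding Ak by (auto intro: lmon_inverse_Lau simp: lmon_nz')
  qed
  \<comment> \<open>\<open>S\<close> is the quotient of the difference of the \<open>e\<close>-th
    powers of \<open>A + xj ^ c * B\<close> and \<open>A\<close> by the difference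
    \<open>xj ^ c * B\<close> of the bases.\<close>
  define S where "S = (\<Sum>i<e. A ^ (e - Suc i) * (A + xj ^ c * B) ^ i)"
  define \<beta> where "\<beta> = C * zk * xj ^ (c - 1) * B * S"
  have "S \<in> NN" unfolding S_def
    by (intro sub_sum[OF NN] sub_mult[OF NN] sub_power[OF NN] sub_add[OF NN] ABCD xjNN)
  hence \<beta>: "\<beta> \<in> NN" unfolding \<beta>_def by (intro sub_mult[OF NN] sub_power[OF NN] ABCD xjNN)
  have x2j_eq: "x2j = M * x j + \<beta>"
  proof -
    have S: "(A + xj ^ c * B) ^ e = A ^ e + xj ^ c * B * S"
      using power_diff_sumr2[of "A + xj ^ c * B" e A] by (simp add: S_def algebra_simps)
    have zk: "zk * x k ^ e = 1" using kj(1) xkn by (simp add: zk_def lmon_single power_int_minus)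
    have "xk ^ e = (A + xj ^ c * B) ^ e * zk"
      unfolding xk_def power_divide using xkn zk by (simp add: field_simps)
    hence "C * xk ^ e + D = M * Q + C * zk * xj ^ c * B * S" unfolding MQ S by (simp add: algebra_simps)
    also have "xj ^ c = xj * xj ^ (c - 1)" using c by (cases c) auto
    also have "M * Q = M * x j * xj" using xkn by (simp add: xj_def)
    finally have "C * xk ^ e + D = xj * (M * x j + \<beta>)" by (simp add: \<beta>_def algebra_simps)
    thus ?thesis using xj_nz by (simp add: x2j_def)
  qed
  have Mj: "M * x j = lmon N x (\<lambda>i. (negp b j i - negp b1 j i) + unit_vec j i)"
    unfolding M_def lmon_add' using lmon_single[OF kj(2), of x 1] by simp
  have hMj: "hcomp w n (M * x j) = (if n = -1 then M * x j else 0)" for n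
    unfolding Mj hcomp_lmon wt_w using b b1j by (simp add: negp_def)
  show x2jL: "x2j \<in> Lau UNIV" unfolding x2j_eq
    by (intro sub_add[OF subalg_L] NNL[OF \<beta>]) (simp add: Mj lmon_Lau)
  show "nzd (Lau UNIV) Q x2j"
  proof (rule nzd_homogeneous[OF x2jL _ _ _ _ QL gQ])
    show "hcomp w n x2j = 0" if "n < -1" for n
      using \<beta> that unfolding x2j_eq scalar_linear_add[OF hcomp_linear] hMj by (simp add: NN_def)
    show "hcomp w (-1) x2j = M * x j"
      using \<beta> unfolding x2j_eq scalar_linear_add[OF hcomp_linear] hMj by (simp add: NN_def)
    show "M * x j \<noteq> 0" "inverse (M * x j) \<in> Lau UNIV"
      unfolding Mj by (auto intro: lmon_inverse_Lau simp: lmon_nz')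
  qed
qed

text \<open>For a weight orthogonal to column \<open>j\<close> but not to column \<open>k\<close>,
  the first exchange polynomial is homogeneous, while the lowest component of the second is a single
  monomial and hence a unit.\<close>

lemma commuting_nzd:
  assumes fr: "full_rank N ex b" and ex: "finite ex" and jk: "j \<in> ex" "k \<in> ex" "j \<noteq> k"
  shows "nzd (Lau UNIV) (exch N b x j) (exch N b x k)"
proof -
  obtain w where w: "(\<Sum>i=1..N. w i * b i j) = 0" "(\<Sum>i=1..N. w i * b i k) > 0"
    using full_rank_separating_weight[OF fr ex jk] .
  have wt: "wt N w (posp b u) = wt N w (negp b u) + (\<Sum>i=1..N. w i * b i u)" for u
    unfolding wt_def sum.distrib[symmetric]
    by (intro sum.cong) (auto simp: posp_def negp_def max_def algebra_simps)
  have L: "exch N b x u \<in> Lau UNIV" for u using exch_in_Lau[of b u "{}"] Lau_UNIV by blast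
  have h: "hcomp w n (exch N b x k) = (if n = wt N w (posp b k) then lmon N x (posp b k) else 0) +
     (if n = wt N w (negp b k) then lmon N x (negp b k) else 0)" for n
    unfolding exch_def scalar_linear_add[OF hcomp_linear] hcomp_lmon by simp
  show ?thesis
  proof (rule nzd_homogeneous[OF L _ _ _ _ L grade_exch[of w b j, OF _ refl]])
    show "wt N w (posp b j) = wt N w (negp b j)" using wt[of j] w by simp
    show "hcomp w n (exch N b x k) = 0" if "n < wt N w (negp b k)" for n
      unfolding h using wt[of k] w that by auto
    show "hcomp w (wt N w (negp b k)) (exch N b x k) = lmon N x (negp b k)"
      unfolding h using wt[of k] w by auto
  qed (auto simp: lmon_nz' lmon_inverse_Lau)
qed

end

section \<open>The upper bound theorem\<close>

lemma wt_unit_vec': "i \<in> {1..N} \<Longrightarrow> wt N (unit_vec i) a = a i"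
  unfolding wt_def by (simp add: if_distrib[of "\<lambda>x. x * _"] cong: if_cong)

context complex_algebra
begin

text \<open>Written in the cluster \<open>x12\<close>, elements of the Laurent ring of
  \<open>x1\<close> have only powers of \<open>Q\<close> as denominators, and elements of that of
  \<open>x2\<close> only powers of \<open>h = x k * x2 j\<close>. As \<open>h\<close> is not a zero
  divisor modulo \<open>Q\<close>, an element of both rings has no denominator. A last division by
  powers of \<open>Q\<close> restores the nonnegativity of the exponents in
  \<open>S\<close>.\<close>

lemma two_step_mutation:
  assumes x: "algebraically_independent \<iota> N x" and ex: "ex \<subseteq> {1..N}" and S: "S \<subseteq> {1..N} - ex"
    and ss: "sign_skew ex b" and fr: "full_rank N ex b" and jk: "j \<in> ex" "k \<in> ex" "j \<noteq> k"
  defines "x1 \<equiv> x(k := exch N b x k / x k)" and "b1 \<equiv> mutate_matrix k b"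
  defines "x12 \<equiv> x1(j := exch N b1 x1 j / x1 j)" and "x2 \<equiv> x(j := exch N b x j / x j)"
  assumes f1: "f \<in> laurent.Lau \<iota> N x1 (cone S)" and f2: "f \<in> laurent.Lau \<iota> N x2 UNIV"
  shows "f \<in> laurent.Lau \<iota> N x12 (cone S)"
proof -
  interpret X: laurent \<iota> N x by unfold_locales fact
  have kj: "k \<in> {1..N}" "j \<in> {1..N}" "k \<noteq> j" using ex jk by auto
  have bd: "b k k = 0" "b j j = 0" using sign_skew_diag[OF ss] jk by auto
  interpret X1: laurent \<iota> N x1 unfolding x1_def by unfold_locales (rule X.indep_exch, use kj bd in auto)
  have b1jj: "b1 j j = 0"
  proof -
    have "b k j = 0 \<and> b j k = 0 \<or> b k j > 0 \<and> b j k < 0 \<or> b k j < 0 \<and> b j k > 0"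
      using ss jk unfolding sign_skew_def by (metis linorder_cases)
    thus ?thesis using bd kj by (auto simp: b1_def mutate_matrix_pos mutate_matrix_neg)
  qed
  interpret X12: laurent \<iota> N x12
    unfolding x12_def by unfold_locales (rule X1.indep_exch, use kj b1jj in auto)
  interpret X2: laurent \<iota> N x2 unfolding x2_def by unfold_locales (rule X.indep_exch, use kj bd in auto)
  define R where "R = X12.Lau UNIV"
  have R: "subalg R" unfolding R_def by (rule X12.subalg_L)
  define Q where "Q = exch N b1 x12 j"
  have Q: "Q = exch N b1 x1 j" unfolding Q_def x12_def using b1jj by (intro exch_cong) auto
  have Q_nz: "Q \<noteq> 0" unfolding Q_def by (rule X12.exch_nz)
  have QC: "Q \<in> X12.Lau (cone T)" for T unfolding Q_def by (rule X12.exch_in_Lau)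
  have QR: "Q \<in> R" unfolding R_def using QC[of "{}"] X12.Lau_UNIV by blast
  have xj: "x j = Q / x12 j" "x1 j = Q / x12 j"
    using kj X.x_nz[OF kj(2)] Q_nz by (auto simp: x12_def Q x1_def)
  have xjR: "x j \<in> R" unfolding xj R_def divide_inverse
    using QR[unfolded R_def] X12.inverse_x_in_Lau[OF kj(2), of "{}"] X12.Lau_UNIV X12.subalg_L
    by (blast intro: sub_mult)
  have zR: "x12 i \<in> R" "inverse (x12 i) \<in> R" if "i \<in> {1..N}" for i
    unfolding R_def using X12.x_in_Lau[OF that, of "{}"] X12.inverse_x_in_Lau[OF that, of "{}"]
      X12.Lau_UNIV by blast+
  have zi: "x12 i = x i" if "i \<noteq> k" "i \<noteq> j" for i using that by (simp add: x12_def x1_def)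
  have zk: "x12 k = exch N b x k / x k" using kj by (simp add: x12_def x1_def)
  have xk: "x k = exch N b x k / x12 k" using X.x_nz[OF kj(1)] X.exch_nz by (simp add: zk)
  have main: "x k \<in> R \<and> x2 j \<in> R \<and> nzd R Q (x k) \<and> nzd R Q (x2 j)"
  proof -
    \<comment> \<open>\<open>b'\<close> will be \<open>b\<close> or \<open>- b\<close>, whichever is
      positive at \<open>(k, j)\<close>. A change of sign swaps the two monomials of each exchange
      polynomial and commutes with mutation.\<close>
    have gen: "x k \<in> R \<and> x2 j \<in> R \<and> nzd R Q (x k) \<and> nzd R Q (x2 j)"
      if b': "b' k j > 0" "b' j k < 0" "b' k k = 0" "b' j j = 0"
        and e: "exch N b' x k = exch N b x k" "exch N b' x j = exch N b x j"
          "exch N (mutate_matrix k b') x12 j = Q" for b'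
    proof -
      have lm: "lmon N x a = lmon N x12 a" if "a k = 0" "a j = 0" for a
      proof -
        have "x i powi a i = x12 i powi a i" for i
          using zi[of i] that by (cases "i = k"; cases "i = j") auto
        thus ?thesis unfolding lmon_def by simp
      qed
      define c where "c = nat (- b' j k)"
      define e' where "e' = nat (b' k j)"
      have ek: "exch N b x k = lmon N x12 (posp b' k) + x j ^ c * lmon N x12 ((negp b' k)(j := 0))"
      proof -
        have "lmon N x (negp b' k) = x j powi negp b' k j * lmon N x ((negp b' k)(j := 0))"
          by (rule lmon_split[OF kj(2)])
        also have "negp b' k j = int c" using b' by (simp add: negp_def c_def)
        finally have n: "lmon N x (negp b' k) = x j ^ c * lmon N x ((negp b' k)(j := 0))" by (simp only: power_int_of_nat)
        have "lmon N x (posp b' k) = lmon N x12 (posp b' k)"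
          "lmon N x ((negp b' k)(j := 0)) = lmon N x12 ((negp b' k)(j := 0))"
          by (rule lm; use b' kj in \<open>simp add: posp_def negp_def\<close>)+
        thus ?thesis unfolding e(1)[symmetric] unfolding exch_def n by simp
      qed
      have ej: "exch N b x j = lmon N x12 ((posp b' j)(k := 0)) * x k ^ e' + lmon N x12 (negp b' j)"
      proof -
        have "lmon N x (posp b' j) = x k powi posp b' j k * lmon N x ((posp b' j)(k := 0))"
          by (rule lmon_split[OF kj(1)])
        also have "posp b' j k = int e'" using b' by (simp add: posp_def e'_def)
        finally have n: "lmon N x (posp b' j) = x k ^ e' * lmon N x ((posp b' j)(k := 0))" by (simp only: power_int_of_nat)
        have "lmon N x (negp b' j) = lmon N x12 (negp b' j)"
          "lmon N x ((posp b' j)(k := 0)) = lmon N x12 ((posp b' j)(k := 0))"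
          by (rule lm; use b' kj in \<open>simp add: posp_def negp_def\<close>)+
        thus ?thesis unfolding e(2)[symmetric] unfolding exch_def n by simp
      qed
      have xk': "x k = (lmon N x12 (posp b' k) + (Q / x12 j) ^ c * lmon N x12 ((negp b' k)(j := 0))) / x12 k"
        using xk ek xj(1) by simp
      have x2j': "x2 j = (lmon N x12 ((posp b' j)(k := 0)) * x k ^ e' + lmon N x12 (negp b' j)) / (Q / x12 j)"
        unfolding x2_def using ej xj(1) by simp
      note * = X12.mutation_nzd[of k j b', OF kj b', unfolded e(3), folded c_def e'_def, folded xk', folded x2j']
      show ?thesis unfolding R_def using * by blast
    qed
    consider "b k j = 0" "b j k = 0" | "b k j > 0" "b j k < 0" | "b k j < 0" "b j k > 0"
      using ss jk unfolding sign_skew_def by (metis linorder_cases)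
    thus ?thesis
    proof cases
      case 1
      \<comment> \<open>With vanishing entries at \<open>(k, j)\<close> and \<open>(j, k)\<close>
        the two mutations commute, and the separating weight of \<open>commuting_nzd\<close> takes
        over.\<close>
      have bj: "b1 i j = b i j" for i
        using 1 kj by (cases "i = k") (auto simp: b1_def mutate_matrix_pos mutate_matrix_k)
      have Qj: "Q = exch N b x12 j" unfolding Q_def exch_def posp_def negp_def by (simp add: bj)
      have Qx: "Q = exch N b x j" unfolding Qj using 1 bd zi by (intro exch_cong) metis
      have ek: "exch N b x k = exch N b x12 k" using 1 bd zi by (intro exch_cong) metis
      have "x2 j = Q / x j" unfolding Qx x2_def by simp
      hence "x2 j = x12 j" using xj(1) Q_nz by simp
      have nz: "nzd R Q (exch N b x k)"
        unfolding ek Qj R_def by (rule X12.commuting_nzd[OF fr finite_subset[OF ex] jk]) simp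
      have ekR: "exch N b x k \<in> R"
        unfolding ek R_def using X12.exch_in_Lau[of b k "{}"] X12.Lau_UNIV by blast
      have unit: "nzd R Q (inverse (x12 k))" "nzd R Q (x12 j)"
        using X12.x_nz[OF kj(1)] X12.x_nz[OF kj(2)] zR[OF kj(1)] zR[OF kj(2)]
        by (auto intro!: nzd_unit[OF R])
      have "x k \<in> R" unfolding xk divide_inverse by (intro sub_mult[OF R] ekR zR kj)
      moreover have "nzd R Q (x k)"
        unfolding xk divide_inverse by (intro nzd_mult[OF R] ekR zR kj nz unit)
      ultimately show ?thesis using unit zR[OF kj(2)] \<open>x2 j = x12 j\<close> by simp
    next
      case 2
      show ?thesis by (rule gen[of b]) (use 2 bd in \<open>auto simp: Q_def b1_def\<close>)
    next
      case 3
      show ?thesis by (rule gen[of "\<lambda>i j. - b i j"])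
           (use 3 bd in \<open>auto simp: Q_def b1_def exch_uminus mutate_matrix_uminus\<close>)
    qed
  qed
  define h where "h = x k * x2 j"
  have hR: "h \<in> R" and hn: "nzd R Q h"
    unfolding h_def using main by (auto intro!: sub_mult[OF R] nzd_mult[OF R])
  have h_nz: "x k \<noteq> 0" "x2 j \<noteq> 0" using X.x_nz X2.x_nz kj by auto
  have "X1.Lau (cone S) \<subseteq> {f. \<exists>n. Q ^ n * f \<in> X12.Lau (cone S)}"
  proof (rule X1.Lau_subset_subalg[OF subalg_localization[OF X12.subalg_cone QC]])
    fix i assume i: "i \<in> {1..N}"
    have "Q ^ 0 * x1 i \<in> X12.Lau (cone S)" if "i \<noteq> j"
      using X12.x_in_Lau[OF i, of S] that by (simp add: x12_def)
    moreover have "Q ^ 0 * x1 j \<in> X12.Lau (cone S)" using QC X12.inverse_x_in_Lau[OF kj(2), of S] S jk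
      by (auto simp: xj divide_inverse intro!: sub_mult[OF X12.subalg_cone])
    ultimately show "x1 i \<in> {f. \<exists>n. Q ^ n * f \<in> X12.Lau (cone S)}" by blast
    fix a assume "a \<in> cone S" "a i < 0"
    hence iS: "i \<notin> S" by (auto simp: cone_def)
    have "Q ^ 0 * inverse (x1 i) \<in> X12.Lau (cone S)" if "i \<noteq> j"
      using X12.inverse_x_in_Lau[OF i iS] that by (simp add: x12_def)
    moreover have "Q ^ 1 * inverse (x1 j) \<in> X12.Lau (cone S)"
      using X12.x_in_Lau[OF kj(2), of S] Q_nz by (simp add: xj)
    ultimately show "inverse (x1 i) \<in> {f. \<exists>n. Q ^ n * f \<in> X12.Lau (cone S)}" by blast
  qed
  then obtain n where n: "Q ^ n * f \<in> X12.Lau (cone S)" using f1 by blast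
  have "X2.Lau UNIV \<subseteq> {f. \<exists>n. h ^ n * f \<in> R}"
  proof (rule X2.Lau_subset_subalg[OF subalg_localization[OF R hR]])
    fix i assume i: "i \<in> {1..N}"
    have "h ^ 0 * x2 i \<in> R" if "i \<noteq> j" "i \<noteq> k" using zR[OF i] that zi by (simp add: x2_def)
    moreover have "h ^ 0 * x2 j \<in> R" "h ^ 0 * x2 k \<in> R" using main kj by (auto simp: x2_def)
    ultimately show "x2 i \<in> {f. \<exists>n. h ^ n * f \<in> R}" by blast
    have "h ^ 0 * inverse (x2 i) \<in> R" if "i \<noteq> j" "i \<noteq> k" using zR[OF i] that zi by (simp add: x2_def)
    moreover have "h ^ 1 * inverse (x2 j) \<in> R" "h ^ 1 * inverse (x2 k) \<in> R"
      using main kj h_nz by (auto simp: h_def field_simps, simp add: x2_def)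
    ultimately show "inverse (x2 i) \<in> {f. \<exists>n. h ^ n * f \<in> R}" by blast
  qed
  then obtain m where m: "h ^ m * f \<in> R" using f2 by blast
  have "Q ^ n * f \<in> R" using n X12.Lau_UNIV R_def by blast
  from nzd_localization[OF R QR Q_nz hR hn this m] have fR: "f \<in> X12.Lau UNIV" by (simp add: R_def)
  show ?thesis
  proof (rule X12.Lau_cone_divide[OF fR _ QC _ n])
    show "S \<subseteq> {1..N}" using S by auto
    fix i assume "i \<in> S"
    hence i: "i \<in> {1..N}" using S by auto
    \<comment> \<open>At most one of the two monomials of \<open>Q\<close> contains the variable
      with index \<open>i\<close>, so this variable does not divide \<open>Q\<close>.\<close>
    have h: "X12.hcomp (unit_vec i) 0 Q = (if posp b1 j i = 0 then lmon N x12 (posp b1 j) else 0) +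
        (if negp b1 j i = 0 then lmon N x12 (negp b1 j) else 0)"
      unfolding Q_def exch_def scalar_linear_add[OF X12.hcomp_linear] X12.hcomp_lmon wt_unit_vec'[OF i] by simp
    show "X12.hcomp (unit_vec i) 0 Q \<noteq> 0"
    proof (cases "posp b1 j i = 0 \<and> negp b1 j i = 0")
      case True thus ?thesis using Q_nz unfolding h by (simp add: Q_def exch_def)
    next
      case False
      hence "posp b1 j i = 0 \<longleftrightarrow> negp b1 j i \<noteq> 0" by (auto simp: posp_def negp_def max_def)
      thus ?thesis unfolding h using X12.lmon_nz' by auto
    qed
  qed
qed

end

definition mutate :: "nat \<Rightarrow> nat \<Rightarrow> (nat \<Rightarrow> 'f::field) \<times> (exmatrix) \<Rightarrow> (nat \<Rightarrow> 'f) \<times> (exmatrix)" where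
  "mutate N k s = (mutate_variables N k (snd s) (fst s), mutate_matrix k (snd s))"

context complex_algebra
begin

definition full_rank_seed :: "nat \<Rightarrow> nat set \<Rightarrow> (nat \<Rightarrow> 'f) \<times> (exmatrix) \<Rightarrow> bool" where
  "full_rank_seed N ex s \<longleftrightarrow> algebraically_independent \<iota> N (fst s) \<and>
     skew_symmetrizable ex (snd s) \<and> full_rank N ex (snd s)"

definition upper_bound :: "nat \<Rightarrow> nat set \<Rightarrow> nat set \<Rightarrow> (nat \<Rightarrow> 'f) \<times> (exmatrix) \<Rightarrow> 'f set" where
  "upper_bound N ex S s = laurent.Lau \<iota> N (fst s) (cone S) \<inter>
     (\<Inter>k\<in>ex. laurent.Lau \<iota> N (fst (mutate N k s)) (cone S))"

context
  fixes N :: nat and ex S :: "nat set"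
  assumes ex: "ex \<subseteq> {1..N}" and S: "S \<subseteq> {1..N} - ex"
begin

text \<open>Since the diagonal entry is zero, the exchange polynomial does not involve the variable
  that is replaced, and both mutations use the same polynomial.\<close>

lemma mutate_involution:
  assumes "algebraically_independent \<iota> N (fst s)" "k \<in> ex" "snd s k k = 0"
  shows "mutate N k (mutate N k s) = s"
proof -
  obtain x b where s: "s = (x, b)" by (cases s)
  interpret X: laurent \<iota> N x by unfold_locales (use assms s in auto)
  have e: "exch N (mutate_matrix k b) (x(k := exch N b x k / x k)) k = exch N b x k"
  proof -
    have "exch N (mutate_matrix k b) (x(k := exch N b x k / x k)) k = exch N (mutate_matrix k b) x k"
      using assms s by (intro exch_cong) (auto simp: mutate_matrix_k)
    also have "\<dots> = exch N b x k" by (simp add: exch_def posp_def negp_def mutate_matrix_k)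
    finally show ?thesis .
  qed
  have "x k \<noteq> 0" using X.x_nz assms ex by auto
  hence "(x(k := exch N b x k / x k))(k := exch N b x k / (exch N b x k / x k)) = x"
    using X.exch_nz by auto
  thus ?thesis unfolding s mutate_def by (simp add: mutate_variables_eq mutate_matrix_involution e)
qed

lemma full_rank_seed_mutate:
  assumes "full_rank_seed N ex s" "k \<in> ex"
  shows "full_rank_seed N ex (mutate N k s)"
proof -
  obtain x b where s: "s = (x, b)" by (cases s)
  have g: "algebraically_independent \<iota> N x" "skew_symmetrizable ex b" "full_rank N ex b"
    using assms s by (auto simp: full_rank_seed_def)
  interpret X: laurent \<iota> N x by unfold_locales fact
  have bkk: "b k k = 0" using sign_skew_diag[OF skew_symmetrizable_sign_skew[OF g(2)] assms(2)] .
  have "algebraically_independent \<iota> N (x(k := exch N b x k / x k))"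
    by (rule X.indep_exch, use ex assms bkk in auto)
  thus ?thesis unfolding full_rank_seed_def s mutate_def
    using skew_symmetrizable_mutate[OF g(2) assms(2)] full_rank_mutate[OF g(3) ex assms(2) bkk]
    by (simp add: mutate_variables_eq)
qed

lemma full_rank_seed_diag: "full_rank_seed N ex s \<Longrightarrow> k \<in> ex \<Longrightarrow> snd s k k = 0"
  unfolding full_rank_seed_def using sign_skew_diag[OF skew_symmetrizable_sign_skew] by blast

text \<open>The neighbour of the mutated seed at \<open>k\<close> is the original seed; its
  neighbours at other indices are two mutations away from the original seed and are reached by
  \<open>two_step_mutation\<close>.\<close>

lemma upper_bound_mutate_subset:
  assumes s: "full_rank_seed N ex s" and k: "k \<in> ex"
  shows "upper_bound N ex S s \<subseteq> upper_bound N ex S (mutate N k s)"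
proof
  fix f assume f: "f \<in> upper_bound N ex S s"
  have "f \<in> laurent.Lau \<iota> N (fst (mutate N j (mutate N k s))) (cone S)" if j: "j \<in> ex" for j
  proof (cases "j = k")
    case True
    have "mutate N k (mutate N k s) = s"
      using full_rank_seed_diag[OF s k] s k by (intro mutate_involution) (simp_all add: full_rank_seed_def)
    thus ?thesis using f True by (simp add: upper_bound_def)
  next
    case False
    obtain x b where sx: "s = (x, b)" by (cases s)
    have g: "algebraically_independent \<iota> N x" "skew_symmetrizable ex b" "full_rank N ex b"
      using s sx by (auto simp: full_rank_seed_def)
    have f1: "f \<in> laurent.Lau \<iota> N (x(k := exch N b x k / x k)) (cone S)"
      and f2: "f \<in> laurent.Lau \<iota> N (x(j := exch N b x j / x j)) (cone S)"
      using f k j by (auto simp: upper_bound_def sx mutate_def mutate_variables_eq)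
    interpret X2: laurent \<iota> N "x(j := exch N b x j / x j)" using full_rank_seed_mutate[OF s j]
      by unfold_locales (simp add: sx mutate_def mutate_variables_eq full_rank_seed_def)
    from two_step_mutation[OF g(1) ex S skew_symmetrizable_sign_skew[OF g(2)] g(3) j k False f1
        X2.Lau_UNIV[OF f2]]
    show ?thesis by (simp add: sx mutate_def mutate_variables_eq)
  qed
  with f k show "f \<in> upper_bound N ex S (mutate N k s)" by (auto simp: upper_bound_def)
qed

lemma upper_bound_mutate:
  assumes s: "full_rank_seed N ex s" and k: "k \<in> ex"
  shows "upper_bound N ex S (mutate N k s) = upper_bound N ex S s"
proof -
  have inv: "mutate N k (mutate N k s) = s"
    using full_rank_seed_diag[OF s k] s k by (intro mutate_involution) (simp_all add: full_rank_seed_def)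
  show ?thesis
    using upper_bound_mutate_subset[OF s k] upper_bound_mutate_subset[OF full_rank_seed_mutate[OF s k] k]
    unfolding inv by blast
qed

theorem upper_cluster_algebra_eq_upper_bound:
  assumes Inv: "Inv \<union> S = {1..N} - ex" "Inv \<inter> S = {}"
    and s: "is_seed \<iota> N ex s" "full_rank N ex (snd s)"
  shows "upper_cluster_algebra \<iota> N ex Inv S s = upper_bound N ex S s"
proof -
  have fs: "full_rank_seed N ex s" using s by (auto simp: full_rank_seed_def is_seed_def)
  have mix: "mixed_laurent_ring \<iota> ex Inv S (fst s') = laurent.Lau \<iota> N (fst s') (cone S)"
    if s': "full_rank_seed N ex s'" for s'
  proof -
    interpret X: laurent \<iota> N "fst s'" using s' by unfold_locales (simp add: full_rank_seed_def)
    have "ex \<union> Inv \<union> S = {1..N}" "(ex \<union> Inv) \<inter> S = {}" using ex Inv S by auto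
    thus ?thesis by (rule X.mixed_laurent_ring_eq)
  qed
  have step: "mutation_step \<iota> N ex a c \<longleftrightarrow> is_seed \<iota> N ex a \<and> (\<exists>k\<in>ex. c = mutate N k a)" for a c
    by (simp add: mutation_step_def mutate_def)
  \<comment> \<open>Full rank belongs to the invariant because the two-step argument uses it at each
    seed. A mutation step is traversed backwards by mutating at \<open>k\<close> once more.\<close>
  define P where "P = (\<lambda>s'. full_rank_seed N ex s' \<and> upper_bound N ex S s' = upper_bound N ex S s)"
  have P: "P s'" if "mutation_equivalent \<iota> N ex s s'" for s' using that unfolding mutation_equivalent_def
  proof (rule equivclp_invariant)
    show "P s" using fs by (simp add: P_def)
    fix a c assume "mutation_step \<iota> N ex a c"
    then obtain k where k: "is_seed \<iota> N ex a" "k \<in> ex" "c = mutate N k a" unfolding step by blast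
    have akk: "snd a k k = 0"
      using k sign_skew_diag[OF skew_symmetrizable_sign_skew] by (auto simp: is_seed_def)
    have inv: "mutate N k c = a"
      unfolding k(3) using k akk by (intro mutate_involution) (auto simp: is_seed_def)
    have imp: "P (mutate N k a')" if "P a'" for a'
      using that full_rank_seed_mutate[of a' k] upper_bound_mutate[of a' k] k(2) unfolding P_def by simp
    show "P a \<longleftrightarrow> P c" using imp[of a] imp[of c] inv k(3) by metis
  qed
  have "mutation_equivalent \<iota> N ex s s" unfolding mutation_equivalent_def by simp
  moreover have "mutation_equivalent \<iota> N ex s (mutate N k s)" if "k \<in> ex" for k
    unfolding mutation_equivalent_def using s(1) that by (intro r_into_equivclp) (auto simp: step)
  ultimately have "upper_cluster_algebra \<iota> N ex Inv S s \<subseteq> upper_bound N ex S s"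
    using mix[OF fs] mix[OF full_rank_seed_mutate[OF fs]]
    unfolding upper_cluster_algebra_def upper_bound_def by blast
  moreover have "upper_bound N ex S s \<subseteq> mixed_laurent_ring \<iota> ex Inv S (fst s')"
    if "mutation_equivalent \<iota> N ex s s'" for s'
  proof -
    have s': "full_rank_seed N ex s'" "upper_bound N ex S s' = upper_bound N ex S s"
      using P[OF that] by (simp_all add: P_def)
    show ?thesis unfolding mix[OF s'(1)] s'(2)[symmetric] by (simp add: upper_bound_def)
  qed
  ultimately show ?thesis unfolding upper_cluster_algebra_def by blast
qed

end

end

section \<open>Derivations and automorphisms of the function field\<close>

context complex_algebra
begin

lemma hom_powi: "\<iota> (c powi n) = \<iota> c powi n" by (simp add: power_int_def \<iota>.hom_power \<iota>.hom_inverse)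

definition derivation :: "('f \<Rightarrow> 'f) \<Rightarrow> bool" where
  "derivation D \<longleftrightarrow> (\<forall>f g. D (f + g) = D f + D g) \<and> (\<forall>f g. D (f * g) = f * D g + g * D f) \<and>
     (\<forall>c. D (\<iota> c) = 0)"

context
  fixes D assumes D: "derivation D"
begin

lemma der_add: "D (f + g) = D f + D g"
  and der_mult: "D (f * g) = f * D g + g * D f"
  and der_const [simp]: "D (\<iota> c) = 0" using D by (auto simp: derivation_def)

lemma der_0 [simp]: "D 0 = 0" using der_const[of 0] by simp
lemma der_1 [simp]: "D 1 = 0" using der_const[of 1] by simp

lemma der_scale: "D (\<iota> c * f) = \<iota> c * D f" by (simp add: der_mult)

lemma der_of_int [simp]: "D (of_int n) = 0"
  using der_const[of "of_int n"] by (simp add: \<iota>.hom_of_int del: der_const)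

lemma der_scalar_linear: "scalar_linear \<iota> \<iota> D" by (simp add: scalar_linear_def der_add der_scale)

lemma der_uminus: "D (- f) = - D f" and der_diff: "D (f - g) = D f - D g"
  and der_sum: "D (sum h I) = (\<Sum>i\<in>I. D (h i))"
  using der_scalar_linear by (auto intro: scalar_linear_uminus scalar_linear_diff scalar_linear_sum)

lemma der_inverse: "D (inverse f) = - D f / f ^ 2"
proof (cases "f = 0")
  case False
  have "D (f * inverse f) = 0" using False by simp
  hence "f * D (inverse f) = - inverse f * D f" by (simp add: der_mult add_eq_0_iff)
  thus ?thesis using False by (simp add: field_simps power2_eq_square)
qed simp

lemma der_divide: "q \<noteq> 0 \<Longrightarrow> D (p / q) = (D p * q - p * D q) / q ^ 2"
  by (simp add: divide_inverse der_mult der_inverse) (simp add: field_simps power2_eq_square)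

lemma der_powi_log: assumes "D f = c * f" "f \<noteq> 0" shows "D (f powi n) = of_int n * c * f powi n"
proof -
  have 1: "D (f ^ m) = of_nat m * c * f ^ m" for m
    using assms(1) by (induction m) (auto simp: der_mult algebra_simps)
  show ?thesis
  proof (cases "n \<ge> 0")
    case True thus ?thesis by (simp add: power_int_def 1)
  next
    case False
    define m where "m = nat (- n)"
    hence n: "n = - int m" using False by simp
    have "f powi n = inverse (f ^ m)" by (simp add: n power_int_minus)
    moreover have "(of_int n :: 'f) = - of_nat m" by (simp add: n)
    moreover have "- (of_nat m * c * f ^ m) / (f ^ m)\<^sup>2 = - of_nat m * c * inverse (f ^ m)"
      using assms(2) by (simp add: field_simps power2_eq_square)
    ultimately show ?thesis by (simp only: der_inverse 1)
  qed
qed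

lemma der_prod_log:
  assumes "\<And>i. i \<in> A \<Longrightarrow> D (h i) = c i * h i"
  shows "D (prod h A) = (\<Sum>i\<in>A. c i) * prod h A"
  using assms by (induction A rule: infinite_finite_induct) (auto simp: der_mult algebra_simps)

lemma der_lmon:
  assumes "\<And>i. i \<in> {1..N} \<Longrightarrow> D (y i) = c i * y i" "\<And>i. i \<in> {1..N} \<Longrightarrow> y i \<noteq> 0"
  shows "D (lmon N y a) = (\<Sum>i=1..N. of_int (a i) * c i) * lmon N y a"
  unfolding lmon_def using assms by (intro der_prod_log) (simp add: der_powi_log)

lemma der_generated_zero:
  assumes "\<And>s. s \<in> S \<Longrightarrow> D s = 0" "f \<in> alg S"
  shows "D f = 0" using assms(2) by induction (auto simp: assms(1) der_add der_mult)

end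

lemma derivation_diff: "derivation D \<Longrightarrow> derivation D' \<Longrightarrow> derivation (\<lambda>f. D f - D' f)"
  unfolding derivation_def by (auto simp: algebra_simps)

lemma derivation_smult: "derivation D \<Longrightarrow> derivation (\<lambda>f. h * D f)"
  unfolding derivation_def by (auto simp: algebra_simps)

lemma derivation_add: "derivation D \<Longrightarrow> derivation D' \<Longrightarrow> derivation (\<lambda>f. D f + D' f)"
  unfolding derivation_def by (auto simp: algebra_simps)

lemma derivation_sum: "(\<And>i. i \<in> I \<Longrightarrow> derivation (D i)) \<Longrightarrow> derivation (\<lambda>f. \<Sum>i\<in>I. D i f)"
proof (induction I rule: infinite_finite_induct)
  case (insert i I)
  thus ?case using derivation_add[of "D i" "\<lambda>f. \<Sum>i\<in>I. D i f"] by simp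
qed (auto simp: derivation_def)

lemma derivation_commutator:
  assumes "derivation D" "derivation D'" shows "derivation (\<lambda>f. D (D' f) - D' (D f))"
  unfolding derivation_def
  by (auto simp: der_add[OF assms(1)] der_add[OF assms(2)] der_mult[OF assms(1)] der_mult[OF assms(2)]
    der_const[OF assms(1)] der_const[OF assms(2)] der_0[OF assms(1)] der_0[OF assms(2)] algebra_simps)

text \<open>A monomial is multiplied by an integral combination of the logarithmic derivatives
  \<open>c i\<close>, so no new denominators arise.\<close>

lemma (in laurent) der_preserves_Lau:
  assumes D: "derivation D" and c: "\<And>i. i \<in> {1..N} \<Longrightarrow> D (x i) = c i * x i \<and> c i \<in> Lau (cone S)"
    and f: "f \<in> Lau (cone S)"
  shows "D f \<in> Lau (cone S)" using f
proof (induction rule: Lau_induct)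
  case zero thus ?case by (simp add: der_0[OF D] Lau_0)
next
  case (step d a g)
  have "D (lmon N x a) = (\<Sum>i=1..N. of_int (a i) * c i) * lmon N x a"
    using c x_nz by (intro der_lmon[OF D]) auto
  also have "\<dots> \<in> Lau (cone S)"
    using c step by (intro sub_mult[OF subalg_cone] sub_sum[OF subalg_cone] sub_of_int[OF subalg_cone] lmon_Lau) auto
  finally show ?case using step by (auto simp: der_add[OF D] der_scale[OF D] intro!: Lau_add Lau_scale)
qed

end

locale laurent_field = laurent \<iota> N x for \<iota> :: "complex \<Rightarrow> 'f::field" and N x +
  assumes gen: "generates_field \<iota> N x"
begin

lemma fraction: "\<exists>p\<in>alg (x ` {1..N}). \<exists>q\<in>alg (x ` {1..N}). q \<noteq> 0 \<and> f = p / q"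
  using gen[unfolded generates_field_def] by (rule spec)

lemma generated_subset_Lau: "alg (x ` {1..N}) \<subseteq> Lau (cone S)"
  by (intro sub_generated subalg_cone) (auto intro: x_in_Lau)

lemma fraction_L: "\<exists>p\<in>Lau UNIV. \<exists>q\<in>Lau UNIV. q \<noteq> 0 \<and> f = p / q"
  using fraction[of f] generated_subset_Lau[of "{}"] Lau_UNIV by blast

lemma derivation_eqI:
  assumes D: "derivation D" "derivation D'" and "\<And>i. i \<in> {1..N} \<Longrightarrow> D (x i) = D' (x i)"
  shows "D f = D' f"
proof -
  note DD = derivation_diff[OF D]
  have 0: "D g - D' g = 0" if "g \<in> alg (x ` {1..N})" for g
    by (rule der_generated_zero[OF DD _ that]) (use assms(3) in auto)
  obtain p q where pq: "p \<in> alg (x ` {1..N})" "q \<in> alg (x ` {1..N})"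
    "q \<noteq> 0" "f = p / q" using fraction by blast
  show ?thesis using 0[OF pq(1)] 0[OF pq(2)] by (simp add: pq der_divide[OF D(1)] der_divide[OF D(2)])
qed

lemma derivation_extend:
  assumes T: "scalar_linear \<iota> \<iota> T" "\<And>f g. f \<in> Lau UNIV \<Longrightarrow> g \<in> Lau UNIV \<Longrightarrow> T (f * g) = f * T g + g * T f"
  shows "\<exists>D. derivation D \<and> (\<forall>f\<in>Lau UNIV. D f = T f)"
proof -
  have "\<forall>f. \<exists>p q. p \<in> Lau UNIV \<and> q \<in> Lau UNIV \<and> q \<noteq> 0 \<and> f = p / q" using fraction_L by blast
  then obtain nu de where nd: "\<And>f. nu f \<in> Lau UNIV" "\<And>f. de f \<in> Lau UNIV" "\<And>f. de f \<noteq> 0" "\<And>f. f = nu f / de f"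
    by metis
  define D where "D f = (T (nu f) * de f - nu f * T (de f)) / de f ^ 2" for f
  \<comment> \<open>The value does not depend on how the fraction is written, so sums and products
    may be computed with any common denominator.\<close>
  have D: "D (p / q) = (T p * q - p * T q) / q ^ 2" if pq: "p \<in> Lau UNIV" "q \<in> Lau UNIV" "q \<noteq> 0" for p q
  proof -
    define n d where "n = nu (p / q)" and "d = de (p / q)"
    have nd': "n \<in> Lau UNIV" "d \<in> Lau UNIV" "d \<noteq> 0" "p / q = n / d" unfolding n_def d_def using nd by auto
    hence e: "p * d = n * q" using pq by (simp add: field_simps)
    hence "T (p * d) = T (n * q)" by simp
    hence "p * T d + d * T p = n * T q + q * T n" using T(2) pq nd' by simp
    hence Tn: "T n = (p * T d + d * T p - n * T q) / q" using pq by (simp add: field_simps)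
    have n: "n = p * d / q" using e pq by (simp add: field_simps)
    have "D (p / q) = (T n * d - n * T d) / d ^ 2" by (simp add: D_def n_def d_def)
    also have "\<dots> = (T p * q - p * T q) / q ^ 2"
      unfolding Tn unfolding n using pq(3) nd'(3) by (simp add: field_simps power2_eq_square)
    finally show ?thesis .
  qed
  have "T 1 = T 1 + T 1" using T(2)[OF sub_1[OF subalg_L] sub_1[OF subalg_L]] by (simp only: mult_1)
  hence T1: "T 1 = 0" by (simp only: add_cancel_right_right)
  note L = sub_mult[OF subalg_L] sub_add[OF subalg_L]
  have "derivation D" unfolding derivation_def
  proof (intro conjI allI)
    fix f g
    obtain p q p' q' where f: "p \<in> Lau UNIV" "q \<in> Lau UNIV" "q \<noteq> 0" "f = p / q"
      and g: "p' \<in> Lau UNIV" "q' \<in> Lau UNIV" "q' \<noteq> 0" "g = p' / q'" using fraction_L by metis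
    have s: "f + g = (p * q' + p' * q) / (q * q')" and m: "f * g = (p * p') / (q * q')"
      unfolding f(4) g(4) using f(3) g(3) by (simp_all add: field_simps)
    have 1: "D (f + g) = (T (p * q' + p' * q) * (q * q') - (p * q' + p' * q) * T (q * q')) / (q * q') ^ 2"
      unfolding s using f g by (intro D L) auto
    show "D (f + g) = D f + D g" unfolding 1 using f g L by (simp add: D T(2) scalar_linear_add[OF T(1)])
        (simp add: field_simps power2_eq_square)
    have 2: "D (f * g) = (T (p * p') * (q * q') - (p * p') * T (q * q')) / (q * q') ^ 2"
      unfolding m using f g by (intro D L) auto
    show "D (f * g) = f * D g + g * D f" unfolding 2 using f g L by (simp add: D T(2))
        (simp add: field_simps power2_eq_square)
  next
    fix c
    have "T (\<iota> c) = 0" using scalar_linear_scale[OF T(1), of c 1] T1 by simp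
    thus "D (\<iota> c) = 0" using D[of "\<iota> c" 1] T1 by (simp add: sub_const[OF subalg_L] sub_1[OF subalg_L])
  qed
  moreover have "D f = T f" if "f \<in> Lau UNIV" for f using D[OF that sub_1[OF subalg_L]] T1 by simp
  ultimately show ?thesis by blast
qed

section \<open>Derivations that are diagonal on the initial cluster\<close>

definition logder :: "(nat \<Rightarrow> 'f) \<Rightarrow> 'f \<Rightarrow> 'f" where
  "logder w = (SOME D. derivation D \<and> (\<forall>i\<in>{1..N}. D (x i) = w i * x i))"

lemma derivation_logder: "derivation (logder w)"
  and logder_x: "i \<in> {1..N} \<Longrightarrow> logder w (x i) = w i * x i"
proof -
  obtain T where T: "scalar_linear \<iota> \<iota> T" "\<forall>a. T (lmon N x a) = (\<Sum>i=1..N. of_int (a i) * w i) * lmon N x a"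
    "\<forall>f\<in>Lau UNIV. \<forall>g\<in>Lau UNIV. T (f * g) = f * T g + g * T f" using log_derivation_exists by blast
  obtain D where D: "derivation D" "\<forall>f\<in>Lau UNIV. D f = T f" using derivation_extend[of T] T by blast
  have "D (x i) = w i * x i" if i: "i \<in> {1..N}" for i
  proof -
    have xi: "x i = lmon N x (unit_vec i)" using lmon_single[OF i, of x 1] by simp
    have "D (x i) = T (x i)" using D(2) xi lmon_Lau by auto
    also have "\<dots> = (\<Sum>j=1..N. of_int (unit_vec i j) * w j) * x i" unfolding xi using T(2) by blast
    also have "(\<Sum>j=1..N. of_int (unit_vec i j) * w j) = (\<Sum>j=1..N. if j = i then w j else 0)"
      by (intro sum.cong) auto
    finally show ?thesis using i by simp
  qed
  with D have "\<exists>D. derivation D \<and> (\<forall>i\<in>{1..N}. D (x i) = w i * x i)" by blast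
  from someI_ex[OF this] show "derivation (logder w)" "i \<in> {1..N} \<Longrightarrow> logder w (x i) = w i * x i"
    unfolding logder_def by auto
qed

text \<open>The Euler derivation, \<open>x k\<close> times the partial derivative in
  \<open>x k\<close>. These form a basis of all derivations over the field, in which bracket and
  torus have constant coefficients.\<close>

abbreviation E :: "nat \<Rightarrow> 'f \<Rightarrow> 'f" where
  "E k \<equiv> logder (\<lambda>i. if i = k then 1 else 0)"

lemma derivation_eq_sum_E:
  assumes "derivation D" shows "D f = (\<Sum>i=1..N. D (x i) / x i * E i f)"
proof (rule derivation_eqI[OF assms])
  show "derivation (\<lambda>f. \<Sum>i=1..N. D (x i) / x i * E i f)"
    by (intro derivation_sum derivation_smult derivation_logder)
  fix j assume j: "j \<in> {1..N}"
  have "(\<Sum>i=1..N. D (x i) / x i * E i (x j)) = (\<Sum>i=1..N. if i = j then D (x j) else 0)"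
    using j x_nz by (intro sum.cong) (auto simp: logder_x)
  thus "D (x j) = (\<Sum>i=1..N. D (x i) / x i * E i (x j))" using j by simp
qed

lemma logder_eq_sum: "logder w f = (\<Sum>i=1..N. w i * E i f)"
  unfolding derivation_eq_sum_E[OF derivation_logder, of w f]
  using x_nz by (intro sum.cong) (auto simp: logder_x)

lemma logder_lmon: "logder w (lmon N x a) = (\<Sum>i=1..N. of_int (a i) * w i) * lmon N x a"
  using x_nz by (intro der_lmon derivation_logder logder_x)

section \<open>Automorphisms of the function field\<close>

definition automorphism :: "('f \<Rightarrow> 'f) \<Rightarrow> bool" where
  "automorphism \<theta> \<longleftrightarrow> unital_ring_hom \<theta> \<and> (\<forall>c. \<theta> (\<iota> c) = \<iota> c)"

context
  fixes \<theta> assumes \<theta>: "automorphism \<theta>"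
begin

lemma aut_add: "\<theta> (f + g) = \<theta> f + \<theta> g" and aut_mult: "\<theta> (f * g) = \<theta> f * \<theta> g"
  and aut_1 [simp]: "\<theta> 1 = 1" and aut_const [simp]: "\<theta> (\<iota> c) = \<iota> c"
  using \<theta> by (auto simp: automorphism_def unital_ring_hom_def)

lemma aut_0 [simp]: "\<theta> 0 = 0" using aut_const[of 0] by simp

lemma aut_of_int [simp]: "\<theta> (of_int n) = of_int n"
  using aut_const[of "of_int n"] by (simp add: \<iota>.hom_of_int del: aut_const)

lemma aut_inverse: "\<theta> (inverse f) = inverse (\<theta> f)"
proof (cases "f = 0")
  case False
  have "\<theta> f * \<theta> (inverse f) = 1" using False by (simp flip: aut_mult)
  thus ?thesis by (metis inverse_unique)
qed simp

lemma aut_uminus: "\<theta> (- f) = - \<theta> f" using aut_mult[of "of_int (-1)" f] aut_of_int[of "-1"] by simp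

lemma aut_diff: "\<theta> (f - g) = \<theta> f - \<theta> g" using aut_add[of f "- g"] by (simp add: aut_uminus)

lemma aut_sum: "\<theta> (sum h I) = (\<Sum>i\<in>I. \<theta> (h i))"
  by (induction I rule: infinite_finite_induct) (auto simp: aut_add)

lemma aut_prod: "\<theta> (prod h I) = (\<Prod>i\<in>I. \<theta> (h i))"
  by (induction I rule: infinite_finite_induct) (auto simp: aut_mult)

lemma aut_power: "\<theta> (f ^ n) = \<theta> f ^ n" by (induction n) (auto simp: aut_mult)

lemma aut_powi: "\<theta> (f powi n) = \<theta> f powi n" by (simp add: power_int_def aut_power aut_inverse)

lemma aut_lmon: "\<theta> (lmon N y a) = lmon N (\<lambda>i. \<theta> (y i)) a" by (simp add: lmon_def aut_prod aut_powi)

end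

lemma automorphism_eqI:
  assumes A: "automorphism \<theta>" "automorphism \<theta>'" and e: "\<And>i. i \<in> {1..N} \<Longrightarrow> \<theta> (x i) = \<theta>' (x i)"
  shows "\<theta> = \<theta>'"
proof
  fix f
  have eq: "\<theta> g = \<theta>' g" if "g \<in> alg (x ` {1..N})" for g using that
    by induction (auto simp: e aut_add[OF A(1)] aut_add[OF A(2)] aut_mult[OF A(1)] aut_mult[OF A(2)]
      aut_const[OF A(1)] aut_const[OF A(2)])
  obtain p q where pq: "p \<in> alg (x ` {1..N})" "q \<in> alg (x ` {1..N})"
    "q \<noteq> 0" "f = p / q" using fraction by blast
  thus "\<theta> f = \<theta>' f"
    by (simp add: divide_inverse aut_mult[OF A(1)] aut_mult[OF A(2)] aut_inverse[OF A(1)] aut_inverse[OF A(2)] eq)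
qed

lemma automorphism_exists:
  assumes s: "\<And>i. i \<in> {1..N} \<Longrightarrow> s i \<noteq> 0"
  shows "\<exists>\<theta>. automorphism \<theta> \<and> (\<forall>i\<in>{1..N}. \<theta> (x i) = \<iota> (s i) * x i)"
proof -
  have ex: "\<exists>T. scalar_linear \<iota> \<iota> T \<and> (\<forall>a. T (lmon N x a) = lmon N (\<lambda>i. \<iota> (s i) * x i) a) \<and>
           (\<forall>f\<in>Lau UNIV. \<forall>g\<in>Lau UNIV. T (f * g) = T f * T g)" if "\<And>i. i \<in> {1..N} \<Longrightarrow> s i \<noteq> 0" for s
    using that x_nz by (intro hom_exists complex_algebra_axioms) auto
  from ex[of s, OF s] obtain T where T: "scalar_linear \<iota> \<iota> T"
    "\<forall>a. T (lmon N x a) = lmon N (\<lambda>i. \<iota> (s i) * x i) a"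
    "\<forall>f\<in>Lau UNIV. \<forall>g\<in>Lau UNIV. T (f * g) = T f * T g" by auto
  from ex[of "\<lambda>i. inverse (s i)"] s obtain T' where T': "scalar_linear \<iota> \<iota> T'"
    "\<forall>a. T' (lmon N x a) = lmon N (\<lambda>i. \<iota> (inverse (s i)) * x i) a" by auto
  have lc: "\<exists>c. lmon N (\<lambda>i. \<iota> (s i)) a = \<iota> c" for a
    by (intro exI[of _ "lmon N s a"]) (simp add: lmon_def \<iota>.hom_prod hom_powi)
  \<comment> \<open>Scaling back by the inverses shows that \<open>T\<close> is injective on Laurent
    polynomials; it thus keeps denominators nonzero and extends to fractions.\<close>
  have inv: "T' (T f) = f" if "f \<in> Lau UNIV" for f using that
  proof (induction rule: Lau_induct)
    case zero thus ?case by (simp add: scalar_linear_0[OF T(1)] scalar_linear_0[OF T'(1)])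
  next
    case (step c a g)
    obtain d where d: "lmon N (\<lambda>i. \<iota> (s i)) a = \<iota> d" using lc by blast
    have "T' (T (lmon N x a)) = \<iota> d * T' (lmon N x a)"
      using T(2) d by (simp add: lmon_map_mult scalar_linear_scale[OF T'(1)])
    also have "\<dots> = \<iota> d * (lmon N (\<lambda>i. \<iota> (inverse (s i))) a * lmon N x a)"
      using T'(2) by (simp add: lmon_map_mult)
    also have "\<dots> = lmon N (\<lambda>i. \<iota> (s i) * \<iota> (inverse (s i)) * x i) a" by (simp add: lmon_map_mult d)
    also have "\<dots> = lmon N x a" using s by (intro lmon_cong) (simp_all flip: \<iota>_mult)
    finally show ?case using step
      by (simp add: scalar_linear_add[OF T(1)] scalar_linear_add[OF T'(1)] scalar_linear_scale[OF T(1)]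
          scalar_linear_scale[OF T'(1)])
  qed
  have T_nz: "T q \<noteq> 0" if "q \<in> Lau UNIV" "q \<noteq> 0" for q
    using inv[OF that(1)] that(2) scalar_linear_0[OF T'(1)] by auto
  have T1: "T 1 = 1" using T(2)[rule_format, of "\<lambda>_. 0"] by simp
  have "\<forall>f. \<exists>p q. p \<in> Lau UNIV \<and> q \<in> Lau UNIV \<and> q \<noteq> 0 \<and> f = p / q" using fraction_L by blast
  then obtain nu de where nd: "\<And>f. nu f \<in> Lau UNIV" "\<And>f. de f \<in> Lau UNIV" "\<And>f. de f \<noteq> 0" "\<And>f. f = nu f / de f"
    by metis
  define \<theta> where "\<theta> f = T (nu f) / T (de f)" for f
  have \<theta>: "\<theta> (p / q) = T p / T q" if pq: "p \<in> Lau UNIV" "q \<in> Lau UNIV" "q \<noteq> 0" for p q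
  proof -
    define n d where "n = nu (p / q)" and "d = de (p / q)"
    have nd': "n \<in> Lau UNIV" "d \<in> Lau UNIV" "d \<noteq> 0" "p / q = n / d" unfolding n_def d_def using nd by auto
    hence e: "p * d = n * q" using pq by (simp add: field_simps)
    hence "T (p * d) = T (n * q)" by simp
    hence "T p * T d = T n * T q" using T(3) pq nd' by simp
    thus ?thesis using T_nz pq nd' by (simp add: \<theta>_def n_def[symmetric] d_def[symmetric] field_simps)
  qed
  have \<theta>T: "\<theta> f = T f" if "f \<in> Lau UNIV" for f using \<theta>[OF that sub_1[OF subalg_L]] T1 by simp
  note L = sub_mult[OF subalg_L] sub_add[OF subalg_L]
  have "automorphism \<theta>" unfolding automorphism_def unital_ring_hom_def
  proof (intro conjI allI)
    show "\<theta> 1 = 1" using \<theta>T[OF sub_1[OF subalg_L]] T1 by simp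
    show "\<theta> (\<iota> c) = \<iota> c" for c
      using \<theta>T[OF sub_const[OF subalg_L]] scalar_linear_scale[OF T(1), of c 1] T1 by simp
    fix f g
    obtain p q p' q' where f: "p \<in> Lau UNIV" "q \<in> Lau UNIV" "q \<noteq> 0" "f = p / q"
      and g: "p' \<in> Lau UNIV" "q' \<in> Lau UNIV" "q' \<noteq> 0" "g = p' / q'" using fraction_L by metis
    have s: "f + g = (p * q' + p' * q) / (q * q')" and m: "f * g = (p * p') / (q * q')"
      unfolding f(4) g(4) using f(3) g(3) by (simp_all add: field_simps)
    have 1: "\<theta> (f + g) = T (p * q' + p' * q) / T (q * q')" unfolding s using f g by (intro \<theta> L) auto
    show "\<theta> (f + g) = \<theta> f + \<theta> g"
      unfolding 1 using f g L T_nz by (simp add: \<theta> T(3) scalar_linear_add[OF T(1)]) (simp add: field_simps)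
    have 2: "\<theta> (f * g) = T (p * p') / T (q * q')" unfolding m using f g by (intro \<theta> L) auto
    show "\<theta> (f * g) = \<theta> f * \<theta> g" unfolding 2 using f g L T_nz by (simp add: \<theta> T(3))
  qed
  moreover have "\<theta> (x i) = \<iota> (s i) * x i" if i: "i \<in> {1..N}" for i
  proof -
    have xi: "x i = lmon N x (unit_vec i)" using lmon_single[OF i, of x 1] by simp
    hence "\<theta> (x i) = T (lmon N x (unit_vec i))" using \<theta>T lmon_Lau by auto
    also have "\<dots> = lmon N (\<lambda>i. \<iota> (s i) * x i) (unit_vec i)" using T(2) by blast
    also have "\<dots> = \<iota> (s i) * x i" using lmon_single[OF i, of "\<lambda>i. \<iota> (s i) * x i" 1] by simp
    finally show ?thesis .
  qed
  ultimately show ?thesis by blast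
qed

end

section \<open>The bracket and the torus action\<close>

lemma (in complex_algebra) poisson_bracket_derivation:
  assumes br: "poisson_bracket \<iota> br"
  shows "derivation (br f)" and "derivation (\<lambda>f. br f g)" and "br f g = - br g f"
proof -
  have a: "\<And>f g h. br (f + g) h = br f h + br g h" and s: "\<And>c f g. br (\<iota> c * f) g = \<iota> c * br f g"
    and m: "\<And>f g h. br f (g * h) = br f g * h + g * br f h"
    using br unfolding poisson_bracket_def by blast+
  show k: "br f g = - br g f" for f g using br unfolding poisson_bracket_def by blast
  have a': "br f (g + h) = br f g + br f h" for f g h using a[of g h f] k[of f] by simp
  have 1: "br f 1 = 0" for f using m[of f 1 1] by (simp only: mult_1 mult_1_right add_cancel_right_right)
  have c: "br f (\<iota> c) = 0" for f c using s[of c 1 f] k[of f "\<iota> c"] k[of 1 f] 1 by simp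
  show D: "derivation (br f)" for f unfolding derivation_def using a' m c by (simp add: mult.commute)
  have "(\<lambda>f. br f g) = (\<lambda>f. (-1) * br g f)"
  proof
    show "br f g = (-1) * br g f" for f using k[of f g] by simp
  qed
  thus "derivation (\<lambda>f. br f g)" using derivation_smult[OF D, of "-1" g] by simp
qed

context laurent_field
begin

definition pbr :: "(exmatrix) \<Rightarrow> 'f \<Rightarrow> 'f \<Rightarrow> 'f" where
  "pbr \<Lambda> f g = (\<Sum>k=1..N. \<Sum>i=1..N. of_int (\<Lambda> k i) * E k f * E i g)"

context
  fixes \<Lambda> :: "exmatrix"
  assumes skew: "\<And>i j. i \<in> {1..N} \<Longrightarrow> j \<in> {1..N} \<Longrightarrow> \<Lambda> i j = - \<Lambda> j i"
begin

lemma derivation_pbr: "derivation (pbr \<Lambda> f)" "derivation (\<lambda>f. pbr \<Lambda> f g)"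
proof -
  have "derivation (\<lambda>g. of_int (\<Lambda> k i) * E k f * E i g)" for k i
    by (intro derivation_smult derivation_logder)
  thus "derivation (pbr \<Lambda> f)" unfolding pbr_def by (intro derivation_sum)
  have "derivation (\<lambda>f. (of_int (\<Lambda> k i) * E i g) * E k f)" for k i
    by (intro derivation_smult derivation_logder)
  hence "derivation (\<lambda>f. \<Sum>k=1..N. \<Sum>i=1..N. (of_int (\<Lambda> k i) * E i g) * E k f)" by (intro derivation_sum)
  thus "derivation (\<lambda>f. pbr \<Lambda> f g)" unfolding pbr_def by (simp add: algebra_simps)
qed

lemma pbr_skew: "pbr \<Lambda> f g = - pbr \<Lambda> g f"
proof -
  have "pbr \<Lambda> f g = (\<Sum>i=1..N. \<Sum>k=1..N. of_int (\<Lambda> k i) * E k f * E i g)"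
    unfolding pbr_def by (rule sum.swap)
  also have "\<dots> = (\<Sum>i=1..N. \<Sum>k=1..N. - (of_int (\<Lambda> i k) * E i g * E k f))"
    by (intro sum.cong refl) (subst skew, auto)
  finally show ?thesis by (simp add: pbr_def sum_negf)
qed

lemma pbr_x: assumes k: "k \<in> {1..N}" shows "pbr \<Lambda> (x k) g = x k * logder (\<lambda>i. of_int (\<Lambda> k i)) g"
proof -
  have "pbr \<Lambda> (x k) g = (\<Sum>j=1..N. if j = k then (\<Sum>i=1..N. of_int (\<Lambda> k i) * x k * E i g) else 0)"
    unfolding pbr_def by (intro sum.cong refl) (use k in \<open>auto simp: logder_x\<close>)
  also have "\<dots> = (\<Sum>i=1..N. x k * (of_int (\<Lambda> k i) * E i g))" using k by (simp add: ac_simps)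
  also have "\<dots> = x k * logder (\<lambda>i. of_int (\<Lambda> k i)) g"
    unfolding logder_eq_sum[of "\<lambda>i. of_int (\<Lambda> k i)"] sum_distrib_left ..
  finally show ?thesis .
qed

lemma pbr_xx: "k \<in> {1..N} \<Longrightarrow> i \<in> {1..N} \<Longrightarrow> pbr \<Lambda> (x k) (x i) = of_int (\<Lambda> k i) * x k * x i"
  by (simp add: pbr_x logder_x)

text \<open>The Jacobiator is a derivation in its last argument and invariant under cyclic
  permutations, so it suffices to evaluate it on the generators.\<close>

lemma pbr_jacobi: "pbr \<Lambda> f (pbr \<Lambda> g h) + pbr \<Lambda> g (pbr \<Lambda> h f) + pbr \<Lambda> h (pbr \<Lambda> f g) = 0"
proof -
  define J where "J f g h = pbr \<Lambda> f (pbr \<Lambda> g h) + pbr \<Lambda> g (pbr \<Lambda> h f) + pbr \<Lambda> h (pbr \<Lambda> f g)" for f g h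
  have um: "pbr \<Lambda> f (- g) = - pbr \<Lambda> f g" for f g by (rule der_uminus[OF derivation_pbr(1)])
  have J: "J f g h = (pbr \<Lambda> f (pbr \<Lambda> g h) - pbr \<Lambda> g (pbr \<Lambda> f h)) - pbr \<Lambda> (pbr \<Lambda> f g) h" for f g h
    unfolding J_def using pbr_skew[of h f] pbr_skew[of h "pbr \<Lambda> f g"] by (simp add: um)
  have "derivation (\<lambda>h. (pbr \<Lambda> f (pbr \<Lambda> g h) - pbr \<Lambda> g (pbr \<Lambda> f h)) - pbr \<Lambda> (pbr \<Lambda> f g) h)" for f g
    by (intro derivation_diff derivation_commutator derivation_pbr)
  moreover have "J f g = (\<lambda>h. (pbr \<Lambda> f (pbr \<Lambda> g h) - pbr \<Lambda> g (pbr \<Lambda> f h)) - pbr \<Lambda> (pbr \<Lambda> f g) h)" for f g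
    using J by blast
  ultimately have dJ: "derivation (J f g)" for f g by simp
  have cyc: "J f g h = J g h f" for f g h by (simp add: J_def algebra_simps)
  have d0: "derivation (\<lambda>_. 0)" by (simp add: derivation_def)
  have 0: "J f g h = 0" if "\<And>i. i \<in> {1..N} \<Longrightarrow> J f g (x i) = 0" for f g h
    using derivation_eqI[OF dJ d0, of f g] that by simp
  have xxx: "J (x i) (x j) (x k) = 0" if "i \<in> {1..N}" "j \<in> {1..N}" "k \<in> {1..N}" for i j k
  proof -
    have t: "pbr \<Lambda> (x i) (pbr \<Lambda> (x j) (x k)) = of_int (\<Lambda> j k * (\<Lambda> i j + \<Lambda> i k)) * (x i * x j * x k)"
      if "i \<in> {1..N}" "j \<in> {1..N}" "k \<in> {1..N}" for i j k
      using that by (simp add: pbr_xx pbr_x der_mult[OF derivation_logder] der_of_int[OF derivation_logder] logder_x)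
        (simp add: algebra_simps)
    have "\<Lambda> j k * (\<Lambda> i j + \<Lambda> i k) + \<Lambda> k i * (\<Lambda> j k + \<Lambda> j i) + \<Lambda> i j * (\<Lambda> k i + \<Lambda> k j) = 0"
      using skew[of i j] skew[of j k] skew[of k i] that by (simp add: algebra_simps)
    moreover have "J (x i) (x j) (x k) = of_int (\<Lambda> j k * (\<Lambda> i j + \<Lambda> i k) + \<Lambda> k i * (\<Lambda> j k + \<Lambda> j i) + \<Lambda> i j * (\<Lambda> k i + \<Lambda> k j)) * (x i * x j * x k)"
      unfolding J_def t[OF that] t[OF that(2,3,1)] t[OF that(3,1,2)] by (simp add: algebra_simps)
    ultimately show ?thesis by simp
  qed
  have "J (x i) (x j) h = 0" if "i \<in> {1..N}" "j \<in> {1..N}" for i j h by (rule 0) (use xxx that in blast)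
  hence "J h (x i) (x j) = 0" if "i \<in> {1..N}" "j \<in> {1..N}" for i j h
    using that cyc[of h "x i" "x j"] by simp
  hence "J h (x i) g = 0" if "i \<in> {1..N}" for i g h by (rule 0) (use that in blast)
  hence "J g h (x i) = 0" if "i \<in> {1..N}" for i g h
    using that cyc[of g h "x i"] cyc[of h "x i" g] cyc[of "x i" g h] by simp
  hence "J f g h = 0" by (rule 0)
  thus ?thesis by (simp add: J_def)
qed

lemma poisson_bracket_pbr: "poisson_bracket \<iota> (pbr \<Lambda>)" unfolding poisson_bracket_def
proof (intro conjI allI)
  show "pbr \<Lambda> (f + g) h = pbr \<Lambda> f h + pbr \<Lambda> g h" for f g h by (rule der_add[OF derivation_pbr(2)])
  show "pbr \<Lambda> (\<iota> c * f) g = \<iota> c * pbr \<Lambda> f g" for c f g by (rule der_scale[OF derivation_pbr(2)])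
  show "pbr \<Lambda> f g = - pbr \<Lambda> g f" for f g by (rule pbr_skew)
  show "pbr \<Lambda> f (g * h) = pbr \<Lambda> f g * h + g * pbr \<Lambda> f h" for f g h
    using der_mult[OF derivation_pbr(1), of f g h] by (simp add: mult.commute)
  show "pbr \<Lambda> f (pbr \<Lambda> g h) + pbr \<Lambda> g (pbr \<Lambda> h f) + pbr \<Lambda> h (pbr \<Lambda> f g) = 0" for f g h by (rule pbr_jacobi)
qed

text \<open>Uniqueness follows by applying \<open>derivation_eqI\<close> twice: with a generator as
  first argument, and then for an arbitrary first argument.\<close>

lemma gsv_bracket_eq: "gsv_bracket \<iota> N x \<Lambda> = pbr \<Lambda>" unfolding gsv_bracket_def
proof (rule the_equality)
  show "poisson_bracket \<iota> (pbr \<Lambda>) \<and> (\<forall>k\<in>{1..N}. \<forall>i\<in>{1..N}. pbr \<Lambda> (x k) (x i) = of_int (\<Lambda> k i) * x k * x i)"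
    using poisson_bracket_pbr pbr_xx by blast
  fix br assume br: "poisson_bracket \<iota> br \<and> (\<forall>k\<in>{1..N}. \<forall>i\<in>{1..N}. br (x k) (x i) = of_int (\<Lambda> k i) * x k * x i)"
  note D = poisson_bracket_derivation[OF conjunct1[OF br]]
  have 1: "br (x k) g = pbr \<Lambda> (x k) g" if "k \<in> {1..N}" for k g
    by (rule derivation_eqI[OF D(1) derivation_pbr(1)]) (use br pbr_xx that in auto)
  have "br f g = pbr \<Lambda> f g" for f g by (rule derivation_eqI[OF D(2) derivation_pbr(2)]) (rule 1)
  thus "br = pbr \<Lambda>" by blast
qed

end

text \<open>Conjugation by the automorphism turns \<open>logder w\<close> into a derivation with the
  same values on the \<open>x i\<close>, since these are only rescaled.\<close>

lemma logder_aut: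
  assumes \<theta>: "automorphism \<theta>" "automorphism \<theta>'" "\<And>f. \<theta> (\<theta>' f) = f" "\<And>f. \<theta>' (\<theta> f) = f"
    and s: "\<And>i. i \<in> {1..N} \<Longrightarrow> \<theta> (x i) = \<iota> (s i) * x i"
    and w: "\<And>i. \<theta>' (w i) = w i"
  shows "logder w (\<theta> f) = \<theta> (logder w f)"
proof -
  have D: "derivation (\<lambda>f. \<theta>' (logder w (\<theta> f)))" unfolding derivation_def
    by (simp add: aut_add[OF \<theta>(1)] aut_add[OF \<theta>(2)] aut_mult[OF \<theta>(1)] aut_mult[OF \<theta>(2)]
      der_add[OF derivation_logder] der_mult[OF derivation_logder] \<theta>(4) aut_const[OF \<theta>(1)]
      der_const[OF derivation_logder] aut_0[OF \<theta>(2)])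
  have e: "\<theta>' (logder w (\<theta> (x i))) = logder w (x i)" if "i \<in> {1..N}" for i
  proof -
    have "logder w (\<theta> (x i)) = \<iota> (s i) * (w i * x i)"
      unfolding s[OF that] der_scale[OF derivation_logder] logder_x[OF that] ..
    also have "\<dots> = w i * \<theta> (x i)" unfolding s[OF that] by (rule mult.left_commute)
    finally have "\<theta>' (logder w (\<theta> (x i))) = \<theta>' (w i) * \<theta>' (\<theta> (x i))" by (simp only: aut_mult[OF \<theta>(2)])
    thus ?thesis unfolding w \<theta>(4) logder_x[OF that] .
  qed
  have "\<theta>' (logder w (\<theta> f)) = logder w f"
    by (rule derivation_eqI[where D = "\<lambda>f. \<theta>' (logder w (\<theta> f))" and D' = "logder w", OF D derivation_logder e])
  hence "\<theta> (\<theta>' (logder w (\<theta> f))) = \<theta> (logder w f)" by simp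
  thus ?thesis unfolding \<theta>(3) .
qed

section \<open>The action of the torus on the function field\<close>

context
  fixes n :: nat and \<nu> :: "exmatrix" and l :: nat
begin

abbreviation "act \<equiv> torus_act \<iota> N x n \<nu> l"

definition tscale :: "(nat \<Rightarrow> complex) \<Rightarrow> nat \<Rightarrow> complex" where
  "tscale t k = (\<Prod>i=1..n. t i powi (int l * \<nu> i k))"

lemma tscale_nz: "t \<in> torus n \<Longrightarrow> tscale t k \<noteq> 0" by (auto simp: tscale_def torus_def PiE_iff)

lemma
  assumes "t \<in> torus n"
  shows automorphism_act: "automorphism (act t)"
    and act_x: "k \<in> {1..N} \<Longrightarrow> act t (x k) = \<iota> (tscale t k) * x k"
proof -
  obtain \<theta> where \<theta>: "automorphism \<theta>" "\<forall>i\<in>{1..N}. \<theta> (x i) = \<iota> (tscale t i) * x i"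
    using automorphism_exists[of "tscale t"] tscale_nz[OF assms] by blast
  have "act t = \<theta>" unfolding torus_act_def tscale_def[symmetric]
  proof (rule the_equality)
    show "unital_ring_hom \<theta> \<and> (\<forall>c. \<theta> (\<iota> c) = \<iota> c) \<and> (\<forall>k\<in>{1..N}. \<theta> (x k) = \<iota> (tscale t k) * x k)"
      using \<theta> by (auto simp: automorphism_def)
    fix \<theta>' assume "unital_ring_hom \<theta>' \<and> (\<forall>c. \<theta>' (\<iota> c) = \<iota> c) \<and> (\<forall>k\<in>{1..N}. \<theta>' (x k) = \<iota> (tscale t k) * x k)"
    thus "\<theta>' = \<theta>" using \<theta> by (intro automorphism_eqI) (auto simp: automorphism_def)
  qed
  with \<theta> show "automorphism (act t)" "k \<in> {1..N} \<Longrightarrow> act t (x k) = \<iota> (tscale t k) * x k" by auto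
qed

definition tinv :: "(nat \<Rightarrow> complex) \<Rightarrow> nat \<Rightarrow> complex" where
  "tinv t = restrict (\<lambda>i. inverse (t i)) {1..n}"

definition tmult :: "(nat \<Rightarrow> complex) \<Rightarrow> (nat \<Rightarrow> complex) \<Rightarrow> nat \<Rightarrow> complex" where
  "tmult s t = restrict (\<lambda>i. s i * t i) {1..n}"

lemma tinv_torus: "t \<in> torus n \<Longrightarrow> tinv t \<in> torus n"
  and tmult_torus: "s \<in> torus n \<Longrightarrow> t \<in> torus n \<Longrightarrow> tmult s t \<in> torus n"
  by (auto simp: torus_def tinv_def tmult_def PiE_iff)

lemma tscale_mult: "tscale (tmult s t) k = tscale s k * tscale t k"
  by (simp add: tscale_def tmult_def prod.distrib power_int_mult_distrib)

lemma tscale_inv: "tscale (tinv t) k = inverse (tscale t k)"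
  by (simp add: tscale_def tinv_def prod_inversef[symmetric] power_int_inverse)

lemma automorphism_comp:
  assumes "automorphism \<theta>" "automorphism \<theta>'" shows "automorphism (\<lambda>f. \<theta> (\<theta>' f))"
  using assms unfolding automorphism_def unital_ring_hom_def by auto

lemma act_act:
  assumes s: "s \<in> torus n" and t: "t \<in> torus n"
  shows "act s (act t f) = act (tmult s t) f"
proof -
  have "(\<lambda>f. act s (act t f)) = act (tmult s t)"
  proof (rule automorphism_eqI[OF automorphism_comp[OF automorphism_act[OF s] automorphism_act[OF t]]
        automorphism_act[OF tmult_torus[OF s t]]])
    fix i assume i: "i \<in> {1..N}"
    show "act s (act t (x i)) = act (tmult s t) (x i)"
      unfolding act_x[OF t i] act_x[OF tmult_torus[OF s t] i] aut_mult[OF automorphism_act[OF s]]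
        aut_const[OF automorphism_act[OF s]] act_x[OF s i] tscale_mult \<iota>_mult by (simp add: ac_simps)
  qed
  thus ?thesis by (rule fun_cong)
qed

lemma act_tinv:
  assumes t: "t \<in> torus n"
  shows "act (tinv t) (act t f) = f" "act t (act (tinv t) f) = f"
proof -
  have id: "automorphism (\<lambda>f. f)" by (simp add: automorphism_def unital_ring_hom_def)
  have t': "tinv t \<in> torus n" by (rule tinv_torus[OF t])
  have c: "\<iota> (tscale t i) * \<iota> (tscale (tinv t) i) = 1" for i
    using tscale_nz[OF t, of i] by (simp add: tscale_inv flip: \<iota>_mult)
  have "(\<lambda>f. act (tinv t) (act t f)) = (\<lambda>f. f)"
  proof (rule automorphism_eqI[OF automorphism_comp[OF automorphism_act[OF t'] automorphism_act[OF t]] id])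
    fix i assume i: "i \<in> {1..N}"
    have "act (tinv t) (act t (x i)) = \<iota> (tscale t i) * \<iota> (tscale (tinv t) i) * x i"
      unfolding act_x[OF t i] aut_mult[OF automorphism_act[OF t']]
        aut_const[OF automorphism_act[OF t']] act_x[OF t' i] by (simp add: ac_simps)
    thus "act (tinv t) (act t (x i)) = x i" unfolding c by simp
  qed
  thus "act (tinv t) (act t f) = f" by (rule fun_cong)
  have "(\<lambda>f. act t (act (tinv t) f)) = (\<lambda>f. f)"
  proof (rule automorphism_eqI[OF automorphism_comp[OF automorphism_act[OF t] automorphism_act[OF t']] id])
    fix i assume i: "i \<in> {1..N}"
    have "act t (act (tinv t) (x i)) = \<iota> (tscale t i) * \<iota> (tscale (tinv t) i) * x i"
      unfolding act_x[OF t' i] aut_mult[OF automorphism_act[OF t]]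
        aut_const[OF automorphism_act[OF t]] act_x[OF t i] by (simp add: ac_simps)
    thus "act t (act (tinv t) (x i)) = x i" unfolding c by simp
  qed
  thus "act t (act (tinv t) f) = f" by (rule fun_cong)
qed

lemma logder_act:
  assumes t: "t \<in> torus n"
  shows "logder (\<lambda>i. of_int (w i)) (act t f) = act t (logder (\<lambda>i. of_int (w i)) f)"
  by (rule logder_aut[OF automorphism_act[OF t] automorphism_act[OF tinv_torus[OF t]]
        act_tinv(2)[OF t] act_tinv(1)[OF t] act_x[OF t]])
     (auto simp: aut_of_int[OF automorphism_act[OF tinv_torus[OF t]]])

lemma pbr_act:
  assumes t: "t \<in> torus n"
  shows "pbr \<Lambda> (act t f) (act t g) = act t (pbr \<Lambda> f g)"
proof -
  note A = automorphism_act[OF t]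
  have "E k (act t f) = act t (E k f)" for k f
    using logder_act[OF t, of "\<lambda>i. if i = k then 1 else 0"] by (simp add: if_distrib cong: if_cong)
  thus ?thesis unfolding pbr_def by (simp add: aut_sum[OF A] aut_mult[OF A] aut_of_int[OF A])
qed

end

end

section \<open>The upper cluster algebra\<close>

lemma prod_powi_sum:
  fixes c :: "'a::field" assumes "c \<noteq> 0"
  shows "(\<Prod>i\<in>A. c powi f i) = c powi (sum f A)"
  by (induction A rule: infinite_finite_induct) (auto simp: power_int_add assms)

lemma powi_prod: "prod f A powi m = (\<Prod>i\<in>A. (f i :: 'a::field) powi m)"
  by (induction A rule: infinite_finite_induct) (auto simp: power_int_mult_distrib)

locale cluster = laurent_field \<iota> N x for \<iota> :: "complex \<Rightarrow> 'f::field" and N x +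
  fixes b \<Lambda> :: "exmatrix" and ex Inv Ninv :: "nat set" and n :: nat and \<nu> :: "exmatrix"
    and l :: nat
  assumes ex: "ex \<subseteq> {1..N}" and frozen: "Inv \<union> Ninv = {1..N} - ex" "Inv \<inter> Ninv = {}"
    and skew_symm: "skew_symmetrizable ex b"
    and compat: "compatible N ex b \<Lambda>"
    and basis: "kernel_basis N ex b n \<nu>"
    and l_pos: "l > 0"
    and fg: "finitely_generated_algebra \<iota> (upper_cluster_algebra \<iota> N ex Inv Ninv (x, b))"
begin

abbreviation "br \<equiv> pbr \<Lambda>"
abbreviation "ts \<equiv> tscale n \<nu> l"
abbreviation "theta \<equiv> act n \<nu> l"

text \<open>The derivative of the action at the identity would carry an additional factor
  \<open>l\<close>, which is dropped.\<close>

definition Ed :: "nat \<Rightarrow> 'f \<Rightarrow> 'f" where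
  "Ed p = logder (\<lambda>k. of_int (\<nu> p k))"

definition U :: "'f set" where
  "U = upper_cluster_algebra \<iota> N ex Inv Ninv (x, b)"

definition clusters :: "(nat \<Rightarrow> 'f) set" where
  "clusters = insert x ((\<lambda>k. x(k := exch N b x k / x k)) ` ex)"

definition L :: "(nat \<Rightarrow> 'f) \<Rightarrow> 'f set" where
  "L y = laurent.Lau \<iota> N y (cone Ninv)"

lemma \<Lambda>_skew: "i \<in> {1..N} \<Longrightarrow> j \<in> {1..N} \<Longrightarrow> \<Lambda> i j = - \<Lambda> j i" using compat unfolding compatible_def by blast

lemma compat_d: "\<exists>d. (\<forall>j\<in>ex. d j > 0) \<and>
    (\<forall>j\<in>ex. \<forall>k\<in>{1..N}. (\<Sum>i=1..N. b i j * \<Lambda> i k) = (if k = j then d j else 0))"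
  using compat unfolding compatible_def by blast

lemma Ninv: "Ninv \<subseteq> {1..N} - ex" and Inv: "Inv \<subseteq> {1..N} - ex" using frozen by auto

lemma b_diag: "k \<in> ex \<Longrightarrow> b k k = 0" using sign_skew_diag[OF skew_symmetrizable_sign_skew[OF skew_symm]] .

lemma derivation_Ed: "derivation (Ed p)" unfolding Ed_def by (rule derivation_logder)

lemmas derivation_br = derivation_pbr[of \<Lambda>, OF \<Lambda>_skew]

lemma br_skew: "br f g = - br g f" by (rule pbr_skew[OF \<Lambda>_skew])

lemma br_x: "k \<in> {1..N} \<Longrightarrow> br (x k) g = x k * logder (\<lambda>i. of_int (\<Lambda> k i)) g" by (rule pbr_x[OF \<Lambda>_skew])

lemma br_self: "br f f = 0"
proof -
  have "br f f + br f f = 0" using br_skew[of f f] by (simp add: add_eq_0_iff)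
  hence "of_nat 2 * br f f = 0" by simp
  thus ?thesis by (simp del: of_nat_numeral)
qed

lemma U_eq: "U = (\<Inter>y\<in>clusters. L y)"
proof -
  have "U = upper_bound N ex Ninv (x, b)" unfolding U_def
    using frozen ex indep gen skew_symm compatible_full_rank[OF compat ex] Ninv
    by (intro upper_cluster_algebra_eq_upper_bound) (auto simp: is_seed_def)
  thus ?thesis by (simp add: upper_bound_def clusters_def L_def mutate_def mutate_variables_eq)
qed

lemma cluster_cases:
  assumes "y \<in> clusters"
  obtains "y = x" | k where "k \<in> ex" "y = x(k := exch N b x k / x k)"
  using assms unfolding clusters_def by blast

lemma laurent_cluster: assumes "y \<in> clusters" shows "laurent \<iota> N y" using assms
proof (cases rule: cluster_cases)
  case 1 thus ?thesis using laurent_axioms by simp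
next
  case (2 k)
  show ?thesis unfolding 2(2) by unfold_locales (rule indep_exch, use 2 ex b_diag in auto)
qed

lemma cluster_nz: "y \<in> clusters \<Longrightarrow> i \<in> {1..N} \<Longrightarrow> y i \<noteq> 0" using laurent.x_nz[OF laurent_cluster] .

lemma subalg_L_cluster: "y \<in> clusters \<Longrightarrow> subalg (L y)"
  unfolding L_def by (rule laurent.subalg_cone[OF laurent_cluster])

lemma subalg_U: "subalg U" unfolding U_eq using subalg_L_cluster by (intro subalg_Inter) auto

lemmas U_0 = sub_0[OF subalg_U]
  and U_1 = sub_1[OF subalg_U]
  and U_add = sub_add[OF subalg_U]
  and U_const = sub_const[OF subalg_U]
  and U_diff = sub_diff[OF subalg_U]
  and U_generated = sub_generated[OF subalg_U]
  and U_mult = sub_mult[OF subalg_U]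
  and U_power = sub_power[OF subalg_U]
  and U_prod = sub_prod[OF subalg_U]
  and U_sum = sub_sum[OF subalg_U]
  and U_uminus = sub_uminus[OF subalg_U]

lemma x_cluster: "x \<in> clusters" by (simp add: clusters_def)

lemma U_L: "y \<in> clusters \<Longrightarrow> f \<in> U \<Longrightarrow> f \<in> L y" unfolding U_eq by blast

lemma U_I: "(\<And>y. y \<in> clusters \<Longrightarrow> f \<in> L y) \<Longrightarrow> f \<in> U" unfolding U_eq by blast

lemma cluster_in_L: "y \<in> clusters \<Longrightarrow> i \<in> {1..N} \<Longrightarrow> y i \<in> L y"
  unfolding L_def by (rule laurent.x_in_Lau[OF laurent_cluster])

lemma inverse_cluster_in_L: "y \<in> clusters \<Longrightarrow> i \<in> {1..N} \<Longrightarrow> i \<notin> Ninv \<Longrightarrow> inverse (y i) \<in> L y"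
  unfolding L_def by (rule laurent.inverse_x_in_Lau[OF laurent_cluster])

lemma cluster_frozen: "y \<in> clusters \<Longrightarrow> i \<notin> ex \<Longrightarrow> y i = x i" by (auto simp: clusters_def)

lemma exch_L: assumes "k \<in> ex" "y = x \<or> y = x(k := exch N b x k / x k)"
  shows "exch N b x k \<in> L y"
proof -
  have y: "y \<in> clusters" using assms by (auto simp: clusters_def)
  have "exch N b x k = exch N b y k"
    using assms(2) b_diag[OF assms(1)] by (intro exch_cong) (auto split: if_splits)
  also have "\<dots> \<in> L y" unfolding L_def by (rule laurent.exch_in_Lau[OF laurent_cluster[OF y]])
  finally show ?thesis .
qed

lemma x_in_U: assumes i: "i \<in> {1..N}" shows "x i \<in> U"
proof (rule U_I)
  fix y assume y: "y \<in> clusters"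
  thus "x i \<in> L y"
  proof (cases rule: cluster_cases)
    case 1 thus ?thesis using cluster_in_L[OF y i] by simp
  next
    case (2 k)
    show ?thesis
    proof (cases "i = k")
      case False thus ?thesis using cluster_in_L[OF y i] 2 by simp
    next
      case True
      have e: "exch N b x k \<noteq> 0" "x k \<noteq> 0" using exch_nz x_nz ex 2 by auto
      have "x i = exch N b x k * inverse (y k)" using True e 2 by simp
      moreover have "k \<in> {1..N}" "k \<notin> Ninv" using 2 ex Ninv by auto
      hence "exch N b x k * inverse (y k) \<in> L y"
        using 2 by (intro sub_mult[OF subalg_L_cluster[OF y]] exch_L inverse_cluster_in_L[OF y]) auto
      ultimately show ?thesis by simp
    qed
  qed
qed

lemma exch_U: "exch N b x k \<in> U" unfolding exch_def
  by (intro U_add lmon_in_subalg[OF subalg_U]) (auto simp: x_in_U posp_def negp_def)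

lemma cluster_in_U: assumes y: "y \<in> clusters" and i: "i \<in> {1..N}" shows "y i \<in> U" using y
proof (cases rule: cluster_cases)
  case 1 thus ?thesis using x_in_U[OF i] by simp
next
  case (2 k)
  show ?thesis
  proof (cases "i = k")
    case False thus ?thesis using x_in_U[OF i] 2 by simp
  next
    case True
    show ?thesis
    proof (rule U_I)
      fix z assume z: "z \<in> clusters"
      thus "y i \<in> L z"
      proof (cases "z = y")
        case True thus ?thesis using cluster_in_L[OF y i] by simp
      next
        case False
        \<comment> \<open>Every cluster other than \<open>y\<close> keeps the variable
          \<open>x k\<close>, which is invertible there because \<open>k\<close> is mutable.\<close>
        hence "z k = x k" using z 2 by (auto simp: clusters_def)
        moreover have "k \<notin> Ninv" using Ninv 2 by auto
        ultimately have "inverse (x k) \<in> L z" using inverse_cluster_in_L[OF z i] True by auto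
        moreover have "y i = exch N b x k * inverse (x k)" using 2 True by (simp add: divide_inverse)
        ultimately show ?thesis
          using U_L[OF z exch_U] by (auto intro!: sub_mult[OF subalg_L_cluster[OF z]])
      qed
    qed
  qed
qed

text \<open>A weight orthogonal to column \<open>k\<close> takes the same value on both monomials of
  the exchange polynomial, which is therefore an eigenvector.\<close>

lemma logder_exch:
  assumes "(\<Sum>i=1..N. b i k * w i) = 0"
  shows "logder (\<lambda>i. of_int (w i)) (exch N b x k) = of_int (\<Sum>i=1..N. posp b k i * w i) * exch N b x k"
proof -
  have "(\<Sum>i=1..N. posp b k i * w i) - (\<Sum>i=1..N. negp b k i * w i) = (\<Sum>i=1..N. b i k * w i)"
    unfolding sum_subtractf[symmetric]
    by (intro sum.cong) (auto simp: posp_def negp_def max_def algebra_simps)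
  hence e: "(\<Sum>i=1..N. negp b k i * w i) = (\<Sum>i=1..N. posp b k i * w i)" using assms by simp
  have l: "logder (\<lambda>i. of_int (w i)) (lmon N x a) = of_int (\<Sum>i=1..N. a i * w i) * lmon N x a" for a
    by (simp add: logder_lmon)
  show ?thesis unfolding exch_def der_add[OF derivation_logder] l e by (simp add: algebra_simps)
qed

lemma logder_mutated:
  assumes k: "k \<in> ex" and w: "(\<Sum>i=1..N. b i k * w i) = 0"
  shows "logder (\<lambda>i. of_int (w i)) (exch N b x k / x k) =
    of_int ((\<Sum>i=1..N. posp b k i * w i) - w k) * (exch N b x k / x k)"
proof -
  have kN: "k \<in> {1..N}" using k ex by auto
  show ?thesis using x_nz[OF kN]
    by (simp add: der_divide[OF derivation_logder] logder_exch[OF w] logder_x[OF kN])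
       (simp add: field_simps power2_eq_square)
qed

lemma logder_cluster:
  assumes y: "y \<in> clusters" and w: "\<And>k. k \<in> ex \<Longrightarrow> (\<Sum>i=1..N. b i k * w i) = 0"
  shows "\<exists>\<mu>. \<forall>i\<in>{1..N}. logder (\<lambda>i. of_int (w i)) (y i) = of_int (\<mu> i) * y i" using y
proof (cases rule: cluster_cases)
  case 1 thus ?thesis using logder_x by auto
next
  case (2 k)
  let ?\<mu> = "w(k := (\<Sum>i=1..N. posp b k i * w i) - w k)"
  have "logder (\<lambda>i. of_int (w i)) (y i) = of_int (?\<mu> i) * y i" if "i \<in> {1..N}" for i
    using logder_mutated[OF 2(1) w[OF 2(1)]] logder_x[OF that] 2 by (cases "i = k") simp_all
  thus ?thesis by blast
qed

lemma kernel_\<nu>: assumes "p \<in> {1..n}" "k \<in> ex" shows "(\<Sum>i=1..N. b i k * \<nu> p i) = 0"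
  using basis assms unfolding kernel_basis_def kernel_lattice_def by blast

lemma Ed_cluster:
  assumes "y \<in> clusters" "p \<in> {1..n}"
  shows "\<exists>\<mu>. \<forall>i\<in>{1..N}. Ed p (y i) = of_int (\<mu> i) * y i"
  unfolding Ed_def by (intro logder_cluster assms(1) kernel_\<nu>[OF assms(2)])

text \<open>This makes row \<open>i\<close> of \<Lambda> an admissible weight in
  \<open>logder_mutated\<close>, so that the new variable has a bracket of monomial form with every
  other \<open>x i\<close>.\<close>

lemma compat_zero:
  assumes "k \<in> ex" "i \<in> {1..N}" "i \<noteq> k" shows "(\<Sum>m=1..N. b m k * \<Lambda> i m) = 0"
proof -
  have "(\<Sum>m=1..N. b m k * \<Lambda> m i) = 0" using compat_d assms by auto
  moreover have "(\<Sum>m=1..N. b m k * \<Lambda> i m) = (\<Sum>m=1..N. - (b m k * \<Lambda> m i))"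
  proof (intro sum.cong refl)
    fix m assume "m \<in> {1..N}"
    thus "b m k * \<Lambda> i m = - (b m k * \<Lambda> m i)" using \<Lambda>_skew[of i m] assms by simp
  qed
  ultimately show ?thesis by (simp add: sum_negf)
qed

lemma br_cluster:
  assumes y: "y \<in> clusters"
  shows "\<exists>c. \<forall>i\<in>{1..N}. \<forall>j\<in>{1..N}. br (y i) (y j) = of_int (c i j) * y i * y j"
proof -
  have "\<exists>c. br (y i) (y j) = of_int c * y i * y j" if ij: "i \<in> {1..N}" "j \<in> {1..N}" for i j using y
  proof (cases rule: cluster_cases)
    case 1 thus ?thesis using ij by (intro exI[of _ "\<Lambda> i j"]) (simp add: br_x logder_x)
  next
    case (2 k)
    have yk: "y k = exch N b x k / x k" using 2 by simp
    have mixed: "\<exists>c. br (x i) (y k) = of_int c * x i * y k" if "i \<in> {1..N}" "i \<noteq> k" for i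
      unfolding br_x[OF that(1)] yk logder_mutated[OF 2(1) compat_zero[OF 2(1) that]]
      by (intro exI[of _ "(\<Sum>m=1..N. posp b k m * \<Lambda> i m) - \<Lambda> i k"]) (simp only: ac_simps)
    consider "i = k" "j = k" | "i = k" "j \<noteq> k" | "i \<noteq> k" "j = k" | "i \<noteq> k" "j \<noteq> k" by blast
    thus ?thesis
    proof cases
      case c: 1 thus ?thesis by (intro exI[of _ 0]) (simp add: br_self)
    next
      case c: 2
      obtain c' where "br (x j) (y k) = of_int c' * x j * y k" using mixed[OF ij(2) c(2)] by blast
      hence "br (y k) (x j) = of_int (- c') * y k * x j"
        using br_skew[of "y k" "x j"] by (simp add: algebra_simps)
      thus ?thesis using c 2 by (intro exI[of _ "- c'"]) simp
    next
      case c: 3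
      thus ?thesis using mixed[OF ij(1) c(1)] 2 by simp
    next
      case c: 4
      thus ?thesis using 2 ij by (intro exI[of _ "\<Lambda> i j"]) (simp add: br_x logder_x)
    qed
  qed
  thus ?thesis by metis
qed

lemma derivation_U:
  assumes D: "derivation D"
    and c: "\<And>y. y \<in> clusters \<Longrightarrow> \<exists>c. \<forall>i\<in>{1..N}. D (y i) = c i * y i \<and> c i \<in> L y" and f: "f \<in> U"
  shows "D f \<in> U"
proof (rule U_I)
  fix y assume y: "y \<in> clusters"
  obtain c where "\<forall>i\<in>{1..N}. D (y i) = c i * y i \<and> c i \<in> L y" using c[OF y] by blast
  thus "D f \<in> L y"
    using laurent.der_preserves_Lau[OF laurent_cluster[OF y] D, of c] U_L[OF y f] by (simp add: L_def)
qed

lemma Ed_U: assumes p: "p \<in> {1..n}" and "f \<in> U" shows "Ed p f \<in> U"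
proof (rule derivation_U[OF derivation_Ed _ assms(2)])
  fix y assume y: "y \<in> clusters"
  obtain \<mu> where "\<forall>i\<in>{1..N}. Ed p (y i) = of_int (\<mu> i) * y i" using Ed_cluster[OF y p] by blast
  thus "\<exists>c. \<forall>i\<in>{1..N}. Ed p (y i) = c i * y i \<and> c i \<in> L y"
    using sub_of_int[OF subalg_L_cluster[OF y]] by (intro exI[of _ "\<lambda>i. of_int (\<mu> i)"]) auto
qed

text \<open>The bracket with \<open>y i\<close>, divided by \<open>y i\<close>, multiplies cluster
  variables by integers. It preserves \<open>L y\<close> even if \<open>y i\<close> is not
  invertible there.\<close>

lemma br_cluster_L:
  assumes y: "y \<in> clusters" and i: "i \<in> {1..N}" and f: "f \<in> L y"
  shows "\<exists>g\<in>L y. br (y i) f = y i * g"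
proof -
  obtain c where c: "\<forall>i\<in>{1..N}. \<forall>j\<in>{1..N}. br (y i) (y j) = of_int (c i j) * y i * y j"
    using br_cluster[OF y] by blast
  have D: "derivation (\<lambda>f. inverse (y i) * br (y i) f)" by (intro derivation_smult derivation_br)
  have "inverse (y i) * br (y i) (y j) = of_int (c i j) * y j" if "j \<in> {1..N}" for j
    using c i that cluster_nz[OF y i] by simp
  hence "inverse (y i) * br (y i) f \<in> L y" using f sub_of_int[OF subalg_L_cluster[OF y]] unfolding L_def
    by (intro laurent.der_preserves_Lau[OF laurent_cluster[OF y] D, of "\<lambda>j. of_int (c i j)"]) auto
  thus ?thesis using cluster_nz[OF y i] by (intro bexI[of _ "inverse (y i) * br (y i) f"]) auto
qed

text \<open>With the second argument fixed, the bracket is a derivation in the first;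
  \<open>br_cluster_L\<close> says that its logarithmic derivatives on each cluster have no
  denominators.\<close>

lemma br_U: assumes f: "f \<in> U" and g: "g \<in> U" shows "br f g \<in> U"
proof (rule derivation_U[OF derivation_br(2) _ f])
  fix y assume y: "y \<in> clusters"
  have "\<forall>i\<in>{1..N}. \<exists>c\<in>L y. br (y i) g = y i * c" using br_cluster_L[OF y] U_L[OF y g] by blast
  then obtain c where "\<forall>i\<in>{1..N}. c i \<in> L y \<and> br (y i) g = y i * c i" by metis
  thus "\<exists>c. \<forall>i\<in>{1..N}. br (y i) g = c i * y i \<and> c i \<in> L y"
    by (intro exI[of _ c]) (auto simp: mult.commute)
qed

text \<open>A frozen variable belongs to every cluster, so the quotient of the bracket by it lies in
  each of the Laurent rings.\<close>

lemma br_frozen: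
  assumes i: "i \<in> {1..N} - ex" and f: "f \<in> U" shows "\<exists>g\<in>U. br f (x i) = g * x i"
proof -
  have iN: "i \<in> {1..N}" using i by auto
  define g where "g = - (inverse (x i) * br (x i) f)"
  have "g \<in> U"
  proof (rule U_I)
    fix y assume y: "y \<in> clusters"
    have yi: "y i = x i" using i cluster_frozen[OF y] by auto
    from br_cluster_L[OF y iN U_L[OF y f]] obtain h where "h \<in> L y" "br (x i) f = x i * h"
      unfolding yi by blast
    moreover from this have "g = - h" unfolding g_def using x_nz[OF iN] by simp
    ultimately show "g \<in> L y" by (auto intro!: sub_uminus[OF subalg_L_cluster[OF y]])
  qed
  moreover have "br f (x i) = g * x i" using br_skew[of f "x i"] x_nz[OF iN] by (simp add: g_def)
  ultimately show ?thesis by blast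
qed

text \<open>The monomial with exponents from column \<open>k\<close> takes the value 1 at the
  scaling factors, because each \<nu> p is orthogonal to that column.\<close>

lemma lmon_ts:
  assumes t: "t \<in> torus n" and k: "k \<in> ex" shows "lmon N (ts t) (posp b k) = lmon N (ts t) (negp b k)"
proof -
  have tnz: "t i \<noteq> 0" if "i \<in> {1..n}" for i using t that by (auto simp: torus_def)
  have "lmon N (ts t) (\<lambda>m. b m k) = (\<Prod>m=1..N. \<Prod>i=1..n. t i powi (int l * \<nu> i m * b m k))"
    unfolding lmon_def tscale_def by (intro prod.cong refl) (simp add: powi_prod power_int_mult)
  also have "\<dots> = (\<Prod>i=1..n. \<Prod>m=1..N. t i powi (int l * \<nu> i m * b m k))" by (rule prod.swap)
  also have "\<dots> = (\<Prod>i=1..n. 1)"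
  proof (intro prod.cong refl)
    fix i assume i: "i \<in> {1..n}"
    have "(\<Sum>m=1..N. int l * \<nu> i m * b m k) = int l * (\<Sum>m=1..N. b m k * \<nu> i m)"
      by (simp add: sum_distrib_left ac_simps)
    also have "\<dots> = 0" using kernel_\<nu>[OF i k] by simp
    finally show "(\<Prod>m=1..N. t i powi (int l * \<nu> i m * b m k)) = 1"
      using tnz[OF i] by (simp add: prod_powi_sum)
  qed
  finally have 1: "lmon N (ts t) (\<lambda>m. b m k) = 1" by simp
  have "lmon N (ts t) (posp b k) = lmon N (ts t) (\<lambda>m. negp b k m + b m k)"
    by (intro lmon_cong) (auto simp: posp_def negp_def)
  also have "\<dots> = lmon N (ts t) (negp b k)" using tscale_nz[OF t] by (subst lmon_add) (auto simp: 1)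
  finally show ?thesis .
qed

lemma lmon_\<iota>: "lmon N (\<lambda>i. \<iota> (s i)) a = \<iota> (lmon N s a)" by (simp add: lmon_def \<iota>.hom_prod hom_powi)

lemma theta_lmon:
  assumes t: "t \<in> torus n" shows "theta t (lmon N x a) = \<iota> (lmon N (ts t) a) * lmon N x a"
proof -
  have "theta t (lmon N x a) = lmon N (\<lambda>i. \<iota> (ts t i) * x i) a"
    unfolding aut_lmon[OF automorphism_act[OF t]] by (intro lmon_cong) (auto simp: act_x[OF t])
  thus ?thesis by (simp add: lmon_map_mult lmon_\<iota>)
qed

lemma theta_cluster:
  assumes y: "y \<in> clusters" and t: "t \<in> torus n" and i: "i \<in> {1..N}"
  shows "\<exists>c. theta t (y i) = \<iota> c * y i" using y
proof (cases rule: cluster_cases)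
  case 1 thus ?thesis using act_x[OF t i] by auto
next
  case (2 k)
  note A = automorphism_act[OF t, of \<nu> l]
  show ?thesis
  proof (cases "i = k")
    case False thus ?thesis using act_x[OF t i] 2 by auto
  next
    case True
    have "theta t (exch N b x k) = \<iota> (lmon N (ts t) (negp b k)) * exch N b x k"
      unfolding exch_def aut_add[OF A] theta_lmon[OF t] lmon_ts[OF t 2(1)] by (simp add: algebra_simps)
    hence "theta t (exch N b x k / x k) =
        \<iota> (lmon N (ts t) (negp b k)) * exch N b x k * inverse (\<iota> (ts t k) * x k)"
      unfolding divide_inverse aut_mult[OF A] aut_inverse[OF A] using act_x[OF t i] True by simp
    also have "\<dots> = \<iota> (lmon N (ts t) (negp b k) * inverse (ts t k)) * (exch N b x k / x k)"
      by (simp add: \<iota>_mult \<iota>.hom_inverse divide_inverse ac_simps)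
    finally show ?thesis using 2 True by auto
  qed
qed

lemma theta_U_subset: assumes t: "t \<in> torus n" and f: "f \<in> U" shows "theta t f \<in> U"
proof (rule U_I)
  fix y assume y: "y \<in> clusters"
  interpret Y: laurent \<iota> N y by (rule laurent_cluster[OF y])
  note A = automorphism_act[OF t, of \<nu> l]
  obtain c where c: "\<forall>i\<in>{1..N}. theta t (y i) = \<iota> (c i) * y i" using theta_cluster[OF y t] by metis
  have "f \<in> Y.Lau (cone Ninv)" using U_L[OF y f] by (simp add: L_def)
  thus "theta t f \<in> L y" unfolding L_def
  proof (induction rule: Y.Lau_induct)
    case zero thus ?case by (simp add: aut_0[OF A] Y.Lau_0)
  next
    case (step d a g)
    have "theta t (lmon N y a) = lmon N (\<lambda>i. \<iota> (c i) * y i) a"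
      unfolding aut_lmon[OF A] by (intro lmon_cong) (use c in auto)
    also have "\<dots> = \<iota> (lmon N c a) * lmon N y a" by (simp add: lmon_map_mult lmon_\<iota>)
    finally show ?case using step by (auto simp: aut_add[OF A] aut_mult[OF A] aut_const[OF A]
          intro!: Y.Lau_add Y.Lau_scale Y.lmon_Lau)
  qed
qed

end

section \<open>Points of affine varieties\<close>

context complex_algebra
begin

lemma ring_on_simps [simp]:
  "carrier (ring_on A) = A" "mult (ring_on A) = (*)" "one (ring_on A) = (1::'f)"
  "zero (ring_on A) = 0" "add (ring_on A) = (+)" by (simp_all add: ring_on_def)

lemma cring_ring_on: assumes A: "subalg A" shows "cring (ring_on A)"
proof (rule cringI)
  show "abelian_group (ring_on A)"
  proof (rule abelian_groupI)
    fix f assume "f \<in> carrier (ring_on A)"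
    thus "\<exists>g\<in>carrier (ring_on A). g \<oplus>\<^bsub>ring_on A\<^esub> f = \<zero>\<^bsub>ring_on A\<^esub>"
      using sub_uminus[OF A, of f] by (intro bexI[of _ "- f"]) auto
  qed (auto simp: sub_add[OF A] sub_0[OF A] algebra_simps)
  show "comm_monoid (ring_on A)" by unfold_locales (auto simp: sub_mult[OF A] sub_1[OF A] algebra_simps)
qed (auto simp: algebra_simps)

definition is_ideal :: "'f set \<Rightarrow> 'f set \<Rightarrow> bool" where
  "is_ideal A I \<longleftrightarrow> I \<subseteq> A \<and> 0 \<in> I \<and> (\<forall>f\<in>I. \<forall>g\<in>I. f + g \<in> I) \<and> (\<forall>f\<in>I. \<forall>g\<in>A. g * f \<in> I)"

lemma is_ideal_0: "is_ideal A I \<Longrightarrow> 0 \<in> I"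
  and is_ideal_subset: "is_ideal A I \<Longrightarrow> I \<subseteq> A"
  and is_ideal_add: "is_ideal A I \<Longrightarrow> f \<in> I \<Longrightarrow> g \<in> I \<Longrightarrow> f + g \<in> I"
  and is_ideal_mult: "is_ideal A I \<Longrightarrow> f \<in> I \<Longrightarrow> g \<in> A \<Longrightarrow> g * f \<in> I" by (auto simp: is_ideal_def)

lemma is_ideal_uminus: "subalg A \<Longrightarrow> is_ideal A I \<Longrightarrow> f \<in> I \<Longrightarrow> - f \<in> I"
  using sub_uminus[OF _ sub_1, of A] unfolding is_ideal_def by (metis mult_minus1)

lemma is_ideal_diff: "subalg A \<Longrightarrow> is_ideal A I \<Longrightarrow> f \<in> I \<Longrightarrow> g \<in> I \<Longrightarrow> f - g \<in> I"
  using is_ideal_uminus[of A I g] unfolding is_ideal_def by (metis diff_conv_add_uminus)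

lemma is_ideal_sum: "is_ideal A I \<Longrightarrow> (\<And>i. i \<in> K \<Longrightarrow> f i \<in> I) \<Longrightarrow> sum f K \<in> I"
  by (induction K rule: infinite_finite_induct) (auto simp: is_ideal_def)

lemma ideal_ring_on: assumes A: "subalg A" shows "ideal I (ring_on A) \<longleftrightarrow> is_ideal A I"
proof
  assume "ideal I (ring_on A)"
  then interpret I: ideal I "ring_on A" .
  show "is_ideal A I" unfolding is_ideal_def
    using additive_subgroup.a_subset[OF I.is_additive_subgroup] additive_subgroup.zero_closed[OF I.is_additive_subgroup]
      additive_subgroup.a_closed[OF I.is_additive_subgroup] I.I_l_closed by auto
next
  assume I: "is_ideal A I"
  interpret R: cring "ring_on A" by (rule cring_ring_on[OF A])
  show "ideal I (ring_on A)"
  proof (rule idealI)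
    show "ring (ring_on A)" by (rule R.ring_axioms)
    show "subgroup I (add_monoid (ring_on A))"
    proof (rule group.subgroupI[OF R.a_group])
      fix f assume f: "f \<in> I"
      hence fA: "f \<in> A" using I by (auto simp: is_ideal_def)
      have "inv\<^bsub>add_monoid (ring_on A)\<^esub> f = - f"
        using fA sub_uminus[OF A fA] by (intro group.inv_equality[OF R.a_group]) auto
      thus "inv\<^bsub>add_monoid (ring_on A)\<^esub> f \<in> I" using is_ideal_uminus[OF A I f] by simp
    qed (use I in \<open>auto simp: is_ideal_def\<close>)
  qed (use I in \<open>auto simp: is_ideal_def mult.commute\<close>)
qed

definition is_prime :: "'f set \<Rightarrow> 'f set \<Rightarrow> bool" where
  "is_prime A P \<longleftrightarrow> is_ideal A P \<and> 1 \<notin> P \<and> (\<forall>f\<in>A. \<forall>g\<in>A. f * g \<in> P \<longrightarrow> f \<in> P \<or> g \<in> P)"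

lemma is_ideal_1: "is_ideal A I \<Longrightarrow> 1 \<in> I \<longleftrightarrow> I = A" if "subalg A"
  using sub_1[OF that] unfolding is_ideal_def by (metis mult_1_right subsetI subset_antisym)

lemma primeideal_ring_on: assumes A: "subalg A" shows "primeideal P (ring_on A) \<longleftrightarrow> is_prime A P"
proof
  assume "primeideal P (ring_on A)"
  then interpret P: primeideal P "ring_on A" .
  have "is_ideal A P" using P.is_ideal ideal_ring_on[OF A] by simp
  thus "is_prime A P" unfolding is_prime_def using P.I_notcarr P.I_prime is_ideal_1[OF A, of P] by auto
next
  assume "is_prime A P"
  thus "primeideal P (ring_on A)"
    using cring_ring_on[OF A] ideal_ring_on[OF A, of P] is_ideal_1[OF A, of P]
    by (intro primeidealI) (auto simp: is_prime_def)
qed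

text \<open>Points are handled as characters, which compose well with automorphisms and flows;
  \<open>kernel\<close> and \<open>value_at\<close> translate to maximal ideals and back. The values
  outside \<open>A\<close> are arbitrary, except on scalars.\<close>

definition point :: "'f set \<Rightarrow> ('f \<Rightarrow> complex) \<Rightarrow> bool" where
  "point A \<phi> \<longleftrightarrow> (\<forall>c. \<phi> (\<iota> c) = c) \<and> (\<forall>f\<in>A. \<forall>g\<in>A. \<phi> (f + g) = \<phi> f + \<phi> g \<and> \<phi> (f * g) = \<phi> f * \<phi> g)"

definition kernel :: "'f set \<Rightarrow> ('f \<Rightarrow> complex) \<Rightarrow> 'f set" where
  "kernel A \<phi> = {f \<in> A. \<phi> f = 0}"

context
  fixes A \<phi> assumes A: "subalg A" and \<phi>: "point A \<phi>"
begin

lemma pt_const [simp]: "\<phi> (\<iota> c) = c"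
  and pt_add: "f \<in> A \<Longrightarrow> g \<in> A \<Longrightarrow> \<phi> (f + g) = \<phi> f + \<phi> g"
  and pt_mult: "f \<in> A \<Longrightarrow> g \<in> A \<Longrightarrow> \<phi> (f * g) = \<phi> f * \<phi> g" using \<phi> by (auto simp: point_def)

lemma pt_0 [simp]: "\<phi> 0 = 0" using pt_const[of 0] by simp
lemma pt_1 [simp]: "\<phi> 1 = 1" using pt_const[of 1] by simp
lemma pt_of_int [simp]: "\<phi> (of_int n) = of_int n"
  using pt_const[of "of_int n"] by (simp add: \<iota>.hom_of_int del: pt_const)

lemma pt_uminus: "f \<in> A \<Longrightarrow> \<phi> (- f) = - \<phi> f"
  using pt_add[of f "- f"] sub_uminus[OF A, of f] by (simp add: add_eq_0_iff)

lemma pt_diff: "f \<in> A \<Longrightarrow> g \<in> A \<Longrightarrow> \<phi> (f - g) = \<phi> f - \<phi> g"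
  using pt_add[of f "- g"] sub_uminus[OF A, of g] by (simp add: pt_uminus)

lemma pt_sum: "(\<And>i. i \<in> K \<Longrightarrow> h i \<in> A) \<Longrightarrow> \<phi> (sum h K) = (\<Sum>i\<in>K. \<phi> (h i))"
  by (induction K rule: infinite_finite_induct) (auto simp: pt_add sub_sum[OF A])

lemma pt_prod: "(\<And>i. i \<in> K \<Longrightarrow> h i \<in> A) \<Longrightarrow> \<phi> (prod h K) = (\<Prod>i\<in>K. \<phi> (h i))"
  by (induction K rule: infinite_finite_induct) (auto simp: pt_mult sub_prod[OF A])

lemma pt_power: "f \<in> A \<Longrightarrow> \<phi> (f ^ n) = \<phi> f ^ n" by (induction n) (auto simp: pt_mult sub_power[OF A])

lemma is_prime_kernel: "is_prime A (kernel A \<phi>)" unfolding is_prime_def is_ideal_def kernel_def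
  by (auto simp: pt_add pt_mult sub_add[OF A] sub_mult[OF A] sub_0[OF A])

lemma is_ideal_kernel: "is_ideal A (kernel A \<phi>)" using is_prime_kernel by (simp add: is_prime_def)

lemma kernel_max_spec: "kernel A \<phi> \<in> max_spec A" unfolding max_spec_def mem_Collect_eq
proof (rule maximalidealI)
  show "ideal (kernel A \<phi>) (ring_on A)" using ideal_ring_on[OF A] is_ideal_kernel by simp
  show "carrier (ring_on A) \<noteq> kernel A \<phi>"
  proof
    assume e: "carrier (ring_on A) = kernel A \<phi>"
    have "1 \<in> carrier (ring_on A)" using sub_1[OF A] by simp
    hence "1 \<in> kernel A \<phi>" unfolding e .
    thus False by (simp add: kernel_def)
  qed
  fix J assume J: "ideal J (ring_on A)" "kernel A \<phi> \<subseteq> J" "J \<subseteq> carrier (ring_on A)"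
  have JI: "is_ideal A J" using J ideal_ring_on[OF A] by simp
  show "J = kernel A \<phi> \<or> J = carrier (ring_on A)"
  proof (cases "J \<subseteq> kernel A \<phi>")
    case False
    then obtain f where f: "f \<in> J" "\<phi> f \<noteq> 0" "f \<in> A" using J(3) by (auto simp: kernel_def)
    have "f - \<iota> (\<phi> f) \<in> kernel A \<phi>"
      using f by (simp add: kernel_def pt_diff sub_diff[OF A] sub_const[OF A])
    hence "f - (f - \<iota> (\<phi> f)) \<in> J" using J(2) by (intro is_ideal_diff[OF A JI f(1) subsetD])
    hence "\<iota> (\<phi> f) \<in> J" by simp
    hence "\<iota> (inverse (\<phi> f)) * \<iota> (\<phi> f) \<in> J" by (intro is_ideal_mult[OF JI] sub_const[OF A])
    hence "1 \<in> J" using f(2) by (simp flip: \<iota>_mult)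
    hence "J = A" using is_ideal_1[OF A JI] by blast
    thus ?thesis by simp
  next
    case True
    hence "J = kernel A \<phi>" using J(2) by (rule subset_antisym)
    thus ?thesis ..
  qed
qed

lemma value_at_kernel: assumes f: "f \<in> A" shows "value_at \<iota> (kernel A \<phi>) f = \<phi> f" unfolding value_at_def
proof (rule the_equality)
  show "f - \<iota> (\<phi> f) \<in> kernel A \<phi>"
    using f by (simp add: kernel_def pt_diff sub_diff[OF A] sub_const[OF A])
  fix c assume "f - \<iota> c \<in> kernel A \<phi>"
  thus "c = \<phi> f" using f by (simp add: kernel_def pt_diff sub_const[OF A])
qed

end

text \<open>Products of at most \<open>k\<close> elements of \<open>S\<close>; admitting the factor
  1 makes these sets increasing in \<open>k\<close>, as a filtration by degree.\<close>

fun mons :: "'f set \<Rightarrow> nat \<Rightarrow> 'f set" where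
  "mons S 0 = {1}"
| "mons S (Suc k) = (\<lambda>(s, p). s * p) ` (insert 1 S \<times> mons S k)"

lemma finite_mons: "finite S \<Longrightarrow> finite (mons S k)" by (induction k) auto

lemma mons_mono: "j \<le> k \<Longrightarrow> mons S j \<subseteq> mons S k"
proof (induction rule: dec_induct)
  case (step i)
  have "mons S i \<subseteq> mons S (Suc i)"
  proof
    fix p assume "p \<in> mons S i"
    thus "p \<in> mons S (Suc i)" by (auto intro!: image_eqI[of _ _ "(1, p)"])
  qed
  thus ?case using step by blast
qed simp

lemma mons_mult: "p \<in> mons S j \<Longrightarrow> q \<in> mons S k \<Longrightarrow> p * q \<in> mons S (j + k)"
proof (induction j arbitrary: p)
  case (Suc j)
  then obtain s p' where p: "s \<in> insert 1 S" "p' \<in> mons S j" "p = s * p'" by auto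
  hence "p' * q \<in> mons S (j + k)" using Suc by blast
  thus ?case using p by (auto intro!: image_eqI[of _ _ "(s, p' * q)"] simp: mult.assoc)
qed simp

lemma mons_split: "p \<in> mons S (j + k) \<Longrightarrow> \<exists>q\<in>mons S j. \<exists>r\<in>mons S k. p = q * r"
proof (induction j arbitrary: p)
  case (Suc j)
  then obtain s p' where p: "s \<in> insert 1 S" "p' \<in> mons S (j + k)" "p = s * p'" by auto
  then obtain q r where qr: "q \<in> mons S j" "r \<in> mons S k" "p' = q * r" using Suc.IH by blast
  have "s * q \<in> mons S (Suc j)" using p qr by (auto intro!: image_eqI[of _ _ "(s, q)"])
  moreover have "p = (s * q) * r" using p qr by (simp add: mult.assoc)
  ultimately show ?case using qr(2) by blast
qed simp

lemma span_mult:
  assumes "f \<in> V.span S" "g \<in> V.span T" "\<And>p q. p \<in> S \<Longrightarrow> q \<in> T \<Longrightarrow> p * q \<in> V.span R"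
  shows "f * g \<in> V.span R"
proof -
  have 1: "p * g \<in> V.span R" if "p \<in> S" for p using assms(2)
  proof (induction rule: V.span_induct_alt)
    case base thus ?case by (simp add: V.span_zero)
  next
    case (step c u v)
    have "p * (\<iota> c * u + v) = \<iota> c * (p * u) + p * v" by (simp add: algebra_simps)
    thus ?case using step assms(3)[OF that] by (auto intro!: V.span_add V.span_scale)
  qed
  show ?thesis using assms(1)
  proof (induction rule: V.span_induct_alt)
    case base thus ?case by (simp add: V.span_zero)
  next
    case (step c u v)
    have "(\<iota> c * u + v) * g = \<iota> c * (u * g) + v * g" by (simp add: algebra_simps)
    thus ?case using step 1 by (auto intro!: V.span_add V.span_scale)
  qed
qed

lemma generated_algebra_mons: "f \<in> alg S \<Longrightarrow> \<exists>k. f \<in> V.span (mons S k)"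
proof (induction rule: generated_algebra.induct)
  case (scalar c)
  have "\<iota> c * 1 \<in> V.span (mons S 0)" by (intro V.span_scale V.span_base) simp
  thus ?case by (intro exI[of _ 0]) simp
next
  case (gen s)
  hence "s \<in> mons S (Suc 0)" by (auto intro!: image_eqI[of _ _ "(s, 1)"])
  thus ?case by (blast intro: V.span_base)
next
  case (add f g)
  then obtain j k where jk: "f \<in> V.span (mons S j)" "g \<in> V.span (mons S k)" by blast
  have "V.span (mons S j) \<subseteq> V.span (mons S (max j k))" "V.span (mons S k) \<subseteq> V.span (mons S (max j k))"
    by (intro V.span_mono mons_mono; simp)+
  thus ?case using jk by (intro exI[of _ "max j k"] V.span_add) auto
next
  case (mult f g)
  then obtain j k where jk: "f \<in> V.span (mons S j)" "g \<in> V.span (mons S k)" by blast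
  hence "f * g \<in> V.span (mons S (j + k))" by (rule span_mult) (auto intro: V.span_base mons_mult)
  thus ?case ..
qed

lemma map_poly_\<iota>_add: "map_poly \<iota> (p + q) = map_poly \<iota> p + map_poly \<iota> q"
  by (intro poly_eqI) (simp add: coeff_map_poly \<iota>_add)

lemma map_poly_\<iota>_smult: "map_poly \<iota> (Polynomial.smult c p) = Polynomial.smult (\<iota> c) (map_poly \<iota> p)"
  by (intro poly_eqI) (simp add: coeff_map_poly \<iota>_mult)

lemma poly_\<iota>_linear_mult: "poly (map_poly \<iota> ([:- c, 1:] * p)) f = (f - \<iota> c) * poly (map_poly \<iota> p) f"
proof -
  have "[:- c, 1:] * p = Polynomial.smult (- c) p + pCons 0 p" by simp
  hence "map_poly \<iota> ([:- c, 1:] * p) = Polynomial.smult (\<iota> (- c)) (map_poly \<iota> p) + pCons 0 (map_poly \<iota> p)"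
    by (simp only: map_poly_\<iota>_add map_poly_\<iota>_smult map_poly_pCons \<iota>_0)
  thus ?thesis by (simp only: poly_add poly_smult poly_pCons) (simp add: \<iota>.hom_uminus algebra_simps)
qed

text \<open>Over the complex numbers \<open>q\<close> splits into linear factors, and a prime ideal
  containing their product contains one of them.\<close>

lemma prime_poly_root:
  assumes A: "subalg A" and P: "is_prime A P" and f: "f \<in> A"
  shows "q \<noteq> 0 \<Longrightarrow> poly (map_poly \<iota> q) f \<in> P \<Longrightarrow> \<exists>c. f - \<iota> c \<in> P"
proof (induction "degree q" arbitrary: q)
  case 0
  from degree_eq_zeroE[OF 0(1)[symmetric]] obtain c where qc: "q = [:c:]" by blast
  hence q: "q = [:c:]" "c \<noteq> 0" using 0(2) by auto
  hence "\<iota> c \<in> P" using 0 by (simp add: map_poly_pCons)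
  hence "\<iota> (inverse c) * \<iota> c \<in> P" using P sub_const[OF A] by (auto simp: is_prime_def is_ideal_def)
  hence "1 \<in> P" using q by (simp flip: \<iota>_mult)
  thus ?case using P by (simp add: is_prime_def)
next
  case (Suc d)
  hence "\<not> constant (poly q)" by (simp add: constant_degree)
  then obtain c where "poly q c = 0" using Fundamental_Theorem_Algebra.fundamental_theorem_of_algebra[of q] by blast
  hence "[:- c, 1:] dvd q" by (rule iffD1[OF poly_eq_0_iff_dvd])
  then obtain r where r: "q = [:- c, 1:] * r" by (elim dvdE)
  have rA: "poly (map_poly \<iota> r) f \<in> A" for r
  proof (induction r)
    case (pCons a p)
    thus ?case
      using sub_add[OF A sub_const[OF A] sub_mult[OF A f pCons.IH], of a] by (simp add: map_poly_pCons)
  qed (simp add: sub_0[OF A])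
  have "poly (map_poly \<iota> q) f = (f - \<iota> c) * poly (map_poly \<iota> r) f"
    unfolding r by (rule poly_\<iota>_linear_mult)
  hence "(f - \<iota> c) * poly (map_poly \<iota> r) f \<in> P" using Suc.prems by simp
  moreover have "f - \<iota> c \<in> A" by (intro sub_diff[OF A] sub_const[OF A] f)
  ultimately have "f - \<iota> c \<in> P \<or> poly (map_poly \<iota> r) f \<in> P" using P rA unfolding is_prime_def by blast
  moreover have r0: "r \<noteq> 0" using Suc.prems r by auto
  moreover have "degree q = 1 + degree r" unfolding r using r0 by (subst degree_mult_eq) auto
  hence "d = degree r" using Suc.hyps(2) by simp
  ultimately show ?case using Suc.hyps(1)[of r] by blast
qed

lemma max_spec_inverse:
  assumes A: "subalg A" and m: "m \<in> max_spec A" and f: "f \<in> A" "f \<notin> m"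
  shows "\<exists>h\<in>A. h * f - 1 \<in> m"
proof -
  interpret m: maximalideal m "ring_on A" using m by (simp add: max_spec_def)
  have mI: "is_ideal A m" using m.is_ideal ideal_ring_on[OF A] by simp
  define J where "J = {h * f + g | h g. h \<in> A \<and> g \<in> m}"
  have JI: "h * f + g \<in> J" if "h \<in> A" "g \<in> m" for h g using that by (auto simp: J_def)
  have mA: "m \<subseteq> A" by (rule is_ideal_subset[OF mI])
  have J: "is_ideal A J" unfolding is_ideal_def
  proof (intro conjI ballI)
    show "J \<subseteq> A" using f mA by (auto simp: J_def intro!: sub_add[OF A] sub_mult[OF A])
    show "0 \<in> J" using JI[OF sub_0[OF A] is_ideal_0[OF mI]] by simp
    fix u assume "u \<in> J"
    then obtain h g where u: "u = h * f + g" "h \<in> A" "g \<in> m" by (auto simp: J_def)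
    show "v * u \<in> J" if "v \<in> A" for v
      using JI[OF sub_mult[OF A that u(2)] is_ideal_mult[OF mI u(3) that]]
      by (simp add: u(1) algebra_simps)
    show "u + v \<in> J" if v: "v \<in> J" for v
    proof -
      obtain h' g' where v: "v = h' * f + g'" "h' \<in> A" "g' \<in> m" using v by (auto simp: J_def)
      show ?thesis using JI[OF sub_add[OF A u(2) v(2)] is_ideal_add[OF mI u(3) v(3)]]
        by (simp add: u(1) v(1) algebra_simps)
    qed
  qed
  have "m \<subseteq> J" using JI[OF sub_0[OF A]] by auto
  moreover have fJ: "f \<in> J" using JI[OF sub_1[OF A] is_ideal_0[OF mI]] by simp
  ultimately have "J = m \<or> J = A"
    using m.I_maximal[of J] J ideal_ring_on[OF A] is_ideal_subset[OF J] by simp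
  hence "J = A" using fJ f(2) by auto
  hence "1 \<in> J" using sub_1[OF A] by simp
  then obtain h g where hg: "1 = h * f + g" "h \<in> A" "g \<in> m" unfolding J_def by blast
  hence "h * f - 1 = - g" by (simp add: algebra_simps)
  hence "h * f - 1 \<in> m" using is_ideal_uminus[OF A mI hg(3)] by simp
  thus ?thesis using hg(2) by blast
qed

lemma max_spec_prime: assumes A: "subalg A" and m: "m \<in> max_spec A" shows "is_prime A m"
proof -
  interpret m: maximalideal m "ring_on A" using m by (simp add: max_spec_def)
  have mI: "is_ideal A m" using m.is_ideal ideal_ring_on[OF A] by simp
  have mA: "m \<subseteq> A" using mI by (simp add: is_ideal_def)
  have "1 \<notin> m" using m.I_notcarr is_ideal_1[OF A mI] by simp
  moreover have "g \<in> m" if fg: "f \<in> A" "g \<in> A" "f * g \<in> m" "f \<notin> m" for f g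
  proof -
    obtain h where h: "h \<in> A" "h * f - 1 \<in> m" using max_spec_inverse[OF A m fg(1,4)] by blast
    have "h * (f * g) - g * (h * f - 1) \<in> m"
      by (rule is_ideal_diff[OF A mI is_ideal_mult[OF mI fg(3) h(1)] is_ideal_mult[OF mI h(2) fg(2)]])
    thus "g \<in> m" by (simp add: algebra_simps)
  qed
  ultimately show ?thesis using mI unfolding is_prime_def by blast
qed

text \<open>The algebra has countable dimension, but if \<open>f\<close> had no value at \<open>m\<close> then the
  uncountably many inverses of \<open>f - \<iota> c\<close> modulo \<open>m\<close> would be linearly independent.\<close>

lemma nullstellensatz:
  assumes fg: "finitely_generated_algebra \<iota> A" and m: "m \<in> max_spec A" and f: "f \<in> A"
  shows "\<exists>c. f - \<iota> c \<in> m"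
proof (rule ccontr)
  assume no: "\<nexists>c. f - \<iota> c \<in> m"
  obtain S where S: "finite S" "A = alg S" using fg by (auto simp: finitely_generated_algebra_def)
  have A: "subalg A" unfolding S by (rule subalg_generated)
  have P: "is_prime A m" by (rule max_spec_prime[OF A m])
  hence mI: "is_ideal A m" by (simp add: is_prime_def)
  have fc: "f - \<iota> c \<in> A" for c by (intro sub_diff[OF A] sub_const[OF A] f)
  have "\<forall>c. \<exists>h. h \<in> A \<and> h * (f - \<iota> c) - 1 \<in> m" using max_spec_inverse[OF A m fc] no by blast
  then obtain h where h: "\<And>c. h c \<in> A" "\<And>c. h c * (f - \<iota> c) - 1 \<in> m" by metis
  have "\<forall>c. \<exists>k. h c \<in> V.span (mons S k)" using generated_algebra_mons h(1) S(2) by blast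
  hence "(UNIV :: complex set) = (\<Union>k. {c. h c \<in> V.span (mons S k)})" by auto
  hence "\<exists>k. infinite {c. h c \<in> V.span (mons S k)}"
    using uncountable_UNIV_complex by (metis countable_UN countable_finite countableI_type)
  then obtain k where "infinite {c. h c \<in> V.span (mons S k)}" ..
  then obtain C where C: "C \<subseteq> {c. h c \<in> V.span (mons S k)}" "finite C" "card C = Suc (card (mons S k))"
    using infinite_arbitrarily_large by blast
  have inj: "inj_on h C"
  proof (rule inj_onI, rule ccontr)
    fix c d assume cd: "h c = h d" "c \<noteq> d"
    have "(h c * (f - \<iota> c) - 1) - (h d * (f - \<iota> d) - 1) \<in> m" by (rule is_ideal_diff[OF A mI h(2) h(2)])
    hence "h c * \<iota> (d - c) \<in> m" unfolding cd(1) by (simp add: \<iota>.hom_minus algebra_simps)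
    moreover have "\<iota> (inverse (d - c)) * (f - \<iota> c) \<in> A" by (intro sub_mult[OF A] sub_const[OF A] fc)
    ultimately have "(\<iota> (inverse (d - c)) * (f - \<iota> c)) * (h c * \<iota> (d - c)) \<in> m"
      using mI by (auto simp: is_ideal_def)
    also have "(\<iota> (inverse (d - c)) * (f - \<iota> c)) * (h c * \<iota> (d - c)) =
        \<iota> (inverse (d - c) * (d - c)) * (h c * (f - \<iota> c))" unfolding \<iota>_mult by (simp only: ac_simps)
    also have "inverse (d - c) * (d - c) = 1" using cd(2) by simp
    finally have "h c * (f - \<iota> c) \<in> m" by simp
    from is_ideal_diff[OF A mI this h(2)[of c]] have "1 \<in> m" by simp
    thus False using P by (simp add: is_prime_def)
  qed
  have "V.dependent (h ` C)"
  proof (rule ccontr)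
    assume "\<not> V.dependent (h ` C)"
    hence "V.independent (h ` C)" by simp
    hence "card (h ` C) \<le> card (mons S k)"
      using V.independent_span_bound[OF finite_mons[OF S(1)], of "h ` C" k] C(1) by auto
    thus False using C(3) card_image[OF inj] by simp
  qed
  then obtain u v where u: "(\<Sum>w\<in>h ` C. \<iota> (u w) * w) = 0" "v \<in> h ` C" "u v \<noteq> 0"
    using V.dependent_finite[of "h ` C"] C(2) by auto
  \<comment> \<open>Modulo \<open>m\<close>, \<open>h c\<close> is the inverse of
    \<open>f - \<iota> c\<close>. Multiplying the relation by all these factors turns it into the
    value of \<open>q\<close> at \<open>f\<close>. At \<open>c0\<close> all summands of
    \<open>q\<close> but one vanish, so \<open>q\<close> is not zero.\<close>
  define q where "q = (\<Sum>c\<in>C. Polynomial.smult (u (h c)) (\<Prod>d\<in>C - {c}. [:- d, 1:]))"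
  obtain c0 where c0: "c0 \<in> C" "v = h c0" using u(2) by blast
  have "poly q c0 = (\<Sum>c\<in>C. if c = c0 then u v * (\<Prod>d\<in>C - {c0}. c0 - d) else 0)" unfolding q_def poly_sum
  proof (intro sum.cong refl)
    fix c assume "c \<in> C"
    show "poly (Polynomial.smult (u (h c)) (\<Prod>d\<in>C - {c}. [:- d, 1:])) c0 =
        (if c = c0 then u v * (\<Prod>d\<in>C - {c0}. c0 - d) else 0)" using c0 C(2) by (auto simp: poly_prod)
  qed
  also have "\<dots> \<noteq> 0" using c0 C(2) u(3) by simp
  finally have q_nz: "q \<noteq> 0" by auto
  have ev_sum: "poly (map_poly \<iota> (sum g K)) f = (\<Sum>i\<in>K. poly (map_poly \<iota> (g i)) f)" for g and K :: "complex set"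
    by (induction K rule: infinite_finite_induct) (auto simp: map_poly_\<iota>_add)
  have ev_prod: "poly (map_poly \<iota> (\<Prod>d\<in>K. [:- d, 1:])) f = (\<Prod>d\<in>K. f - \<iota> d)" for K :: "complex set"
    by (induction K rule: infinite_finite_induct)
      (auto simp: poly_\<iota>_linear_mult map_poly_1' simp del: mult_pCons_left)
  have "poly (map_poly \<iota> q) f = (\<Sum>c\<in>C. \<iota> (u (h c)) * (\<Prod>d\<in>C - {c}. f - \<iota> d))"
    by (simp add: q_def ev_sum map_poly_\<iota>_smult ev_prod)
  also have "\<dots> = - (\<Sum>c\<in>C. (\<iota> (u (h c)) * (\<Prod>d\<in>C - {c}. f - \<iota> d)) * (h c * (f - \<iota> c) - 1))"
  proof -
    have "(\<Sum>c\<in>C. (\<iota> (u (h c)) * (\<Prod>d\<in>C - {c}. f - \<iota> d)) * (h c * (f - \<iota> c) - 1)) =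
      (\<Sum>c\<in>C. (\<Prod>d\<in>C. f - \<iota> d) * (\<iota> (u (h c)) * h c) - \<iota> (u (h c)) * (\<Prod>d\<in>C - {c}. f - \<iota> d))"
    proof (intro sum.cong refl)
      fix c assume c: "c \<in> C"
      show "(\<iota> (u (h c)) * (\<Prod>d\<in>C - {c}. f - \<iota> d)) * (h c * (f - \<iota> c) - 1) =
        (\<Prod>d\<in>C. f - \<iota> d) * (\<iota> (u (h c)) * h c) - \<iota> (u (h c)) * (\<Prod>d\<in>C - {c}. f - \<iota> d)"
        unfolding prod.remove[OF C(2) c] by (simp add: algebra_simps)
    qed
    also have "\<dots> = (\<Prod>d\<in>C. f - \<iota> d) * (\<Sum>w\<in>h ` C. \<iota> (u w) * w) -
        (\<Sum>c\<in>C. \<iota> (u (h c)) * (\<Prod>d\<in>C - {c}. f - \<iota> d))"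
      by (simp add: sum_subtractf sum_distrib_left sum.reindex[OF inj])
    finally show ?thesis using u(1) by simp
  qed
  also have "\<dots> \<in> m" using mI h(2) by (intro is_ideal_uminus[OF A mI] is_ideal_sum[OF mI])
      (auto simp: is_ideal_def intro!: sub_mult[OF A] sub_prod[OF A] sub_const[OF A] fc)
  finally show False using prime_poly_root[OF A P f q_nz] no by blast
qed

lemma
  assumes fg: "finitely_generated_algebra \<iota> A" and m: "m \<in> max_spec A"
  shows point_value_at: "point A (value_at \<iota> m)"
    and kernel_value_at: "kernel A (value_at \<iota> m) = m"
proof -
  obtain S where S: "A = alg S" using fg by (auto simp: finitely_generated_algebra_def)
  have A: "subalg A" unfolding S by (rule subalg_generated)
  have P: "is_prime A m" by (rule max_spec_prime[OF A m])
  hence mI: "is_ideal A m" by (simp add: is_prime_def)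
  have uniq: "c = d" if "f - \<iota> c \<in> m" "f - \<iota> d \<in> m" for c d f
  proof (rule ccontr)
    assume "c \<noteq> d"
    have "(f - \<iota> c) - (f - \<iota> d) \<in> m" by (rule is_ideal_diff[OF A mI that])
    hence "\<iota> (d - c) \<in> m" by (simp add: \<iota>.hom_minus)
    hence "\<iota> (inverse (d - c)) * \<iota> (d - c) \<in> m" using mI sub_const[OF A] by (auto simp: is_ideal_def)
    hence "1 \<in> m" using \<open>c \<noteq> d\<close> by (simp flip: \<iota>_mult)
    thus False using P by (simp add: is_prime_def)
  qed
  have val: "value_at \<iota> m f = c" if "f - \<iota> c \<in> m" for f c
    unfolding value_at_def using that uniq by (intro the_equality) auto
  have val': "f - \<iota> (value_at \<iota> m f) \<in> m" if "f \<in> A" for f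
    using nullstellensatz[OF fg m that] val by metis
  have m0: "0 \<in> m" using mI by (simp add: is_ideal_def)
  show "point A (value_at \<iota> m)" unfolding point_def
  proof (intro conjI allI ballI)
    show "value_at \<iota> m (\<iota> c) = c" for c using m0 by (intro val) simp
    fix f g assume fg: "f \<in> A" "g \<in> A"
    let ?c = "value_at \<iota> m f" and ?d = "value_at \<iota> m g"
    have "(f - \<iota> ?c) + (g - \<iota> ?d) \<in> m" using val' fg mI by (auto simp: is_ideal_def)
    thus "value_at \<iota> m (f + g) = ?c + ?d" by (intro val) (simp add: \<iota>_add algebra_simps)
    have "g * (f - \<iota> ?c) + \<iota> ?c * (g - \<iota> ?d) \<in> m"
      using val' fg mI sub_const[OF A] by (auto simp: is_ideal_def)
    thus "value_at \<iota> m (f * g) = ?c * ?d" by (intro val) (simp add: \<iota>_mult algebra_simps)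
  qed
  have "f \<in> m \<longleftrightarrow> value_at \<iota> m f = 0" if "f \<in> A" for f using val[of f 0] val'[OF that] by auto
  moreover have "m \<subseteq> A" using mI by (simp add: is_ideal_def)
  ultimately show "kernel A (value_at \<iota> m) = m" by (auto simp: kernel_def)
qed

end

section \<open>Krull dimension\<close>

context complex_algebra
begin

lemma span_times:
  assumes "g \<in> V.span B" shows "g * h \<in> V.span ((\<lambda>p. p * h) ` B)" using assms
proof (induction rule: V.span_induct_alt)
  case base thus ?case by (simp add: V.span_zero)
next
  case (step c u v)
  have "(\<iota> c * u + v) * h = \<iota> c * (u * h) + v * h" by (simp add: algebra_simps)
  moreover have "u * h \<in> V.span ((\<lambda>p. p * h) ` B)" by (intro V.span_base imageI step(1))
  ultimately show ?case using step(2) by (auto intro!: V.span_add V.span_scale)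
qed

end

context laurent_field
begin

definition box :: "nat \<Rightarrow> 'f set" where
  "box K = lmon N x ` ({1..N} \<rightarrow>\<^sub>E {0..int K})"

lemma finite_box: "finite (box K)" and card_box: "card (box K) \<le> (K + 1) ^ N"
proof -
  have fin: "finite ({1..N} \<rightarrow>\<^sub>E {0..int K})" by (intro finite_PiE) auto
  thus "finite (box K)" unfolding box_def by simp
  have "card (box K) \<le> card ({1..N} \<rightarrow>\<^sub>E {0..int K})" unfolding box_def by (intro card_image_le fin)
  also have "\<dots> = (K + 1) ^ N" by (simp add: card_PiE nat_add_distrib)
  finally show "card (box K) \<le> (K + 1) ^ N" .
qed

lemma boxI: "(\<And>i. i \<in> {1..N} \<Longrightarrow> 0 \<le> a i \<and> a i \<le> int K) \<Longrightarrow> lmon N x a \<in> box K"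
  unfolding box_def by (rule image_eqI[of _ _ "restrict a {1..N}"]) auto

lemma box_mult: assumes "p \<in> box J" "q \<in> box K" shows "p * q \<in> box (J + K)"
proof -
  obtain a c where a: "a \<in> {1..N} \<rightarrow>\<^sub>E {0..int J}" "p = lmon N x a"
    and c: "c \<in> {1..N} \<rightarrow>\<^sub>E {0..int K}" "q = lmon N x c" using assms unfolding box_def by blast
  have "lmon N x (\<lambda>i. a i + c i) \<in> box (J + K)" using a(1) c(1) by (intro boxI) (force simp: PiE_iff)
  thus ?thesis using a c by (simp add: lmon_add')
qed

lemma box_mono: assumes "J \<le> K" shows "box J \<subseteq> box K"
  unfolding box_def using assms by (intro image_mono PiE_mono) auto

lemma span_box_mult: "f \<in> V.span (box J) \<Longrightarrow> g \<in> V.span (box K) \<Longrightarrow> f * g \<in> V.span (box (J + K))"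
  by (erule span_mult, assumption) (auto intro: V.span_base box_mult)

lemma span_box_mono: "J \<le> K \<Longrightarrow> V.span (box J) \<subseteq> V.span (box K)" by (intro V.span_mono box_mono)

lemma one_box: "1 \<in> box K" using boxI[of "\<lambda>_. 0" K] by simp

lemma span_box_power: "f \<in> V.span (box K) \<Longrightarrow> f ^ n \<in> V.span (box (n * K))"
proof (induction n)
  case 0 thus ?case using one_box[of 0] by (simp add: V.span_base)
next
  case (Suc n) thus ?case using span_box_mult[of f K "f ^ n" "n * K"] by simp
qed

lemma span_box_prod:
  assumes "finite I" "\<And>i. i \<in> I \<Longrightarrow> h i \<in> V.span (box K)"
  shows "prod h I \<in> V.span (box (card I * K))" using assms
proof (induction I rule: finite_induct)
  case empty thus ?case using one_box[of 0] by (simp add: V.span_base)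
next
  case (insert i I)
  thus ?case using span_box_mult[of "h i" K "prod h I" "card I * K"] by simp
qed

lemma generated_box: "f \<in> alg (x ` {1..N}) \<Longrightarrow> \<exists>K. f \<in> V.span (box K)"
proof (induction rule: generated_algebra.induct)
  case (scalar c)
  have "\<iota> c * 1 \<in> V.span (box 0)" by (intro V.span_scale V.span_base one_box)
  thus ?case by auto
next
  case (gen s)
  then obtain i where i: "i \<in> {1..N}" "s = x i" by blast
  have "lmon N x (unit_vec i) \<in> box 1" by (intro boxI) auto
  thus ?case using i lmon_single[OF i(1), of x 1] by (auto intro: V.span_base)
next
  case (add f g)
  then obtain J K where "f \<in> V.span (box J)" "g \<in> V.span (box K)" by blast
  hence "f \<in> V.span (box (max J K))" "g \<in> V.span (box (max J K))"
    using span_box_mono[of J "max J K"] span_box_mono[of K "max J K"] by auto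
  thus ?case by (blast intro: V.span_add)
next
  case (mult f g)
  thus ?case using span_box_mult by blast
qed

text \<open>There are \<open>(D + 1) ^ (N + 1)\<close> monomials of degree at most \<open>D\<close> in each of the \<open>N + 1\<close> elements,
  and they lie in a space whose dimension grows like \<open>D ^ N\<close>.\<close>

lemma algebraically_dependent:
  shows "\<not> algebraically_independent \<iota> (Suc N) y"
proof
  assume "algebraically_independent \<iota> (Suc N) y"
  then interpret Y: laurent \<iota> "Suc N" y by unfold_locales
  let ?P = "alg (x ` {1..N})"
  have P: "subalg ?P" by (rule subalg_generated)
  have "\<forall>f. \<exists>p q. p \<in> ?P \<and> q \<in> ?P \<and> q \<noteq> 0 \<and> f = p / q" using fraction by blast
  then obtain nu de where nd: "\<And>f. nu f \<in> ?P" "\<And>f. de f \<in> ?P" "\<And>f. de f \<noteq> 0" "\<And>f. f = nu f / de f"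
    by metis
  define q where "q = (\<Prod>i=1..Suc N. de (y i))"
  have q: "q \<in> ?P" "q \<noteq> 0"
  proof -
    show "q \<in> ?P" unfolding q_def by (intro sub_prod[OF P] nd)
    show "q \<noteq> 0" unfolding q_def prod_zero_iff[OF finite_atLeastAtMost] using nd(3) by blast
  qed
  define p where "p i = y i * q" for i
  have p: "p i \<in> ?P" if i: "i \<in> {1..Suc N}" for i
  proof -
    have "p i = nu (y i) * (\<Prod>j\<in>{1..Suc N} - {i}. de (y j))"
      unfolding p_def q_def prod.remove[OF finite_atLeastAtMost i] using nd(3,4)[of "y i"] by (simp add: field_simps)
    also have "\<dots> \<in> ?P" by (intro sub_mult[OF P] sub_prod[OF P] nd)
    finally show ?thesis .
  qed
  have "\<exists>K. q \<in> V.span (box K) \<and> (\<forall>i\<in>{1..Suc N}. p i \<in> V.span (box K))"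
  proof -
    obtain K0 where K0: "q \<in> V.span (box K0)" using generated_box[OF q(1)] by blast
    have "\<forall>i. \<exists>K. i \<in> {1..Suc N} \<longrightarrow> p i \<in> V.span (box K)" using generated_box p by blast
    then obtain Kf where Kf: "\<And>i. i \<in> {1..Suc N} \<Longrightarrow> p i \<in> V.span (box (Kf i))" by metis
    define K where "K = Max (insert K0 (Kf ` {1..Suc N}))"
    have "K0 \<le> K" unfolding K_def by (rule Max_ge) auto
    moreover have "Kf i \<le> K" if "i \<in> {1..Suc N}" for i
      unfolding K_def by (rule Max_ge) (use that in blast)+
    ultimately show ?thesis using K0 Kf span_box_mono by blast
  qed
  then obtain K where K: "q \<in> V.span (box K)" "\<And>i. i \<in> {1..Suc N} \<Longrightarrow> p i \<in> V.span (box K)" by blast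
  \<comment> \<open>After multiplication by \<open>q ^ E\<close>, a monomial with exponents up to
    \<open>D\<close> in the \<open>y i\<close> lies in the span of \<open>box (K' * D)\<close>.
    Taking \<open>K' ^ N\<close> for \<open>D\<close> makes the dimension bound
    \<open>(K' * (D + 1)) ^ N\<close> equal to \<open>D * (D + 1) ^ N\<close>, below the number of
    monomials.\<close>
  define K' where "K' = Suc N * Suc K"
  define D where "D = K' ^ N"
  define E where "E = D * Suc N"
  have K': "K' \<ge> 1" by (simp add: K'_def)
  define W where "W = lmon (Suc N) y ` ({1..Suc N} \<rightarrow>\<^sub>E {0..int D})"
  define T where "T = (\<lambda>h. h * inverse (q ^ E)) ` box (K' * D)"
  have "card W = (D + 1) ^ Suc N"
  proof -
    have "inj_on (lmon (Suc N) y) ({1..Suc N} \<rightarrow>\<^sub>E {0..int D})"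
      by (rule inj_on_subset[OF Y.inj_lmon]) (intro PiE_mono, auto)
    hence "card W = card ({1..Suc N} \<rightarrow>\<^sub>E {0..int D})" unfolding W_def by (rule card_image)
    also have "\<dots> = card {0..int D} ^ card {1..Suc N}" by (subst card_PiE) (simp_all only: finite_atLeastAtMost prod_constant)
    finally show ?thesis by (simp add: nat_add_distrib)
  qed
  moreover have "V.independent W"
    unfolding W_def by (rule V.independent_mono[OF Y.independent_lmon]) (auto intro!: image_mono PiE_mono)
  moreover have "W \<subseteq> V.span T"
  proof
    fix w assume "w \<in> W"
    then obtain a where a: "a \<in> {1..Suc N} \<rightarrow>\<^sub>E {0..int D}" "w = lmon (Suc N) y a" unfolding W_def by blast
    have "w * q ^ E = (\<Prod>i=1..Suc N. p i ^ nat (a i) * q ^ (D - nat (a i)))"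
    proof -
      have "w * q ^ E = (\<Prod>i=1..Suc N. y i powi a i * q ^ D)"
      proof -
        have "(\<Prod>i=1..Suc N. q ^ D) = q ^ E" unfolding prod_constant by (simp add: E_def power_mult power_add mult.commute)
        thus ?thesis unfolding a(2) lmon_def prod.distrib by simp
      qed
      also have "\<dots> = (\<Prod>i=1..Suc N. p i ^ nat (a i) * q ^ (D - nat (a i)))"
      proof (intro prod.cong refl)
        fix i assume "i \<in> {1..Suc N}"
        hence ai: "0 \<le> a i" "a i \<le> int D" using a(1) by (auto simp: PiE_iff)
        hence "q ^ D = q ^ nat (a i) * q ^ (D - nat (a i))" by (simp flip: power_add)
        thus "y i powi a i * q ^ D = p i ^ nat (a i) * q ^ (D - nat (a i))"
          using ai by (simp add: power_int_def p_def power_mult_distrib)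
      qed
      finally show ?thesis .
    qed
    also have "\<dots> \<in> V.span (box (card {1..Suc N} * (D * K)))"
    proof (rule span_box_prod)
      fix i assume i: "i \<in> {1..Suc N}"
      hence ai: "0 \<le> a i" "a i \<le> int D" using a(1) by (auto simp: PiE_iff)
      hence e: "nat (a i) * K + (D - nat (a i)) * K = D * K" by (simp flip: add_mult_distrib)
      show "p i ^ nat (a i) * q ^ (D - nat (a i)) \<in> V.span (box (D * K))"
        using span_box_mult[OF span_box_power[OF K(2)[OF i], of "nat (a i)"] span_box_power[OF K(1), of "D - nat (a i)"]]
        unfolding e .
    qed simp
    also have "V.span (box (card {1..Suc N} * (D * K))) \<subseteq> V.span (box (K' * D))"
      by (intro span_box_mono) (simp add: K'_def algebra_simps)
    finally have "w * q ^ E * inverse (q ^ E) \<in> V.span T" unfolding T_def by (rule span_times)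
    moreover have "w * q ^ E * inverse (q ^ E) = w" using q(2) by simp
    ultimately show "w \<in> V.span T" by (simp only:)
  qed
  moreover have "finite T" unfolding T_def using finite_box by simp
  ultimately have "(D + 1) ^ Suc N \<le> card T" using V.independent_span_bound by metis
  also have "\<dots> \<le> card (box (K' * D))" unfolding T_def by (rule card_image_le[OF finite_box])
  also have "\<dots> \<le> (K' * D + 1) ^ N" by (rule card_box)
  also have "\<dots> \<le> (K' * (D + 1)) ^ N" using K' by (intro power_mono) auto
  also have "\<dots> = D * (D + 1) ^ N" unfolding power_mult_distrib D_def[symmetric] ..
  also have "\<dots> < (D + 1) ^ Suc N" by simp
  finally show False by simp
qed

end

section \<open>Chains of prime ideals and the transcendence degree\<close>

context complex_algebra
begin

lemma is_prime_power: assumes "subalg A" "is_prime A P" "f \<in> A" "f \<notin> P" shows "f ^ n \<notin> P"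
proof (induction n)
  case 0 thus ?case using assms(2) by (simp add: is_prime_def)
next
  case (Suc n) thus ?case using assms sub_power[OF assms(1,3), of n] unfolding is_prime_def by auto
qed

text \<open>In a polynomial relation modulo \<open>p j\<close>, cancel the largest power of the next variable, then
  reduce modulo the next prime.\<close>

lemma prime_chain_independent:
  assumes A: "subalg A" and P: "\<And>i. i \<le> d \<Longrightarrow> is_prime A (p i)"
    and sub: "\<And>i. i < d \<Longrightarrow> p i \<subseteq> p (Suc i)"
    and y: "\<And>i. i \<in> {1..d} \<Longrightarrow> y i \<in> p i \<and> y i \<notin> p (i - 1)"
    and j: "j \<le> d"
    and M: "finite M" "M \<subseteq> {Suc j..d} \<rightarrow>\<^sub>E (UNIV :: nat set)" "a0 \<in> M" "c a0 \<noteq> (0 :: complex)"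
  shows "(\<Sum>a\<in>M. \<iota> (c a) * (\<Prod>i\<in>{Suc j..d}. y i ^ a i)) \<notin> p j" using j M
proof (induction "d - j" arbitrary: j M c a0)
  case 0
  hence jd: "j = d" by simp
  hence "M \<subseteq> {\<lambda>_. undefined}" using "0.prems" by auto
  hence M1: "M = {a0}" using "0.prems" by blast
  show ?case
  proof
    assume "(\<Sum>a\<in>M. \<iota> (c a) * (\<Prod>i\<in>{Suc j..d}. y i ^ a i)) \<in> p j"
    hence "\<iota> (c a0) \<in> p d" using jd M1 by simp
    moreover have "is_ideal A (p d)" using P[of d] by (simp add: is_prime_def)
    ultimately have "\<iota> (inverse (c a0)) * \<iota> (c a0) \<in> p d" using is_ideal_mult sub_const[OF A] by blast
    thus False using "0.prems" P[of d] by (simp add: is_prime_def flip: \<iota>_mult)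
  qed
next
  case (Suc e)
  hence jd: "Suc j \<le> d" by simp
  define k where "k = Suc j"
  have k: "k \<in> {1..d}" using jd by (simp add: k_def)
  have yA: "y i \<in> A" if "i \<in> {1..d}" for i
    using y[OF that] P[of i] that by (auto simp: is_prime_def dest: is_ideal_subset)
  define M' where "M' = {a\<in>M. c a \<noteq> 0}"
  define r where "r = Min ((\<lambda>a. a k) ` M')"
  have M': "finite M'" "a0 \<in> M'" "M' \<subseteq> M" using Suc.prems by (auto simp: M'_def)
  have r: "r \<le> a k" if "a \<in> M'" for a unfolding r_def using M' that by (intro Min_le) auto
  have "r \<in> (\<lambda>a. a k) ` M'" unfolding r_def using M' by (intro Min_in) auto
  then obtain a1 where a1: "a1 \<in> M'" "a1 k = r" by blast
  define M1 where "M1 = {a\<in>M'. a k = r}"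
  let ?mon = "\<lambda>a. \<Prod>i\<in>{Suc k..d}. y i ^ a i"
  have split: "(\<Prod>i\<in>{Suc j..d}. y i ^ a i) = y k ^ a k * ?mon a" for a
    using jd by (simp add: k_def prod.atLeast_Suc_atMost)
  define R0 where "R0 = (\<Sum>a\<in>M1. \<iota> (c a) * ?mon a)"
  define R1 where "R1 = (\<Sum>a\<in>M' - M1. \<iota> (c a) * (y k ^ (a k - r - 1) * ?mon a))"
  have monA: "?mon a \<in> A" for a by (intro sub_prod[OF A] sub_power[OF A] yA) (auto simp: k_def)
  have R1A: "R1 \<in> A" and R0A: "R0 \<in> A" unfolding R1_def R0_def
    by (intro sub_sum[OF A] sub_mult[OF A] sub_const[OF A] monA sub_power[OF A] yA k)+
  have "(\<Sum>a\<in>M. \<iota> (c a) * (\<Prod>i\<in>{Suc j..d}. y i ^ a i)) = (\<Sum>a\<in>M'. \<iota> (c a) * (y k ^ a k * ?mon a))"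
    unfolding split using Suc.prems by (intro sum.mono_neutral_right) (auto simp: M'_def)
  also have "\<dots> = (\<Sum>a\<in>M1. \<iota> (c a) * (y k ^ a k * ?mon a)) + (\<Sum>a\<in>M' - M1. \<iota> (c a) * (y k ^ a k * ?mon a))"
    using M'(1) by (subst sum.subset_diff[of M1]) (auto simp: M1_def add.commute)
  also have "(\<Sum>a\<in>M1. \<iota> (c a) * (y k ^ a k * ?mon a)) = y k ^ r * R0"
    unfolding R0_def sum_distrib_left by (intro sum.cong) (auto simp: M1_def)
  also have "(\<Sum>a\<in>M' - M1. \<iota> (c a) * (y k ^ a k * ?mon a)) = y k ^ r * (y k * R1)"
    unfolding R1_def sum_distrib_left
  proof (intro sum.cong refl)
    fix a assume a: "a \<in> M' - M1"
    hence "a k = r + Suc (a k - r - 1)" using r[of a] by (auto simp: M1_def)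
    hence "y k ^ a k = y k ^ r * (y k * y k ^ (a k - r - 1))" by (metis power_add power_Suc)
    thus "\<iota> (c a) * (y k ^ a k * ?mon a) = y k ^ r * (y k * (\<iota> (c a) * (y k ^ (a k - r - 1) * ?mon a)))"
      by (simp only: ac_simps)
  qed
  finally have eq: "(\<Sum>a\<in>M. \<iota> (c a) * (\<Prod>i\<in>{Suc j..d}. y i ^ a i)) = y k ^ r * (R0 + y k * R1)"
    by (simp only: distrib_left)
  have R0: "R0 \<notin> p k"
  proof -
    define g where "g a = restrict a {Suc k..d}" for a :: "nat \<Rightarrow> nat"
    have inj: "inj_on g M1"
    proof (rule inj_onI)
      fix a a' assume aa: "a \<in> M1" "a' \<in> M1" "g a = g a'"
      have PE: "a \<in> {Suc j..d} \<rightarrow>\<^sub>E UNIV" "a' \<in> {Suc j..d} \<rightarrow>\<^sub>E UNIV"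
        using aa M'(3) Suc.prems(3) by (auto simp: M1_def)
      have "a i = a' i" if "i \<in> {Suc j..d}" for i
      proof (cases "i = k")
        case True thus ?thesis using aa by (simp add: M1_def)
      next
        case False
        hence "i \<in> {Suc k..d}" using that by (auto simp: k_def)
        thus ?thesis using fun_cong[OF aa(3), of i] by (simp add: g_def)
      qed
      thus "a = a'" by (rule PiE_ext[OF PE])
    qed
    define c' where "c' a = c (inv_into M1 g a)" for a
    have "(\<Sum>a\<in>g ` M1. \<iota> (c' a) * ?mon a) = (\<Sum>a\<in>M1. \<iota> (c a) * ?mon (g a))"
      using inj by (simp add: sum.reindex c'_def)
    also have "\<dots> = R0" unfolding R0_def
    proof (intro sum.cong refl)
      fix a
      have "?mon (g a) = ?mon a" by (intro prod.cong) (auto simp: g_def)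
      thus "\<iota> (c a) * ?mon (g a) = \<iota> (c a) * ?mon a" by simp
    qed
    finally have e: "(\<Sum>a\<in>g ` M1. \<iota> (c' a) * ?mon a) = R0" .
    have a1': "a1 \<in> M1" using a1 by (simp add: M1_def)
    have "(\<Sum>a\<in>g ` M1. \<iota> (c' a) * ?mon a) \<notin> p k"
    proof (rule Suc.hyps(1)[of k "g ` M1" "g a1" c'])
      show "e = d - k" "k \<le> d" using Suc.hyps(2) jd by (auto simp: k_def)
      show "finite (g ` M1)" using M' by (simp add: M1_def)
      show "g ` M1 \<subseteq> {Suc k..d} \<rightarrow>\<^sub>E UNIV" by (auto simp: g_def)
      show "g a1 \<in> g ` M1" using a1' by blast
      show "c' (g a1) \<noteq> 0" using a1' inj a1 by (simp add: c'_def M'_def)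
    qed
    thus ?thesis unfolding e .
  qed
  show ?case
  proof
    assume "(\<Sum>a\<in>M. \<iota> (c a) * (\<Prod>i\<in>{Suc j..d}. y i ^ a i)) \<in> p j"
    hence "y k ^ r * (R0 + y k * R1) \<in> p j" unfolding eq .
    moreover have Pj: "is_prime A (p j)" and Pk: "is_prime A (p k)" using P jd by (auto simp: k_def)
    moreover have "y k ^ r \<notin> p j" using is_prime_power[OF A Pj yA[OF k]] y[OF k] by (simp add: k_def)
    moreover have "y k ^ r \<in> A" "R0 + y k * R1 \<in> A"
      by (intro sub_add[OF A] sub_mult[OF A] sub_power[OF A] yA k R0A R1A)+
    ultimately have "R0 + y k * R1 \<in> p j" unfolding is_prime_def by blast
    hence 1: "R0 + y k * R1 \<in> p k" using sub[of j] jd by (auto simp: k_def)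
    have Ik: "is_ideal A (p k)" using Pk by (simp add: is_prime_def)
    have "R1 * y k \<in> p k" using is_ideal_mult[OF Ik _ R1A] y[OF k] by blast
    from is_ideal_diff[OF A Ik 1 this] have "R0 \<in> p k" by (simp add: mult.commute)
    thus False using R0 by blast
  qed
qed

text \<open>Elements chosen in the differences of \<open>N + 1\<close> successive members of the
  chain would be algebraically independent: a relation would put a combination of their monomials
  into the smallest prime.\<close>

lemma (in laurent_field) prime_chain_length:
  assumes A: "subalg A" and P: "\<And>i. i \<le> d \<Longrightarrow> is_prime A (p i)"
    and sub: "\<And>i. i < d \<Longrightarrow> p i \<subset> p (Suc i)"
  shows "d \<le> N"
proof (rule ccontr)
  assume "\<not> d \<le> N"
  hence dN: "Suc N \<le> d" by simp
  have "\<forall>i. \<exists>y. i \<in> {1..Suc N} \<longrightarrow> y \<in> p i \<and> y \<notin> p (i - 1)"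
  proof (intro allI)
    fix i
    show "\<exists>y. i \<in> {1..Suc N} \<longrightarrow> y \<in> p i \<and> y \<notin> p (i - 1)"
    proof (cases "i \<in> {1..Suc N}")
      case True
      hence "p (i - 1) \<subset> p i" using sub[of "i - 1"] dN by (cases i) auto
      thus ?thesis by blast
    qed blast
  qed
  then obtain y where y: "\<And>i. i \<in> {1..Suc N} \<Longrightarrow> y i \<in> p i \<and> y i \<notin> p (i - 1)" by metis
  have "algebraically_independent \<iota> (Suc N) y" unfolding algebraically_independent_def
  proof (intro allI impI ballI, elim conjE, rule ccontr)
    fix M c a assume M: "finite M" "M \<subseteq> {1..Suc N} \<rightarrow>\<^sub>E (UNIV :: nat set)" "a \<in> M" "c a \<noteq> (0::complex)"
      and 0: "(\<Sum>a\<in>M. \<iota> (c a) * (\<Prod>i = 1..Suc N. y i ^ a i)) = 0"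
    have "(\<Sum>a\<in>M. \<iota> (c a) * (\<Prod>i\<in>{Suc 0..Suc N}. y i ^ a i)) \<notin> p 0"
    proof (rule prime_chain_independent[OF A, where p = p and d = "Suc N"])
      show "M \<subseteq> {Suc 0..Suc N} \<rightarrow>\<^sub>E UNIV" using M(2) by simp
      show "p i \<subseteq> p (Suc i)" if "i < Suc N" for i using sub[of i] dN that by auto
    qed (use M P dN y in auto)
    moreover have "0 \<in> p 0" by (rule is_ideal_0[of A]) (use P[of 0] in \<open>simp add: is_prime_def\<close>)
    ultimately show False using 0 by simp
  qed
  thus False using algebraically_dependent by blast
qed

end

section \<open>Exponentials of derivations\<close>

context complex_algebra
begin

text \<open>The coefficients of the formal exponential exp(tD).\<close>

definition dpow :: "('f \<Rightarrow> 'f) \<Rightarrow> nat \<Rightarrow> 'f \<Rightarrow> 'f" where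
  "dpow D n f = (D ^^ n) f / of_nat (fact n)"

context
  fixes D assumes D: "derivation D"
begin

lemma funpow_add: "(D ^^ n) (f + g) = (D ^^ n) f + (D ^^ n) g"
  by (induction n) (auto simp: der_add[OF D])

lemma dpow_0 [simp]: "dpow D 0 f = f" by (simp add: dpow_def)

lemma dpow_Suc: "of_nat (Suc n) * dpow D (Suc n) f = dpow D n (D f)"
proof -
  have "(D ^^ n) (D f) = (D ^^ Suc n) f" by (simp only: funpow_Suc_right comp_def)
  moreover have "(of_nat (Suc n) :: 'f) \<noteq> 0" "(of_nat (fact n) :: 'f) \<noteq> 0"
    by (simp_all only: of_nat_eq_0_F) simp_all
  moreover have "(of_nat (fact (Suc n)) :: 'f) = of_nat (Suc n) * of_nat (fact n)"
    by (simp only: fact_Suc of_nat_mult of_nat_id)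
  ultimately show ?thesis unfolding dpow_def by (simp del: of_nat_Suc fact_Suc)
qed

lemma dpow_add: "dpow D n (f + g) = dpow D n f + dpow D n g"
  by (simp add: dpow_def funpow_add add_divide_distrib)

lemma dpow_const: "dpow D n (\<iota> c) = (if n = 0 then \<iota> c else 0)"
proof (cases n)
  case (Suc m)
  have "(D ^^ k) 0 = 0" for k by (induction k) (auto simp: der_0[OF D])
  hence "(D ^^ m) (D (\<iota> c)) = 0" by (simp add: der_const[OF D])
  hence "(D ^^ n) (\<iota> c) = 0" unfolding Suc funpow_Suc_right comp_def .
  thus ?thesis using Suc by (simp add: dpow_def)
qed simp

text \<open>The series \<open>T f\<close> is exp(tD) applied to \<open>f\<close>, and its derivative
  is the series of \<open>D f\<close>. Both sides of the product formula have the same constant term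
  and, by induction, the same derivative.\<close>

lemma dpow_mult: "dpow D n (f * g) = (\<Sum>i\<le>n. dpow D i f * dpow D (n - i) g)"
proof -
  define T where "T f = Abs_fps (\<lambda>n. dpow D n f)" for f
  have dT: "fps_deriv (T f) = T (D f)" for f
    by (intro fps_ext) (simp only: T_def fps_deriv_nth fps_nth_Abs_fps Suc_eq_plus1[symmetric] dpow_Suc)
  have T_add: "T (f + g) = T f + T g" for f g by (intro fps_ext) (simp add: T_def dpow_add)
  have "fps_nth (T (f * g)) n = fps_nth (T f * T g) n" for f g
  proof (induction n arbitrary: f g)
    case 0 thus ?case by (simp add: T_def)
  next
    case (Suc n)
    have "of_nat (Suc n) * fps_nth (T (f * g)) (Suc n) = fps_nth (fps_deriv (T (f * g))) n"
      by (simp only: fps_deriv_nth Suc_eq_plus1)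
    also have "\<dots> = fps_nth (T (f * D g)) n + fps_nth (T (g * D f)) n"
      by (simp add: dT der_mult[OF D] T_add)
    also have "\<dots> = fps_nth (T f * T (D g) + T g * T (D f)) n" by (simp add: Suc.IH)
    also have "T f * T (D g) + T g * T (D f) = fps_deriv (T f * T g)" by (simp add: dT mult.commute)
    also have "fps_nth \<dots> n = of_nat (Suc n) * fps_nth (T f * T g) (Suc n)"
      by (simp only: fps_deriv_nth Suc_eq_plus1)
    finally show ?case using of_nat_eq_0_F[of "Suc n"] by (simp only: mult_cancel_left) blast
  qed
  thus ?thesis by (simp add: T_def fps_mult_nth atLeast0AtMost)
qed

end

lemma dpow_in_subalg:
  assumes A: "subalg A" and DA: "\<And>f. f \<in> A \<Longrightarrow> D f \<in> A" and f: "f \<in> A"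
  shows "dpow D n f \<in> A"
proof -
  have "(D ^^ n) f \<in> A" by (induction n) (auto simp: f DA)
  moreover have "dpow D n f = \<iota> (inverse (of_nat (fact n))) * (D ^^ n) f"
    unfolding dpow_def divide_inverse \<iota>.hom_inverse \<iota>.hom_of_nat by (rule mult.commute)
  ultimately show ?thesis by (simp add: sub_mult[OF A] sub_const[OF A])
qed

text \<open>This is the preimage, under the homomorphism exp(tD), of the prime ideal of power series
  with coefficients in \<open>P\<close>. Primality is seen at the first coefficients of
  \<open>f\<close> and \<open>g\<close> outside \<open>P\<close>: their product is the only term of
  the corresponding coefficient of the product that is not in \<open>P\<close>.\<close>

lemma prime_derivation:
  assumes A: "subalg A" and P: "is_prime A P" and D: "derivation D" and DA: "\<And>f. f \<in> A \<Longrightarrow> D f \<in> A"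
  shows "is_prime A {f \<in> A. \<forall>n. dpow D n f \<in> P}"
proof -
  have dA: "dpow D n f \<in> A" if "f \<in> A" for n f by (rule dpow_in_subalg[OF A DA that])
  have I: "is_ideal A P" using P by (simp add: is_prime_def)
  have "f \<in> {f \<in> A. \<forall>n. dpow D n f \<in> P} \<or> g \<in> {f \<in> A. \<forall>n. dpow D n f \<in> P}"
    if fg: "f \<in> A" "g \<in> A" "f * g \<in> {f \<in> A. \<forall>n. dpow D n f \<in> P}" for f g
  proof (rule ccontr)
    assume "\<not> ?thesis"
    hence "\<exists>i. dpow D i f \<notin> P" "\<exists>i. dpow D i g \<notin> P" using fg by auto
    then obtain i j where i: "dpow D i f \<notin> P" "\<And>m. m < i \<Longrightarrow> dpow D m f \<in> P"
      and j: "dpow D j g \<notin> P" "\<And>m. m < j \<Longrightarrow> dpow D m g \<in> P"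
      using exists_least_iff[of "\<lambda>i. dpow D i f \<notin> P"] exists_least_iff[of "\<lambda>i. dpow D i g \<notin> P"] by metis
    have "dpow D (i + j) (f * g) = (\<Sum>m\<le>i + j. dpow D m f * dpow D (i + j - m) g)"
      by (rule dpow_mult[OF D])
    also have "\<dots> = dpow D i f * dpow D j g + (\<Sum>m\<in>{..i + j} - {i}. dpow D m f * dpow D (i + j - m) g)"
      by (subst sum.remove[of _ i]) auto
    finally have e: "dpow D i f * dpow D j g =
       dpow D (i + j) (f * g) - (\<Sum>m\<in>{..i + j} - {i}. dpow D m f * dpow D (i + j - m) g)" by simp
    have "(\<Sum>m\<in>{..i + j} - {i}. dpow D m f * dpow D (i + j - m) g) \<in> P"
    proof (rule is_ideal_sum[OF I])
      fix m assume m: "m \<in> {..i + j} - {i}"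
      show "dpow D m f * dpow D (i + j - m) g \<in> P"
      proof (cases "m < i")
        case True
        thus ?thesis
          using is_ideal_mult[OF I i(2) dA[OF fg(2)], of m "i + j - m"] by (simp add: mult.commute)
      next
        case False
        hence "i + j - m < j" using m by auto
        thus ?thesis using is_ideal_mult[OF I j(2) dA[OF fg(1)]] by blast
      qed
    qed
    hence "dpow D i f * dpow D j g \<in> P" unfolding e using fg(3) by (intro is_ideal_diff[OF A I]) auto
    thus False using i(1) j(1) P dA[OF fg(1)] dA[OF fg(2)] unfolding is_prime_def by blast
  qed
  moreover have "is_ideal A {f \<in> A. \<forall>n. dpow D n f \<in> P}" unfolding is_ideal_def
  proof (intro conjI ballI)
    show "0 \<in> {f \<in> A. \<forall>n. dpow D n f \<in> P}"
      using dpow_const[OF D, of _ 0] is_ideal_0[OF I] sub_0[OF A] by auto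
    fix f assume f: "f \<in> {f \<in> A. \<forall>n. dpow D n f \<in> P}"
    show "f + g \<in> {f \<in> A. \<forall>n. dpow D n f \<in> P}" if "g \<in> {f \<in> A. \<forall>n. dpow D n f \<in> P}" for g
      using f that by (auto simp: dpow_add[OF D] intro: is_ideal_add[OF I] sub_add[OF A])
    show "g * f \<in> {f \<in> A. \<forall>n. dpow D n f \<in> P}" if "g \<in> A" for g
      using f that by (auto simp: dpow_mult[OF D] intro!: is_ideal_sum[OF I] is_ideal_mult[OF I] sub_mult[OF A] dA)
  qed auto
  moreover have "1 \<notin> P" using P by (simp add: is_prime_def)
  hence "1 \<notin> {f \<in> A. \<forall>n. dpow D n f \<in> P}"
    using dpow_0[OF D, of 1] by (metis (mono_tags, lifting) mem_Collect_eq)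
  ultimately show ?thesis unfolding is_prime_def by blast
qed

lemma dpow_in_ideal:
  assumes A: "subalg A" and J: "is_ideal A J" and D: "derivation D" and DJ: "\<And>f. f \<in> J \<Longrightarrow> D f \<in> J"
    and f: "f \<in> J"
  shows "dpow D n f \<in> J"
proof -
  have "(D ^^ n) f \<in> J" using f DJ by (induction n) auto
  moreover have "dpow D n f = \<iota> (inverse (of_nat (fact n))) * (D ^^ n) f"
    unfolding dpow_def divide_inverse \<iota>.hom_inverse \<iota>.hom_of_nat by (rule mult.commute)
  ultimately show ?thesis using is_ideal_mult[OF J _ sub_const[OF A]] by simp
qed

lemma derivation_prime_chain:
  assumes A: "subalg A" and m: "is_prime A m"
    and D: "\<And>i. i < d \<Longrightarrow> derivation (D i)" "\<And>i f. i < d \<Longrightarrow> f \<in> A \<Longrightarrow> D i f \<in> A"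
    and f: "\<And>i. i < d \<Longrightarrow> f i \<in> m" and Df: "\<And>i j. i < d \<Longrightarrow> j < d \<Longrightarrow> D i (f j) = (if i = j then g else 0)"
    and g: "g \<notin> m"
    and J: "is_ideal A J" "J \<subseteq> m" "\<And>i f. i < d \<Longrightarrow> f \<in> J \<Longrightarrow> D i f \<in> J"
  shows "\<exists>p. (\<forall>i\<le>d. is_prime A (p i) \<and> p i \<subseteq> m) \<and> (\<forall>i<d. p i \<subset> p (Suc i)) \<and> J \<subseteq> p 0"
proof -
  define P where "P = rec_nat m (\<lambda>i Q. {f \<in> A. \<forall>n. dpow (D i) n f \<in> Q})"
  have P0: "P 0 = m" and PS: "P (Suc i) = {f \<in> A. \<forall>n. dpow (D i) n f \<in> P i}" for i
    by (simp_all add: P_def)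
  have prime: "is_prime A (P i)" if "i \<le> d" for i using that
  proof (induction i)
    case (Suc i) thus ?case unfolding PS by (intro prime_derivation A D) auto
  qed (simp add: P0 m)
  have sub: "P (Suc i) \<subseteq> P i" if "i < d" for i
    unfolding PS using dpow_0[OF D(1)[OF that]] by (auto dest: spec[of _ 0])
  have Pm: "P i \<subseteq> m" if "i \<le> d" for i using that
  proof (induction i)
    case (Suc i) thus ?case using sub[of i] by auto
  qed (simp add: P0)
  have mA: "m \<subseteq> A" using m is_ideal_subset by (auto simp: is_prime_def)
  have JP: "J \<subseteq> P i" if "i \<le> d" for i using that
  proof (induction i)
    case (Suc i)
    hence "dpow (D i) n f \<in> P i" if "f \<in> J" for f n
      using dpow_in_ideal[OF A J(1) D(1) J(3) that, of i n] by auto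
    thus ?case unfolding PS using is_ideal_subset[OF J(1)] by auto
  qed (use J P0 in simp)
  have in_P: "f k \<in> P i" if "i \<le> k" "k < d" for i k using that
  proof (induction i)
    case (Suc i)
    have fk: "f k \<in> P i" using Suc by simp
    have "dpow (D i) n (f k) \<in> P i" for n
    proof (cases n)
      case 0 thus ?thesis using fk dpow_0[OF D(1), of i] Suc.prems by simp
    next
      case (Suc n')
      have i: "i < d" "D i (f k) = 0" using \<open>Suc i \<le> k\<close> \<open>k < d\<close> Df by auto
      have "dpow (D i) n' (D i (f k)) = 0" using i dpow_const[OF D(1)[OF i(1)], of n' 0] by simp
      hence "of_nat (Suc n') * dpow (D i) n (f k) = 0" using dpow_Suc[OF D(1)[OF i(1)], of n'] Suc by simp
      moreover have "(of_nat (Suc n') :: 'f) \<noteq> 0" using of_nat_eq_0_F[of "Suc n'"] by blast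
      ultimately have "dpow (D i) n (f k) = 0" by (metis mult_eq_0_iff)
      moreover have "is_ideal A (P i)" using prime[of i] i by (simp add: is_prime_def)
      ultimately show ?thesis using is_ideal_0 by metis
    qed
    thus ?case unfolding PS using f Suc.prems mA by auto
  next
    case 0 thus ?case using f P0 by simp
  qed
  have strict: "P (Suc k) \<subset> P k" if k: "k < d" for k
  proof -
    have "f k \<notin> P (Suc k)"
    proof
      assume "f k \<in> P (Suc k)"
      hence "dpow (D k) 1 (f k) \<in> P k" by (simp add: PS)
      moreover have "dpow (D k) 1 (f k) = g" using Df[OF k k] by (simp add: dpow_def)
      ultimately show False using Pm[of k] g k by auto
    qed
    thus ?thesis using sub[OF k] in_P[of k k] k by auto
  qed
  show ?thesis
  proof (intro exI[of _ "\<lambda>i. P (d - i)"] conjI allI impI)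
    fix i assume i: "i < d"
    hence "Suc (d - Suc i) = d - i" by simp
    thus "P (d - i) \<subset> P (d - Suc i)" using strict[of "d - Suc i"] i by simp
  qed (use prime Pm JP in auto)
qed

definition taylor :: "('f \<Rightarrow> complex) \<Rightarrow> ('f \<Rightarrow> 'f) \<Rightarrow> 'f \<Rightarrow> complex fps" where
  "taylor \<phi> D f = Abs_fps (\<lambda>n. \<phi> (dpow D n f))"

section \<open>Convergence of the Taylor series along a derivation\<close>

context
  fixes A \<phi> D
  assumes A: "subalg A" and \<phi>: "point A \<phi>" and D: "derivation D" and DA: "\<And>f. f \<in> A \<Longrightarrow> D f \<in> A"
begin

lemma dA: "f \<in> A \<Longrightarrow> dpow D n f \<in> A" by (rule dpow_in_subalg[OF A DA])

lemma taylor_add: "f \<in> A \<Longrightarrow> g \<in> A \<Longrightarrow> taylor \<phi> D (f + g) = taylor \<phi> D f + taylor \<phi> D g"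
  by (intro fps_ext) (simp add: taylor_def dpow_add[OF D] pt_add[OF A \<phi>] dA)

lemma taylor_const: "taylor \<phi> D (\<iota> c) = fps_const c"
  by (intro fps_ext) (simp add: taylor_def dpow_const[OF D] pt_const[OF A \<phi>] pt_0[OF A \<phi>])

lemma taylor_mult: "f \<in> A \<Longrightarrow> g \<in> A \<Longrightarrow> taylor \<phi> D (f * g) = taylor \<phi> D f * taylor \<phi> D g" by (intro fps_ext)
     (simp add: taylor_def dpow_mult[OF D] fps_mult_nth atLeast0AtMost pt_sum[OF A \<phi>] pt_mult[OF A \<phi>] dA sub_mult[OF A])

lemma pt_of_nat: "\<phi> (of_nat n) = of_nat n" using pt_of_int[OF A \<phi>, of "int n"] by simp

lemma taylor_deriv: "f \<in> A \<Longrightarrow> fps_deriv (taylor \<phi> D f) = taylor \<phi> D (D f)"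
proof (intro fps_ext)
  fix n assume f: "f \<in> A"
  have "fps_nth (fps_deriv (taylor \<phi> D f)) n = \<phi> (of_nat (Suc n)) * \<phi> (dpow D (Suc n) f)"
    unfolding pt_of_nat by (simp only: taylor_def fps_deriv_nth fps_nth_Abs_fps Suc_eq_plus1)
  also have "\<dots> = \<phi> (of_nat (Suc n) * dpow D (Suc n) f)"
    by (rule pt_mult[OF A \<phi>, symmetric]) (rule sub_of_nat[OF A], rule dA[OF f])
  also have "\<dots> = fps_nth (taylor \<phi> D (D f)) n" by (simp only: dpow_Suc[OF D] taylor_def fps_nth_Abs_fps)
  finally show "fps_nth (fps_deriv (taylor \<phi> D f)) n = fps_nth (taylor \<phi> D (D f)) n" .
qed

lemma der_mons:
  assumes S: "\<And>s. s \<in> S \<Longrightarrow> D s \<in> V.span (mons S \<kappa>)" and "p \<in> mons S k"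
  shows "D p \<in> V.span (mons S (k + \<kappa>))" using assms(2)
proof (induction k arbitrary: p)
  case 0
  thus ?case by (simp add: der_1[OF D] V.span_zero)
next
  case (Suc k)
  then obtain s q where p: "s \<in> insert 1 S" "q \<in> mons S k" "p = s * q" by auto
  have "D s \<in> V.span (mons S \<kappa>)" using p(1) S by (auto simp: der_1[OF D] V.span_zero)
  hence "q * D s \<in> V.span (mons S (k + \<kappa>))"
    using p(2) by (intro span_mult[of q "mons S k" _ "mons S \<kappa>"]) (auto intro: V.span_base mons_mult)
  hence 1: "q * D s \<in> V.span (mons S (Suc k + \<kappa>))"
    using V.span_mono[OF mons_mono[of "k + \<kappa>" "Suc k + \<kappa>" S]] by auto
  have "s \<in> mons S (Suc 0)" using p(1) by (auto intro!: image_eqI[of _ _ "(s, 1)"])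
  hence "s * D q \<in> V.span (mons S (Suc 0 + (k + \<kappa>)))" using Suc.IH[OF p(2)]
    by (rule span_mult[OF V.span_base]) (rule V.span_base, rule mons_mult)
  thus ?case using 1 unfolding p(3) der_mult[OF D] by (auto intro!: V.span_add)
qed

text \<open>If \<open>D\<close> maps a finite set \<open>B\<close> into the span of \<open>B * B\<close>, the quantities
  \<open>s n = (\<Sum>b\<in>B. |\<phi> (D^n b) / n!|)\<close> satisfy \<open>(n + 1) s (n + 1) \<le> K (\<Sum>i\<le>n. s i * s (n - i))\<close>, which
  forces geometric growth.\<close>

lemma quadratic_growth:
  fixes s :: "nat \<Rightarrow> real"
  assumes s0: "\<And>n. s n \<ge> 0" and K: "K \<ge> 0"
    and rec: "\<And>n. real (Suc n) * s (Suc n) \<le> K * (\<Sum>i\<le>n. s i * s (n - i))"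
  shows "\<exists>C>0. \<exists>M. \<forall>n. s n \<le> M * C ^ n"
proof -
  \<comment> \<open>The induction uses that \<open>K * M\<close> is at most \<open>C\<close>; the
    added ones keep both constants positive.\<close>
  define M where "M = s 0 + 1"
  define C where "C = K * M + 1"
  have M: "M > 0" using s0[of 0] by (simp add: M_def)
  have C: "C > 0" using M K by (simp add: C_def add_nonneg_pos)
  have "s n \<le> M * C ^ n" for n
  proof (induction n rule: less_induct)
    case (less n)
    show ?case
    proof (cases n)
      case 0 thus ?thesis by (simp add: M_def)
    next
      case (Suc k)
      have "real n * s n \<le> K * (\<Sum>i\<le>k. s i * s (k - i))" using rec[of k] Suc by simp
      also have "\<dots> \<le> K * (\<Sum>i\<le>k. (M * C ^ i) * (M * C ^ (k - i)))"
        using K M C s0 less.IH Suc by (intro mult_left_mono sum_mono mult_mono) (auto simp: less_imp_le)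
      also have "(\<Sum>i\<le>k. (M * C ^ i) * (M * C ^ (k - i))) = (\<Sum>i\<le>k. M * M * C ^ k)"
      proof (intro sum.cong refl)
        fix i assume "i \<in> {..k}"
        hence "C ^ k = C ^ i * C ^ (k - i)" by (simp flip: power_add)
        thus "(M * C ^ i) * (M * C ^ (k - i)) = M * M * C ^ k" by simp
      qed
      also have "K * (\<Sum>i\<le>k. M * M * C ^ k) = real n * ((K * M) * (M * C ^ k))"
        using Suc by (simp add: algebra_simps)
      also have "\<dots> \<le> real n * (C * (M * C ^ k))"
        using M C by (intro mult_left_mono mult_right_mono) (auto simp: C_def)
      finally have "s n \<le> C * (M * C ^ k)" using Suc by (simp del: of_nat_Suc)
      thus ?thesis using Suc by (simp add: algebra_simps)
    qed
  qed
  with C show ?thesis by blast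
qed

text \<open>Products of at most twice \<kappa> generators factor into two elements of
  \<open>B\<close>, so \<open>D\<close> maps \<open>B\<close> into the span of products of two
  elements of \<open>B\<close> and \<open>quadratic_growth\<close> applies. The radius obtained on
  the finite set \<open>B\<close> persists under sums and products, hence is common to all of
  \<open>A\<close>.\<close>

lemma taylor_conv_radius:
  assumes S: "finite S" and AS: "A = alg S"
  shows "\<exists>r>0. \<forall>f\<in>A. fps_conv_radius (taylor \<phi> D f) \<ge> ereal r"
proof -
  have SA: "S \<subseteq> A" unfolding AS by (auto intro: generated_algebra.gen)
  have "\<forall>s. \<exists>k. s \<in> S \<longrightarrow> D s \<in> V.span (mons S k)" using generated_algebra_mons DA SA AS by blast
  then obtain kf where kf: "\<And>s. s \<in> S \<Longrightarrow> D s \<in> V.span (mons S (kf s))" by metis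
  \<comment> \<open>The maximum bounds the degree of each \<open>D s\<close>; the successor
    guarantees that the generators themselves lie in \<open>B\<close>.\<close>
  define \<kappa> where "\<kappa> = Suc (Max (insert 0 (kf ` S)))"
  have kf': "kf s \<le> \<kappa>" if "s \<in> S" for s
  proof -
    have "kf s \<le> Max (insert 0 (kf ` S))" using S that by (intro Max_ge) auto
    thus ?thesis by (simp add: \<kappa>_def)
  qed
  have DS: "D s \<in> V.span (mons S \<kappa>)" if "s \<in> S" for s
    using kf[OF that] V.span_mono[OF mons_mono[OF kf'[OF that], of S]] by blast
  define B where "B = mons S \<kappa>"
  have finB: "finite B" unfolding B_def by (rule finite_mons[OF S])
  have monsA: "mons S k \<subseteq> A" for k
  proof (induction k)
    case (Suc k) thus ?case using SA sub_1[OF A] by (auto intro!: sub_mult[OF A])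
  qed (simp add: sub_1[OF A])
  have BA: "B \<subseteq> A" unfolding B_def by (rule monsA)
  define s where "s n = (\<Sum>b\<in>B. norm (\<phi> (dpow D n b)))" for n
  have s_ge: "norm (\<phi> (dpow D n b)) \<le> s n" if "b \<in> B" for n b
    unfolding s_def using finB that by (intro member_le_sum) auto
  have s0: "s n \<ge> 0" for n unfolding s_def by (intro sum_nonneg) auto
  have span_bound: "\<exists>K\<ge>0. \<forall>n. norm (\<phi> (dpow D n h)) \<le> K * (\<Sum>i\<le>n. s i * s (n - i))"
    if "h \<in> V.span (mons S (\<kappa> + \<kappa>))" for h
  proof -
    have "h \<in> A \<and> (\<exists>K\<ge>0. \<forall>n. norm (\<phi> (dpow D n h)) \<le> K * (\<Sum>i\<le>n. s i * s (n - i)))" using that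
    proof (induction rule: V.span_induct_alt)
      case base
      show ?case using dpow_const[OF D, of _ 0] by (intro conjI exI[of _ 0]) (auto simp: sub_0[OF A] pt_0[OF A \<phi>])
    next
      case (step c u v)
      obtain q r where qr: "q \<in> B" "r \<in> B" "u = q * r" using mons_split[OF step(1)] by (auto simp: B_def)
      have uA: "u \<in> A" using step(1) monsA by blast
      have vA: "v \<in> A" using step by blast
      have u: "norm (\<phi> (dpow D n u)) \<le> (\<Sum>i\<le>n. s i * s (n - i))" for n
      proof -
        have "\<phi> (dpow D n u) = (\<Sum>i\<le>n. \<phi> (dpow D i q) * \<phi> (dpow D (n - i) r))"
          unfolding qr(3) dpow_mult[OF D]
          using subsetD[OF BA qr(1)] subsetD[OF BA qr(2)] by (subst pt_sum[OF A \<phi>]) (auto simp: pt_mult[OF A \<phi>] dA intro!: sub_mult[OF A])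
        also have "norm \<dots> \<le> (\<Sum>i\<le>n. norm (\<phi> (dpow D i q) * \<phi> (dpow D (n - i) r)))" by (rule norm_sum)
        also have "\<dots> \<le> (\<Sum>i\<le>n. s i * s (n - i))"
          unfolding norm_mult by (intro sum_mono mult_mono s_ge qr s0) auto
        finally show ?thesis .
      qed
      obtain K where K: "K \<ge> 0" "\<And>n. norm (\<phi> (dpow D n v)) \<le> K * (\<Sum>i\<le>n. s i * s (n - i))" using step by blast
      have "norm (\<phi> (dpow D n (\<iota> c * u + v))) \<le> (norm c + K) * (\<Sum>i\<le>n. s i * s (n - i))" for n
      proof -
        have "dpow D n (\<iota> c * u) = \<iota> c * dpow D n u"
        proof -
          have "(D ^^ n) (\<iota> c * u) = \<iota> c * (D ^^ n) u" by (induction n) (auto simp: der_scale[OF D])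
          thus ?thesis by (simp add: dpow_def)
        qed
        hence "\<phi> (dpow D n (\<iota> c * u + v)) = c * \<phi> (dpow D n u) + \<phi> (dpow D n v)"
          by (simp add: dpow_add[OF D] pt_add[OF A \<phi>] pt_mult[OF A \<phi>] pt_const[OF A \<phi>] dA uA vA sub_mult[OF A] sub_const[OF A])
        also have "norm \<dots> \<le> norm c * norm (\<phi> (dpow D n u)) + norm (\<phi> (dpow D n v))"
          by (metis norm_mult norm_triangle_ineq)
        also have "\<dots> \<le> norm c * (\<Sum>i\<le>n. s i * s (n - i)) + K * (\<Sum>i\<le>n. s i * s (n - i))"
          by (intro add_mono mult_left_mono u K) auto
        finally show ?thesis by (simp add: distrib_right)
      qed
      moreover have "norm c + K \<ge> 0" using K by simp
      moreover have "\<iota> c * u + v \<in> A" using uA vA by (intro sub_add[OF A] sub_mult[OF A] sub_const[OF A])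
      ultimately show ?case by blast
    qed
    thus ?thesis by blast
  qed
  have "\<forall>b. \<exists>K. b \<in> B \<longrightarrow> K \<ge> 0 \<and> (\<forall>n. norm (\<phi> (dpow D n (D b))) \<le> K * (\<Sum>i\<le>n. s i * s (n - i)))"
    using span_bound der_mons[OF DS] unfolding B_def by blast
  then obtain Kf where Kf: "\<And>b. b \<in> B \<Longrightarrow> Kf b \<ge> 0"
    "\<And>b n. b \<in> B \<Longrightarrow> norm (\<phi> (dpow D n (D b))) \<le> Kf b * (\<Sum>i\<le>n. s i * s (n - i))" by metis
  define K where "K = (\<Sum>b\<in>B. Kf b)"
  have "real (Suc n) * s (Suc n) \<le> K * (\<Sum>i\<le>n. s i * s (n - i))" for n
  proof -
    have "real (Suc n) * s (Suc n) = (\<Sum>b\<in>B. norm (\<phi> (dpow D n (D b))))" unfolding s_def sum_distrib_left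
    proof (intro sum.cong refl)
      fix b assume b: "b \<in> B"
      have "\<phi> (dpow D n (D b)) = \<phi> (of_nat (Suc n)) * \<phi> (dpow D (Suc n) b)"
        unfolding dpow_Suc[OF D, symmetric] using b BA
        by (intro pt_mult[OF A \<phi>] sub_of_nat[OF A] dA) auto
      thus "real (Suc n) * norm (\<phi> (dpow D (Suc n) b)) = norm (\<phi> (dpow D n (D b)))"
        unfolding pt_of_nat by (simp add: norm_mult del: of_nat_Suc)
    qed
    also have "\<dots> \<le> (\<Sum>b\<in>B. Kf b * (\<Sum>i\<le>n. s i * s (n - i)))" by (intro sum_mono Kf)
    finally show ?thesis by (simp add: K_def sum_distrib_right)
  qed
  moreover have "K \<ge> 0" unfolding K_def by (intro sum_nonneg Kf)
  ultimately obtain C M where C: "C > 0" "\<And>n. s n \<le> M * C ^ n" using quadratic_growth[of s K] s0 by blast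
  define r where "r = 1 / C"
  have r: "r > 0" using C by (simp add: r_def)
  have B: "fps_conv_radius (taylor \<phi> D b) \<ge> ereal r" if b: "b \<in> B" for b unfolding fps_conv_radius_def
  proof (rule conv_radius_geI_ex')
    fix t :: real assume t: "0 < t" "ereal t < ereal r"
    hence Ct: "C * t < 1" "C * t \<ge> 0" using C by (auto simp: r_def field_simps)
    show "summable (\<lambda>n. fps_nth (taylor \<phi> D b) n * of_real t ^ n)"
    proof (rule summable_comparison_test'[of "\<lambda>n. M * (C * t) ^ n" 0])
      show "summable (\<lambda>n. M * (C * t) ^ n)" using Ct by (intro summable_mult summable_geometric) auto
      fix n :: nat
      have "norm (fps_nth (taylor \<phi> D b) n * of_real t ^ n) = norm (\<phi> (dpow D n b)) * t ^ n"
        using t by (simp add: taylor_def norm_mult norm_power)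
      also have "\<dots> \<le> (M * C ^ n) * t ^ n"
        using s_ge[OF b, of n] C(2)[of n] t by (intro mult_right_mono) auto
      finally show "norm (fps_nth (taylor \<phi> D b) n * of_real t ^ n) \<le> M * (C * t) ^ n"
        by (simp add: power_mult_distrib mult.assoc)
    qed
  qed
  have "fps_conv_radius (taylor \<phi> D f) \<ge> ereal r" if "f \<in> A" for f using that unfolding AS
  proof (induction rule: generated_algebra.induct)
    case (scalar c) thus ?case by (simp add: taylor_const)
  next
    case (gen s)
    hence "s \<in> mons S (Suc 0)" by (auto intro!: image_eqI[of _ _ "(s, 1)"])
    hence "s \<in> B" unfolding B_def using mons_mono[of "Suc 0" \<kappa> S] by (auto simp: \<kappa>_def simp del: mons.simps)
    thus ?case by (rule B)
  next
    case (add f g)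
    hence "min (fps_conv_radius (taylor \<phi> D f)) (fps_conv_radius (taylor \<phi> D g)) \<ge> ereal r" by simp
    also have "min (fps_conv_radius (taylor \<phi> D f)) (fps_conv_radius (taylor \<phi> D g)) \<le> fps_conv_radius (taylor \<phi> D (f + g))"
      using add taylor_add[of f g] fps_conv_radius_add[of "taylor \<phi> D f" "taylor \<phi> D g"] by (simp add: AS)
    finally show ?case .
  next
    case (mult f g)
    hence "min (fps_conv_radius (taylor \<phi> D f)) (fps_conv_radius (taylor \<phi> D g)) \<ge> ereal r" by simp
    also have "min (fps_conv_radius (taylor \<phi> D f)) (fps_conv_radius (taylor \<phi> D g)) \<le> fps_conv_radius (taylor \<phi> D (f * g))"
      using mult taylor_mult[of f g] fps_conv_radius_mult[of "taylor \<phi> D f" "taylor \<phi> D g"] by (simp add: AS)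
    finally show ?case .
  qed
  with r show ?thesis by blast
qed

text \<open>The family is \<phi> composed with exp(tD). Its values are again characters because the
  Taylor expansion is multiplicative and converges on one disc for all of \<open>A\<close>.\<close>

lemma flow:
  assumes fg: "finitely_generated_algebra \<iota> A"
  shows "\<exists>r>0. \<exists>\<Phi>. (\<forall>f\<in>A. \<Phi> 0 f = \<phi> f) \<and>
    (\<forall>t. norm t < r \<longrightarrow> point A (\<Phi> t) \<and>
      (\<forall>f\<in>A. ((\<lambda>t. \<Phi> t f) has_field_derivative \<Phi> t (D f)) (at t)))"
proof -
  obtain S where S: "finite S" "A = alg S" using fg by (auto simp: finitely_generated_algebra_def)
  obtain r where r: "r > 0" "\<And>f. f \<in> A \<Longrightarrow> fps_conv_radius (taylor \<phi> D f) \<ge> ereal r"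
    using taylor_conv_radius[OF S] by blast
  define \<Phi> where "\<Phi> t f = eval_fps (taylor \<phi> D f) t" for t f
  have cr: "ereal (norm t) < fps_conv_radius (taylor \<phi> D f)" if "f \<in> A" "norm t < r" for f and t :: complex
    using r(2)[OF that(1)] that(2) by (meson less_ereal.simps(1) less_le_trans)
  have "point A (\<Phi> t)" if t: "norm t < r" for t unfolding point_def \<Phi>_def using cr t
    by (auto simp: taylor_const taylor_add taylor_mult eval_fps_add eval_fps_mult)
  moreover have "((\<lambda>t. \<Phi> t f) has_field_derivative \<Phi> t (D f)) (at t)" if "norm t < r" "f \<in> A" for t f
    unfolding \<Phi>_def taylor_deriv[OF that(2), symmetric]
    by (rule has_field_derivative_eval_fps[OF cr[OF that(2,1)]])
  moreover have "\<Phi> 0 f = \<phi> f" for f by (simp add: \<Phi>_def eval_fps_at_0 taylor_def dpow_0[OF D])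
  ultimately show ?thesis using r(1) by blast
qed

end

end

section \<open>Cotangent spaces\<close>

context complex_algebra
begin

definition sq :: "'f set \<Rightarrow> 'f set \<Rightarrow> 'f set" where
  "sq A m = ideal_prod (ring_on A) m m"

lemma sq_prod: "p \<in> m \<Longrightarrow> q \<in> m \<Longrightarrow> p * q \<in> sq A m"
  using ideal_prod.prod[of p m q m "ring_on A"] by (simp add: sq_def)

lemma sq_add: "p \<in> sq A m \<Longrightarrow> q \<in> sq A m \<Longrightarrow> p + q \<in> sq A m"
  using ideal_prod.sum[of p "ring_on A" m m q] by (simp add: sq_def)

lemma sq_induct [consumes 1, case_names prod add]:
  assumes "w \<in> sq A m" "\<And>p q. p \<in> m \<Longrightarrow> q \<in> m \<Longrightarrow> P (p * q)"
    "\<And>v w. v \<in> sq A m \<Longrightarrow> P v \<Longrightarrow> w \<in> sq A m \<Longrightarrow> P w \<Longrightarrow> P (v + w)"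
  shows "P w" using assms(1) unfolding sq_def
proof (induction rule: ideal_prod.induct)
  case (prod p q) thus ?case using assms(2) by simp
next
  case (sum v w) thus ?case using assms(3)[of v w] by (simp add: sq_def)
qed

lemma is_ideal_sq:
  assumes A: "subalg A" and m: "is_ideal A m" shows "is_ideal A (sq A m)" unfolding is_ideal_def
proof (intro conjI ballI)
  show "0 \<in> sq A m" using sq_prod[OF is_ideal_0[OF m] is_ideal_0[OF m]] by simp
  fix f assume f: "f \<in> sq A m"
  show "f + g \<in> sq A m" if "g \<in> sq A m" for g using sq_add f that by blast
  show "g * f \<in> sq A m" if g: "g \<in> A" for g using f
  proof (induction rule: sq_induct)
    case (prod p q)
    thus ?case using sq_prod[OF is_ideal_mult[OF m prod(1) g] prod(2)] by (simp add: mult.assoc)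
  next
    case (add v w) thus ?case using sq_add by (simp add: distrib_left)
  qed
next
  show "sq A m \<subseteq> A"
  proof
    fix w assume "w \<in> sq A m"
    thus "w \<in> A"
      using is_ideal_subset[OF m] by (induction rule: sq_induct) (auto intro: sub_mult[OF A] sub_add[OF A])
  qed
qed

lemma sq_subset: "subalg A \<Longrightarrow> is_ideal A m \<Longrightarrow> sq A m \<subseteq> m"
proof
  fix w assume A: "subalg A" and m: "is_ideal A m" and "w \<in> sq A m"
  from this(3) show "w \<in> m"
    using is_ideal_subset[OF m] by (induction rule: sq_induct) (auto intro: is_ideal_mult[OF m] is_ideal_add[OF m])
qed

text \<open>Derivations along a homomorphism \<open>\<phi>\<close>, with values in the field. This covers the derivations
  of the field and, for \<open>\<phi> = \<iota> \<circ> \<phi>'\<close>, the tangent vectors at the point \<open>\<phi>'\<close>.\<close>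

definition gder :: "'f set \<Rightarrow> ('f \<Rightarrow> 'f) \<Rightarrow> ('f \<Rightarrow> 'f) \<Rightarrow> bool" where
  "gder A \<phi> \<delta> \<longleftrightarrow> (\<forall>c. \<phi> (\<iota> c) = \<iota> c \<and> \<delta> (\<iota> c) = 0) \<and>
     (\<forall>f\<in>A. \<forall>g\<in>A. \<phi> (f + g) = \<phi> f + \<phi> g \<and> \<phi> (f * g) = \<phi> f * \<phi> g \<and>
        \<delta> (f + g) = \<delta> f + \<delta> g \<and> \<delta> (f * g) = \<phi> f * \<delta> g + \<phi> g * \<delta> f)"

lemma gder_derivation: "derivation D \<Longrightarrow> gder A (\<lambda>f. f) D"
  by (auto simp: gder_def der_const der_add der_mult)

context
  fixes A \<phi> \<delta> assumes A: "subalg A" and g: "gder A \<phi> \<delta>"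
begin

lemma gd_\<phi>_const: "\<phi> (\<iota> c) = \<iota> c" and gd_const: "\<delta> (\<iota> c) = 0"
  and gd_\<phi>_add: "p \<in> A \<Longrightarrow> q \<in> A \<Longrightarrow> \<phi> (p + q) = \<phi> p + \<phi> q"
  and gd_\<phi>_mult: "p \<in> A \<Longrightarrow> q \<in> A \<Longrightarrow> \<phi> (p * q) = \<phi> p * \<phi> q"
  and gd_add: "p \<in> A \<Longrightarrow> q \<in> A \<Longrightarrow> \<delta> (p + q) = \<delta> p + \<delta> q"
  and gd_mult: "p \<in> A \<Longrightarrow> q \<in> A \<Longrightarrow> \<delta> (p * q) = \<phi> p * \<delta> q + \<phi> q * \<delta> p" using g by (auto simp: gder_def)

lemma gd_\<phi>_0: "\<phi> 0 = 0" using gd_\<phi>_const[of 0] by simp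
lemma gd_0: "\<delta> 0 = 0" using gd_const[of 0] by simp

lemma gd_\<phi>_sum: "(\<And>i. i \<in> I \<Longrightarrow> h i \<in> A) \<Longrightarrow> \<phi> (sum h I) = (\<Sum>i\<in>I. \<phi> (h i))"
  by (induction I rule: infinite_finite_induct) (auto simp: gd_\<phi>_0 gd_\<phi>_add sub_sum[OF A])

lemma gd_sum: "(\<And>i. i \<in> I \<Longrightarrow> h i \<in> A) \<Longrightarrow> \<delta> (sum h I) = (\<Sum>i\<in>I. \<delta> (h i))"
  by (induction I rule: infinite_finite_induct) (auto simp: gd_0 gd_add sub_sum[OF A])

lemma gd_\<phi>_uminus: "p \<in> A \<Longrightarrow> \<phi> (- p) = - \<phi> p"
  using gd_\<phi>_add[of p "- p"] sub_uminus[OF A, of p] by (simp add: gd_\<phi>_0 add_eq_0_iff)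

lemma gd_\<phi>_diff: "p \<in> A \<Longrightarrow> q \<in> A \<Longrightarrow> \<phi> (p - q) = \<phi> p - \<phi> q"
  using gd_\<phi>_add[of p "- q"] sub_uminus[OF A, of q] by (simp add: gd_\<phi>_uminus)

lemma gd_scale: "p \<in> A \<Longrightarrow> \<delta> (\<iota> c * p) = \<iota> c * \<delta> p"
  by (simp add: gd_mult sub_const[OF A] gd_const gd_\<phi>_const)

end

text \<open>The classes of the \<open>f i\<close> span m modulo its square but need not be
  independent, so a shorter family can be padded with zeros. Independence is recovered from dual
  derivations where they exist.\<close>

definition spans_cotangent :: "'f set \<Rightarrow> ('f \<Rightarrow> complex) \<Rightarrow> nat \<Rightarrow> (nat \<Rightarrow> 'f) \<Rightarrow> bool" where
  "spans_cotangent A \<phi> d f \<longleftrightarrow> (\<forall>i<d. f i \<in> kernel A \<phi>) \<and>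
     (\<forall>q\<in>kernel A \<phi>. \<exists>c. q - (\<Sum>i<d. \<iota> (c i) * f i) \<in> sq A (kernel A \<phi>))"

definition cot :: "'f set \<Rightarrow> 'f set \<Rightarrow> nat \<Rightarrow> (nat \<Rightarrow> 'f) \<Rightarrow> 'f set" where
  "cot A m d f = {q. \<exists>c. q - (\<Sum>i<d. \<iota> (c i) * f i) \<in> sq A m}"

context
  fixes A m assumes A: "subalg A" and m: "is_ideal A m"
begin

private lemma sqI: "is_ideal A (sq A m)" by (rule is_ideal_sq[OF A m])

lemma sq_cot: "sq A m \<subseteq> cot A m d f" unfolding cot_def by (auto intro!: exI[of _ "\<lambda>_. 0"])

lemma subspace_cot: "V.subspace (cot A m d f)"
proof (rule V.subspaceI)
  show "0 \<in> cot A m d f" using sq_cot is_ideal_0[OF sqI] by blast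
  fix p assume "p \<in> cot A m d f"
  then obtain a where p: "p - (\<Sum>i<d. \<iota> (a i) * f i) \<in> sq A m" unfolding cot_def by blast
  show "p + q \<in> cot A m d f" if qX: "q \<in> cot A m d f" for q
  proof -
    obtain b where q: "q - (\<Sum>i<d. \<iota> (b i) * f i) \<in> sq A m" using qX unfolding cot_def by blast
    have e: "(p + q) - (\<Sum>i<d. \<iota> (a i + b i) * f i) =
        (p - (\<Sum>i<d. \<iota> (a i) * f i)) + (q - (\<Sum>i<d. \<iota> (b i) * f i))"
      by (simp only: \<iota>_add distrib_right sum.distrib) (simp add: algebra_simps)
    show ?thesis unfolding cot_def mem_Collect_eq
      by (rule exI[of _ "\<lambda>i. a i + b i"], unfold e, rule is_ideal_add[OF sqI p q])
  qed
  show "\<iota> c * p \<in> cot A m d f" for c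
  proof -
    have e: "\<iota> c * p - (\<Sum>i<d. \<iota> (c * a i) * f i) = \<iota> c * (p - (\<Sum>i<d. \<iota> (a i) * f i))"
      by (simp only: \<iota>_mult right_diff_distrib sum_distrib_left mult.assoc)
    show ?thesis unfolding cot_def mem_Collect_eq
      by (rule exI[of _ "\<lambda>i. c * a i"], unfold e, rule is_ideal_mult[OF sqI p sub_const[OF A]])
  qed
qed

lemma gen_cot: assumes "j < d" shows "f j \<in> cot A m d f"
proof -
  have "(\<Sum>i<d. \<iota> (if i = j then 1 else 0) * f i) = (\<Sum>i<d. if i = j then f j else 0)"
    by (intro sum.cong) auto
  also have "\<dots> = f j" using assms by simp
  finally show ?thesis unfolding cot_def mem_Collect_eq using is_ideal_0[OF sqI]
    by (intro exI[of _ "\<lambda>i. if i = j then 1 else 0"]) simp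
qed

end

text \<open>\<open>u ds\<close> is a combination of the \<open>df i\<close> and of the \<open>dt\<close> with \<open>t \<in> T\<close>.\<close>

definition diff_rel :: "'f set \<Rightarrow> nat \<Rightarrow> (nat \<Rightarrow> 'f) \<Rightarrow> 'f set \<Rightarrow> 'f \<Rightarrow> (nat \<Rightarrow> 'f) \<Rightarrow> ('f \<Rightarrow> 'f) \<Rightarrow> 'f \<Rightarrow> bool" where
  "diff_rel A d f T u c \<mu> s \<longleftrightarrow> u \<in> A \<and> (\<forall>i<d. c i \<in> A) \<and> (\<forall>\<phi> \<delta>. gder A \<phi> \<delta> \<longrightarrow>
     \<phi> u * \<delta> s = (\<Sum>i<d. \<phi> (c i) * \<delta> (f i)) + (\<Sum>t\<in>T. \<phi> (\<mu> t) * \<delta> t))"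

lemma
  assumes "diff_rel A d f T u c \<mu> s"
  shows diff_rel_u: "u \<in> A" and diff_rel_c: "i < d \<Longrightarrow> c i \<in> A"
    and diff_rel_eq: "gder A \<phi> \<delta> \<Longrightarrow> \<phi> u * \<delta> s = (\<Sum>i<d. \<phi> (c i) * \<delta> (f i)) + (\<Sum>t\<in>T. \<phi> (\<mu> t) * \<delta> t)"
  using assms by (auto simp: diff_rel_def)

section \<open>Local coordinates from functions spanning the cotangent space\<close>

context
  fixes A S assumes A: "A = alg S" and S: "finite S"
begin

lemma A_sub: "subalg A" unfolding A by (rule subalg_generated)

lemma S_sub: "s \<in> S \<Longrightarrow> s \<in> A" unfolding A by (rule generated_algebra.gen)

text \<open>The \<open>r s\<close> act as partial derivatives of a polynomial expression for
  \<open>q\<close> in the generators. They are chosen once and serve derivations of the field and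
  tangent vectors at every point alike.\<close>

lemma chain_rule:
  assumes "q \<in> A"
  shows "\<exists>r. (\<forall>s\<in>S. r s \<in> A) \<and> (\<forall>\<phi> \<delta>. gder A \<phi> \<delta> \<longrightarrow> \<delta> q = (\<Sum>s\<in>S. \<phi> (r s) * \<delta> s))" using assms unfolding A
proof (induction rule: generated_algebra.induct)
  case (scalar c)
  show ?case by (intro exI[of _ "\<lambda>_. 0"])
       (auto simp: gd_const[OF A_sub] gd_\<phi>_0[OF A_sub] A[symmetric] sub_0[OF A_sub])
next
  case (gen t)
  have "\<delta> t = (\<Sum>s\<in>S. \<phi> (if s = t then 1 else 0) * \<delta> s)" if "gder A \<phi> \<delta>" for \<phi> \<delta>
  proof -
    have "(\<Sum>s\<in>S. \<phi> (if s = t then 1 else 0) * \<delta> s) = (\<Sum>s\<in>S. if s = t then \<delta> t else 0)"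
      using gd_\<phi>_const[OF A_sub that, of 1] gd_\<phi>_0[OF A_sub that] by (intro sum.cong) auto
    thus ?thesis using gen S by simp
  qed
  thus ?case by (intro exI[of _ "\<lambda>s. if s = t then 1 else 0"])
       (auto simp: A[symmetric] sub_0[OF A_sub] sub_1[OF A_sub])
next
  case (add f g)
  then obtain r r' where r: "\<forall>s\<in>S. r s \<in> A" "\<And>\<phi> \<delta>. gder A \<phi> \<delta> \<Longrightarrow> \<delta> f = (\<Sum>s\<in>S. \<phi> (r s) * \<delta> s)"
    and r': "\<forall>s\<in>S. r' s \<in> A" "\<And>\<phi> \<delta>. gder A \<phi> \<delta> \<Longrightarrow> \<delta> g = (\<Sum>s\<in>S. \<phi> (r' s) * \<delta> s)"
    unfolding A[symmetric] by blast
  have "\<delta> (f + g) = (\<Sum>s\<in>S. \<phi> (r s + r' s) * \<delta> s)" if d: "gder A \<phi> \<delta>" for \<phi> \<delta>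
    using add r r' by (simp add: gd_add[OF A_sub d] A[symmetric] r(2)[OF d] r'(2)[OF d] gd_\<phi>_add[OF A_sub d]
      distrib_right sum.distrib)
  thus ?case unfolding A[symmetric] using r r'
    by (intro exI[of _ "\<lambda>s. r s + r' s"]) (auto intro: sub_add[OF A_sub])
next
  case (mult f g)
  then obtain r r' where r: "\<forall>s\<in>S. r s \<in> A" "\<And>\<phi> \<delta>. gder A \<phi> \<delta> \<Longrightarrow> \<delta> f = (\<Sum>s\<in>S. \<phi> (r s) * \<delta> s)"
    and r': "\<forall>s\<in>S. r' s \<in> A" "\<And>\<phi> \<delta>. gder A \<phi> \<delta> \<Longrightarrow> \<delta> g = (\<Sum>s\<in>S. \<phi> (r' s) * \<delta> s)"
    unfolding A[symmetric] by blast
  have fg: "f \<in> A" "g \<in> A" using mult A by auto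
  have "\<delta> (f * g) = (\<Sum>s\<in>S. \<phi> (f * r' s + g * r s) * \<delta> s)" if d: "gder A \<phi> \<delta>" for \<phi> \<delta>
  proof -
    have "\<delta> (f * g) = (\<Sum>s\<in>S. \<phi> f * (\<phi> (r' s) * \<delta> s) + \<phi> g * (\<phi> (r s) * \<delta> s))"
      using fg by (simp add: gd_mult[OF A_sub d] r(2)[OF d] r'(2)[OF d] sum.distrib sum_distrib_left)
    also have "\<dots> = (\<Sum>s\<in>S. \<phi> (f * r' s + g * r s) * \<delta> s)" using fg r r' by (intro sum.cong refl)
        (simp add: gd_\<phi>_add[OF A_sub d] gd_\<phi>_mult[OF A_sub d] sub_mult[OF A_sub] algebra_simps)
    finally show ?thesis .
  qed
  thus ?case unfolding A[symmetric] using r r' fg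
    by (intro exI[of _ "\<lambda>s. f * r' s + g * r s"]) (auto intro!: sub_add[OF A_sub] sub_mult[OF A_sub])
qed

text \<open>Differentiating a product of two elements of \<open>m\<close> always leaves one of them
  as a factor, so the coefficients can be taken in \<open>m\<close>.\<close>

lemma chain_rule_sq:
  assumes m: "is_ideal A m" and "w \<in> sq A m"
  shows "\<exists>r. (\<forall>s\<in>S. r s \<in> m) \<and> (\<forall>\<phi> \<delta>. gder A \<phi> \<delta> \<longrightarrow> \<delta> w = (\<Sum>s\<in>S. \<phi> (r s) * \<delta> s))" using assms(2)
proof (induction rule: sq_induct)
  case (prod f g)
  hence fg: "f \<in> A" "g \<in> A" using is_ideal_subset[OF m] by auto
  obtain r where r: "\<forall>s\<in>S. r s \<in> A" "\<And>\<phi> \<delta>. gder A \<phi> \<delta> \<Longrightarrow> \<delta> f = (\<Sum>s\<in>S. \<phi> (r s) * \<delta> s)"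
    using chain_rule[OF fg(1)] by blast
  obtain r' where r': "\<forall>s\<in>S. r' s \<in> A" "\<And>\<phi> \<delta>. gder A \<phi> \<delta> \<Longrightarrow> \<delta> g = (\<Sum>s\<in>S. \<phi> (r' s) * \<delta> s)"
    using chain_rule[OF fg(2)] by blast
  have "\<delta> (f * g) = (\<Sum>s\<in>S. \<phi> (r' s * f + r s * g) * \<delta> s)" if d: "gder A \<phi> \<delta>" for \<phi> \<delta>
  proof -
    have "\<delta> (f * g) = (\<Sum>s\<in>S. \<phi> f * (\<phi> (r' s) * \<delta> s) + \<phi> g * (\<phi> (r s) * \<delta> s))"
      using fg by (simp add: gd_mult[OF A_sub d] r(2)[OF d] r'(2)[OF d] sum.distrib sum_distrib_left)
    also have "\<dots> = (\<Sum>s\<in>S. \<phi> (r' s * f + r s * g) * \<delta> s)" using fg r r' by (intro sum.cong refl)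
        (simp add: gd_\<phi>_add[OF A_sub d] gd_\<phi>_mult[OF A_sub d] sub_mult[OF A_sub] algebra_simps)
    finally show ?thesis .
  qed
  thus ?case using r r' prod
    by (intro exI[of _ "\<lambda>s. r' s * f + r s * g"]) (auto intro!: is_ideal_add[OF m] is_ideal_mult[OF m])
next
  case (add f g)
  hence fg: "f \<in> A" "g \<in> A" using is_ideal_subset[OF is_ideal_sq[OF A_sub m]] by auto
  obtain r r' where r: "\<forall>s\<in>S. r s \<in> m" "\<And>\<phi> \<delta>. gder A \<phi> \<delta> \<Longrightarrow> \<delta> f = (\<Sum>s\<in>S. \<phi> (r s) * \<delta> s)"
    and r': "\<forall>s\<in>S. r' s \<in> m" "\<And>\<phi> \<delta>. gder A \<phi> \<delta> \<Longrightarrow> \<delta> g = (\<Sum>s\<in>S. \<phi> (r' s) * \<delta> s)" using add by blast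
  have rA: "r s \<in> A" "r' s \<in> A" if "s \<in> S" for s using r(1) r'(1) that is_ideal_subset[OF m] by auto
  have "\<delta> (f + g) = (\<Sum>s\<in>S. \<phi> (r s + r' s) * \<delta> s)" if d: "gder A \<phi> \<delta>" for \<phi> \<delta>
    using fg rA by (simp add: gd_add[OF A_sub d] r(2)[OF d] r'(2)[OF d] gd_\<phi>_add[OF A_sub d]
      distrib_right sum.distrib)
  thus ?case using r r' by (intro exI[of _ "\<lambda>s. r s + r' s"]) (auto intro: is_ideal_add[OF m])
qed

text \<open>Nakayama's lemma for the differentials, by eliminating the generators in \<open>T\<close> one by one.\<close>

lemma eliminate_differentials:
  fixes d :: nat
  assumes m: "is_prime A m" and T: "T \<subseteq> S" and f: "\<And>i. i < d \<Longrightarrow> f i \<in> A"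
    and eq: "\<And>s. s \<in> S \<Longrightarrow> \<exists>u c \<mu>. u \<notin> m \<and> (\<forall>t\<in>T. \<mu> t \<in> m) \<and> diff_rel A d f T u c \<mu> s"
    and s: "s \<in> S"
  shows "\<exists>u c \<mu>. u \<notin> m \<and> diff_rel A d f {} u c \<mu> s"
proof -
  have "finite T" using T S finite_subset by blast
  thus ?thesis using T eq s
  proof (induction T arbitrary: s rule: finite_induct)
    case empty
    show ?case using empty.prems(2)[OF empty.prems(3)] by blast
  next
    case (insert t0 T)
    have mI: "is_ideal A m" using m by (simp add: is_prime_def)
    have mA: "p \<in> A" if "p \<in> m" for p using that is_ideal_subset[OF mI] by blast
    have t0: "t0 \<in> S" using insert by simp
    from insert.prems(2)[OF t0] obtain u0 c0 \<mu>0 where 0: "u0 \<notin> m" "\<forall>t\<in>insert t0 T. \<mu>0 t \<in> m"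
      and rel0: "diff_rel A d f (insert t0 T) u0 c0 \<mu>0 t0" by (elim exE conjE)
    \<comment> \<open>In the relation for the differential of \<open>t0\<close> its own coefficient
      on the right is in \<open>m\<close>. Moving it to the left changes \<open>u0\<close> into
      \<open>v\<close>, which is still outside \<open>m\<close>, and the relation can be solved for
      that differential.\<close>
    define v where "v = u0 - \<mu>0 t0"
    have v: "v \<in> A" "v \<notin> m"
    proof -
      show "v \<in> A" unfolding v_def using 0 mA diff_rel_u[OF rel0] by (intro sub_diff[OF A_sub]) auto
      show "v \<notin> m"
      proof
        assume "v \<in> m"
        hence "v + \<mu>0 t0 \<in> m" using 0 by (intro is_ideal_add[OF mI]) auto
        thus False using 0 by (simp add: v_def)
      qed
    qed
    have v_eq: "\<phi> v * \<delta> t0 = (\<Sum>i<d. \<phi> (c0 i) * \<delta> (f i)) + (\<Sum>t\<in>T. \<phi> (\<mu>0 t) * \<delta> t)"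
      if dd: "gder A \<phi> \<delta>" for \<phi> \<delta>
    proof -
      have "\<phi> v = \<phi> u0 - \<phi> (\<mu>0 t0)" unfolding v_def using 0 mA diff_rel_u[OF rel0] by (intro gd_\<phi>_diff[OF A_sub dd]) auto
      thus ?thesis using diff_rel_eq[OF rel0 dd] insert(1,2) by (simp add: left_diff_distrib)
    qed
    show ?case
    proof (rule insert.IH)
      show "T \<subseteq> S" "s \<in> S" using insert.prems by auto
      fix s assume s: "s \<in> S"
      from insert.prems(2)[OF s] obtain u c \<mu> where 1: "u \<notin> m" "\<forall>t\<in>insert t0 T. \<mu> t \<in> m"
        and rel: "diff_rel A d f (insert t0 T) u c \<mu> s" by (elim exE conjE)
      define c' where "c' i = v * c i + \<mu> t0 * c0 i" for i
      define \<mu>' where "\<mu>' t = v * \<mu> t + \<mu> t0 * \<mu>0 t" for t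
      have \<mu>A: "\<mu> t \<in> A" "\<mu>0 t \<in> A" if "t \<in> insert t0 T" for t using that 0 1 mA by auto
      have "\<phi> (v * u) * \<delta> s = (\<Sum>i<d. \<phi> (c' i) * \<delta> (f i)) + (\<Sum>t\<in>T. \<phi> (\<mu>' t) * \<delta> t)"
        if dd: "gder A \<phi> \<delta>" for \<phi> \<delta>
      proof -
        have "\<phi> (v * u) * \<delta> s = \<phi> v * (\<phi> u * \<delta> s)"
          using v diff_rel_u[OF rel] by (simp add: gd_\<phi>_mult[OF A_sub dd] mult.assoc)
        also have "\<phi> u * \<delta> s = (\<Sum>i<d. \<phi> (c i) * \<delta> (f i)) + (\<Sum>t\<in>T. \<phi> (\<mu> t) * \<delta> t) + \<phi> (\<mu> t0) * \<delta> t0"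
          using diff_rel_eq[OF rel dd] insert(1,2) by simp
        also have "\<phi> v * ((\<Sum>i<d. \<phi> (c i) * \<delta> (f i)) + (\<Sum>t\<in>T. \<phi> (\<mu> t) * \<delta> t) + \<phi> (\<mu> t0) * \<delta> t0) =
          \<phi> v * (\<Sum>i<d. \<phi> (c i) * \<delta> (f i)) + \<phi> v * (\<Sum>t\<in>T. \<phi> (\<mu> t) * \<delta> t) + \<phi> (\<mu> t0) * (\<phi> v * \<delta> t0)"
          by (simp add: algebra_simps)
        also have "\<dots> = (\<Sum>i<d. \<phi> (c' i) * \<delta> (f i)) + (\<Sum>t\<in>T. \<phi> (\<mu>' t) * \<delta> t)"
        proof -
          have "\<phi> (c' i) = \<phi> v * \<phi> (c i) + \<phi> (\<mu> t0) * \<phi> (c0 i)" if "i < d" for i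
            unfolding c'_def using v \<mu>A diff_rel_c[OF rel that] diff_rel_c[OF rel0 that]
            by (simp add: gd_\<phi>_add[OF A_sub dd] gd_\<phi>_mult[OF A_sub dd] sub_mult[OF A_sub])
          hence c': "(\<Sum>i<d. \<phi> (c' i) * \<delta> (f i)) =
              \<phi> v * (\<Sum>i<d. \<phi> (c i) * \<delta> (f i)) + \<phi> (\<mu> t0) * (\<Sum>i<d. \<phi> (c0 i) * \<delta> (f i))"
            by (simp add: sum_distrib_left sum.distrib distrib_right mult.assoc)
          have "\<phi> (\<mu>' t) = \<phi> v * \<phi> (\<mu> t) + \<phi> (\<mu> t0) * \<phi> (\<mu>0 t)" if "t \<in> T" for t
            unfolding \<mu>'_def using that v \<mu>A
            by (simp add: gd_\<phi>_add[OF A_sub dd] gd_\<phi>_mult[OF A_sub dd] sub_mult[OF A_sub])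
          hence \<mu>': "(\<Sum>t\<in>T. \<phi> (\<mu>' t) * \<delta> t) =
              \<phi> v * (\<Sum>t\<in>T. \<phi> (\<mu> t) * \<delta> t) + \<phi> (\<mu> t0) * (\<Sum>t\<in>T. \<phi> (\<mu>0 t) * \<delta> t)"
            by (simp add: sum_distrib_left sum.distrib distrib_right mult.assoc)
          show ?thesis unfolding v_eq[OF dd] c' \<mu>' by (simp add: algebra_simps)
        qed
        finally show ?thesis .
      qed
      moreover have "v * u \<in> A" by (rule sub_mult[OF A_sub v(1) diff_rel_u[OF rel]])
      moreover have "\<forall>i<d. c' i \<in> A" unfolding c'_def using v \<mu>A diff_rel_c[OF rel] diff_rel_c[OF rel0]
        by (auto intro!: sub_add[OF A_sub] sub_mult[OF A_sub])
      ultimately have "diff_rel A d f T (v * u) c' \<mu>' s" by (simp add: diff_rel_def)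
      moreover have "v * u \<notin> m" using v 1(1) diff_rel_u[OF rel] m unfolding is_prime_def by blast
      moreover have "\<forall>t\<in>T. \<mu>' t \<in> m" unfolding \<mu>'_def using v(1) 0(2) 1(2) \<mu>A
        by (auto intro!: is_ideal_add[OF mI] is_ideal_mult[OF mI])
      ultimately show "\<exists>u c \<mu>. u \<notin> m \<and> (\<forall>t\<in>T. \<mu> t \<in> m) \<and> diff_rel A d f T u c \<mu> s" by blast
    qed
  qed
qed

text \<open>Each generator is, up to a constant, a combination of the \<open>f i\<close> plus an
  element of the square of the maximal ideal. By \<open>chain_rule_sq\<close> its differential is a
  combination of those of the \<open>f i\<close> plus an error with coefficients in the maximal
  ideal, which elimination removes. The product of the finitely many denominators serves all
  generators, and then all of \<open>A\<close>.\<close>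

lemma local_coordinates:
  assumes \<phi>0: "point A \<phi>0" and sp: "spans_cotangent A \<phi>0 d f"
  shows "\<exists>u\<in>A. \<phi>0 u \<noteq> 0 \<and> (\<forall>q\<in>A. \<exists>c \<mu>. diff_rel A d f {} u c \<mu> q)"
proof -
  let ?m = "kernel A \<phi>0"
  have m: "is_prime A ?m" by (rule is_prime_kernel[OF A_sub \<phi>0])
  hence mI: "is_ideal A ?m" by (simp add: is_prime_def)
  have fA: "f i \<in> A" if "i < d" for i using sp that by (auto simp: spans_cotangent_def kernel_def)
  have eq: "\<exists>u c \<mu>. u \<notin> ?m \<and> (\<forall>t\<in>S. \<mu> t \<in> ?m) \<and> diff_rel A d f S u c \<mu> s" if s: "s \<in> S" for s
  proof -
    have "s - \<iota> (\<phi>0 s) \<in> ?m" using S_sub[OF s]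
      by (simp add: kernel_def pt_diff[OF A_sub \<phi>0] pt_const[OF A_sub \<phi>0] sub_diff[OF A_sub] sub_const[OF A_sub])
    then obtain c where c: "(s - \<iota> (\<phi>0 s)) - (\<Sum>i<d. \<iota> (c i) * f i) \<in> sq A ?m"
      using sp by (auto simp: spans_cotangent_def)
    define w where "w = (s - \<iota> (\<phi>0 s)) - (\<Sum>i<d. \<iota> (c i) * f i)"
    have w: "w \<in> sq A ?m" using c by (simp add: w_def)
    hence wA: "w \<in> A" using is_ideal_subset[OF is_ideal_sq[OF A_sub mI]] by blast
    obtain r where r: "\<forall>s\<in>S. r s \<in> ?m" "\<And>\<phi> \<delta>. gder A \<phi> \<delta> \<Longrightarrow> \<delta> w = (\<Sum>s\<in>S. \<phi> (r s) * \<delta> s)"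
      using chain_rule_sq[OF mI w] by blast
    have "\<phi> 1 * \<delta> s = (\<Sum>i<d. \<phi> (\<iota> (c i)) * \<delta> (f i)) + (\<Sum>t\<in>S. \<phi> (r t) * \<delta> t)" if dd: "gder A \<phi> \<delta>" for \<phi> \<delta>
    proof -
      have fA': "\<iota> (c i) * f i \<in> A" if "i < d" for i using fA[OF that] by (intro sub_mult[OF A_sub] sub_const[OF A_sub])
      hence sA: "(\<Sum>i<d. \<iota> (c i) * f i) \<in> A" by (intro sub_sum[OF A_sub]) auto
      have "s = \<iota> (\<phi>0 s) + ((\<Sum>i<d. \<iota> (c i) * f i) + w)" by (simp add: w_def)
      hence "\<delta> s = \<delta> (\<iota> (\<phi>0 s) + ((\<Sum>i<d. \<iota> (c i) * f i) + w))" by (rule arg_cong)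
      also have "\<dots> = \<delta> (\<Sum>i<d. \<iota> (c i) * f i) + \<delta> w"
        using sA wA by (simp add: gd_add[OF A_sub dd] gd_const[OF A_sub dd] sub_const[OF A_sub] sub_add[OF A_sub])
      also have "\<delta> (\<Sum>i<d. \<iota> (c i) * f i) = (\<Sum>i<d. \<delta> (\<iota> (c i) * f i))"
        using fA' by (intro gd_sum[OF A_sub dd]) auto
      also have "\<dots> = (\<Sum>i<d. \<iota> (c i) * \<delta> (f i))"
        using fA by (intro sum.cong refl gd_scale[OF A_sub dd]) auto
      finally show ?thesis using gd_\<phi>_const[OF A_sub dd] gd_\<phi>_const[OF A_sub dd, of 1] r(2)[OF dd] by simp
    qed
    moreover have "1 \<notin> ?m" using m by (simp add: is_prime_def)
    ultimately have "diff_rel A d f S 1 (\<lambda>i. \<iota> (c i)) r s" "1 \<notin> ?m"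
      using sub_1[OF A_sub] sub_const[OF A_sub] by (simp_all add: diff_rel_def)
    thus ?thesis using r(1) by blast
  qed
  have "\<forall>s\<in>S. \<exists>u c \<mu>. u \<notin> ?m \<and> diff_rel A d f {} u c \<mu> s"
    using eliminate_differentials[OF m subset_refl fA eq] by blast
  from bchoice[OF this] obtain us where "\<forall>s\<in>S. \<exists>c \<mu>. us s \<notin> ?m \<and> diff_rel A d f {} (us s) c \<mu> s" ..
  from bchoice[OF this] obtain cs where P: "\<forall>s\<in>S. \<exists>\<mu>. us s \<notin> ?m \<and> diff_rel A d f {} (us s) (cs s) \<mu> s" ..
  have us: "us s \<in> A" "us s \<notin> ?m" "\<And>i. i < d \<Longrightarrow> cs s i \<in> A"
    "\<And>\<phi> \<delta>. gder A \<phi> \<delta> \<Longrightarrow> \<phi> (us s) * \<delta> s = (\<Sum>i<d. \<phi> (cs s i) * \<delta> (f i))" if "s \<in> S" for s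
  proof -
    from bspec[OF P that] obtain \<mu> where n: "us s \<notin> ?m" and rel: "diff_rel A d f {} (us s) (cs s) \<mu> s"
      by (elim exE conjE)
    show "us s \<in> A" "us s \<notin> ?m" by (rule diff_rel_u[OF rel], rule n)
    show "cs s i \<in> A" if "i < d" for i by (rule diff_rel_c[OF rel that])
    show "\<phi> (us s) * \<delta> s = (\<Sum>i<d. \<phi> (cs s i) * \<delta> (f i))" if "gder A \<phi> \<delta>" for \<phi> \<delta>
      using diff_rel_eq[OF rel that] by simp
  qed
  define u where "u = (\<Prod>s\<in>S. us s)"
  define u' where "u' s = (\<Prod>t\<in>S - {s}. us t)" for s
  have uA: "u \<in> A" unfolding u_def by (intro sub_prod[OF A_sub] us)
  have u'A: "u' s \<in> A" for s unfolding u'_def by (intro sub_prod[OF A_sub]) (auto intro: us)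
  have u_eq: "u = u' s * us s" if "s \<in> S" for s
    unfolding u_def u'_def using S that by (subst prod.remove[of S s]) (auto simp: mult.commute)
  have "\<phi>0 u \<noteq> 0"
  proof -
    have "\<phi>0 u = (\<Prod>s\<in>S. \<phi>0 (us s))" unfolding u_def by (intro pt_prod[OF A_sub \<phi>0] us)
    moreover have "\<phi>0 (us s) \<noteq> 0" if "s \<in> S" for s using us[OF that] by (auto simp: kernel_def)
    ultimately show ?thesis using S by simp
  qed
  moreover have "\<exists>c \<mu>. diff_rel A d f {} u c \<mu> q" if q: "q \<in> A" for q
  proof -
    obtain r where r: "\<forall>s\<in>S. r s \<in> A" "\<And>\<phi> \<delta>. gder A \<phi> \<delta> \<Longrightarrow> \<delta> q = (\<Sum>s\<in>S. \<phi> (r s) * \<delta> s)"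
      using chain_rule[OF q] by blast
    define c where "c i = (\<Sum>s\<in>S. r s * (u' s * cs s i))" for i
    have cA: "c i \<in> A" if "i < d" for i unfolding c_def
      using r(1) that by (intro sub_sum[OF A_sub] sub_mult[OF A_sub] u'A us) auto
    have "\<phi> u * \<delta> q = (\<Sum>i<d. \<phi> (c i) * \<delta> (f i))" if dd: "gder A \<phi> \<delta>" for \<phi> \<delta>
    proof -
      have "\<phi> u * \<delta> q = (\<Sum>s\<in>S. \<phi> (r s) * (\<phi> u * \<delta> s))"
        by (simp add: r(2)[OF dd] sum_distrib_left ac_simps)
      also have "\<dots> = (\<Sum>s\<in>S. \<Sum>i<d. \<phi> (r s * (u' s * cs s i)) * \<delta> (f i))"
      proof (intro sum.cong refl)
        fix s assume s: "s \<in> S"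
        have "\<phi> u * \<delta> s = \<phi> (u' s) * (\<phi> (us s) * \<delta> s)"
          unfolding u_eq[OF s] using us(1)[OF s] u'A by (simp add: gd_\<phi>_mult[OF A_sub dd] mult.assoc)
        also have "\<dots> = (\<Sum>i<d. \<phi> (u' s) * (\<phi> (cs s i) * \<delta> (f i)))"
          by (simp add: us(4)[OF s dd] sum_distrib_left)
        finally have "\<phi> (r s) * (\<phi> u * \<delta> s) = (\<Sum>i<d. \<phi> (r s) * (\<phi> (u' s) * (\<phi> (cs s i) * \<delta> (f i))))"
          by (simp add: sum_distrib_left)
        also have "\<dots> = (\<Sum>i<d. \<phi> (r s * (u' s * cs s i)) * \<delta> (f i))"
        proof (intro sum.cong refl)
          fix i assume "i \<in> {..<d}"
          hence "cs s i \<in> A" "r s \<in> A" using us(3)[OF s] r(1) s by auto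
          thus "\<phi> (r s) * (\<phi> (u' s) * (\<phi> (cs s i) * \<delta> (f i))) = \<phi> (r s * (u' s * cs s i)) * \<delta> (f i)"
            using u'A by (simp add: gd_\<phi>_mult[OF A_sub dd] sub_mult[OF A_sub] mult.assoc)
        qed
        finally show "\<phi> (r s) * (\<phi> u * \<delta> s) = (\<Sum>i<d. \<phi> (r s * (u' s * cs s i)) * \<delta> (f i))" .
      qed
      also have "\<dots> = (\<Sum>i<d. \<Sum>s\<in>S. \<phi> (r s * (u' s * cs s i)) * \<delta> (f i))" by (rule sum.swap)
      also have "\<dots> = (\<Sum>i<d. \<phi> (c i) * \<delta> (f i))"
      proof (intro sum.cong refl)
        fix i assume "i \<in> {..<d}"
        hence "r s * (u' s * cs s i) \<in> A" if "s \<in> S" for s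
          using us(3)[OF that] r(1) that u'A by (auto intro!: sub_mult[OF A_sub])
        thus "(\<Sum>s\<in>S. \<phi> (r s * (u' s * cs s i)) * \<delta> (f i)) = \<phi> (c i) * \<delta> (f i)"
          by (simp add: c_def gd_\<phi>_sum[OF A_sub dd] sum_distrib_right)
      qed
      finally show ?thesis .
    qed
    with cA uA show ?thesis unfolding diff_rel_def by (intro exI[of _ c]) simp
  qed
  ultimately show ?thesis using uA by (intro bexI[of _ u]) auto
qed

text \<open>If the \<open>f i - f i(\<phi>)\<close> do not span the cotangent space at \<open>\<phi>\<close>, there is a nonzero tangent
  vector annihilating them.\<close>

lemma spans_cotangent_nearby:
  assumes \<phi>: "point A \<phi>" and f: "\<And>i. i < d \<Longrightarrow> f i \<in> A" and u: "u \<in> A" "\<phi> u \<noteq> 0"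
    and loc: "\<And>q. q \<in> A \<Longrightarrow> \<exists>c \<mu>. diff_rel A d f {} u c \<mu> q"
  shows "spans_cotangent A \<phi> d (\<lambda>i. f i - \<iota> (\<phi> (f i)))"
proof -
  let ?m = "kernel A \<phi>" and ?f = "\<lambda>i. f i - \<iota> (\<phi> (f i))"
  have mI: "is_ideal A ?m" by (rule is_ideal_kernel[OF A_sub \<phi>])
  have sqI: "is_ideal A (sq A ?m)" by (rule is_ideal_sq[OF A_sub mI])
  have km: "q - \<iota> (\<phi> q) \<in> ?m" if "q \<in> A" for q using that
    by (simp add: kernel_def pt_diff[OF A_sub \<phi>] pt_const[OF A_sub \<phi>] sub_diff[OF A_sub] sub_const[OF A_sub])
  define X where "X = cot A ?m d ?f"
  note X_def = X_def[unfolded cot_def]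
  have X: "V.subspace X" and sqX: "sq A ?m \<subseteq> X" and fX: "\<And>j. j < d \<Longrightarrow> ?f j \<in> X"
    using subspace_cot[OF A_sub mI] sq_cot[OF A_sub mI] gen_cot[OF A_sub mI, where f = ?f] by (simp_all add: \<open>X = cot A ?m d ?f\<close>)
  have X_ker: "\<phi> q = 0" if qX: "q \<in> X" for q
  proof -
    obtain c where "q - (\<Sum>i<d. \<iota> (c i) * ?f i) \<in> sq A ?m" using qX unfolding X_def by blast
    hence "q - (\<Sum>i<d. \<iota> (c i) * ?f i) \<in> ?m" using sq_subset[OF A_sub mI] by blast
    moreover have "(\<Sum>i<d. \<iota> (c i) * ?f i) \<in> ?m"
      using f by (intro is_ideal_sum[OF mI] is_ideal_mult[OF mI] km sub_const[OF A_sub]) auto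
    ultimately have "(q - (\<Sum>i<d. \<iota> (c i) * ?f i)) + (\<Sum>i<d. \<iota> (c i) * ?f i) \<in> ?m" by (rule is_ideal_add[OF mI])
    thus ?thesis by (simp add: kernel_def)
  qed
  have mX: "q \<in> X" if q: "q \<in> ?m" for q
  proof (rule ccontr)
    assume qX: "q \<notin> X"
    have qA: "q \<in> A" "\<phi> q = 0" using q by (auto simp: kernel_def)
    \<comment> \<open>The functional \<psi> is built to vanish on constants, on the square of the
      kernel and on the translated \<open>f i\<close>, but not at \<open>q\<close>. The first two
      properties make it a tangent vector at \<phi>.\<close>
    define Y where "Y = insert 1 (X \<inter> A)"
    have XAs: "V.subspace (X \<inter> A)"
    proof (intro V.subspace_inter X)
      show "V.subspace A" by (rule V.subspaceI) (auto intro: sub_0[OF A_sub] sub_add[OF A_sub] sub_mult[OF A_sub] sub_const[OF A_sub])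
    qed
    have qY: "q \<notin> V.span Y"
    proof
      assume "q \<in> V.span Y"
      then obtain k where k: "q - \<iota> k * 1 \<in> V.span (X \<inter> A)" unfolding Y_def V.span_insert by blast
      hence "q - \<iota> k * 1 \<in> X \<inter> A" using V.span_eq_iff[THEN iffD2, OF XAs] by (simp only:)
      hence "\<phi> (q - \<iota> k) = 0" using X_ker by simp
      hence "k = 0" using qA by (simp add: pt_diff[OF A_sub \<phi>] pt_const[OF A_sub \<phi>] sub_const[OF A_sub])
      thus False using \<open>q - \<iota> k * 1 \<in> X \<inter> A\<close> qX by simp
    qed
    obtain B where B: "B \<subseteq> Y" "V.independent B" "Y \<subseteq> V.span B"
      using V.maximal_independent_subset[of Y] by blast
    have "V.span B \<subseteq> V.span Y" by (rule V.span_mono[OF B(1)])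
    hence "q \<notin> V.span B" using qY by blast
    hence iq: "V.independent (insert q B)" "q \<notin> B" using B(2) V.independent_insert V.span_base by auto
    interpret VP: vector_space_pair "\<lambda>c f. \<iota> c * f" "\<lambda>c f. \<iota> c * f" ..
    obtain \<psi> where \<psi>: "Vector_Spaces.linear (\<lambda>c f. \<iota> c * f) (\<lambda>c f. \<iota> c * f) \<psi>"
      "\<forall>v\<in>insert q B. \<psi> v = (if v = q then 1 else 0)"
      using VP.linear_independent_extend[OF iq(1), of "\<lambda>v. if v = q then 1 else 0"] by blast
    interpret \<psi>: Vector_Spaces.linear "\<lambda>c f. \<iota> c * f" "\<lambda>c f. \<iota> c * f" \<psi> by fact
    have \<psi>Y: "\<psi> v = 0" if "v \<in> Y" for v
    proof -
      have "v \<in> V.span B" using B(3) that by blast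
      thus ?thesis
      proof (induction rule: V.span_induct_alt)
        case (step c u w)
        thus ?case using \<psi>(2) iq(2) by (auto simp: \<psi>.add \<psi>.scale)
      qed (simp add: \<psi>.zero)
    qed
    have \<psi>1: "\<psi> 1 = 0" by (rule \<psi>Y) (simp add: Y_def)
    have \<psi>c: "\<psi> (\<iota> c) = 0" for c using \<psi>.scale[of c 1] \<psi>1 by simp
    have \<psi>sq: "\<psi> w = 0" if "w \<in> sq A ?m" for w
      using that sqX is_ideal_subset[OF sqI] by (intro \<psi>Y) (auto simp: Y_def)
    define \<phi>' where "\<phi>' p = \<iota> (\<phi> p)" for p
    have dd: "gder A \<phi>' \<psi>" unfolding gder_def
    proof (intro conjI allI ballI)
      show "\<phi>' (\<iota> c) = \<iota> c" "\<psi> (\<iota> c) = 0" for c by (simp_all add: \<phi>'_def pt_const[OF A_sub \<phi>] \<psi>c)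
      fix p r assume pr: "p \<in> A" "r \<in> A"
      show "\<phi>' (p + r) = \<phi>' p + \<phi>' r" "\<phi>' (p * r) = \<phi>' p * \<phi>' r"
        using pr by (simp_all add: \<phi>'_def pt_add[OF A_sub \<phi>] pt_mult[OF A_sub \<phi>] \<iota>_add \<iota>_mult)
      show "\<psi> (p + r) = \<psi> p + \<psi> r" by (rule \<psi>.add)
      \<comment> \<open>Expanding both factors around the point reduces the Leibniz rule to the
        vanishing of \<psi> on constants and on the square of the kernel.\<close>
      have e: "p * r = (p - \<phi>' p) * (r - \<phi>' r) + \<iota> (\<phi> p) * r + \<iota> (\<phi> r) * p - \<iota> (\<phi> p * \<phi> r)"
        by (simp add: \<phi>'_def \<iota>_mult algebra_simps)
      have "(p - \<phi>' p) * (r - \<phi>' r) \<in> sq A ?m" unfolding \<phi>'_def by (intro sq_prod km pr)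
      thus "\<psi> (p * r) = \<phi>' p * \<psi> r + \<phi>' r * \<psi> p"
        unfolding e \<psi>.diff \<psi>.add \<psi>.scale \<psi>c by (simp add: \<psi>sq \<phi>'_def)
    qed
    obtain c \<mu> where rel: "diff_rel A d f {} u c \<mu> q" using loc[OF qA(1)] by blast
    have c: "\<phi>' u * \<psi> q = (\<Sum>i<d. \<phi>' (c i) * \<psi> (f i))" using diff_rel_eq[OF rel dd] by simp
    have "\<psi> (f i) = 0" if "i < d" for i
    proof -
      have "?f i \<in> Y" using fX[OF that] f[OF that] by (auto simp: Y_def intro: sub_diff[OF A_sub] sub_const[OF A_sub])
      hence "\<psi> (?f i) = 0" by (rule \<psi>Y)
      thus ?thesis by (simp add: \<psi>.diff \<psi>c)
    qed
    hence "\<phi>' u * \<psi> q = 0" using c by simp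
    thus False using u(2) \<psi>(2) by (simp add: \<phi>'_def)
  qed
  show ?thesis unfolding spans_cotangent_def
  proof (intro conjI allI impI ballI)
    show "?f i \<in> ?m" if "i < d" for i using f[OF that] by (rule km)
    show "\<exists>c. q - (\<Sum>i<d. \<iota> (c i) * ?f i) \<in> sq A ?m" if "q \<in> ?m" for q
      using mX[OF that] unfolding X_def by (rule CollectD)
  qed
qed

end

end

section \<open>The cotangent space as a vector space inside a quotient ring\<close>

context complex_algebra
begin

context
  fixes A J assumes A: "subalg A" and J: "is_ideal A J"
begin

abbreviation "cs f \<equiv> a_r_coset (ring_on A) J f"

lemma J_ideal: "ideal J (ring_on A)" using ideal_ring_on[OF A] J by simp

lemma quotient_ring: "ring (ring_on A Quot J)" by (rule ideal.quotient_is_ring[OF J_ideal])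

lemma cs_image: "cs f = (\<lambda>h. h + f) ` J" by (auto simp: a_r_coset_def')

lemma cs_eq: "f \<in> A \<Longrightarrow> g \<in> A \<Longrightarrow> cs f = cs g \<longleftrightarrow> f - g \<in> J"
proof
  assume "cs f = cs g"
  moreover have "f \<in> cs f" using is_ideal_0[OF J] by (auto simp: cs_image intro!: image_eqI[of _ _ 0])
  ultimately show "f - g \<in> J" by (auto simp: cs_image)
next
  assume fg: "f - g \<in> J"
  have 1: "cs f \<subseteq> cs g" if "f - g \<in> J" for f g
  proof
    fix k assume "k \<in> cs f"
    then obtain h where "h \<in> J" "k = h + f" by (auto simp: cs_image)
    hence "h + (f - g) \<in> J" "k = (h + (f - g)) + g" using is_ideal_add[OF J] that by auto
    thus "k \<in> cs g" unfolding cs_image by blast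
  qed
  have "g - f \<in> J" using is_ideal_uminus[OF A J fg] by simp
  thus "cs f = cs g" using 1 fg by blast
qed

lemma quotient_simps:
  "zero (ring_on A Quot J) = J"
  "f \<in> A \<Longrightarrow> cs f \<in> carrier (ring_on A Quot J)"
  "f \<in> A \<Longrightarrow> g \<in> A \<Longrightarrow> add (ring_on A Quot J) (cs f) (cs g) = cs (f + g)"
  "f \<in> A \<Longrightarrow> g \<in> A \<Longrightarrow> mult (ring_on A Quot J) (cs f) (cs g) = cs (f * g)"
  using ideal.a_rcos_sum[OF J_ideal, of f g] ideal.rcoset_mult_add[OF J_ideal, of f g]
  by (auto simp: FactRing_def A_RCOSETS_def')

lemma quotient_carrier: "v \<in> carrier (ring_on A Quot J) \<Longrightarrow> \<exists>f\<in>A. v = cs f"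
  by (auto simp: FactRing_def A_RCOSETS_def')

lemma cs_0: "cs 0 = J" by (auto simp: cs_image)

definition lin_comb :: "nat \<Rightarrow> (nat \<Rightarrow> 'f) \<Rightarrow> 'f set set" where
  "lin_comb d f = range (\<lambda>a. cs (\<Sum>i<d. \<iota> (a i) * f i))"

lemma lin_comb_Suc:
  assumes f: "\<And>i. i < Suc d \<Longrightarrow> f i \<in> A"
  shows "ring.line_extension (ring_on A Quot J) (range (\<lambda>c. cs (\<iota> c))) (cs (f d)) (lin_comb d f) = lin_comb (Suc d) f"
proof -
  interpret Q: ring "ring_on A Quot J" by (rule quotient_ring)
  have s: "(\<Sum>i<d. \<iota> (a i) * f i) \<in> A" for a
    using f by (intro sub_sum[OF A] sub_mult[OF A] sub_const[OF A]) auto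
  have e: "add (ring_on A Quot J) (mult (ring_on A Quot J) (cs (\<iota> c)) (cs (f d))) (cs (\<Sum>i<d. \<iota> (a i) * f i))
      = cs (\<iota> c * f d + (\<Sum>i<d. \<iota> (a i) * f i))" for a c
    using f[of d] s by (simp add: quotient_simps sub_const[OF A] sub_mult[OF A])
  show ?thesis
  proof (intro equalityI subsetI)
    fix u assume "u \<in> ring.line_extension (ring_on A Quot J) (range (\<lambda>c. cs (\<iota> c))) (cs (f d)) (lin_comb d f)"
    then obtain c a where u: "u = cs (\<iota> c * f d + (\<Sum>i<d. \<iota> (a i) * f i))"
      unfolding Q.line_extension_mem_iff lin_comb_def e[symmetric] by blast
    have "(\<Sum>i<Suc d. \<iota> ((a(d := c)) i) * f i) = \<iota> c * f d + (\<Sum>i<d. \<iota> (a i) * f i)" by (simp add: add.commute)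
    hence "u = cs (\<Sum>i<Suc d. \<iota> ((a(d := c)) i) * f i)" using u by (simp only:)
    thus "u \<in> lin_comb (Suc d) f" unfolding lin_comb_def by (rule range_eqI[where x = "a(d := c)"])
  next
    fix u assume "u \<in> lin_comb (Suc d) f"
    then obtain a where "u = cs (\<Sum>i<Suc d. \<iota> (a i) * f i)" by (auto simp: lin_comb_def)
    hence "u = cs (\<iota> (a d) * f d + (\<Sum>i<d. \<iota> (a i) * f i))" by (simp add: add.commute)
    thus "u \<in> ring.line_extension (ring_on A Quot J) (range (\<lambda>c. cs (\<iota> c))) (cs (f d)) (lin_comb d f)"
      unfolding Q.line_extension_mem_iff lin_comb_def e[symmetric] by blast
  qed
qed

lemma lin_comb_cong: "(\<And>i. i < d \<Longrightarrow> f i = g i) \<Longrightarrow> lin_comb d f = lin_comb d g"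
  unfolding lin_comb_def by (auto intro!: arg_cong[of _ _ range] arg_cong[of _ _ cs] sum.cong ext)

lemma dimension_imp_lin_comb:
  assumes "ring.dimension (ring_on A Quot J) d (range (\<lambda>c. cs (\<iota> c))) E"
  shows "\<exists>f. (\<forall>i<d. f i \<in> A) \<and> E = lin_comb d f"
proof -
  interpret Q: ring "ring_on A Quot J" by (rule quotient_ring)
  show ?thesis using assms
  proof (induction d "range (\<lambda>c. cs (\<iota> c))" E rule: Q.dimension.induct)
    case zero_dim
    show ?case by (intro exI[of _ "\<lambda>_. 0"]) (simp add: lin_comb_def cs_0 quotient_simps)
  next
    case (Suc_dim v E d)
    then obtain f where f: "\<forall>i<d. f i \<in> A" "E = lin_comb d f" by blast
    obtain g where g: "g \<in> A" "v = cs g" using quotient_carrier Suc_dim by blast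
    have "lin_comb d f = lin_comb d (f(d := g))" by (rule lin_comb_cong) simp
    moreover have "(f(d := g)) i \<in> A" if "i < Suc d" for i using f g that by (auto simp: less_Suc_eq)
    ultimately show ?case using lin_comb_Suc[of d "f(d := g)"] f g by (intro exI[of _ "f(d := g)"]) simp
  qed
qed

lemma lin_comb_dimension:
  assumes f: "\<And>i. i < d \<Longrightarrow> f i \<in> A"
    and indep: "\<And>a i. (\<Sum>i<d. \<iota> (a i) * f i) \<in> J \<Longrightarrow> i < d \<Longrightarrow> a i = 0"
  shows "ring.dimension (ring_on A Quot J) d (range (\<lambda>c. cs (\<iota> c))) (lin_comb d f)" using assms
proof (induction d)
  interpret Q: ring "ring_on A Quot J" by (rule quotient_ring)
  case 0
  have "lin_comb 0 f = {zero (ring_on A Quot J)}" by (auto simp: lin_comb_def cs_0 quotient_simps)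
  thus ?case using Q.zero_dim by simp
next
  case (Suc d)
  interpret Q: ring "ring_on A Quot J" by (rule quotient_ring)
  have fA: "f i \<in> A" if "i < d" for i using Suc.prems(1) that by simp
  have s: "(\<Sum>i<d. \<iota> (a i) * f i) \<in> A" for a
    using fA by (intro sub_sum[OF A] sub_mult[OF A] sub_const[OF A]) auto
  have "a i = 0" if "(\<Sum>i<d. \<iota> (a i) * f i) \<in> J" "i < d" for a i
    using Suc.prems(2)[of "a(d := 0)" i] that by simp
  hence IH: "ring.dimension (ring_on A Quot J) d (range (\<lambda>c. cs (\<iota> c))) (lin_comb d f)"
    using Suc.IH fA by blast
  have "cs (f d) \<notin> lin_comb d f"
  proof
    assume "cs (f d) \<in> lin_comb d f"
    then obtain a where "cs (\<Sum>i<d. \<iota> (a i) * f i) = cs (f d)" unfolding lin_comb_def by auto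
    hence "(\<Sum>i<d. \<iota> (a i) * f i) - f d \<in> J" using cs_eq[OF s Suc.prems(1)] by simp
    moreover have "(\<Sum>i<Suc d. \<iota> ((a(d := -1)) i) * f i) = (\<Sum>i<d. \<iota> (a i) * f i) - f d"
      by (simp add: \<iota>.hom_uminus)
    ultimately have "(\<Sum>i<Suc d. \<iota> ((a(d := -1)) i) * f i) \<in> J" by simp
    from Suc.prems(2)[OF this, of d] show False by simp
  qed
  hence "ring.dimension (ring_on A Quot J) (Suc d) (range (\<lambda>c. cs (\<iota> c)))
      (ring.line_extension (ring_on A Quot J) (range (\<lambda>c. cs (\<iota> c))) (cs (f d)) (lin_comb d f))"
    using Q.Suc_dim IH quotient_simps(2)[OF Suc.prems(1)] by blast
  thus ?case using lin_comb_Suc[of d f] Suc.prems(1) by simp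
qed

end

context
  fixes A \<phi> Z assumes A: "subalg A" and \<phi>: "point A \<phi>" and Z: "vanishing_ideal A Z = {0}"
begin

private abbreviation "m \<equiv> kernel A \<phi>"

lemma cotangent_dim_iff: "cotangent_dim \<iota> A Z m d \<longleftrightarrow>
   ring.dimension (ring_on A Quot sq A m) d (range (\<lambda>c. a_r_coset (ring_on A) (sq A m) (\<iota> c)))
     ((\<lambda>f. a_r_coset (ring_on A) (sq A m) f) ` m)"
proof -
  have "ideal_prod (ring_on A) m m <+>\<^bsub>ring_on A\<^esub> vanishing_ideal A Z = sq A m"
    unfolding Z sq_def set_add_def' by auto
  thus ?thesis by (simp add: cotangent_dim_def Let_def)
qed

lemma m_ideal: "is_ideal A m" by (rule is_ideal_kernel[OF A \<phi>])

lemma sq_ideal: "is_ideal A (sq A m)" by (rule is_ideal_sq[OF A m_ideal])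

lemma cotangent_dim_spans:
  assumes "cotangent_dim \<iota> A Z m d"
  shows "\<exists>f. spans_cotangent A \<phi> d f"
proof -
  obtain f where f: "\<forall>i<d. f i \<in> A" "(\<lambda>f. a_r_coset (ring_on A) (sq A m) f) ` m = lin_comb A (sq A m) d f"
    using dimension_imp_lin_comb[OF A sq_ideal] assms unfolding cotangent_dim_iff by blast
  have s: "(\<Sum>i<d. \<iota> (a i) * f i) \<in> A" for a
    using f by (intro sub_sum[OF A] sub_mult[OF A] sub_const[OF A]) auto
  have mA: "q \<in> A" if "q \<in> m" for q using is_ideal_subset[OF m_ideal] that by blast
  have "f i \<in> m" if i: "i < d" for i
  proof -
    have "(\<Sum>j<d. \<iota> (if j = i then 1 else 0) * f j) = (\<Sum>j<d. if j = i then f i else 0)"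
      by (intro sum.cong) auto
    hence "(\<Sum>j<d. \<iota> (if j = i then 1 else 0) * f j) = f i" using i by simp
    hence "a_r_coset (ring_on A) (sq A m) (f i) \<in> lin_comb A (sq A m) d f"
      unfolding lin_comb_def[OF A sq_ideal] by (intro range_eqI[of _ _ "\<lambda>j. if j = i then 1 else 0"]) (simp only:)
    then obtain h where h: "h \<in> m" "a_r_coset (ring_on A) (sq A m) (f i) = a_r_coset (ring_on A) (sq A m) h"
      using f(2) by blast
    hence "f i - h \<in> sq A m" using cs_eq[OF A sq_ideal] f i mA by blast
    hence "f i - h \<in> m" using sq_subset[OF A m_ideal] by blast
    hence "(f i - h) + h \<in> m" using h by (intro is_ideal_add[OF m_ideal])
    thus ?thesis by simp
  qed
  moreover have "\<exists>c. q - (\<Sum>i<d. \<iota> (c i) * f i) \<in> sq A m" if q: "q \<in> m" for q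
  proof -
    have "a_r_coset (ring_on A) (sq A m) q \<in> lin_comb A (sq A m) d f" using f(2) q by blast
    then obtain c where "a_r_coset (ring_on A) (sq A m) q = a_r_coset (ring_on A) (sq A m) (\<Sum>i<d. \<iota> (c i) * f i)"
      unfolding lin_comb_def[OF A sq_ideal] by blast
    thus ?thesis using cs_eq[OF A sq_ideal] mA[OF q] s by blast
  qed
  ultimately show ?thesis by (auto simp: spans_cotangent_def)
qed

lemma spans_cotangent_dim:
  assumes f: "spans_cotangent A \<phi> d f"
    and indep: "\<And>a i. (\<Sum>i<d. \<iota> (a i) * f i) \<in> sq A m \<Longrightarrow> i < d \<Longrightarrow> a i = 0"
  shows "cotangent_dim \<iota> A Z m d"
proof -
  have mA: "q \<in> A" if "q \<in> m" for q using is_ideal_subset[OF m_ideal] that by blast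
  have fm: "f i \<in> m" if "i < d" for i using f that by (auto simp: spans_cotangent_def)
  have s: "(\<Sum>i<d. \<iota> (a i) * f i) \<in> m" for a
    using fm by (intro is_ideal_sum[OF m_ideal] is_ideal_mult[OF m_ideal] sub_const[OF A]) auto
  have "(\<lambda>f. a_r_coset (ring_on A) (sq A m) f) ` m = lin_comb A (sq A m) d f"
  proof (intro equalityI subsetI)
    fix u assume "u \<in> (\<lambda>f. a_r_coset (ring_on A) (sq A m) f) ` m"
    then obtain q where q: "q \<in> m" "u = a_r_coset (ring_on A) (sq A m) q" by blast
    then obtain c where "q - (\<Sum>i<d. \<iota> (c i) * f i) \<in> sq A m" using f by (auto simp: spans_cotangent_def)
    hence "u = a_r_coset (ring_on A) (sq A m) (\<Sum>i<d. \<iota> (c i) * f i)"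
      using cs_eq[OF A sq_ideal] mA q s by blast
    thus "u \<in> lin_comb A (sq A m) d f" unfolding lin_comb_def[OF A sq_ideal] by blast
  next
    fix u assume "u \<in> lin_comb A (sq A m) d f"
    thus "u \<in> (\<lambda>f. a_r_coset (ring_on A) (sq A m) f) ` m"
      unfolding lin_comb_def[OF A sq_ideal] using s by blast
  qed
  thus ?thesis unfolding cotangent_dim_iff
    using lin_comb_dimension[OF A sq_ideal, of d f] indep fm mA by simp
qed

end

end

section \<open>Existence of points\<close>

context complex_algebra
begin

lemma max_spec_point:
  assumes "finitely_generated_algebra \<iota> A" "m \<in> max_spec A"
  obtains \<phi> where "point A \<phi>" "m = kernel A \<phi>"
  using point_value_at[OF assms] kernel_value_at[OF assms] that by metis

lemma exists_max_spec:
  assumes A: "subalg A" and I: "is_ideal A I" "1 \<notin> I"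
  shows "\<exists>m\<in>max_spec A. I \<subseteq> m"
proof -
  let ?F = "{K. is_ideal A K \<and> I \<subseteq> K \<and> 1 \<notin> K}"
  have "\<exists>M\<in>?F. \<forall>K\<in>?F. M \<subseteq> K \<longrightarrow> K = M"
  proof (rule subset_Zorn_nonempty)
    show "?F \<noteq> {}" using I by blast
    fix C assume C: "C \<noteq> {}" "subset.chain ?F C"
    have CF: "K \<in> ?F" if "K \<in> C" for K using C(2) that by (auto simp: subset.chain_def)
    have CI: "is_ideal A K" if "K \<in> C" for K using CF[OF that] by simp
    have ch: "K \<subseteq> K' \<or> K' \<subseteq> K" if "K \<in> C" "K' \<in> C" for K K'
      using C(2) that by (auto simp: subset.chain_def)
    obtain K0 where K0: "K0 \<in> C" using C by blast
    have "is_ideal A (\<Union>C)" unfolding is_ideal_def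
    proof (intro conjI ballI)
      show "\<Union>C \<subseteq> A" using is_ideal_subset[OF CI] by blast
      show "0 \<in> \<Union>C" using is_ideal_0[OF CI[OF K0]] K0 by blast
      fix f assume "f \<in> \<Union>C"
      then obtain K where K: "K \<in> C" "f \<in> K" by blast
      show "f + g \<in> \<Union>C" if "g \<in> \<Union>C" for g
      proof -
        obtain K' where K': "K' \<in> C" "g \<in> K'" using \<open>g \<in> \<Union>C\<close> by blast
        hence "f \<in> K' \<or> g \<in> K" using ch K by blast
        thus ?thesis using is_ideal_add[OF CI[OF K(1)]] is_ideal_add[OF CI[OF K'(1)]] K K' by blast
      qed
      show "g * f \<in> \<Union>C" if "g \<in> A" for g using is_ideal_mult[OF CI[OF K(1)] K(2) that] K(1) by blast
    qed
    moreover have "I \<subseteq> \<Union>C" using CF[OF K0] K0 by blast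
    moreover have "1 \<notin> \<Union>C" using CF by blast
    ultimately show "\<Union>C \<in> ?F" by simp
  qed
  then obtain M where MF: "M \<in> ?F" and maxF: "\<forall>K\<in>?F. M \<subseteq> K \<longrightarrow> K = M" by (elim bexE)
  have M: "is_ideal A M" "I \<subseteq> M" "1 \<notin> M" using MF by auto
  have max: "K = M" if "is_ideal A K" "1 \<notin> K" "M \<subseteq> K" for K
    using maxF that subset_trans[OF M(2) that(3)] by simp
  have "maximalideal M (ring_on A)"
  proof (rule maximalidealI)
    show "ideal M (ring_on A)" using ideal_ring_on[OF A] M by simp
    show "carrier (ring_on A) \<noteq> M" using M sub_1[OF A] by auto
    fix K assume K: "ideal K (ring_on A)" "M \<subseteq> K" "K \<subseteq> carrier (ring_on A)"
    hence KI: "is_ideal A K" using ideal_ring_on[OF A] by simp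
    show "K = M \<or> K = carrier (ring_on A)"
    proof (cases "1 \<in> K")
      case True thus ?thesis using is_ideal_1[OF A KI] by simp
    next
      case False thus ?thesis using max[OF KI False K(2)] by simp
    qed
  qed
  thus ?thesis using M by (auto simp: max_spec_def)
qed

lemma point_subset: "point B \<phi> \<Longrightarrow> A \<subseteq> B \<Longrightarrow> point A \<phi>" unfolding point_def by blast

text \<open>A maximal ideal of \<open>A[1/f]\<close> restricts to a point at which \<open>f\<close> does not vanish.\<close>

lemma point_nonvanishing:
  assumes fg: "finitely_generated_algebra \<iota> A" and f: "f \<in> A" "f \<noteq> 0"
  shows "\<exists>\<phi>. point A \<phi> \<and> \<phi> f \<noteq> 0"
proof -
  obtain S where S: "finite S" "A = alg S" using fg by (auto simp: finitely_generated_algebra_def)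
  define B where "B = alg (insert (inverse f) S)"
  have B: "subalg B" unfolding B_def by (rule subalg_generated)
  have fgB: "finitely_generated_algebra \<iota> B"
    unfolding finitely_generated_algebra_def B_def using S(1) by blast
  have "p \<in> B" if "p \<in> alg S" for p using that by (induction rule: generated_algebra.induct)
       (auto simp: B_def intro: generated_algebra.intros)
  hence AB: "A \<subseteq> B" using S by blast
  have "is_ideal B {0}" using sub_0[OF B] by (simp add: is_ideal_def)
  then obtain m where m: "m \<in> max_spec B" using exists_max_spec[OF B, of "{0}"] by auto
  obtain \<phi> where \<phi>: "point B \<phi>" using max_spec_point[OF fgB m] by blast
  have "inverse f \<in> B" unfolding B_def by (intro generated_algebra.gen) simp
  moreover have "f \<in> B" using f AB by blast
  ultimately have "\<phi> f * \<phi> (inverse f) = 1"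
    using pt_mult[OF B \<phi>, of f "inverse f"] pt_1[OF B \<phi>] f by simp
  thus ?thesis using point_subset[OF \<phi> AB] by (metis mult_zero_left zero_neq_one)
qed

text \<open>For the whole spectrum the ideal \<open>I\<close> in the cotangent space and in the
  local dimension is thus zero, and both become notions about the algebra itself.\<close>

lemma vanishing_ideal_max_spec:
  assumes fg: "finitely_generated_algebra \<iota> A"
  shows "vanishing_ideal A (max_spec A) = {0}"
proof -
  have A: "subalg A" using fg subalg_generated by (auto simp: finitely_generated_algebra_def)
  have "f = 0" if f: "f \<in> A" "\<forall>m\<in>max_spec A. f \<in> m" for f
  proof (rule ccontr)
    assume "f \<noteq> 0"
    then obtain \<phi> where \<phi>: "point A \<phi>" "\<phi> f \<noteq> 0" using point_nonvanishing[OF fg f(1)] by blast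
    have "f \<in> kernel A \<phi>" using f(2) kernel_max_spec[OF A \<phi>(1)] by blast
    thus False using \<phi>(2) by (simp add: kernel_def)
  qed
  moreover have "0 \<in> m" if "m \<in> max_spec A" for m
    using max_spec_prime[OF A that] is_ideal_0 by (auto simp: is_prime_def)
  ultimately show ?thesis using sub_0[OF A] by (auto simp: vanishing_ideal_def)
qed

end

section \<open>Determinants of families\<close>

definition dt :: "nat \<Rightarrow> (nat \<Rightarrow> nat \<Rightarrow> 'a::comm_ring_1) \<Rightarrow> 'a" where
  "dt n f = Determinant.det (Matrix.mat n n (\<lambda>(i, j). f i j))"

lemma dt_congruence:
  "dt n (\<lambda>i j. \<Sum>a<n. \<Sum>c<n. P i a * T a c * P j c) = (dt n P)\<^sup>2 * dt n T"
proof -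
  let ?P = "Matrix.mat n n (\<lambda>(i, j). P i j)" and ?T = "Matrix.mat n n (\<lambda>(i, j). T i j)"
  have "Matrix.mat n n (\<lambda>(i, j). \<Sum>a<n. \<Sum>c<n. P i a * T a c * P j c) = ?P * (?T * transpose_mat ?P)"
    by (intro eq_matI) (simp_all add: scalar_prod_def sum_distrib_left mult.assoc atLeast0LessThan)
  moreover have "Determinant.det (transpose_mat ?P) = Determinant.det ?P" by (rule det_transpose) auto
  moreover have "Determinant.det (?P * (?T * transpose_mat ?P)) = Determinant.det ?P * Determinant.det (?T * transpose_mat ?P)"
    by (rule det_mult[of _ n]) auto
  moreover have "Determinant.det (?T * transpose_mat ?P) = Determinant.det ?T * Determinant.det (transpose_mat ?P)"
    by (rule det_mult[of _ n]) auto
  ultimately show ?thesis unfolding dt_def by (simp add: power2_eq_square)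
qed

lemma dt_cong: "(\<And>i j. i < n \<Longrightarrow> j < n \<Longrightarrow> f i j = g i j) \<Longrightarrow> dt n f = dt n g"
  unfolding dt_def by (intro arg_cong[of _ _ Determinant.det] eq_matI) auto

lemma dt_eq_0_iff:
  fixes f :: "nat \<Rightarrow> nat \<Rightarrow> 'a::idom"
  shows "dt n f = 0 \<longleftrightarrow> (\<exists>v. (\<exists>i<n. v i \<noteq> 0) \<and> (\<forall>i<n. (\<Sum>j<n. f i j * v j) = 0))"
proof -
  let ?f = "Matrix.mat n n (\<lambda>(i, j). f i j)"
  have "dt n f = 0 \<longleftrightarrow> (\<exists>v. v \<in> carrier_vec n \<and> v \<noteq> 0\<^sub>v n \<and> ?f *\<^sub>v v = 0\<^sub>v n)"
    unfolding dt_def by (rule det_0_iff_vec_prod_zero) auto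
  also have "\<dots> \<longleftrightarrow> (\<exists>v. (\<exists>i<n. v i \<noteq> 0) \<and> (\<forall>i<n. (\<Sum>j<n. f i j * v j) = 0))"
  proof
    assume "\<exists>v. v \<in> carrier_vec n \<and> v \<noteq> 0\<^sub>v n \<and> ?f *\<^sub>v v = 0\<^sub>v n"
    then obtain v where v: "v \<in> carrier_vec n" "v \<noteq> 0\<^sub>v n" "?f *\<^sub>v v = 0\<^sub>v n" by blast
    have "\<exists>i<n. vec_index v i \<noteq> 0" using v(1,2) by (auto simp: vec_eq_iff)
    moreover have "(\<Sum>j<n. f i j * vec_index v j) = 0" if i: "i < n" for i
    proof -
      have "vec_index (?f *\<^sub>v v) i = 0" using v(3) i by simp
      thus ?thesis using i v(1) by (simp add: scalar_prod_def atLeast0LessThan)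
    qed
    ultimately show "\<exists>v. (\<exists>i<n. v i \<noteq> 0) \<and> (\<forall>i<n. (\<Sum>j<n. f i j * v j) = 0)" by (intro exI[of _ "vec_index v"]) simp
  next
    assume "\<exists>v. (\<exists>i<n. v i \<noteq> 0) \<and> (\<forall>i<n. (\<Sum>j<n. f i j * v j) = 0)"
    then obtain v where v: "\<exists>i<n. v i \<noteq> 0" "\<forall>i<n. (\<Sum>j<n. f i j * v j) = 0" by blast
    show "\<exists>v. v \<in> carrier_vec n \<and> v \<noteq> 0\<^sub>v n \<and> ?f *\<^sub>v v = 0\<^sub>v n"
      using v by (intro exI[of _ "Matrix.vec n v"]) (auto simp: vec_eq_iff scalar_prod_def atLeast0LessThan)
  qed
  finally show ?thesis .
qed

lemma dt_of_int: "dt n (\<lambda>i j. of_int (f i j)) = (of_int (dt n f) :: 'a::comm_ring_1)"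
proof -
  have "Matrix.mat n n (\<lambda>(i, j). of_int (f i j) :: 'a) = map_mat of_int (Matrix.mat n n (\<lambda>(i, j). f i j))"
    by (intro eq_matI) auto
  thus ?thesis unfolding dt_def by simp
qed

lemma dt_smult: "dt n (\<lambda>i j. c * f i j) = c ^ n * dt n f"
proof -
  have "Matrix.mat n n (\<lambda>(i, j). c * f i j) = c \<cdot>\<^sub>m Matrix.mat n n (\<lambda>(i, j). f i j)" by (intro eq_matI) auto
  thus ?thesis unfolding dt_def by simp
qed

lemma dt_diag: "dt n (\<lambda>i j. if i = j then y i else 0) = (\<Prod>i<n. y i)"
proof -
  have "dt n (\<lambda>i j. if i = j then y i else 0) = prod_list (diag_mat (Matrix.mat n n (\<lambda>(i, j). if i = j then y i else 0)))"
    unfolding dt_def by (rule det_upper_triangular[of _ n]) (auto intro!: upper_triangularI)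
  also have "\<dots> = (\<Prod>i<n. y i)" by (simp add: prod_list_diag_prod atLeast0LessThan)
  finally show ?thesis .
qed

lemma dt_adjugate:
  assumes 0: "0 \<in> A" "1 \<in> A" and add: "\<And>p q. p \<in> A \<Longrightarrow> q \<in> A \<Longrightarrow> p + q \<in> A"
    and mult: "\<And>p q. p \<in> A \<Longrightarrow> q \<in> A \<Longrightarrow> p * q \<in> A" and uminus: "\<And>p. p \<in> A \<Longrightarrow> - p \<in> A"
    and f: "\<And>i j. i < n \<Longrightarrow> j < n \<Longrightarrow> f i j \<in> A"
  shows "dt n f \<in> A"
    and "\<exists>a. \<forall>i<n. \<forall>k<n. a i k \<in> A \<and> (\<Sum>j<n. a i j * f j k) = (if i = k then dt n f else 0)"
proof -
  have prod: "prod h I \<in> A" if "\<And>i. i \<in> I \<Longrightarrow> h i \<in> A" for h I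
    using that by (induction I rule: infinite_finite_induct) (auto intro: 0 mult)
  have sum: "sum h I \<in> A" if "\<And>i. i \<in> I \<Longrightarrow> h i \<in> A" for h I
    using that by (induction I rule: infinite_finite_induct) (auto intro: 0 add)
  have det: "Determinant.det M \<in> A" if M: "M \<in> carrier_mat m m" "\<And>i j. i < m \<Longrightarrow> j < m \<Longrightarrow> index_mat M (i, j) \<in> A" for M m
    unfolding det_def'[OF M(1)]
  proof (intro sum mult prod M(2))
    show "signof p \<in> A" for p :: "nat \<Rightarrow> nat" using 0 uminus by (auto simp: sign_def)
    show "i < m" if "i \<in> {0..<m}" for i using that by simp
    show "p i < m" if "p \<in> {p. p permutes {0..<m}}" "i \<in> {0..<m}" for p i
      using that permutes_in_image[of p "{0..<m}" i] by auto
  qed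
  let ?f = "Matrix.mat n n (\<lambda>(i, j). f i j)"
  show "dt n f \<in> A" unfolding dt_def by (intro det[of _ n]) (auto intro: f)
  have co: "cofactor ?f i j \<in> A" if "i < n" "j < n" for i j
  proof -
    have "(- 1) ^ k \<in> A" for k :: nat by (induction k) (auto intro: 0 mult uminus)
    moreover have "Determinant.det (mat_delete ?f i j) \<in> A"
      using that by (intro det[of _ "n - 1"]) (auto simp: mat_delete_def intro!: f)
    ultimately show ?thesis unfolding cofactor_def by (intro mult)
  qed
  show "\<exists>a. \<forall>i<n. \<forall>k<n. a i k \<in> A \<and> (\<Sum>j<n. a i j * f j k) = (if i = k then dt n f else 0)"
  proof (intro exI[of _ "\<lambda>i j. cofactor ?f j i"] allI impI conjI)
    fix i k assume ik: "i < n" "k < n"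
    show "cofactor ?f k i \<in> A" by (intro co ik)
    have "index_mat (adj_mat ?f * ?f) (i, k) = index_mat (Determinant.det ?f \<cdot>\<^sub>m 1\<^sub>m n) (i, k)"
      using adj_mat(3)[of ?f n] by simp
    thus "(\<Sum>j<n. cofactor ?f j i * f j k) = (if i = k then dt n f else 0)"
      using ik by (auto simp: dt_def adj_mat_def scalar_prod_def atLeast0LessThan split: if_splits)
  qed
qed

section \<open>Nonsingularity of the form \<open>Th\<close> on the clusters\<close>

context cluster
begin

lemmas ptU_0 = pt_0[OF subalg_U]
  and ptU_add = pt_add[OF subalg_U]
  and ptU_const = pt_const[OF subalg_U]
  and ptU_diff = pt_diff[OF subalg_U]
  and ptU_mult = pt_mult[OF subalg_U]
  and ptU_power = pt_power[OF subalg_U]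
  and ptU_prod = pt_prod[OF subalg_U]

text \<open>The transposed exchange matrix sends a mutable column of \<Lambda>, up to sign, to a
  multiple of a unit vector. Subtracting suitable multiples of such columns from a multiple of any
  unit vector leaves an element of the kernel lattice; \<Delta>, the product of the
  \<open>d j\<close>, clears the denominators.\<close>

lemma spanning:
  assumes y: "y \<in> {1..N}"
  shows "\<exists>\<Delta> c c'. \<Delta> \<noteq> 0 \<and> (\<forall>k\<in>{1..N}. (if k = y then \<Delta> else 0) =
    (\<Sum>j=1..N. c j * \<Lambda> j k) + (\<Sum>p=1..n. c' p * \<nu> p k))"
proof -
  obtain d where d: "\<forall>j\<in>ex. d j > 0"
    "\<forall>j\<in>ex. \<forall>k\<in>{1..N}. (\<Sum>i=1..N. b i j * \<Lambda> i k) = (if k = j then d j else 0)" using compat_d by blast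
  have fin: "finite ex" using ex finite_subset by blast
  define \<Delta> where "\<Delta> = prod d ex"
  define e where "e j = prod d (ex - {j})" for j
  have de: "d j * e j = \<Delta>" if "j \<in> ex" for j
    unfolding \<Delta>_def e_def using prod.remove[OF fin that, of d] by simp
  have \<Delta>: "\<Delta> \<noteq> 0" using d(1) fin by (auto simp: \<Delta>_def)
  define w where "w k = (if k = y then \<Delta> else 0) - (\<Sum>j\<in>ex. e j * b y j * \<Lambda> k j)" for k
  have "(\<Sum>i=1..N. b i j * w i) = 0" if j: "j \<in> ex" for j
  proof -
    have "(\<Sum>i=1..N. b i j * w i) = (\<Sum>i=1..N. b i j * (if i = y then \<Delta> else 0)) -
       (\<Sum>i=1..N. \<Sum>j'\<in>ex. e j' * b y j' * (b i j * \<Lambda> i j'))"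
      by (simp add: w_def right_diff_distrib sum_subtractf sum_distrib_left ac_simps)
    also have "(\<Sum>i=1..N. b i j * (if i = y then \<Delta> else 0)) = (\<Sum>i=1..N. if i = y then b y j * \<Delta> else 0)"
      by (intro sum.cong) auto
    also have "\<dots> = b y j * \<Delta>" using y by simp
    also have "(\<Sum>i=1..N. \<Sum>j'\<in>ex. e j' * b y j' * (b i j * \<Lambda> i j')) =
       (\<Sum>j'\<in>ex. e j' * b y j' * (\<Sum>i=1..N. b i j * \<Lambda> i j'))"
      by (subst sum.swap) (simp only: sum_distrib_left)
    also have "\<dots> = (\<Sum>j'\<in>ex. if j' = j then e j * b y j * d j else 0)"
    proof (intro sum.cong refl)
      fix j' assume "j' \<in> ex"
      hence "(\<Sum>i=1..N. b i j * \<Lambda> i j') = (if j' = j then d j else 0)" using d(2) j ex by blast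
      thus "e j' * b y j' * (\<Sum>i=1..N. b i j * \<Lambda> i j') = (if j' = j then e j * b y j * d j else 0)" by simp
    qed
    also have "\<dots> = b y j * \<Delta>" using j fin de[OF j] by (simp add: ac_simps)
    finally show ?thesis by simp
  qed
  hence "restrict w {1..N} \<in> kernel_lattice N ex b" by (simp add: kernel_lattice_def)
  then obtain c' where c': "\<forall>k\<in>{1..N}. restrict w {1..N} k = (\<Sum>p=1..n. c' p * \<nu> p k)"
    using basis unfolding kernel_basis_def by blast
  define c where "c j = (if j \<in> ex then - (e j * b y j) else 0)" for j
  have "(if k = y then \<Delta> else 0) = (\<Sum>j=1..N. c j * \<Lambda> j k) + (\<Sum>p=1..n. c' p * \<nu> p k)"
    if k: "k \<in> {1..N}" for k
  proof -
    have "(\<Sum>j=1..N. c j * \<Lambda> j k) = (\<Sum>j\<in>ex. c j * \<Lambda> j k)"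
      using ex by (intro sum.mono_neutral_right) (auto simp: c_def)
    also have "\<dots> = (\<Sum>j\<in>ex. e j * b y j * \<Lambda> k j)"
    proof (intro sum.cong refl)
      fix j assume "j \<in> ex"
      thus "c j * \<Lambda> j k = e j * b y j * \<Lambda> k j" using \<Lambda>_skew[of k j] k ex by (auto simp: c_def)
    qed
    also have "\<dots> = (if k = y then \<Delta> else 0) - w k" by (simp add: w_def)
    finally have "(\<Sum>j=1..N. c j * \<Lambda> j k) = (if k = y then \<Delta> else 0) - w k" .
    moreover have "w k = (\<Sum>p=1..n. c' p * \<nu> p k)" using c' k by simp
    ultimately show ?thesis by linarith
  qed
  thus ?thesis using \<Delta> by blast
qed

text \<open>The matrix of \<open>Th\<close> in the Euler derivations, see
  \<open>Th_eq\<close>.\<close>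

definition K :: "exmatrix" where
  "K a c = \<Lambda> a c + (\<Sum>p=1..n. \<nu> p a * \<nu> p c)"

text \<open>Pairing \<open>K v\<close> with \<open>v\<close> leaves a sum of squares of integers, so
  \<open>v\<close> is orthogonal to every \<nu> p. Then \<Lambda> kills \<open>v\<close> too, and
  \<open>spanning\<close> applies.\<close>

lemma K_kernel:
  fixes v :: "nat \<Rightarrow> int"
  assumes K: "\<And>a. a \<in> {1..N} \<Longrightarrow> (\<Sum>c=1..N. K a c * v c) = 0" and y: "y \<in> {1..N}"
  shows "v y = 0"
proof -
  define s where "s p = (\<Sum>c=1..N. \<nu> p c * v c)" for p
  define t where "t = (\<Sum>a=1..N. \<Sum>c=1..N. v a * \<Lambda> a c * v c)"
  have Kv: "(\<Sum>c=1..N. K a c * v c) = (\<Sum>c=1..N. \<Lambda> a c * v c) + (\<Sum>p=1..n. \<nu> p a * s p)" for a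
  proof -
    have "(\<Sum>c=1..N. K a c * v c) = (\<Sum>c=1..N. \<Lambda> a c * v c) + (\<Sum>c=1..N. \<Sum>p=1..n. \<nu> p a * (\<nu> p c * v c))"
      by (simp add: K_def distrib_right sum.distrib sum_distrib_right mult.assoc)
    also have "(\<Sum>c=1..N. \<Sum>p=1..n. \<nu> p a * (\<nu> p c * v c)) = (\<Sum>p=1..n. \<nu> p a * s p)"
      by (subst sum.swap) (simp only: s_def sum_distrib_left)
    finally show ?thesis .
  qed
  have "t = (\<Sum>a=1..N. \<Sum>c=1..N. - (v c * \<Lambda> c a * v a))" unfolding t_def
  proof (intro sum.cong refl)
    fix a c assume "a \<in> {1..N}" "c \<in> {1..N}"
    thus "v a * \<Lambda> a c * v c = - (v c * \<Lambda> c a * v a)" using \<Lambda>_skew[of a c] by (simp add: ac_simps)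
  qed
  also have "\<dots> = - t" unfolding t_def by (subst sum.swap) (simp add: sum_negf)
  finally have t0: "t = 0" by simp
  have "0 = (\<Sum>a=1..N. v a * (\<Sum>c=1..N. K a c * v c))" using K by simp
  also have "\<dots> = t + (\<Sum>a=1..N. \<Sum>p=1..n. s p * (\<nu> p a * v a))"
  proof -
    have "v a * (\<Sum>c=1..N. K a c * v c) =
        (\<Sum>c=1..N. v a * \<Lambda> a c * v c) + (\<Sum>p=1..n. s p * (\<nu> p a * v a))" for a
      unfolding Kv distrib_left sum_distrib_left by (simp add: ac_simps)
    thus ?thesis by (simp only: t_def sum.distrib)
  qed
  also have "(\<Sum>a=1..N. \<Sum>p=1..n. s p * (\<nu> p a * v a)) = (\<Sum>p=1..n. s p * s p)"
    by (subst sum.swap) (simp only: s_def[symmetric] sum_distrib_left[symmetric])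
  finally have "(\<Sum>p=1..n. s p * s p) = 0" using t0 by simp
  hence s: "s p = 0" if "p \<in> {1..n}" for p
    using that sum_nonneg_eq_0_iff[of "{1..n}" "\<lambda>p. s p * s p"] by auto
  have \<Lambda>v: "(\<Sum>k=1..N. \<Lambda> a k * v k) = 0" if "a \<in> {1..N}" for a using Kv[of a] K[OF that] s by simp
  obtain \<Delta> c c' where sp: "\<Delta> \<noteq> 0" "\<forall>k\<in>{1..N}. (if k = y then \<Delta> else 0) =
    (\<Sum>j=1..N. c j * \<Lambda> j k) + (\<Sum>p=1..n. c' p * \<nu> p k)" using spanning[OF y] by blast
  have "\<Delta> * v y = (\<Sum>k=1..N. (if k = y then \<Delta> else 0) * v k)"
  proof -
    have "(\<Sum>k=1..N. (if k = y then \<Delta> else 0) * v k) = (\<Sum>k=1..N. if k = y then \<Delta> * v y else 0)"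
      by (intro sum.cong) auto
    thus ?thesis using y by simp
  qed
  also have "\<dots> = (\<Sum>k=1..N. ((\<Sum>j=1..N. c j * \<Lambda> j k) + (\<Sum>p=1..n. c' p * \<nu> p k)) * v k)"
    using sp(2) by (intro sum.cong refl) (simp only:)
  also have "\<dots> = (\<Sum>k=1..N. \<Sum>j=1..N. c j * (\<Lambda> j k * v k)) + (\<Sum>k=1..N. \<Sum>p=1..n. c' p * (\<nu> p k * v k))"
    by (simp only: distrib_right sum.distrib sum_distrib_right mult.assoc)
  also have "(\<Sum>k=1..N. \<Sum>j=1..N. c j * (\<Lambda> j k * v k)) = (\<Sum>j=1..N. c j * (\<Sum>k=1..N. \<Lambda> j k * v k))"
    by (subst sum.swap) (simp only: sum_distrib_left)
  also have "\<dots> = 0" using \<Lambda>v by (intro sum.neutral) auto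
  also have "(\<Sum>k=1..N. \<Sum>p=1..n. c' p * (\<nu> p k * v k)) = (\<Sum>p=1..n. c' p * s p)"
    by (subst sum.swap) (simp only: s_def sum_distrib_left)
  also have "\<dots> = 0" using s by (intro sum.neutral) auto
  finally show ?thesis using sp(1) by simp
qed

lemma dt_K: "dt N (\<lambda>a c. K (Suc a) (Suc c)) \<noteq> 0"
proof
  assume "dt N (\<lambda>a c. K (Suc a) (Suc c)) = 0"
  then obtain v where v: "\<exists>i<N. v i \<noteq> 0" "\<forall>a<N. (\<Sum>c<N. K (Suc a) (Suc c) * v c) = 0"
    unfolding dt_eq_0_iff by blast
  have "(\<Sum>c=1..N. K a c * v (c - 1)) = 0" if "a \<in> {1..N}" for a
  proof -
    have "(\<Sum>c=1..N. K a c * v (c - 1)) = (\<Sum>c<N. K a (Suc c) * v c)" by (simp add: sum.atLeast1_atMost_eq)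
    moreover from that obtain a' where "a = Suc a'" "a' < N" by (cases a) auto
    ultimately show ?thesis using v(2) by simp
  qed
  hence "v (y - 1) = 0" if "y \<in> {1..N}" for y using K_kernel[of "\<lambda>c. v (c - 1)"] that by blast
  hence "v i = 0" if "i < N" for i using that by (metis Suc_le_eq atLeastAtMost_iff diff_Suc_1 le_add1 plus_1_eq_Suc)
  thus False using v(1) by blast
qed

definition Th :: "'f \<Rightarrow> 'f \<Rightarrow> 'f" where
  "Th f g = br f g + (\<Sum>p=1..n. Ed p f * Ed p g)"

lemma derivation_Th: "derivation (Th f)" and derivation_Th': "derivation (\<lambda>f. Th f g)"
proof -
  have "derivation (\<lambda>g. Ed p f * Ed p g)" "derivation (\<lambda>f. Ed p g * Ed p f)" for p f g
    by (intro derivation_smult derivation_Ed)+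
  thus "derivation (Th f)" "derivation (\<lambda>f. Th f g)"
    unfolding Th_def by (auto simp: mult.commute[of _ "Ed _ g"] intro!: derivation_add derivation_sum derivation_br)
qed

lemma Th_U: "f \<in> U \<Longrightarrow> g \<in> U \<Longrightarrow> Th f g \<in> U" unfolding Th_def by (intro U_add br_U U_sum U_mult Ed_U) auto

lemma Th_eq: "Th f g = (\<Sum>a<N. \<Sum>c<N. E (Suc a) f * of_int (K (Suc a) (Suc c)) * E (Suc c) g)"
proof -
  have "Ed p f * Ed p g = (\<Sum>a=1..N. \<Sum>c=1..N. E a f * of_int (\<nu> p a * \<nu> p c) * E c g)" for p
    unfolding Ed_def logder_eq_sum[of "\<lambda>k. of_int (\<nu> p k)"] sum_product
    by (intro sum.cong refl) (simp add: ac_simps)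
  hence "Th f g = (\<Sum>a=1..N. \<Sum>c=1..N. E a f * of_int (\<Lambda> a c) * E c g) +
      (\<Sum>p=1..n. \<Sum>a=1..N. \<Sum>c=1..N. E a f * of_int (\<nu> p a * \<nu> p c) * E c g)"
    unfolding Th_def pbr_def by (simp add: ac_simps)
  also have "(\<Sum>p=1..n. \<Sum>a=1..N. \<Sum>c=1..N. E a f * of_int (\<nu> p a * \<nu> p c) * E c g) =
     (\<Sum>a=1..N. \<Sum>c=1..N. E a f * of_int (\<Sum>p=1..n. \<nu> p a * \<nu> p c) * E c g)"
  proof -
    have "(\<Sum>p=1..n. \<Sum>a=1..N. \<Sum>c=1..N. E a f * of_int (\<nu> p a * \<nu> p c) * E c g) =
      (\<Sum>a=1..N. \<Sum>p=1..n. \<Sum>c=1..N. E a f * of_int (\<nu> p a * \<nu> p c) * E c g)" by (rule sum.swap)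
    also have "\<dots> = (\<Sum>a=1..N. \<Sum>c=1..N. \<Sum>p=1..n. E a f * of_int (\<nu> p a * \<nu> p c) * E c g)"
      by (intro sum.cong refl sum.swap)
    finally show ?thesis by (simp only: of_int_sum sum_distrib_left sum_distrib_right)
  qed
  finally have "Th f g = (\<Sum>a=1..N. \<Sum>c=1..N. E a f * of_int (K a c) * E c g)"
    by (simp add: K_def distrib_left distrib_right sum.distrib)
  thus ?thesis by (simp add: sum.atLeast1_atMost_eq)
qed

lemma dt_Th:
  "dt N (\<lambda>i j. Th (f i) (f j)) = (dt N (\<lambda>i a. E (Suc a) (f i)))\<^sup>2 * of_int (dt N (\<lambda>a c. K (Suc a) (Suc c)))"
  unfolding Th_eq dt_congruence dt_of_int ..

lemma der_cluster_zero:
  assumes y: "y \<in> clusters" and D: "derivation D" and 0: "\<And>i. i \<in> {1..N} \<Longrightarrow> D (y i) = 0" and i: "i \<in> {1..N}"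
  shows "D (x i) = 0" using y
proof (cases rule: cluster_cases)
  case 1 thus ?thesis using 0 i by simp
next
  case (2 k)
  have k: "k \<in> {1..N}" using 2 ex by auto
  have 0: "D (x j) = 0" if "j \<in> {1..N}" "j \<noteq> k" for j using 0[of j] 2 that by simp
  show ?thesis
  proof (cases "i = k")
    case True
    have e: "exch N b x k \<noteq> 0" using exch_nz 2 by blast
    have "D (exch N b x k) = 0"
    proof -
      have p: "D (lmon N x a) = 0" if "a k = 0" for a using that
        by (subst der_lmon[OF D, where y = x and c = "\<lambda>i. if i = k then D (x k) / x k else 0"])
           (auto simp: 0 x_nz if_distrib cong: if_cong)
      have "posp b k k = 0" "negp b k k = 0" using b_diag[OF 2(1)] by (simp_all add: posp_def negp_def)
      thus ?thesis unfolding exch_def by (simp add: der_add[OF D] p)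
    qed
    moreover have "x k * y k = exch N b x k" using 2 x_nz[OF k] by simp
    ultimately have "x k * D (y k) + y k * D (x k) = 0" using der_mult[OF D, of "x k" "y k"] by simp
    hence "y k * D (x k) = 0" using assms(3)[OF k] by simp
    thus ?thesis using cluster_nz[OF y k] True by simp
  qed (use 0 i in simp)
qed

text \<open>A vanishing Jacobian yields a nonzero derivation killing all variables of the cluster,
  and by the exchange relation it kills those of the initial cluster as well.\<close>

lemma dt_E_cluster:
  assumes y: "y \<in> clusters" shows "dt N (\<lambda>i a. E (Suc a) (y (Suc i))) \<noteq> 0"
proof
  assume "dt N (\<lambda>i a. E (Suc a) (y (Suc i))) = 0"
  then obtain v where v: "\<exists>i<N. v i \<noteq> 0" "\<forall>i<N. (\<Sum>a<N. E (Suc a) (y (Suc i)) * v a) = 0"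
    unfolding dt_eq_0_iff by blast
  define D where "D f = (\<Sum>a<N. v a * E (Suc a) f)" for f
  have D: "derivation D" unfolding D_def by (intro derivation_sum derivation_smult derivation_logder)
  have "D (y i) = 0" if "i \<in> {1..N}" for i
  proof -
    from that obtain i' where "i = Suc i'" "i' < N" by (cases i) auto
    thus ?thesis using v(2) by (simp add: D_def mult.commute)
  qed
  hence Dx: "D (x i) = 0" if "i \<in> {1..N}" for i using der_cluster_zero[OF y D _ that] by blast
  have "v i = 0" if i: "i < N" for i
  proof -
    have "D (x (Suc i)) = (\<Sum>a<N. if a = i then v i * x (Suc i) else 0)"
      unfolding D_def using i by (intro sum.cong refl) (auto simp: logder_x)
    hence "D (x (Suc i)) = v i * x (Suc i)" using i by simp
    thus ?thesis using Dx[of "Suc i"] x_nz[of "Suc i"] i by simp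
  qed
  thus False using v(1) by blast
qed

text \<open>Bracket and torus derivations are diagonal on the cluster, so the Gram matrix is an
  integer matrix multiplied on both sides by the diagonal matrix of the variables. The integer
  determinant is not computed; it is nonzero by comparison with \<open>dt_Th\<close>.\<close>

lemma dt_Th_cluster:
  assumes y: "y \<in> clusters"
  shows "\<exists>c. c \<noteq> 0 \<and> dt N (\<lambda>i j. Th (y (Suc i)) (y (Suc j))) = of_int c * (\<Prod>i=1..N. y i)\<^sup>2"
proof -
  obtain c where c: "\<forall>i\<in>{1..N}. \<forall>j\<in>{1..N}. br (y i) (y j) = of_int (c i j) * y i * y j"
    using br_cluster[OF y] by blast
  have "\<forall>p\<in>{1..n}. \<exists>\<mu>. \<forall>i\<in>{1..N}. Ed p (y i) = of_int (\<mu> i) * y i" using Ed_cluster[OF y] by blast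
  from bchoice[OF this] obtain \<mu> where \<mu>: "\<forall>p\<in>{1..n}. \<forall>i\<in>{1..N}. Ed p (y i) = of_int (\<mu> p i) * y i" by blast
  define C where "C i j = c (Suc i) (Suc j) + (\<Sum>p=1..n. \<mu> p (Suc i) * \<mu> p (Suc j))" for i j
  let ?P = "\<lambda>i j. if i = j then y (Suc i) else 0"
  have "dt N (\<lambda>i j. Th (y (Suc i)) (y (Suc j))) = dt N (\<lambda>i j. \<Sum>a<N. \<Sum>e<N. ?P i a * of_int (C a e) * ?P j e)"
  proof (rule dt_cong)
    fix i j assume ij: "i < N" "j < N"
    have "(\<Sum>a<N. \<Sum>e<N. ?P i a * of_int (C a e) * ?P j e) = (\<Sum>a<N. if a = i then y (Suc i) * of_int (C i j) * y (Suc j) else 0)"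
    proof (intro sum.cong refl)
      fix a
      have "(\<Sum>e<N. ?P i a * of_int (C a e) * ?P j e) = (\<Sum>e<N. if e = j then ?P i a * of_int (C a j) * y (Suc j) else 0)"
        by (intro sum.cong) auto
      thus "(\<Sum>e<N. ?P i a * of_int (C a e) * ?P j e) = (if a = i then y (Suc i) * of_int (C i j) * y (Suc j) else 0)"
        using ij by simp
    qed
    also have "\<dots> = y (Suc i) * of_int (C i j) * y (Suc j)" using ij by simp
    also have "\<dots> = Th (y (Suc i)) (y (Suc j))"
    proof -
      have "br (y (Suc i)) (y (Suc j)) = of_int (c (Suc i) (Suc j)) * y (Suc i) * y (Suc j)" using c ij by auto
      moreover have "(\<Sum>p=1..n. Ed p (y (Suc i)) * Ed p (y (Suc j))) =
          (\<Sum>p=1..n. of_int (\<mu> p (Suc i) * \<mu> p (Suc j)) * (y (Suc i) * y (Suc j)))"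
        using \<mu> ij by (intro sum.cong refl) (auto simp: ac_simps)
      ultimately show ?thesis unfolding Th_def C_def
        by (simp only: of_int_add of_int_sum sum_distrib_right[symmetric]) (simp add: algebra_simps)
    qed
    finally show "Th (y (Suc i)) (y (Suc j)) = (\<Sum>a<N. \<Sum>e<N. ?P i a * of_int (C a e) * ?P j e)" by simp
  qed
  also have "\<dots> = (\<Prod>i<N. y (Suc i))\<^sup>2 * of_int (dt N C)" by (simp only: dt_congruence dt_of_int dt_diag)
  finally have e: "dt N (\<lambda>i j. Th (y (Suc i)) (y (Suc j))) = of_int (dt N C) * (\<Prod>i=1..N. y i)\<^sup>2"
    by (simp add: prod.atLeast1_atMost_eq mult.commute)
  have "dt N (\<lambda>i j. Th (y (Suc i)) (y (Suc j))) \<noteq> 0"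
    unfolding dt_Th using dt_E_cluster[OF y] dt_K by (simp add: of_int_eq_0_F)
  hence "dt N C \<noteq> 0" using e by auto
  thus ?thesis using e by blast
qed

end

section \<open>Smooth points away from the divisors of non-inverted variables\<close>

context cluster
begin

lemma fg_U: "finitely_generated_algebra \<iota> U" using fg by (simp add: U_def)

lemma generators_U: obtains S where "finite S" "U = alg S"
  using fg_U by (auto simp: finitely_generated_algebra_def)

lemma Ninv_N: "i \<in> Ninv \<Longrightarrow> i \<in> {1..N}" and Ninv_ex: "i \<in> Ninv \<Longrightarrow> i \<notin> ex" using Ninv by auto

lemma dt_U: "(\<And>i j. i < m \<Longrightarrow> j < m \<Longrightarrow> f i j \<in> U) \<Longrightarrow> dt m f \<in> U"
  by (rule dt_adjugate(1)) (auto intro: U_0 U_1 U_add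
    U_mult U_uminus)

lemma adjugate_U:
  assumes "\<And>i j. i < m \<Longrightarrow> j < m \<Longrightarrow> f i j \<in> U"
  shows "\<exists>a. \<forall>i<m. \<forall>k<m. a i k \<in> U \<and> (\<Sum>j<m. a i j * f j k) = (if i = k then dt m f else 0)"
  by (rule dt_adjugate(2)) (auto intro: U_0 U_1 U_add
    U_mult U_uminus assms)

lemma good_coordinates:
  assumes \<phi>: "point U \<phi>" and f: "spans_cotangent U \<phi> N f"
  obtains u where "u \<in> U" "\<phi> u \<noteq> 0"
    "\<And>q. q \<in> U \<Longrightarrow> \<exists>c. (\<forall>i<N. c i \<in> U) \<and> (\<forall>\<delta>. derivation \<delta> \<longrightarrow> u * \<delta> q = (\<Sum>i<N. c i * \<delta> (f i)))"
proof -
  obtain S where S: "finite S" "U = alg S" by (rule generators_U)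
  from local_coordinates[OF S(2,1) \<phi> f] obtain u where u: "u \<in> U" "\<phi> u \<noteq> 0"
    and loc: "\<forall>q\<in>U. \<exists>c \<mu>. diff_rel U N f {} u c \<mu> q" by (elim bexE conjE)
  have "\<exists>c. (\<forall>i<N. c i \<in> U) \<and> (\<forall>\<delta>. derivation \<delta> \<longrightarrow> u * \<delta> q = (\<Sum>i<N. c i * \<delta> (f i)))" if q: "q \<in> U" for q
  proof -
    from bspec[OF loc q] obtain c \<mu> where rel: "diff_rel U N f {} u c \<mu> q" by (elim exE)
    have "u * \<delta> q = (\<Sum>i<N. c i * \<delta> (f i))" if "derivation \<delta>" for \<delta>
      using diff_rel_eq[OF rel gder_derivation[OF that]] by simp
    thus ?thesis using diff_rel_c[OF rel] by (intro exI[of _ c]) simp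
  qed
  thus ?thesis using that u by simp
qed

text \<open>The Gram determinant \<open>g\<close> of \<open>Th\<close> at coordinates of a smooth point divides, up to a function
  that is nonzero at this point, the Gram determinant of every cluster, and the latter is a
  monomial. Hence some such function is divisible by \<open>g\<close> in each of the Laurent rings, and
  therefore in \<open>U\<close>.\<close>

lemma dt_Th_nonzero:
  assumes \<phi>: "point U \<phi>" and nz: "\<forall>i\<in>Ninv. \<phi> (x i) \<noteq> 0" and f: "spans_cotangent U \<phi> N f"
  shows "\<phi> (dt N (\<lambda>i j. Th (f i) (f j))) \<noteq> 0"
proof -
  obtain u where u: "u \<in> U" "\<phi> u \<noteq> 0" and loc: "\<And>q. q \<in> U \<Longrightarrow> \<exists>c. (\<forall>i<N. c i \<in> U) \<and>
      (\<forall>\<delta>. derivation \<delta> \<longrightarrow> u * \<delta> q = (\<Sum>i<N. c i * \<delta> (f i)))" by (rule good_coordinates[OF \<phi> f]) blast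
  have fU: "f i \<in> U" if "i < N" for i using f that by (auto simp: spans_cotangent_def kernel_def)
  define g where "g = dt N (\<lambda>i j. Th (f i) (f j))"
  have eq: "\<exists>c. c \<in> U \<and> (u * u) ^ N * dt N (\<lambda>i j. Th (y (Suc i)) (y (Suc j))) = c\<^sup>2 * g" if y: "y \<in> clusters" for y
  proof -
    have "\<forall>j\<in>{..<N}. \<exists>c. (\<forall>i<N. c i \<in> U) \<and> (\<forall>\<delta>. derivation \<delta> \<longrightarrow> u * \<delta> (y (Suc j)) = (\<Sum>i<N. c i * \<delta> (f i)))"
    proof
      fix j assume "j \<in> {..<N}"
      hence "y (Suc j) \<in> U" by (intro cluster_in_U[OF y]) auto
      thus "\<exists>c. (\<forall>i<N. c i \<in> U) \<and> (\<forall>\<delta>. derivation \<delta> \<longrightarrow> u * \<delta> (y (Suc j)) = (\<Sum>i<N. c i * \<delta> (f i)))"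
        by (rule loc)
    qed
    from bchoice[OF this] obtain c where c': "\<forall>j\<in>{..<N}. (\<forall>i<N. c j i \<in> U) \<and>
      (\<forall>\<delta>. derivation \<delta> \<longrightarrow> u * \<delta> (y (Suc j)) = (\<Sum>i<N. c j i * \<delta> (f i)))" ..
    have c: "\<And>j i. j < N \<Longrightarrow> i < N \<Longrightarrow> c j i \<in> U"
      "\<And>j \<delta>. j < N \<Longrightarrow> derivation \<delta> \<Longrightarrow> u * \<delta> (y (Suc j)) = (\<Sum>i<N. c j i * \<delta> (f i))" using c' by simp_all
    have "(u * u) ^ N * dt N (\<lambda>i j. Th (y (Suc i)) (y (Suc j))) = dt N (\<lambda>i j. (u * u) * Th (y (Suc i)) (y (Suc j)))"
      by (rule dt_smult[symmetric])
    also have "\<dots> = dt N (\<lambda>i j. \<Sum>a<N. \<Sum>e<N. c i a * Th (f a) (f e) * c j e)"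
    proof (rule dt_cong)
      fix i j assume ij: "i < N" "j < N"
      have "(u * u) * Th (y (Suc i)) (y (Suc j)) = u * (u * Th (y (Suc i)) (y (Suc j)))" by (rule mult.assoc)
      also have "\<dots> = u * (\<Sum>a<N. c i a * Th (f a) (y (Suc j)))" by (simp only: c(2)[OF ij(1) derivation_Th'])
      also have "\<dots> = (\<Sum>a<N. c i a * (u * Th (f a) (y (Suc j))))" by (simp add: sum_distrib_left ac_simps)
      also have "\<dots> = (\<Sum>a<N. c i a * (\<Sum>e<N. c j e * Th (f a) (f e)))" by (simp only: c(2)[OF ij(2) derivation_Th])
      also have "\<dots> = (\<Sum>a<N. \<Sum>e<N. c i a * Th (f a) (f e) * c j e)" by (simp add: sum_distrib_left ac_simps)
      finally show "(u * u) * Th (y (Suc i)) (y (Suc j)) = (\<Sum>a<N. \<Sum>e<N. c i a * Th (f a) (f e) * c j e)" .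
    qed
    also have "\<dots> = (dt N c)\<^sup>2 * g" unfolding g_def by (rule dt_congruence)
    finally show ?thesis using dt_U[of N c] c(1) by (intro exI[of _ "dt N c"]) simp
  qed
  have u0: "u \<noteq> 0" using u(2) ptU_0[OF \<phi>] by auto
  have gnz: "g \<noteq> 0"
  proof
    assume "g = 0"
    hence "(u * u) ^ N * dt N (\<lambda>i j. Th (x (Suc i)) (x (Suc j))) = 0" using eq[OF x_cluster] by auto
    thus False using dt_Th_cluster[OF x_cluster] u0 x_nz by auto
  qed
  \<comment> \<open>Only the non-inverted variables have to be put into the numerator; the remaining
    ones, collected in \<open>Y\<close> below, are invertible in \<open>L y\<close>.\<close>
  define X where "X = (\<Prod>i\<in>Ninv. x i)"
  define v where "v = (u * u) ^ N * X\<^sup>2"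
  have "v / g \<in> U"
  proof (rule U_I)
    fix y assume y: "y \<in> clusters"
    obtain c where c: "c \<in> U" "(u * u) ^ N * dt N (\<lambda>i j. Th (y (Suc i)) (y (Suc j))) = c\<^sup>2 * g" using eq[OF y] by blast
    obtain z where z: "z \<noteq> 0" "dt N (\<lambda>i j. Th (y (Suc i)) (y (Suc j))) = of_int z * (\<Prod>i=1..N. y i)\<^sup>2"
      using dt_Th_cluster[OF y] by blast
    define Y where "Y = (\<Prod>i\<in>{1..N} - Ninv. y i)"
    have fin: "finite Ninv" using Ninv finite_subset by blast
    have "(\<Prod>i=1..N. y i) = Y * (\<Prod>i\<in>Ninv. y i)"
      unfolding Y_def using Ninv by (intro prod.subset_diff) auto
    also have "(\<Prod>i\<in>Ninv. y i) = X" unfolding X_def using cluster_frozen[OF y] Ninv by (intro prod.cong) auto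
    finally have YX: "(\<Prod>i=1..N. y i) = Y * X" .
    have nzs: "Y \<noteq> 0" "X \<noteq> 0" using cluster_nz[OF y] fin Ninv x_nz unfolding Y_def X_def by auto
    have "v / g = (c * inverse Y)\<^sup>2 * \<iota> (inverse (of_int z))"
    proof -
      have "(u * u) ^ N * (of_int z * (Y * X)\<^sup>2) = c\<^sup>2 * g" using c(2) z(2) YX by simp
      hence "v * (of_int z * Y\<^sup>2) = c\<^sup>2 * g" by (simp add: v_def power_mult_distrib ac_simps)
      hence "v / g = c\<^sup>2 / (of_int z * Y\<^sup>2)" using gnz nzs z(1) by (simp add: field_simps)
      thus ?thesis by (simp add: \<iota>.hom_inverse \<iota>.hom_of_int divide_inverse power_mult_distrib power_inverse ac_simps)
    qed
    also have "\<dots> \<in> L y"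
    proof -
      note A = subalg_L_cluster[OF y]
      have "inverse Y = (\<Prod>i\<in>{1..N} - Ninv. inverse (y i))"
        unfolding Y_def by (rule prod_inversef[symmetric, unfolded comp_def])
      also have "\<dots> \<in> L y" by (intro sub_prod[OF A] inverse_cluster_in_L[OF y]) auto
      finally show ?thesis using U_L[OF y c(1)] by (intro sub_mult[OF A] sub_power[OF A] sub_const[OF A])
    qed
    finally show "v / g \<in> L y" .
  qed
  moreover have gU: "g \<in> U" unfolding g_def by (intro dt_U Th_U fU)
  ultimately have "\<phi> v = \<phi> g * \<phi> (v / g)" using ptU_mult[OF \<phi>, of g "v / g"] gnz by simp
  moreover have "\<phi> v \<noteq> 0"
  proof -
    have xU: "x i \<in> U" if "i \<in> Ninv" for i using x_in_U Ninv that by blast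
    have XU: "X \<in> U" unfolding X_def by (intro U_prod xU)
    have "\<phi> v = (\<phi> u * \<phi> u) ^ N * (\<phi> X)\<^sup>2" unfolding v_def using u(1) XU
      by (simp add: ptU_mult[OF \<phi>] ptU_power[OF \<phi>] U_mult U_power)
    moreover have "\<phi> X \<noteq> 0"
      unfolding X_def using finite_subset[OF Ninv] nz by (subst ptU_prod[OF \<phi> xU]) (simp_all add: prod_zero_iff)
    ultimately show ?thesis using u(2) by simp
  qed
  ultimately show ?thesis by (auto simp: g_def)
qed

text \<open>By \<open>regular_iff_good\<close> this describes the smooth points off the divisors, in
  a form that can be transported to nearby points and along automorphisms.\<close>

definition good :: "('f \<Rightarrow> complex) \<Rightarrow> bool" where
  "good \<phi> \<longleftrightarrow> point U \<phi> \<and> (\<forall>i\<in>Ninv. \<phi> (x i) \<noteq> 0) \<and> (\<exists>f. spans_cotangent U \<phi> N f)"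

text \<open>Derivations dual to the \<open>f i\<close> up to the factor \<open>g\<close>. The clause
  on ideals records that they are combinations, over \<open>U\<close>, of brackets with elements of
  \<open>U\<close> and of the \<open>Ed p\<close>.\<close>

definition dual_ders :: "(nat \<Rightarrow> 'f) \<Rightarrow> (nat \<Rightarrow> 'f \<Rightarrow> 'f) \<Rightarrow> 'f \<Rightarrow> bool" where
  "dual_ders f D g \<longleftrightarrow> g \<in> U \<and> (\<forall>i<N. derivation (D i) \<and> (\<forall>j<N. D i (f j) = (if i = j then g else 0)) \<and>
     (\<forall>J. is_ideal U J \<longrightarrow> (\<forall>h\<in>J. (\<forall>q\<in>U. br q h \<in> J) \<and> (\<forall>p\<in>{1..n}. Ed p h \<in> J)) \<longrightarrow> (\<forall>h\<in>J. D i h \<in> J)))"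

lemma
  assumes "dual_ders f D g"
  shows dual_g: "g \<in> U" and dual_der: "i < N \<Longrightarrow> derivation (D i)"
    and dual_f: "i < N \<Longrightarrow> j < N \<Longrightarrow> D i (f j) = (if i = j then g else 0)"
    and dual_J: "i < N \<Longrightarrow> is_ideal U J \<Longrightarrow> (\<And>h q. h \<in> J \<Longrightarrow> q \<in> U \<Longrightarrow> br q h \<in> J) \<Longrightarrow>
      (\<And>h p. h \<in> J \<Longrightarrow> p \<in> {1..n} \<Longrightarrow> Ed p h \<in> J) \<Longrightarrow> h \<in> J \<Longrightarrow> D i h \<in> J"
  using assms unfolding dual_ders_def by blast+

text \<open>The adjugate of the Gram matrix of the \<open>f i\<close> combines the derivations
  \<open>Th (f j)\<close> into dual ones without division; \<open>g\<close> is the Gram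
  determinant.\<close>

lemma dual_derivations:
  assumes \<phi>: "point U \<phi>" and nz: "\<forall>i\<in>Ninv. \<phi> (x i) \<noteq> 0" and f: "spans_cotangent U \<phi> N f"
  obtains D g where "dual_ders f D g" "\<phi> g \<noteq> 0"
proof -
  have fU: "f i \<in> U" if "i < N" for i using f that by (auto simp: spans_cotangent_def kernel_def)
  define g where "g = dt N (\<lambda>i j. Th (f i) (f j))"
  have TU: "Th (f i) (f j) \<in> U" if "i < N" "j < N" for i j using Th_U fU that by blast
  obtain a where a: "\<And>i k. i < N \<Longrightarrow> k < N \<Longrightarrow> a i k \<in> U"
    "\<And>i k. i < N \<Longrightarrow> k < N \<Longrightarrow> (\<Sum>j<N. a i j * Th (f j) (f k)) = (if i = k then g else 0)"
    using adjugate_U[of N "\<lambda>i j. Th (f i) (f j)"] TU unfolding g_def by blast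
  have gU: "g \<in> U" unfolding g_def by (intro dt_U TU)
  define D where "D i h = (\<Sum>j<N. a i j * Th (f j) h)" for i h
  show ?thesis
  proof (rule that[of D g])
    show "\<phi> g \<noteq> 0" unfolding g_def by (rule dt_Th_nonzero[OF \<phi> nz f])
    show "dual_ders f D g" unfolding dual_ders_def
    proof (intro conjI allI impI ballI)
      show "g \<in> U" by (rule gU)
      show "derivation (D i)" for i unfolding D_def by (intro derivation_sum derivation_smult derivation_Th)
      show "D i (f j) = (if i = j then g else 0)" if "i < N" "j < N" for i j
        unfolding D_def by (rule a(2)[OF that])
      fix i J h assume i: "i < N" and J: "is_ideal U J"
        "\<forall>h\<in>J. (\<forall>q\<in>U. br q h \<in> J) \<and> (\<forall>p\<in>{1..n}. Ed p h \<in> J)" and h: "h \<in> J"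
      show "D i h \<in> J" unfolding D_def Th_def
      proof (intro is_ideal_sum[OF J(1)] is_ideal_mult[OF J(1)] is_ideal_add[OF J(1)])
        show "br (f j) h \<in> J" if "j \<in> {..<N}" for j using J(2) h fU that by simp
        show "Ed p h \<in> J" if "p \<in> {1..n}" for p using J(2) h that by blast
        show "Ed p (f j) \<in> U" if "j \<in> {..<N}" "p \<in> {1..n}" for p j using that by (intro Ed_U fU) auto
        show "a i j \<in> U" if "j \<in> {..<N}" for j using that by (intro a(1) i) simp
      qed
    qed
  qed
qed

lemma is_ideal_self: "is_ideal U U" using subalg_U by (auto simp: is_ideal_def sub_0 sub_add sub_mult)

lemma prime_chain_good:
  assumes \<phi>: "point U \<phi>" and nz: "\<forall>i\<in>Ninv. \<phi> (x i) \<noteq> 0" and f: "spans_cotangent U \<phi> N f"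
    and J: "is_ideal U J" "J \<subseteq> kernel U \<phi>" "\<And>h q. h \<in> J \<Longrightarrow> q \<in> U \<Longrightarrow> br q h \<in> J"
    "\<And>h p. h \<in> J \<Longrightarrow> p \<in> {1..n} \<Longrightarrow> Ed p h \<in> J"
  shows "\<exists>p. (\<forall>i\<le>N. is_prime U (p i) \<and> p i \<subseteq> kernel U \<phi>) \<and> (\<forall>i<N. p i \<subset> p (Suc i)) \<and> J \<subseteq> p 0"
proof -
  obtain D g where D: "dual_ders f D g" "\<phi> g \<noteq> 0" by (rule dual_derivations[OF \<phi> nz f])
  show ?thesis
  proof (rule derivation_prime_chain[where g = g and f = f])
    show "subalg U" "is_prime U (kernel U \<phi>)" by (rule subalg_U, rule is_prime_kernel[OF subalg_U \<phi>])
    show "f i \<in> kernel U \<phi>" if "i < N" for i using f that by (auto simp: spans_cotangent_def)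
    show "g \<notin> kernel U \<phi>" using D(2) by (simp add: kernel_def)
    show "D i h \<in> U" if "i < N" "h \<in> U" for i h
      by (rule dual_J[OF D(1) that(1) is_ideal_self br_U Ed_U that(2)])
    show "D i h \<in> J" if "i < N" "h \<in> J" for i h by (rule dual_J[OF D(1) that(1) J(1) J(3,4) that(2)])
  qed (use dual_der[OF D(1)] dual_f[OF D(1)] J in auto)
qed

lemma is_ideal_zero: "is_ideal U {0}" using U_0 by (simp add: is_ideal_def)

text \<open>There is no room for a nonzero invariant ideal below a chain of primes of length \<open>N\<close>.\<close>

lemma invariant_ideal_zero:
  assumes good: "good \<phi>"
    and J: "is_ideal U J" "J \<subseteq> kernel U \<phi>" "\<And>h q. h \<in> J \<Longrightarrow> q \<in> U \<Longrightarrow> br q h \<in> J"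
    "\<And>h p. h \<in> J \<Longrightarrow> p \<in> {1..n} \<Longrightarrow> Ed p h \<in> J"
  shows "J = {0}"
proof (rule ccontr)
  assume J0: "J \<noteq> {0}"
  have \<phi>: "point U \<phi>" "\<forall>i\<in>Ninv. \<phi> (x i) \<noteq> 0" using good by (auto simp: good_def)
  obtain f where f: "spans_cotangent U \<phi> N f" using good by (auto simp: good_def)
  obtain p where p: "\<forall>i\<le>N. is_prime U (p i) \<and> p i \<subseteq> kernel U \<phi>" "\<forall>i<N. p i \<subset> p (Suc i)" "J \<subseteq> p 0"
    using prime_chain_good[OF \<phi> f J] by blast
  \<comment> \<open>The zero ideal is put below the chain, which then has one step too many.\<close>
  define p' where "p' i = (case i of 0 \<Rightarrow> {0} | Suc k \<Rightarrow> p k)" for i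
  have "Suc N \<le> N"
  proof (rule prime_chain_length[OF subalg_U, where p = p'])
    fix i assume i: "i \<le> Suc N"
    have "is_prime U {0}" using is_ideal_zero by (auto simp: is_prime_def)
    thus "is_prime U (p' i)" using p(1) i by (auto simp: p'_def split: nat.split)
  next
    fix i assume i: "i < Suc N"
    have "{0} \<subset> p 0" using J0 p(3) is_ideal_0[OF J(1)] by blast
    thus "p' i \<subset> p' (Suc i)" using p(2) i by (auto simp: p'_def split: nat.split)
  qed
  thus False by simp
qed

lemma local_dim_le: "local_dim U (max_spec U) m \<le> enat N" unfolding local_dim_def
proof (rule Sup_least)
  fix e assume "e \<in> {enat d |d. \<exists>p. (\<forall>i\<le>d. primeideal (p i) (ring_on U) \<and> vanishing_ideal U (max_spec U) \<subseteq> p i \<and> p i \<subseteq> m) \<and>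
      (\<forall>i<d. p i \<subset> p (Suc i))}"
  then obtain d p where e: "e = enat d" and p: "\<forall>i\<le>d. primeideal (p i) (ring_on U)" "\<forall>i<d. p i \<subset> p (Suc i)" by blast
  have "d \<le> N" using prime_chain_length[OF subalg_U, of d p] p primeideal_ring_on[OF subalg_U] by blast
  thus "e \<le> enat N" using e by simp
qed

lemma local_dim_ge:
  assumes "point U \<phi>" "\<forall>i\<in>Ninv. \<phi> (x i) \<noteq> 0" "spans_cotangent U \<phi> N f"
  shows "enat N \<le> local_dim U (max_spec U) (kernel U \<phi>)"
proof -
  have "is_ideal U (kernel U \<phi>)" by (rule is_ideal_kernel[OF subalg_U assms(1)])
  moreover have "br q 0 = 0" "Ed p 0 = 0" for q p
    using der_0[OF derivation_br(1)] der_0[OF derivation_Ed] by auto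
  ultimately obtain p where p: "\<forall>i\<le>N. is_prime U (p i) \<and> p i \<subseteq> kernel U \<phi>" "\<forall>i<N. p i \<subset> p (Suc i)"
    using prime_chain_good[OF assms is_ideal_zero] is_ideal_0 by (metis empty_subsetI insert_subset singletonD singletonI)
  have "vanishing_ideal U (max_spec U) \<subseteq> p i" if "i \<le> N" for i
    unfolding vanishing_ideal_max_spec[OF fg_U] using p(1) that is_ideal_0 by (auto simp: is_prime_def)
  thus ?thesis unfolding local_dim_def using p primeideal_ring_on[OF subalg_U] by (intro Sup_upper) blast
qed

lemma spans_cotangent_pad:
  assumes "spans_cotangent U \<phi> d f" "d \<le> N" "point U \<phi>" shows "\<exists>f. spans_cotangent U \<phi> N f"
proof -
  let ?f = "\<lambda>i. if i < d then f i else 0"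
  have "(\<Sum>i<N. \<iota> (c i) * ?f i) = (\<Sum>i<d. \<iota> (c i) * f i)" for c
    using assms(2) by (intro sum.mono_neutral_cong_right) auto
  hence "spans_cotangent U \<phi> N ?f"
    using assms(1) is_ideal_0[OF is_ideal_kernel[OF subalg_U assms(3)]] by (auto simp: spans_cotangent_def)
  thus ?thesis by blast
qed

text \<open>At a smooth point the cotangent dimension equals the local dimension, which is at most
  \<open>N\<close>, and a basis is padded to length \<open>N\<close>. Conversely, dual derivations
  send the square of the maximal ideal into the maximal ideal, so the \<open>f i\<close> are
  independent modulo the square, and the chain of primes built from these derivations gives local
  dimension \<open>N\<close>.\<close>

lemma regular_iff_good:
  assumes \<phi>: "point U \<phi>" and nz: "\<forall>i\<in>Ninv. \<phi> (x i) \<noteq> 0"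
  shows "kernel U \<phi> \<in> regular_part \<iota> U (max_spec U) \<longleftrightarrow> good \<phi>"
proof
  note Z = vanishing_ideal_max_spec[OF fg_U]
  assume "kernel U \<phi> \<in> regular_part \<iota> U (max_spec U)"
  then obtain d where d: "cotangent_dim \<iota> U (max_spec U) (kernel U \<phi>) d"
    "local_dim U (max_spec U) (kernel U \<phi>) = enat d" by (auto simp: regular_part_def)
  obtain f where "spans_cotangent U \<phi> d f" using cotangent_dim_spans[OF subalg_U \<phi> Z d(1)] by blast
  moreover have "d \<le> N" using local_dim_le[of "kernel U \<phi>"] d(2) by simp
  ultimately show "good \<phi>" using spans_cotangent_pad \<phi> nz by (auto simp: good_def)
next
  note Z = vanishing_ideal_max_spec[OF fg_U]
  assume "good \<phi>"
  then obtain f where f: "spans_cotangent U \<phi> N f" by (auto simp: good_def)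
  obtain D g where D: "dual_ders f D g" "\<phi> g \<noteq> 0" by (rule dual_derivations[OF \<phi> nz f])
  let ?m = "kernel U \<phi>"
  have mI: "is_ideal U ?m" by (rule is_ideal_kernel[OF subalg_U \<phi>])
  have DU: "D i h \<in> U" if "i < N" "h \<in> U" for i h
    by (rule dual_J[OF D(1) that(1) is_ideal_self br_U Ed_U that(2)])
  have Dsq: "D i w \<in> ?m" if i: "i < N" and "w \<in> sq U ?m" for i w using that(2)
  proof (induction rule: sq_induct)
    case (prod p q)
    hence "p \<in> U" "q \<in> U" using is_ideal_subset[OF mI] by auto
    thus ?case unfolding der_mult[OF dual_der[OF D(1) i]]
      using is_ideal_mult[OF mI prod(1) DU[OF i]] is_ideal_mult[OF mI prod(2) DU[OF i]]
      by (intro is_ideal_add[OF mI]) (simp_all add: mult.commute)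
  next
    case (add v w)
    thus ?case using der_add[OF dual_der[OF D(1) i]] is_ideal_add[OF mI] by simp
  qed
  have "cotangent_dim \<iota> U (max_spec U) ?m N"
  proof (rule spans_cotangent_dim[OF subalg_U \<phi> Z f])
    fix a i assume a: "(\<Sum>j<N. \<iota> (a j) * f j) \<in> sq U ?m" and i: "i < N"
    have "D i (\<Sum>j<N. \<iota> (a j) * f j) = (\<Sum>j<N. \<iota> (a j) * D i (f j))"
      by (simp add: der_sum[OF dual_der[OF D(1) i]] der_scale[OF dual_der[OF D(1) i]])
    also have "\<dots> = (\<Sum>j<N. if j = i then \<iota> (a i) * g else 0)"
      using dual_f[OF D(1) i] by (intro sum.cong) auto
    also have "\<dots> = \<iota> (a i) * g" using i by simp
    finally have "\<iota> (a i) * g \<in> ?m" using Dsq[OF i a] by simp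
    hence "a i * \<phi> g = 0"
      using ptU_mult[OF \<phi> U_const dual_g[OF D(1)]] ptU_const[OF \<phi>] by (simp add: kernel_def)
    thus "a i = 0" using D(2) by simp
  qed
  moreover have "local_dim U (max_spec U) ?m = enat N"
    using local_dim_le local_dim_ge[OF \<phi> nz f] by (rule antisym)
  ultimately show "?m \<in> regular_part \<iota> U (max_spec U)"
    using kernel_max_spec[OF subalg_U \<phi>] by (auto simp: regular_part_def)
qed

text \<open>The function \<open>u\<close> is a common denominator of the coordinates given by the
  \<open>f i\<close>; where it does not vanish, their translates still span the cotangent space. The
  additional factor keeps the point off the divisors.\<close>

lemma good_open:
  assumes "good \<phi>"
  shows "\<exists>u\<in>U. \<phi> u \<noteq> 0 \<and> (\<forall>\<phi>'. point U \<phi>' \<longrightarrow> \<phi>' u \<noteq> 0 \<longrightarrow> good \<phi>')"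
proof -
  have \<phi>: "point U \<phi>" "\<forall>i\<in>Ninv. \<phi> (x i) \<noteq> 0" using assms by (auto simp: good_def)
  obtain f where f: "spans_cotangent U \<phi> N f" using assms by (auto simp: good_def)
  obtain S where S: "finite S" "U = alg S" by (rule generators_U)
  obtain u where u: "u \<in> U" "\<phi> u \<noteq> 0"
    and loc: "\<forall>q\<in>U. \<exists>c \<mu>. diff_rel U N f {} u c \<mu> q" using local_coordinates[OF S(2,1) \<phi>(1) f] by blast
  have fU: "f i \<in> U" if "i < N" for i using f that by (auto simp: spans_cotangent_def kernel_def)
  have xU: "x i \<in> U" if "i \<in> Ninv" for i using x_in_U Ninv that by blast
  have XU: "(\<Prod>i\<in>Ninv. x i) \<in> U" by (intro U_prod xU)
  have fin: "finite Ninv" using Ninv finite_subset by blast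
  have e: "\<phi>' (u * (\<Prod>i\<in>Ninv. x i)) = \<phi>' u * (\<Prod>i\<in>Ninv. \<phi>' (x i))" if "point U \<phi>'" for \<phi>'
    using ptU_mult[OF that u(1) XU] ptU_prod[OF that, of Ninv x] xU by simp
  show ?thesis
  proof (intro bexI[of _ "u * (\<Prod>i\<in>Ninv. x i)"] conjI allI impI)
    show "u * (\<Prod>i\<in>Ninv. x i) \<in> U" by (intro U_mult u XU)
    show "\<phi> (u * (\<Prod>i\<in>Ninv. x i)) \<noteq> 0" using e[OF \<phi>(1)] u fin \<phi>(2) by simp
    fix \<phi>' assume \<phi>': "point U \<phi>'" "\<phi>' (u * (\<Prod>i\<in>Ninv. x i)) \<noteq> 0"
    hence "\<phi>' u \<noteq> 0" "\<forall>i\<in>Ninv. \<phi>' (x i) \<noteq> 0" using e[OF \<phi>'(1)] fin by auto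
    moreover have "spans_cotangent U \<phi>' N (\<lambda>i. f i - \<iota> (\<phi>' (f i)))"
      using loc by (intro spans_cotangent_nearby[OF S(2,1) \<phi>'(1) fU u(1) \<open>\<phi>' u \<noteq> 0\<close>]) auto
    ultimately show "good \<phi>'" using \<phi>'(1) unfolding good_def by blast
  qed
qed

end

section \<open>The cluster torus\<close>

context laurent_field
begin

lemma ev_exists:
  assumes "\<forall>i\<in>{1..N}. p i \<noteq> 0"
  shows "\<exists>T. point (Lau UNIV) T \<and> (\<forall>a. T (lmon N x a) = lmon N p a)"
proof -
  obtain T where T: "scalar_linear \<iota> (\<lambda>c. c) T" "\<forall>a. T (lmon N x a) = lmon N p a"
    "\<forall>f\<in>Lau UNIV. \<forall>g\<in>Lau UNIV. T (f * g) = T f * T g"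
    using hom_exists[OF complex_algebra_id, of p] assms by blast
  have "T 1 = 1" using T(2)[rule_format, of "\<lambda>_. 0"] by simp
  hence "T (\<iota> c) = c" for c using scalar_linear_scale[OF T(1), of c 1] by simp
  hence "point (Lau UNIV) T" using T(3) scalar_linear_add[OF T(1)] by (simp add: point_def)
  thus ?thesis using T(2) by blast
qed

definition ev :: "(nat \<Rightarrow> complex) \<Rightarrow> 'f \<Rightarrow> complex" where
  "ev p = (SOME T. point (Lau UNIV) T \<and> (\<forall>a. T (lmon N x a) = lmon N p a))"

context
  fixes p :: "nat \<Rightarrow> complex" assumes p: "\<forall>i\<in>{1..N}. p i \<noteq> 0"
begin

lemma point_ev: "point (Lau UNIV) (ev p)" and ev_lmon: "ev p (lmon N x a) = lmon N p a"
  using someI_ex[OF ev_exists[OF p]] by (simp_all add: ev_def)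

lemma ev_x: "i \<in> {1..N} \<Longrightarrow> ev p (x i) = p i"
  using ev_lmon[of "\<lambda>j. if j = i then 1 else 0"] lmon_single[of i N x 1] lmon_single[of i N p 1] by simp

end

text \<open>Along this one-parameter subgroup a monomial varies exponentially, with rate
  \<open>e a\<close> equal to its eigenvalue under the derivation.\<close>

lemma ev_derivative:
  assumes p: "\<forall>i\<in>{1..N}. p i \<noteq> 0" and f: "f \<in> Lau UNIV"
  shows "((\<lambda>s. ev (\<lambda>i. p i * exp (of_real s * w i)) f) has_vector_derivative
    ev (\<lambda>i. p i * exp (of_real s * w i)) (logder (\<lambda>i. \<iota> (w i)) f)) (at s within T)"
proof -
  let ?q = "\<lambda>s i. p i * exp (of_real s * w i)"
  have q: "\<forall>i\<in>{1..N}. ?q s i \<noteq> 0" for s using p by simp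
  note ev = point_ev[OF q]
  note const = sub_const[OF subalg_L] and mult = sub_mult[OF subalg_L] and add = sub_add[OF subalg_L]
  have lm: "lmon N x a \<in> Lau UNIV" for a by (rule lmon_Lau) simp
  define e where "e a = (\<Sum>i=1..N. of_int (a i) * w i)" for a :: "nat \<Rightarrow> int"
  have lmq: "lmon N (?q s) a = lmon N p a * exp (of_real s * e a)" for s a
  proof -
    have "lmon N (\<lambda>i. exp (of_real s * w i)) a = (\<Prod>i=1..N. exp (of_real s * (of_int (a i) * w i)))"
      unfolding lmon_def by (intro prod.cong refl) (simp add: exp_power_int ac_simps)
    also have "\<dots> = exp (of_real s * e a)" by (simp add: exp_sum[symmetric] e_def sum_distrib_left)
    finally show ?thesis by (simp add: lmon_map_mult)
  qed
  have log: "logder (\<lambda>i. \<iota> (w i)) (lmon N x a) = \<iota> (e a) * lmon N x a" for a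
    by (simp add: logder_lmon e_def \<iota>.hom_sum \<iota>.hom_mult \<iota>.hom_of_int)
  have "logder (\<lambda>i. \<iota> (w i)) f \<in> Lau UNIV \<and> ((\<lambda>s. ev (?q s) f) has_vector_derivative ev (?q s) (logder (\<lambda>i. \<iota> (w i)) f)) (at s within T)"
    using f
  proof (induction rule: Lau_induct)
    case zero
    show ?case using der_0[OF derivation_logder] pt_0[OF subalg_L ev] sub_0[OF subalg_L] by simp
  next
    case (step c a g)
    have e1: "ev (?q s) (\<iota> c * lmon N x a + g) = c * (lmon N p a * exp (of_real s * e a)) + ev (?q s) g" for s
      by (simp add: pt_add[OF subalg_L ev] pt_mult[OF subalg_L ev] pt_const[OF subalg_L ev] ev_lmon[OF q]
        const mult lm step(2) lmq)
    have l: "logder (\<lambda>i. \<iota> (w i)) (\<iota> c * lmon N x a + g) = \<iota> (c * e a) * lmon N x a + logder (\<lambda>i. \<iota> (w i)) g"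
      by (simp add: der_add[OF derivation_logder] der_scale[OF derivation_logder] log \<iota>.hom_mult)
    have e2: "ev (?q s) (logder (\<lambda>i. \<iota> (w i)) (\<iota> c * lmon N x a + g)) =
        c * e a * (lmon N p a * exp (of_real s * e a)) + ev (?q s) (logder (\<lambda>i. \<iota> (w i)) g)"
      unfolding l using step(3)
      by (simp add: pt_add[OF subalg_L ev] pt_mult[OF subalg_L ev] pt_const[OF subalg_L ev] ev_lmon[OF q]
        const mult lm lmq)
    have "((\<lambda>s. exp (of_real s * e a)) has_vector_derivative (e a * exp (of_real s * e a))) (at s within T)"
    proof -
      have "((\<lambda>z. exp (z * e a)) has_field_derivative (exp (of_real s * e a) * e a)) (at (of_real s))"
        by (auto intro!: derivative_eq_intros)
      from has_vector_derivative_real_field[OF this] show ?thesis by (simp add: mult.commute)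
    qed
    from has_vector_derivative_mult_right[OF this, of "c * lmon N p a"]
    have "((\<lambda>s. c * (lmon N p a * exp (of_real s * e a))) has_vector_derivative
      (c * e a * (lmon N p a * exp (of_real s * e a)))) (at s within T)" by (simp add: ac_simps)
    from has_vector_derivative_add[OF this conjunct2[OF step(3)]]
    show ?case unfolding e1 e2 unfolding l using step(3) const mult add lm by simp
  qed
  thus ?thesis by blast
qed

end

context cluster
begin

definition X :: "'f" where "X = (\<Prod>i=1..N. x i)"

lemma X_nz: "X \<noteq> 0" unfolding X_def using x_nz by simp

lemma X_U: "X \<in> U" unfolding X_def by (intro U_prod x_in_U)

lemma U_Lau: "f \<in> U \<Longrightarrow> f \<in> Lau UNIV" using U_L[OF x_cluster, of f] Lau_UNIV by (auto simp: L_def)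

lemma clear_denominators:
  assumes "f \<in> U" shows "\<exists>k. X ^ k * f \<in> alg (x ` {1..N})"
proof -
  let ?P = "alg (x ` {1..N})"
  have P: "subalg ?P" by (rule subalg_generated)
  have xP: "x i \<in> ?P" if "i \<in> {1..N}" for i using that by (intro generated_algebra.gen) auto
  have XP: "X \<in> ?P" unfolding X_def by (intro sub_prod[OF P] xP)
  let ?A = "{f. \<exists>k. X ^ k * f \<in> ?P}"
  have "subalg ?A"
  proof (rule subalgI)
    show "\<iota> c \<in> ?A" for c using sub_const[OF P] by (auto intro!: exI[of _ 0])
    fix f g assume "f \<in> ?A" "g \<in> ?A"
    then obtain j k where jk: "X ^ j * f \<in> ?P" "X ^ k * g \<in> ?P" by blast
    have "X ^ (j + k) * (f + g) = X ^ k * (X ^ j * f) + X ^ j * (X ^ k * g)"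
      by (simp add: power_add algebra_simps)
    also have "\<dots> \<in> ?P" by (intro sub_add[OF P] sub_mult[OF P] sub_power[OF P] jk XP)
    finally show "f + g \<in> ?A" by blast
    have "X ^ (j + k) * (f * g) = (X ^ j * f) * (X ^ k * g)" by (simp add: power_add algebra_simps)
    also have "\<dots> \<in> ?P" by (intro sub_mult[OF P] jk)
    finally show "f * g \<in> ?A" by blast
  qed
  hence "Lau UNIV \<subseteq> ?A"
  proof (rule Lau_subset_subalg)
    fix i assume i: "i \<in> {1..N}"
    show "x i \<in> ?A" using xP[OF i] by (auto intro!: exI[of _ 0])
    have "X ^ 1 * inverse (x i) = (\<Prod>j\<in>{1..N} - {i}. x j)"
      using prod.remove[of "{1..N}" i x] i x_nz[OF i] by (simp add: X_def)
    also have "\<dots> \<in> ?P" by (intro sub_prod[OF P] xP) auto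
    finally show "inverse (x i) \<in> ?A" by blast
  qed
  thus ?thesis using U_Lau[OF assms] by blast
qed

lemma generated_U: "alg (x ` {1..N}) \<subseteq> U" by (rule U_generated) (use x_in_U in auto)

lemma pt_X: "point U \<phi> \<Longrightarrow> \<phi> X = (\<Prod>i=1..N. \<phi> (x i))" unfolding X_def by (rule ptU_prod[OF _ x_in_U])

lemma torus_point_unique:
  assumes \<phi>: "point U \<phi>" "point U \<phi>'" and nz: "\<phi> X \<noteq> 0" and e: "\<forall>i\<in>{1..N}. \<phi> (x i) = \<phi>' (x i)"
    and f: "f \<in> U"
  shows "\<phi> f = \<phi>' f"
proof -
  have 1: "\<phi> q = \<phi>' q" if "q \<in> alg (x ` {1..N})" for q using that
  proof (induction rule: generated_algebra.induct)
    case (scalar c) show ?case by (simp add: ptU_const[OF \<phi>(1)] ptU_const[OF \<phi>(2)])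
  next
    case (gen s) thus ?case using e by auto
  next
    case (add f g)
    thus ?case using generated_U by (simp add: ptU_add[OF \<phi>(1)] ptU_add[OF \<phi>(2)] subsetD)
  next
    case (mult f g)
    thus ?case using generated_U by (simp add: ptU_mult[OF \<phi>(1)] ptU_mult[OF \<phi>(2)] subsetD)
  qed
  obtain k where k: "X ^ k * f \<in> alg (x ` {1..N})" using clear_denominators[OF f] by blast
  have "\<phi> X = \<phi>' X" using e by (simp add: pt_X \<phi>)
  moreover have "\<phi> X ^ k * \<phi> f = \<phi>' X ^ k * \<phi>' f"
    using 1[OF k] f X_U by (simp add: ptU_mult[OF \<phi>(1)] ptU_mult[OF \<phi>(2)]
      ptU_power[OF \<phi>(1)] ptU_power[OF \<phi>(2)] U_power)
  ultimately show ?thesis using nz by simp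
qed

text \<open>For polynomials in the \<open>x i\<close> the expansion around the point is explicit. A
  general \<open>q\<close> of the maximal ideal is reduced to this case because
  \<open>X ^ k * q\<close> differs from a nonzero multiple of \<open>q\<close> by an element of the
  square.\<close>

lemma torus_point_good:
  assumes \<phi>: "point U \<phi>" and nz: "\<phi> X \<noteq> 0"
  shows "good \<phi>"
proof -
  let ?m = "kernel U \<phi>" and ?P = "alg (x ` {1..N})"
  define f where "f i = x (Suc i) - \<iota> (\<phi> (x (Suc i)))" for i
  have mI: "is_ideal U ?m" by (rule is_ideal_kernel[OF subalg_U \<phi>])
  have km: "q - \<iota> (\<phi> q) \<in> ?m" if "q \<in> U" for q using that
    by (simp add: kernel_def ptU_diff[OF \<phi>] ptU_const[OF \<phi>] U_diff U_const)
  let ?W = "cot U ?m N f"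
  have W: "V.subspace ?W" by (rule subspace_cot[OF subalg_U mI])
  have sqW: "w \<in> ?W" if "w \<in> sq U ?m" for w using sq_cot[OF subalg_U mI] that by blast
  have PW: "q - \<iota> (\<phi> q) \<in> ?W" if "q \<in> ?P" for q using that
  proof (induction rule: generated_algebra.induct)
    case (scalar c) show ?case using V.subspace_0[OF W] by (simp add: ptU_const[OF \<phi>])
  next
    case (gen s)
    then obtain i where i: "i < N" "s = x (Suc i)" using image_Suc_lessThan[of N] by (metis imageE lessThan_iff One_nat_def)
    hence "s - \<iota> (\<phi> s) = f i" by (simp add: f_def)
    thus ?case using gen_cot[OF subalg_U mI i(1)] by simp
  next
    case (add p q)
    hence e: "(p + q) - \<iota> (\<phi> (p + q)) = (p - \<iota> (\<phi> p)) + (q - \<iota> (\<phi> q))"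
      using generated_U by (simp add: ptU_add[OF \<phi>] subsetD \<iota>_add)
    show ?case unfolding e by (rule V.subspace_add[OF W add.IH])
  next
    case (mult p q)
    have pq: "p \<in> U" "q \<in> U" using mult generated_U by auto
    have "p * q - \<iota> (\<phi> (p * q)) =
       (p - \<iota> (\<phi> p)) * (q - \<iota> (\<phi> q)) + (\<iota> (\<phi> p) * (q - \<iota> (\<phi> q)) + \<iota> (\<phi> q) * (p - \<iota> (\<phi> p)))"
      using pq by (simp add: ptU_mult[OF \<phi>] \<iota>_mult algebra_simps)
    moreover have "(p - \<iota> (\<phi> p)) * (q - \<iota> (\<phi> q)) \<in> ?W" by (intro sqW sq_prod km pq)
    moreover have "\<iota> (\<phi> p) * (q - \<iota> (\<phi> q)) \<in> ?W" "\<iota> (\<phi> q) * (p - \<iota> (\<phi> p)) \<in> ?W"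
      using V.subspace_scale[OF W] mult by auto
    ultimately show ?case using V.subspace_add[OF W] by simp
  qed
  have mW: "q \<in> ?W" if q: "q \<in> ?m" for q
  proof -
    have qU: "q \<in> U" "\<phi> q = 0" using q by (auto simp: kernel_def)
    obtain k where k: "X ^ k * q \<in> ?P" using clear_denominators[OF qU(1)] by blast
    have XkU: "X ^ k \<in> U" by (intro U_power X_U)
    have "\<phi> (X ^ k * q) = 0" using qU by (simp add: ptU_mult[OF \<phi> XkU])
    hence "X ^ k * q \<in> ?W" using PW[OF k] by simp
    moreover have "(X ^ k - \<iota> (\<phi> (X ^ k))) * q \<in> ?W" by (intro sqW sq_prod km XkU q)
    ultimately have "X ^ k * q - (X ^ k - \<iota> (\<phi> (X ^ k))) * q \<in> ?W" by (rule V.subspace_diff[OF W])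
    hence "\<iota> (\<phi> (X ^ k)) * q \<in> ?W" by (simp add: algebra_simps)
    hence "\<iota> (inverse (\<phi> (X ^ k))) * (\<iota> (\<phi> (X ^ k)) * q) \<in> ?W" by (rule V.subspace_scale[OF W])
    moreover have "\<phi> (X ^ k) \<noteq> 0" using nz by (simp add: ptU_power[OF \<phi> X_U])
    hence "\<iota> (inverse (\<phi> (X ^ k))) * (\<iota> (\<phi> (X ^ k)) * q) = q"
      by (simp add: mult.assoc[symmetric] \<iota>_mult[symmetric] del: \<iota>.hom_inverse)
    ultimately show ?thesis by (simp only:)
  qed
  have "f i \<in> ?m" if "i < N" for i unfolding f_def using that by (intro km x_in_U) auto
  hence "spans_cotangent U \<phi> N f" using mW by (auto simp: spans_cotangent_def cot_def)
  moreover have "\<phi> (x i) \<noteq> 0" if "i \<in> Ninv" for i using nz Ninv_N[OF that] by (auto simp: pt_X[OF \<phi>])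
  ultimately show ?thesis using \<phi> by (auto simp: good_def)
qed

lemma point_ev_U: "\<forall>i\<in>{1..N}. p i \<noteq> 0 \<Longrightarrow> point U (ev p)" using point_subset[OF point_ev] U_Lau by blast

lemma ev_X: "\<forall>i\<in>{1..N}. p i \<noteq> 0 \<Longrightarrow> ev p X \<noteq> 0" by (simp add: pt_X[OF point_ev_U] ev_x)

lemma torus_point_eq_ev:
  assumes \<phi>: "point U \<phi>" and nz: "\<phi> X \<noteq> 0" and f: "f \<in> U"
  shows "\<phi> f = ev (\<lambda>i. \<phi> (x i)) f"
proof -
  have p: "\<forall>i\<in>{1..N}. \<phi> (x i) \<noteq> 0" using nz by (auto simp: pt_X[OF \<phi>])
  show ?thesis by (rule torus_point_unique[OF \<phi> point_ev_U[OF p] nz _ f]) (simp add: ev_x[OF p])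
qed

end

section \<open>Hamiltonian trajectories\<close>

lemma box_in_open:
  assumes "openin (cspace n) W" "p \<in> W"
  shows "\<exists>r>0. \<forall>q \<in> {..<n} \<rightarrow>\<^sub>E UNIV. (\<forall>i<n. dist (p i) (q i) < r) \<longrightarrow> q \<in> W"
proof -
  obtain V where V: "\<forall>i\<in>{..<n}. openin euclidean (V i)" "p \<in> Pi\<^sub>E {..<n} V" "Pi\<^sub>E {..<n} V \<subseteq> W"
    using assms unfolding openin_product_topology_alt by blast
  have "\<forall>i\<in>{..<n}. \<exists>r>0. ball (p i) r \<subseteq> V i" using V(1,2) by (auto simp: open_contains_ball PiE_def)
  from bchoice[OF this] obtain r where r: "\<And>i. i < n \<Longrightarrow> r i > 0" "\<And>i. i < n \<Longrightarrow> ball (p i) (r i) \<subseteq> V i" by auto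
  define e where "e = Min (insert 1 (r ` {..<n}))"
  have e: "e > 0" "e \<le> r i" if "i < n" for i unfolding e_def using r that by auto
  have e0: "e > 0" unfolding e_def using r by auto
  have "q \<in> W" if q: "q \<in> {..<n} \<rightarrow>\<^sub>E UNIV" "\<forall>i<n. dist (p i) (q i) < e" for q
  proof -
    have "q i \<in> V i" if "i < n" for i
      using r(2)[OF that] e(2)[OF that] q(2) that by (auto simp: subset_iff dest!: spec[of _ i])
    hence "q \<in> Pi\<^sub>E {..<n} V" using q(1) by (auto simp: PiE_iff)
    thus ?thesis using V(3) by blast
  qed
  thus ?thesis using e0 by blast
qed

text \<open>\<open>H\<close> is bounded near \<open>p\<close> by continuity, and Cauchy's inequality
  on discs in one coordinate bounds the partial derivatives. Their continuity is not
  involved.\<close>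

lemma partial_deriv_locally_bounded:
  assumes H: "holomorphic_several n \<Omega> H" and p: "p \<in> \<Omega>"
  shows "\<exists>r>0. \<exists>C. \<forall>q \<in> {..<n} \<rightarrow>\<^sub>E UNIV. (\<forall>i<n. dist (p i) (q i) < r) \<longrightarrow> (\<forall>i<n. norm (partial_deriv i H q) \<le> C)"
proof -
  have op: "openin (cspace n) \<Omega>" and cont: "continuous_map (subtopology (cspace n) \<Omega>) euclidean H"
    and diff: "\<And>q i. q \<in> \<Omega> \<Longrightarrow> i < n \<Longrightarrow> (\<lambda>z. H (q(i := z))) field_differentiable (at (q i))"
    using H by (auto simp: holomorphic_several_def)
  define W where "W = {q \<in> \<Omega>. H q \<in> ball (H p) 1}"
  have "openin (subtopology (cspace n) \<Omega>) {q \<in> topspace (subtopology (cspace n) \<Omega>). H q \<in> ball (H p) 1}"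
    by (rule openin_continuous_map_preimage[OF cont]) simp
  moreover have "topspace (subtopology (cspace n) \<Omega>) = \<Omega>" using openin_subset[OF op] by auto
  ultimately have "openin (subtopology (cspace n) \<Omega>) W" by (simp only: W_def)
  hence "openin (cspace n) W" using openin_open_subtopology[OF op] by blast
  moreover have "p \<in> W" using p by (simp add: W_def)
  ultimately have "\<exists>r>0. \<forall>q \<in> {..<n} \<rightarrow>\<^sub>E UNIV. (\<forall>i<n. dist (p i) (q i) < r) \<longrightarrow> q \<in> W" by (rule box_in_open)
  then obtain r where r0: "r > 0" "\<forall>q \<in> {..<n} \<rightarrow>\<^sub>E UNIV. (\<forall>i<n. dist (p i) (q i) < r) \<longrightarrow> q \<in> W" by (elim exE conjE)
  have r: "r > 0" "\<And>q. q \<in> {..<n} \<rightarrow>\<^sub>E UNIV \<Longrightarrow> (\<forall>i<n. dist (p i) (q i) < r) \<Longrightarrow> q \<in> W" using r0 by simp_all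
  define B where "B = norm (H p) + 1"
  \<comment> \<open>The point \<open>q\<close> may be displaced by \<open>r / 2\<close> and its
    coordinate \<open>i\<close> by another \<open>r / 2\<close>; closed discs of radius
    \<open>r / 4\<close> stay within this range.\<close>
  have "norm (partial_deriv i H q) \<le> B / (r / 4)"
    if q: "q \<in> {..<n} \<rightarrow>\<^sub>E UNIV" "\<forall>i<n. dist (p i) (q i) < r / 2" and i: "i < n" for q i
  proof -
    define G where "G z = H (q(i := z))" for z
    have qW: "q(i := z) \<in> W" if "dist (q i) z < r / 2" for z
    proof (rule r(2))
      show "q(i := z) \<in> {..<n} \<rightarrow>\<^sub>E UNIV" using q(1) i by (auto simp: PiE_iff extensional_def)
      show "\<forall>j<n. dist (p j) ((q(i := z)) j) < r"
      proof (intro allI impI)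
        fix j assume j: "j < n"
        have qj: "dist (p j) (q j) < r / 2" using q(2) j by blast
        show "dist (p j) ((q(i := z)) j) < r"
        proof (cases "j = i")
          case True
          thus ?thesis using dist_triangle[of "p i" z "q i"] qj that by simp
        next
          case False
          thus ?thesis using qj r(1) by simp
        qed
      qed
    qed
    have G: "G field_differentiable (at z)" if "dist (q i) z < r / 2" for z
    proof -
      have "q(i := z) \<in> \<Omega>" using qW[OF that] by (simp add: W_def)
      from diff[OF this i] show ?thesis by (simp add: G_def[abs_def])
    qed
    have 1: "G holomorphic_on ball (q i) (r / 4)" unfolding holomorphic_on_def
    proof
      fix z assume "z \<in> ball (q i) (r / 4)"
      hence "dist (q i) z < r / 2" using r(1) by simp
      from field_differentiable_at_within[OF G[OF this]]
      show "G field_differentiable at z within ball (q i) (r / 4)" .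
    qed
    have 2: "continuous_on (cball (q i) (r / 4)) G"
    proof (intro continuous_at_imp_continuous_on ballI field_differentiable_imp_continuous_at G)
      fix z assume "z \<in> cball (q i) (r / 4)"
      thus "dist (q i) z < r / 2" using r(1) by simp
    qed
    have 3: "norm (G z) \<le> B" if z: "norm (q i - z) = r / 4" for z
    proof -
      have "dist (q i) z < r / 2" using z r(1) by (simp add: dist_norm)
      from qW[OF this] have "dist (H p) (G z) < 1" by (simp add: W_def G_def)
      thus ?thesis unfolding B_def using norm_triangle_sub[of "G z" "H p"] by (simp add: dist_norm norm_minus_commute)
    qed
    have "0 < r / 4" using r(1) by simp
    from Cauchy_inequality[OF 1 2 this 3, of 1] have "norm (deriv G (q i)) \<le> B / (r / 4)" by simp
    thus ?thesis unfolding partial_deriv_def G_def[abs_def] .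
  qed
  thus ?thesis using r(1) by (intro exI[of _ "r / 2"] exI[of _ "B / (r / 4)"] conjI ballI impI allI) simp_all
qed

text \<open>Uniqueness for the linear equation \<open>c' = A c\<close> with locally bounded \<open>A\<close>.\<close>

lemma linear_ode_nonzero:
  fixes c A :: "real \<Rightarrow> complex"
  assumes der: "\<And>t. t \<in> {0..1} \<Longrightarrow> (c has_vector_derivative A t * c t) (at t within {0..1})"
    and bdd: "\<And>t0. t0 \<in> {0..1} \<Longrightarrow> \<exists>\<delta>>0. \<exists>C. \<forall>t\<in>{0..1}. dist t0 t < \<delta> \<longrightarrow> norm (A t) \<le> C"
    and c0: "c 0 \<noteq> 0" and t: "t \<in> {0..1}"
  shows "c t \<noteq> 0"
proof
  assume "c t = 0"
  have "c 0 = 0"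
  \<comment> \<open>It suffices that vanishing of \<open>c\<close> spreads over a neighbourhood of
    each time, the unit interval being connected.\<close>
  proof (rule connected_induction_simple[of "{0..1}" t 0 "\<lambda>t. c t = 0"])
    fix t0 :: real assume t0: "t0 \<in> {0..1}"
    obtain \<delta> C where C: "\<delta> > 0" "\<And>t. t \<in> {0..1} \<Longrightarrow> dist t0 t < \<delta> \<Longrightarrow> norm (A t) \<le> C" using bdd[OF t0] by blast
    have C0: "C \<ge> 0" using C(2)[OF t0] C(1) norm_ge_zero[of "A t0"] by (simp del: norm_ge_zero)
    \<comment> \<open>The interval is short enough for the bound \<open>C * M\<close> on the
      derivative to allow a variation of at most \<open>M / 2\<close>, which forces \<open>M\<close>
      to be zero once \<open>c\<close> has a zero there. The term \<open>C + 1\<close> keeps the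
      denominator positive.\<close>
    define e where "e = min \<delta> (1 / (4 * (C + 1)))"
    have e: "e > 0" "e \<le> \<delta>" "C * (2 * e) \<le> 1 / 2"
    proof -
      show "e > 0" "e \<le> \<delta>" using C(1) C0 by (auto simp: e_def)
      have "C * (2 * e) \<le> C * (2 * (1 / (4 * (C + 1))))" using C0 by (intro mult_left_mono) (auto simp: e_def)
      also have "\<dots> \<le> 1 / 2" using C0 by (simp add: field_simps)
      finally show "C * (2 * e) \<le> 1 / 2" .
    qed
    let ?T = "{0..1} \<inter> ball t0 e"
    have cont: "continuous_on {0..1} c"
      using has_vector_derivative_continuous[OF der] by (auto simp: continuous_on_eq_continuous_within)
    have "bounded (c ` {0..1})" by (intro compact_imp_bounded compact_continuous_image cont) simp
    hence "bdd_above ((\<lambda>t. norm (c t)) ` {0..1})" by (auto simp: bounded_iff bdd_above_def)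
    hence bd: "bdd_above ((\<lambda>t. norm (c t)) ` ?T)" by (rule bdd_above_mono) auto
    define M where "M = (SUP t\<in>?T. norm (c t))"
    have M: "norm (c s) \<le> M" if "s \<in> ?T" for s unfolding M_def by (rule cSUP_upper[OF that bd])
    have t0T: "t0 \<in> ?T" using t0 e by simp
    have M0: "M \<ge> 0" using M[OF t0T] norm_ge_zero[of "c t0"] by linarith
    have "c b = 0" if a: "a \<in> ?T" "c a = 0" and b: "b \<in> ?T" for a b
    proof -
      have "norm (c s) \<le> M / 2" if s: "s \<in> ?T" for s
      proof -
        have "norm (c s - c a) \<le> (C * M) * norm (s - a)"
        proof (rule differentiable_bound[of ?T c "\<lambda>t h. h *\<^sub>R (A t * c t)"])
          show "convex ?T" by (intro convex_Int) auto
          fix u assume u: "u \<in> ?T"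
          show "(c has_derivative (\<lambda>h. h *\<^sub>R (A u * c u))) (at u within ?T)"
            using der[of u] u has_derivative_subset[of c _ u "{0..1}" ?T] by (simp add: has_vector_derivative_def)
          have "norm (A u * c u) \<le> C * M"
            unfolding norm_mult using u e(2) C(2)[of u] C0 M[OF u] by (intro mult_mono) auto
          thus "onorm (\<lambda>h. h *\<^sub>R (A u * c u)) \<le> C * M"
            by (intro onorm_le) (simp add: mult.commute mult_left_mono)
        qed (use s a in auto)
        also have "\<dots> \<le> (C * M) * (2 * e)"
        proof (rule mult_left_mono)
          show "norm (s - a) \<le> 2 * e" using s a(1) dist_triangle2[of s a t0] by (auto simp: dist_norm dist_commute abs_minus_commute)
          show "0 \<le> C * M" using C0 M0 by simp
        qed
        also have "\<dots> = (C * (2 * e)) * M" by simp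
        also have "\<dots> \<le> (1 / 2) * M" using e(3) M0 by (rule mult_right_mono)
        finally show ?thesis using a(2) by simp
      qed
      hence "M \<le> M / 2" unfolding M_def using t0T by (intro cSUP_least) (auto simp: M_def[symmetric])
      hence "M \<le> 0" by simp
      thus ?thesis using M[OF b] norm_le_zero_iff[of "c b"] by (simp del: norm_le_zero_iff)
    qed
    moreover have "openin (top_of_set {0..1}) ?T" by (simp add: openin_open_Int)
    ultimately show "\<exists>T. openin (top_of_set {0..1}) T \<and> t0 \<in> T \<and> (\<forall>x\<in>T. \<forall>y\<in>T. c x = 0 \<longrightarrow> c y = 0)"
      using t0T by (intro exI[of _ ?T]) blast
  qed (use t \<open>c t = 0\<close> in auto)
  thus False using c0 by simp
qed

text \<open>The local Hamiltonian is made a parameter, so that it can be kept fixed while the curve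
  and the functions \<open>F i\<close> are moved by the torus.\<close>

definition ham_data where
  "ham_data \<iota> A br \<gamma> n F \<Omega> H \<longleftrightarrow> F ` {..<n} \<subseteq> A \<and> holomorphic_several n \<Omega> H \<and>
     (\<forall>t\<in>{0..1}. let p = \<lambda>i\<in>{..<n}. value_at \<iota> (\<gamma> t) (F i) in p \<in> \<Omega> \<and>
        (\<forall>f\<in>A. ((\<lambda>s. value_at \<iota> (\<gamma> s) f) has_vector_derivative
          (\<Sum>i<n. partial_deriv i H p * value_at \<iota> (\<gamma> t) (br (F i) f))) (at t within {0..1})))"

lemma hamiltonian_trajectory_iff:
  "hamiltonian_trajectory \<iota> A br Z \<gamma> \<longleftrightarrow>
     \<gamma> ` {0..1} \<subseteq> regular_part \<iota> A Z \<and> (\<exists>n F \<Omega> H. ham_data \<iota> A br \<gamma> n F \<Omega> H)"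
  unfolding hamiltonian_trajectory_def ham_data_def ..

lemma
  assumes "ham_data \<iota> A br \<gamma> n F \<Omega> H"
  shows ham_data_F: "i < n \<Longrightarrow> F i \<in> A"
    and ham_data_H: "holomorphic_several n \<Omega> H"
    and ham_data_p: "t \<in> {0..1} \<Longrightarrow> (\<lambda>i\<in>{..<n}. value_at \<iota> (\<gamma> t) (F i)) \<in> \<Omega>"
    and ham_data_deriv: "t \<in> {0..1} \<Longrightarrow> f \<in> A \<Longrightarrow> ((\<lambda>s. value_at \<iota> (\<gamma> s) f) has_vector_derivative
       (\<Sum>i<n. partial_deriv i H (\<lambda>i\<in>{..<n}. value_at \<iota> (\<gamma> t) (F i)) * value_at \<iota> (\<gamma> t) (br (F i) f)))
       (at t within {0..1})" using assms by (auto simp: ham_data_def Let_def)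

context cluster
begin

abbreviation "Y \<equiv> max_spec U"
abbreviation "val \<equiv> value_at \<iota>"
abbreviation "traj \<equiv> hamiltonian_trajectory \<iota> U br Y"

lemma point_val: "m \<in> Y \<Longrightarrow> point U (val m)" and kernel_val: "m \<in> Y \<Longrightarrow> kernel U (val m) = m"
  using point_value_at[OF fg_U] kernel_value_at[OF fg_U] by auto

lemma mem_val: "m \<in> Y \<Longrightarrow> f \<in> U \<Longrightarrow> f \<in> m \<longleftrightarrow> val m f = 0" using kernel_val[of m] by (auto simp: kernel_def)

text \<open>By \<open>br_frozen\<close>, a non-inverted frozen variable satisfies a linear equation along a
  trajectory.\<close>

lemma trajectory_frozen:
  assumes \<gamma>: "traj \<gamma>" and i: "i \<in> Ninv" and 0: "x i \<notin> \<gamma> 0" and t: "t \<in> {0..1}"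
  shows "x i \<notin> \<gamma> t"
proof -
  from \<gamma> obtain k F \<Omega> H where reg: "\<gamma> ` {0..1} \<subseteq> regular_part \<iota> U Y" and ham: "ham_data \<iota> U br \<gamma> k F \<Omega> H"
    unfolding hamiltonian_trajectory_iff by blast
  note FU = ham_data_F[OF ham] and der = ham_data_deriv[OF ham]
  have \<gamma>Y: "\<gamma> t \<in> Y" if "t \<in> {0..1}" for t using subsetD[OF reg imageI[OF that]] by (simp add: regular_part_def)
  have xU: "x i \<in> U" using x_in_U Ninv_N[OF i] by blast
  have "\<forall>j\<in>{..<k}. \<exists>g. g \<in> U \<and> br (F j) (x i) = g * x i" using br_frozen[of i] Ninv i FU by blast
  from bchoice[OF this] obtain g where g0: "\<forall>j\<in>{..<k}. g j \<in> U \<and> br (F j) (x i) = g j * x i" ..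
  hence g: "g j \<in> U" "br (F j) (x i) = g j * x i" if "j < k" for j using that by simp_all
  define p where "p t = (\<lambda>i\<in>{..<k}. val (\<gamma> t) (F i))" for t
  define A where "A t = (\<Sum>j<k. partial_deriv j H (p t) * val (\<gamma> t) (g j))" for t
  have cont: "((\<lambda>s. val (\<gamma> s) f) \<longlongrightarrow> val (\<gamma> t) f) (at t within {0..1})" if "t \<in> {0..1}" "f \<in> U" for t f
    using has_vector_derivative_continuous[OF der[OF that]] by (simp add: continuous_within)
  have "val (\<gamma> t) (x i) \<noteq> 0"
  proof (rule linear_ode_nonzero[of "\<lambda>t. val (\<gamma> t) (x i)" A])
    fix t :: real assume t: "t \<in> {0..1}"
    have "(\<Sum>j<k. partial_deriv j H (p t) * val (\<gamma> t) (br (F j) (x i))) = A t * val (\<gamma> t) (x i)"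
      unfolding A_def sum_distrib_right
      using g xU ptU_mult[OF point_val[OF \<gamma>Y[OF t]]] by (intro sum.cong refl) simp
    thus "((\<lambda>t. val (\<gamma> t) (x i)) has_vector_derivative A t * val (\<gamma> t) (x i)) (at t within {0..1})"
      using der[OF t xU] by (simp add: p_def)
    have "\<exists>r>0. \<exists>C. \<forall>q \<in> {..<k} \<rightarrow>\<^sub>E UNIV. (\<forall>i<k. dist (p t i) (q i) < r) \<longrightarrow> (\<forall>i<k. norm (partial_deriv i H q) \<le> C)"
      unfolding p_def by (rule partial_deriv_locally_bounded[OF ham_data_H[OF ham] ham_data_p[OF ham t]])
    then obtain r C where r: "r > 0"
      "\<forall>q \<in> {..<k} \<rightarrow>\<^sub>E UNIV. (\<forall>i<k. dist (p t i) (q i) < r) \<longrightarrow> (\<forall>i<k. norm (partial_deriv i H q) \<le> C)" by (elim exE conjE)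
    define C' where "C' = (\<Sum>j<k. \<bar>C\<bar> * (norm (val (\<gamma> t) (g j)) + 1))"
    \<comment> \<open>Values of regular functions are continuous along the trajectory. Near
      \<open>t\<close>, those of the \<open>F j\<close> stay in the box where the partial
      derivatives are bounded, and those of the \<open>g j\<close> move by less than 1.\<close>
    let ?P = "\<lambda>s. \<forall>j\<in>{..<k}. dist (val (\<gamma> s) (F j)) (val (\<gamma> t) (F j)) < r \<and> dist (val (\<gamma> s) (g j)) (val (\<gamma> t) (g j)) < 1"
    have "eventually ?P (at t within {0..1})"
    proof (intro eventually_ball_finite ballI eventually_conj)
      fix j assume "j \<in> {..<k}"
      hence j: "j < k" by simp
      show "\<forall>\<^sub>F s in at t within {0..1}. dist (val (\<gamma> s) (F j)) (val (\<gamma> t) (F j)) < r"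
        by (rule tendstoD[OF cont[OF t FU[OF j]] r(1)])
      show "\<forall>\<^sub>F s in at t within {0..1}. dist (val (\<gamma> s) (g j)) (val (\<gamma> t) (g j)) < 1"
        by (rule tendstoD[OF cont[OF t g(1)[OF j]]]) simp
    qed simp
    from this[unfolded eventually_at] obtain d where d0: "d > 0"
      "\<forall>s\<in>{0..1}. s \<noteq> t \<and> dist s t < d \<longrightarrow> ?P s" by (elim exE conjE)
    have d: "?P s" if s: "s \<in> {0..1}" "dist s t < d" for s
    proof (cases "s = t")
      case True thus ?thesis using r(1) by simp
    next
      case False thus ?thesis using bspec[OF d0(2) s(1)] s(2) by (simp only: simp_thms)
    qed
    have "norm (A s) \<le> C'" if s: "s \<in> {0..1}" "dist t s < d" for s
    proof -
      have P: "?P s" by (rule d[OF s(1)]) (use s(2) in \<open>simp add: dist_commute\<close>)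
      have "p s \<in> {..<k} \<rightarrow>\<^sub>E UNIV" by (simp add: p_def)
      moreover have "\<forall>i<k. dist (p t i) (p s i) < r" using P by (simp add: p_def dist_commute)
      ultimately have b: "norm (partial_deriv j H (p s)) \<le> C" if "j < k" for j using r(2) that by blast
      have "norm (A s) \<le> (\<Sum>j<k. norm (partial_deriv j H (p s) * val (\<gamma> s) (g j)))"
        unfolding A_def by (rule norm_sum)
      also have "\<dots> \<le> C'" unfolding C'_def norm_mult
      proof (intro sum_mono mult_mono)
        fix j assume j: "j \<in> {..<k}"
        show "norm (partial_deriv j H (p s)) \<le> \<bar>C\<bar>" using b[of j] j by simp
        have "dist (val (\<gamma> s) (g j)) (val (\<gamma> t) (g j)) < 1" using P j by blast
        thus "norm (val (\<gamma> s) (g j)) \<le> norm (val (\<gamma> t) (g j)) + 1"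
          using norm_triangle_sub[of "val (\<gamma> s) (g j)" "val (\<gamma> t) (g j)"] by (simp add: dist_norm)
      qed auto
      finally show ?thesis .
    qed
    hence "\<forall>s\<in>{0..1}. dist t s < d \<longrightarrow> norm (A s) \<le> C'" by (intro ballI impI)
    thus "\<exists>\<delta>>0. \<exists>C. \<forall>s\<in>{0..1}. dist t s < \<delta> \<longrightarrow> norm (A s) \<le> C" using d0(1) by blast
  next
    show "val (\<gamma> 0) (x i) \<noteq> 0" using 0 mem_val[OF \<gamma>Y xU] by simp
  qed (rule t)
  thus ?thesis using mem_val[OF \<gamma>Y[OF t] xU] by simp
qed

text \<open>The open set of the theorem. It may contain many leaves; that the torus permutes them
  transitively is what remains to be shown.\<close>

definition leaf :: "'f set set" where "leaf = {kernel U \<phi> | \<phi>. good \<phi>}"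

lemma leaf_iff: "m \<in> leaf \<longleftrightarrow> m \<in> Y \<and> good (val m)"
proof
  assume "m \<in> leaf"
  then obtain \<phi> where \<phi>: "good \<phi>" "m = kernel U \<phi>" by (auto simp: leaf_def)
  have p: "point U \<phi>" using \<phi> by (simp add: good_def)
  have m: "m \<in> Y" using kernel_max_spec[OF subalg_U p] \<phi> by simp
  moreover have "val m (x i) = \<phi> (x i)" if "i \<in> Ninv" for i
    unfolding \<phi>(2) using value_at_kernel[OF subalg_U p x_in_U] Ninv_N[OF that] by blast
  moreover have "spans_cotangent U (val m) N f = spans_cotangent U \<phi> N f" for f
    unfolding spans_cotangent_def using kernel_val[OF m] \<phi>(2) by simp
  ultimately show "m \<in> Y \<and> good (val m)" using \<phi>(1) point_val[OF m] by (simp add: good_def)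
next
  assume "m \<in> Y \<and> good (val m)"
  thus "m \<in> leaf" using kernel_val[of m] by (auto simp: leaf_def)
qed

lemma leaf_eq: "leaf = regular_part \<iota> U Y - (\<Union>i\<in>Ninv. zero_locus U (x i))"
proof -
  have "m \<in> leaf \<longleftrightarrow> m \<in> regular_part \<iota> U Y \<and> (\<forall>i\<in>Ninv. x i \<notin> m)" if m: "m \<in> Y" for m
  proof -
    have "x i \<in> m \<longleftrightarrow> val m (x i) = 0" if "i \<in> Ninv" for i
      using mem_val[OF m] x_in_U Ninv_N[OF that] by blast
    moreover have "m \<in> regular_part \<iota> U Y \<longleftrightarrow> good (val m)" if "\<forall>i\<in>Ninv. val m (x i) \<noteq> 0"
      using regular_iff_good[OF point_val[OF m] that] kernel_val[OF m] by simp
    ultimately show ?thesis using m unfolding leaf_iff by (auto simp: good_def)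
  qed
  thus ?thesis by (auto simp: leaf_iff zero_locus_def regular_part_def)
qed

lemma leaf_open: "zariski_open U leaf"
proof -
  \<comment> \<open>\<open>S\<close> collects the functions whose nonvanishing locus lies inside
    \<open>leaf\<close>; by \<open>good_open\<close> these loci cover it.\<close>
  define S where "S = {f \<in> U. \<forall>m\<in>Y. f \<notin> m \<longrightarrow> m \<in> leaf}"
  have "\<exists>f\<in>S. f \<notin> m" if m: "m \<in> leaf" for m
  proof -
    have mY: "m \<in> Y" "good (val m)" using m leaf_iff by auto
    obtain u where u: "u \<in> U" "val m u \<noteq> 0" "\<forall>\<phi>'. point U \<phi>' \<longrightarrow> \<phi>' u \<noteq> 0 \<longrightarrow> good \<phi>'"
      using good_open[OF mY(2)] by (elim bexE conjE)
    have "m' \<in> leaf" if "m' \<in> Y" "u \<notin> m'" for m'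
    proof -
      have "val m' u \<noteq> 0" using mem_val[OF that(1) u(1)] that(2) by simp
      hence "good (val m')" using u(3) point_val[OF that(1)] by simp
      thus ?thesis using that(1) by (simp add: leaf_iff)
    qed
    hence "u \<in> S" unfolding S_def using u(1) by blast
    moreover have "u \<notin> m" using mem_val[OF mY(1) u(1)] u(2) by simp
    ultimately show ?thesis by blast
  qed
  note 1 = this
  have 2: "m \<in> leaf" if "m \<in> Y" "f \<in> S" "f \<notin> m" for m f using that by (simp add: S_def)
  have "leaf = Y - (\<Inter>f\<in>S. {m \<in> Y. f \<in> m})"
  proof (intro equalityI subsetI)
    fix m assume m: "m \<in> leaf"
    obtain f where "f \<in> S" "f \<notin> m" using 1[OF m] by (elim bexE)
    thus "m \<in> Y - (\<Inter>f\<in>S. {m \<in> Y. f \<in> m})" using m leaf_iff by auto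
  next
    fix m assume "m \<in> Y - (\<Inter>f\<in>S. {m \<in> Y. f \<in> m})"
    then obtain f where "m \<in> Y" "f \<in> S" "f \<notin> m" by auto
    thus "m \<in> leaf" by (rule 2)
  qed
  moreover have "S \<subseteq> U" by (auto simp: S_def)
  ultimately show ?thesis unfolding zariski_open_def zero_locus_def by (intro exI[of _ S] conjI)
qed

lemma leaf_trajectory:
  assumes \<gamma>: "traj \<gamma>" and 0: "\<gamma> 0 \<in> leaf" and t: "t \<in> {0..1}"
  shows "\<gamma> t \<in> leaf"
proof -
  have "x i \<notin> \<gamma> t" if i: "i \<in> Ninv" for i
  proof (rule trajectory_frozen[OF \<gamma> i _ t])
    show "x i \<notin> \<gamma> 0" using 0 i unfolding leaf_eq by (auto simp: zero_locus_def regular_part_def)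
  qed
  moreover have "\<gamma> t \<in> regular_part \<iota> U Y" using \<gamma> t by (auto simp: hamiltonian_trajectory_iff)
  ultimately show ?thesis unfolding leaf_eq by (auto simp: zero_locus_def)
qed

section \<open>The torus acts on points and on Hamiltonian trajectories\<close>

lemma point_theta:
  assumes t: "t \<in> torus n" and \<phi>: "point U \<phi>" shows "point U (\<lambda>f. \<phi> (theta t f))"
proof -
  note A = automorphism_act[OF t]
  show ?thesis using theta_U_subset[OF t]
    by (simp add: point_def aut_const[OF A] aut_add[OF A] aut_mult[OF A] ptU_const[OF \<phi>]
      ptU_add[OF \<phi>] ptU_mult[OF \<phi>])
qed

text \<open>The image of an ideal corresponds to composing the character with the inverse
  automorphism, hence the inverse torus element on the right.\<close>

lemma kernel_theta:
  assumes t: "t \<in> torus n"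
  shows "theta t ` kernel U \<phi> = kernel U (\<lambda>f. \<phi> (theta (tinv n t) f))"
proof (intro equalityI subsetI)
  fix f assume "f \<in> theta t ` kernel U \<phi>"
  thus "f \<in> kernel U (\<lambda>f. \<phi> (theta (tinv n t) f))"
    using theta_U_subset[OF t] act_tinv(1)[OF t] by (auto simp: kernel_def)
next
  fix f assume f: "f \<in> kernel U (\<lambda>f. \<phi> (theta (tinv n t) f))"
  hence "theta (tinv n t) f \<in> kernel U \<phi>"
    using theta_U_subset[OF tinv_torus[OF t]] by (simp add: kernel_def)
  hence "theta t (theta (tinv n t) f) \<in> theta t ` kernel U \<phi>" by (rule imageI)
  thus "f \<in> theta t ` kernel U \<phi>" by (simp add: act_tinv(2)[OF t])
qed

lemma theta_Y:
  assumes t: "t \<in> torus n" and m: "m \<in> Y"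
  shows "theta t ` m \<in> Y" and "f \<in> U \<Longrightarrow> val (theta t ` m) f = val m (theta (tinv n t) f)"
proof -
  have p: "point U (\<lambda>f. val m (theta (tinv n t) f))"
    by (rule point_theta[OF tinv_torus[OF t] point_val[OF m]])
  have e: "theta t ` m = kernel U (\<lambda>f. val m (theta (tinv n t) f))"
    using kernel_theta[OF t, of "val m"] kernel_val[OF m] by simp
  show "theta t ` m \<in> Y" unfolding e by (rule kernel_max_spec[OF subalg_U p])
  show "f \<in> U \<Longrightarrow> val (theta t ` m) f = val m (theta (tinv n t) f)"
    unfolding e by (rule value_at_kernel[OF subalg_U p])
qed

lemma theta_leaf:
  assumes t: "t \<in> torus n" and m: "m \<in> leaf" shows "theta t ` m \<in> leaf"
proof -
  have mY: "m \<in> Y" "good (val m)" using m leaf_iff by auto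
  obtain f where f: "spans_cotangent U (val m) N f" using mY(2) by (auto simp: good_def)
  define \<phi> where "\<phi> = (\<lambda>f. val m (theta (tinv n t) f))"
  note t' = tinv_torus[OF t]
  note A = automorphism_act[OF t]
  have p: "point U \<phi>" unfolding \<phi>_def by (rule point_theta[OF t' point_val[OF mY(1)]])
  have e: "theta t ` m = kernel U \<phi>"
    using kernel_theta[OF t, of "val m"] kernel_val[OF mY(1)] by (simp add: \<phi>_def)
  have k: "kernel U (val m) = m" by (rule kernel_val[OF mY(1)])
  have sq: "theta t w \<in> sq U (kernel U \<phi>)" if "w \<in> sq U m" for w using that
  proof (induction rule: sq_induct)
    case (prod p q)
    thus ?case unfolding aut_mult[OF A] e[symmetric] by (intro sq_prod imageI)
  next
    case (add v w) thus ?case unfolding aut_add[OF A] by (intro sq_add)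
  qed
  have "spans_cotangent U \<phi> N (\<lambda>i. theta t (f i))" unfolding spans_cotangent_def
  proof (intro conjI allI impI ballI)
    show "theta t (f i) \<in> kernel U \<phi>" if "i < N" for i
      using f that k unfolding e[symmetric] by (auto simp: spans_cotangent_def)
    fix q assume "q \<in> kernel U \<phi>"
    then obtain q' where q': "q' \<in> m" "q = theta t q'" using e by blast
    then obtain c where c: "q' - (\<Sum>i<N. \<iota> (c i) * f i) \<in> sq U m" using f k by (auto simp: spans_cotangent_def)
    have "q - (\<Sum>i<N. \<iota> (c i) * theta t (f i)) \<in> sq U (kernel U \<phi>)"
      using sq[OF c] unfolding q'(2) by (simp add: aut_diff[OF A] aut_sum[OF A] aut_mult[OF A] aut_const[OF A])
    thus "\<exists>c. q - (\<Sum>i<N. \<iota> (c i) * theta t (f i)) \<in> sq U (kernel U \<phi>)" by blast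
  qed
  moreover have "\<phi> (x i) \<noteq> 0" if i: "i \<in> Ninv" for i
  proof -
    have iN: "i \<in> {1..N}" by (rule Ninv_N[OF i])
    have "\<phi> (x i) = tscale n \<nu> l (tinv n t) i * val m (x i)" unfolding \<phi>_def act_x[OF t' iN]
      using ptU_mult[OF point_val[OF mY(1)] U_const x_in_U[OF iN]] ptU_const[OF point_val[OF mY(1)]]
      by simp
    thus ?thesis using mY(2) i tscale_nz[OF t'] by (simp add: good_def)
  qed
  ultimately show ?thesis using p unfolding e leaf_def good_def by blast
qed

text \<open>The function \<open>H\<close> is kept and each \<open>F i\<close> is replaced by its
  translate. Values at translated points cancel the translation, and the bracket commutes with
  it.\<close>

lemma theta_trajectory:
  assumes t: "t \<in> torus n" and \<gamma>: "traj \<gamma>" and 0: "\<gamma> 0 \<in> leaf"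
  shows "traj (\<lambda>s. theta t ` \<gamma> s)"
proof -
  from \<gamma> obtain k F \<Omega> H where ham: "ham_data \<iota> U br \<gamma> k F \<Omega> H"
    unfolding hamiltonian_trajectory_iff by blast
  note FU = ham_data_F[OF ham]
  note t' = tinv_torus[OF t]
  have \<gamma>Y: "\<gamma> s \<in> Y" if "s \<in> {0..1}" for s using leaf_trajectory[OF \<gamma> 0 that] leaf_iff by blast
  have val: "val (theta t ` \<gamma> s) f = val (\<gamma> s) (theta (tinv n t) f)" if "s \<in> {0..1}" "f \<in> U" for s f
    by (rule theta_Y(2)[OF t \<gamma>Y[OF that(1)] that(2)])
  have p: "(\<lambda>i\<in>{..<k}. val (theta t ` \<gamma> s) (theta t (F i))) = (\<lambda>i\<in>{..<k}. val (\<gamma> s) (F i))" if "s \<in> {0..1}" for s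
    using val[OF that theta_U_subset[OF t FU]] act_tinv(1)[OF t] by (intro restrict_ext) simp
  have "ham_data \<iota> U br (\<lambda>s. theta t ` \<gamma> s) k (\<lambda>i. theta t (F i)) \<Omega> H" unfolding ham_data_def Let_def
  proof (intro conjI ballI)
    show "(\<lambda>i. theta t (F i)) ` {..<k} \<subseteq> U" using theta_U_subset[OF t FU] by auto
    show "holomorphic_several k \<Omega> H" by (rule ham_data_H[OF ham])
    fix s :: real assume s: "s \<in> {0..1}"
    show "(\<lambda>i\<in>{..<k}. val (theta t ` \<gamma> s) (theta t (F i))) \<in> \<Omega>" unfolding p[OF s] by (rule ham_data_p[OF ham s])
    fix f assume f: "f \<in> U"
    hence f': "theta (tinv n t) f \<in> U" by (rule theta_U_subset[OF t'])
    have e: "val (theta t ` \<gamma> s) (br (theta t (F i)) f) = val (\<gamma> s) (br (F i) (theta (tinv n t) f))" if "i < k" for i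
    proof -
      have "br (theta t (F i)) f = theta t (br (F i) (theta (tinv n t) f))"
        by (simp add: pbr_act[OF t, symmetric] act_tinv(2)[OF t])
      thus ?thesis using val[OF s theta_U_subset[OF t br_U[OF FU[OF that] f']]] by (simp add: act_tinv(1)[OF t])
    qed
    have sm: "(\<Sum>i<k. partial_deriv i H (\<lambda>i\<in>{..<k}. val (theta t ` \<gamma> s) (theta t (F i))) *
        val (theta t ` \<gamma> s) (br (theta t (F i)) f)) =
      (\<Sum>i<k. partial_deriv i H (\<lambda>i\<in>{..<k}. val (\<gamma> s) (F i)) * val (\<gamma> s) (br (F i) (theta (tinv n t) f)))"
      unfolding p[OF s] by (intro sum.cong refl) (simp add: e)
    show "((\<lambda>s. val (theta t ` \<gamma> s) f) has_vector_derivative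
      (\<Sum>i<k. partial_deriv i H (\<lambda>i\<in>{..<k}. val (theta t ` \<gamma> s) (theta t (F i))) *
        val (theta t ` \<gamma> s) (br (theta t (F i)) f))) (at s within {0..1})" unfolding sm using val[OF _ f]
      by (intro has_vector_derivative_transform[OF s _ ham_data_deriv[OF ham s f']]) simp
  qed
  moreover have "(\<lambda>s. theta t ` \<gamma> s) ` {0..1} \<subseteq> regular_part \<iota> U Y"
    using theta_leaf[OF t leaf_trajectory[OF \<gamma> 0]] unfolding leaf_eq by blast
  ultimately show ?thesis unfolding hamiltonian_trajectory_iff by blast
qed

abbreviation "hc \<equiv> hamiltonian_connected \<iota> U br Y"

lemma hc_refl: "hc m m" by (simp add: hamiltonian_connected_def)

lemma hc_trans: "hc m m' \<Longrightarrow> hc m' m'' \<Longrightarrow> hc m m''"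
  unfolding hamiltonian_connected_def by (rule rtranclp_trans)

lemma hc_trajectory: "traj \<gamma> \<Longrightarrow> hc (\<gamma> 0) (\<gamma> 1)" unfolding hamiltonian_connected_def by blast

text \<open>Both claims are proved together, because each trajectory of the path can be translated
  only once its starting point is known to lie in \<open>leaf\<close>.\<close>

lemma hc_leaf_theta:
  assumes "hc m m'" and "m \<in> leaf" and t: "t \<in> torus n"
  shows "m' \<in> leaf \<and> hc (theta t ` m) (theta t ` m')" using assms(1) unfolding hamiltonian_connected_def
proof (induction rule: rtranclp_induct)
  case base show ?case using assms(2) by simp
next
  case (step y z)
  then obtain \<gamma> where \<gamma>: "traj \<gamma>" "\<gamma> 0 = y" "\<gamma> 1 = z" by blast
  have "z \<in> leaf" using leaf_trajectory[OF \<gamma>(1), of 1] \<gamma> step by simp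
  moreover have "hc (theta t ` y) (theta t ` z)"
    using hc_trajectory[OF theta_trajectory[OF t \<gamma>(1)]] \<gamma> step by simp
  ultimately show ?case using step hc_trans unfolding hamiltonian_connected_def by blast
qed

end

lemma interpolation:
  fixes z v :: "'a \<Rightarrow> 'b::field"
  assumes "finite W" "inj_on z W"
  shows "\<exists>P. \<forall>w\<in>W. poly P (z w) = v w" using assms
proof (induction W rule: finite_induct)
  case (insert w0 W)
  then obtain P where P: "\<forall>w\<in>W. poly P (z w) = v w" by auto
  define Q where "Q = (\<Prod>w\<in>W. [:- z w, 1:])"
  have Q: "poly Q y = (\<Prod>w\<in>W. y - z w)" for y by (simp add: Q_def poly_prod)
  have "poly Q (z w) = 0" if "w \<in> W" for w using that insert(1) by (auto simp: Q)
  moreover have "poly Q (z w0) \<noteq> 0" using insert by (auto simp: Q)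
  ultimately have "\<forall>w\<in>insert w0 W. poly (P + [:(v w0 - poly P (z w0)) / poly Q (z w0):] * Q) (z w) = v w"
    using P by auto
  thus ?case by (rule exI)
qed simp

section \<open>Reachability and invariant ideals\<close>

context cluster
begin

text \<open>The Hamiltonian is \<open>a\<close> times the single function \<open>F\<close>. The
  constant rescales the flow to unit time and allows any complex direction, in particular the
  reversed one.\<close>

lemma trajectory_flowI:
  assumes F: "F \<in> U" and good: "\<And>t. t \<in> {0..1} \<Longrightarrow> good (\<Phi> t)"
    and der: "\<And>t f. t \<in> {0..1} \<Longrightarrow> f \<in> U \<Longrightarrow>
      ((\<lambda>s. \<Phi> s f) has_vector_derivative a * \<Phi> t (br F f)) (at t within {0..1})"
  shows "traj (\<lambda>t. kernel U (\<Phi> t))"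
proof -
  let ?H = "\<lambda>p :: nat \<Rightarrow> complex. a * p 0"
  have pt: "point U (\<Phi> t)" if "t \<in> {0..1}" for t using good[OF that] by (simp add: good_def)
  have pd: "partial_deriv 0 ?H p = a" for p
  proof -
    have "((\<lambda>z. a * z) has_field_derivative a) (at (p 0))" by (auto intro!: derivative_eq_intros)
    thus ?thesis unfolding partial_deriv_def by (simp add: DERIV_imp_deriv)
  qed
  have "ham_data \<iota> U br (\<lambda>t. kernel U (\<Phi> t)) 1 (\<lambda>_. F) (topspace (cspace 1)) ?H"
    unfolding ham_data_def Let_def
  proof (intro conjI ballI)
    show "(\<lambda>_. F) ` {..<1::nat} \<subseteq> U" using F by auto
    show "holomorphic_several 1 (topspace (cspace 1)) ?H" unfolding holomorphic_several_def
    proof (intro conjI ballI allI impI)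
      show "openin (cspace 1) (topspace (cspace 1))" by (rule openin_topspace)
      have 1: "continuous_map euclidean euclidean (\<lambda>z. a * z)"
        by (simp add: continuous_map_iff_continuous2 continuous_intros)
      have 2: "continuous_map (cspace 1) euclidean (\<lambda>p. p 0)"
        by (rule continuous_map_product_projection) simp
      show "continuous_map (subtopology (cspace 1) (topspace (cspace 1))) euclidean ?H"
        using continuous_map_compose[OF 2 1] by (simp only: comp_def subtopology_topspace)
      show "(\<lambda>z. ?H (p(i := z))) field_differentiable at (p i)" if "i < 1" for p i
        using that by (simp add: field_differentiable_mult)
    qed
    fix t :: real assume t: "t \<in> {0..1}"
    show "(\<lambda>i\<in>{..<1::nat}. val (kernel U (\<Phi> t)) F) \<in> topspace (cspace 1)" by simp
    fix f assume f: "f \<in> U"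
    have v: "val (kernel U (\<Phi> s)) h = \<Phi> s h" if "s \<in> {0..1}" "h \<in> U" for s h
      by (rule value_at_kernel[OF subalg_U pt[OF that(1)] that(2)])
    have "(\<Sum>i<1. partial_deriv i ?H (\<lambda>i\<in>{..<1::nat}. val (kernel U (\<Phi> t)) F) * val (kernel U (\<Phi> t)) (br F f)) = a * \<Phi> t (br F f)"
      using v[OF t br_U[OF F f]] by (simp add: pd)
    thus "((\<lambda>s. val (kernel U (\<Phi> s)) f) has_vector_derivative
      (\<Sum>i<1. partial_deriv i ?H (\<lambda>i\<in>{..<1::nat}. val (kernel U (\<Phi> t)) F) * val (kernel U (\<Phi> t)) (br F f))) (at t within {0..1})"
      using v[OF _ f] by (intro has_vector_derivative_transform[OF t _ der[OF t f], THEN has_vector_derivative_eq_rhs]) simp_all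
  qed
  moreover have "kernel U (\<Phi> t) \<in> leaf" if "t \<in> {0..1}" for t using good[OF that] by (auto simp: leaf_def)
  hence "(\<lambda>t. kernel U (\<Phi> t)) ` {0..1} \<subseteq> regular_part \<iota> U Y" unfolding leaf_eq by blast
  ultimately show ?thesis unfolding hamiltonian_trajectory_iff by blast
qed

text \<open>From points on a short piece of the flow of \<open>q\<close> starting at \<phi>, the
  point \<phi> can be reached by running the flow backwards. So \<open>h\<close> vanishes on this
  piece, and the bracket is its derivative at time 0.\<close>

lemma reachable_bracket:
  assumes \<phi>: "good \<phi>" and q: "q \<in> U" and h: "h \<in> U" and van: "\<And>m'. m' \<in> leaf \<Longrightarrow> hc m' (kernel U \<phi>) \<Longrightarrow> h \<in> m'"
  shows "\<phi> (br q h) = 0"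
proof -
  have p: "point U \<phi>" using \<phi> by (simp add: good_def)
  have D: "derivation (br q)" by (intro derivation_br)
  have "\<exists>r>0. \<exists>\<Phi>. (\<forall>f\<in>U. \<Phi> 0 f = \<phi> f) \<and> (\<forall>t. norm t < r \<longrightarrow> point U (\<Phi> t) \<and>
      (\<forall>f\<in>U. ((\<lambda>t. \<Phi> t f) has_field_derivative \<Phi> t (br q f)) (at t)))"
    by (rule flow[OF subalg_U p D _ fg_U]) (rule br_U[OF q])
  then obtain r \<Phi> where r: "r > 0" and \<Phi>0: "\<forall>f\<in>U. \<Phi> 0 f = \<phi> f"
    and \<Phi>': "\<forall>t. norm t < r \<longrightarrow> point U (\<Phi> t) \<and>
      (\<forall>f\<in>U. ((\<lambda>t. \<Phi> t f) has_field_derivative \<Phi> t (br q f)) (at t))" by (elim exE conjE)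
  have \<Phi>: "point U (\<Phi> t)" "f \<in> U \<Longrightarrow> ((\<lambda>t. \<Phi> t f) has_field_derivative \<Phi> t (br q f)) (at t)"
    if "norm t < r" for t f using \<Phi>' that by auto
  obtain u where u: "u \<in> U" "\<phi> u \<noteq> 0" "\<forall>\<phi>'. point U \<phi>' \<longrightarrow> \<phi>' u \<noteq> 0 \<longrightarrow> good \<phi>'"
    using good_open[OF \<phi>] by (elim bexE conjE)
  have "isCont (\<lambda>t. \<Phi> t u) 0" by (rule DERIV_isCont[OF \<Phi>(2)]) (use r u in auto)
  hence "eventually (\<lambda>t. \<Phi> t u \<noteq> 0) (at 0)"
    using \<Phi>0 u by (intro tendsto_imp_eventually_ne[where c = "\<phi> u"]) (auto simp: isCont_def)
  then obtain e where e: "e > 0" "\<And>t. t \<noteq> 0 \<Longrightarrow> dist t 0 < e \<Longrightarrow> \<Phi> t u \<noteq> 0" unfolding eventually_at by auto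
  define t1 where "t1 = min (r / 2) (e / 2)"
  have t1: "t1 > 0" "t1 < r" "t1 < e" using r e(1) by (auto simp: t1_def)
  have good: "good (\<Phi> t)" if "norm t \<le> t1" for t
  proof -
    have "\<Phi> t u \<noteq> 0" using e(2)[of t] that t1 u \<Phi>0 by (cases "t = 0") auto
    thus ?thesis using u(3) \<Phi>(1)[of t] that t1 by auto
  qed
  have \<Phi>h: "\<Phi> (of_real \<tau>) h = 0" if \<tau>: "\<tau> \<in> {0..t1}" for \<tau>
  proof -
    \<comment> \<open>The reversed path, from the point at time \<tau> to \<phi>, reparametrized to
      the unit interval.\<close>
    define \<Psi> where "\<Psi> s = \<Phi> (of_real \<tau> * (1 - of_real s))" for s
    have small: "norm (of_real \<tau> * (1 - of_real s) :: complex) \<le> t1" if "s \<in> {0..1}" for s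
    proof -
      have "of_real \<tau> * (1 - of_real s) = (of_real (\<tau> * (1 - s)) :: complex)" by simp
      hence "norm (of_real \<tau> * (1 - of_real s) :: complex) = \<tau> * (1 - s)"
        using \<tau> that by (simp only: norm_of_real) simp
      also have "\<dots> \<le> t1 * 1" using \<tau> that by (intro mult_mono) auto
      finally show ?thesis by simp
    qed
    have gd: "good (\<Psi> s)" if "s \<in> {0..1}" for s unfolding \<Psi>_def by (rule good[OF small[OF that]])
    have "traj (\<lambda>s. kernel U (\<Psi> s))"
    proof (rule trajectory_flowI[OF q gd, where a = "- of_real \<tau>"])
      fix s :: real and f assume s: "s \<in> {0..1}" and f: "f \<in> U"
      let ?z = "of_real \<tau> * (1 - of_real s) :: complex"
      have 1: "((\<lambda>z. of_real \<tau> * (1 - z)) has_field_derivative - of_real \<tau>) (at (of_real s))"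
        by (auto intro!: derivative_eq_intros)
      have 2: "((\<lambda>t. \<Phi> t f) has_field_derivative \<Phi> ?z (br q f)) (at ?z)"
        by (rule \<Phi>(2)[OF _ f]) (use small[OF s] t1 in linarith)
      have "((\<lambda>z. \<Phi> (of_real \<tau> * (1 - z)) f) has_field_derivative \<Phi> ?z (br q f) * - of_real \<tau>) (at (of_real s))"
        by (rule DERIV_chain2[OF 2 1])
      from has_vector_derivative_real_field[OF this]
      show "((\<lambda>s. \<Psi> s f) has_vector_derivative - of_real \<tau> * \<Psi> s (br q f)) (at s within {0..1})"
        by (simp add: \<Psi>_def mult.commute)
    qed
    from hc_trajectory[OF this] have "hc (kernel U (\<Psi> 0)) (kernel U (\<Psi> 1))" .
    moreover have "kernel U (\<Psi> 1) = kernel U \<phi>" using \<Phi>0 by (auto simp: \<Psi>_def kernel_def)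
    moreover have "kernel U (\<Psi> 0) \<in> leaf" using gd[of 0] by (auto simp: leaf_def)
    ultimately have "h \<in> kernel U (\<Psi> 0)" using van by simp
    thus ?thesis by (simp add: kernel_def \<Psi>_def)
  qed
  have "((\<lambda>\<tau>. \<Phi> (of_real \<tau>) h) has_vector_derivative \<Phi> (of_real 0) (br q h)) (at 0 within {0..t1})"
    by (rule has_vector_derivative_real_field[OF \<Phi>(2)[OF _ h]]) (use r in simp)
  moreover have "((\<lambda>\<tau>. \<Phi> (of_real \<tau>) h) has_vector_derivative 0) (at 0 within {0..t1})"
    by (rule has_vector_derivative_transform[OF _ _ has_vector_derivative_const]) (use \<Phi>h t1 in auto)
  ultimately have "\<Phi> (of_real 0) (br q h) = 0"
    using vector_derivative_unique_within_closed_interval[of 0 t1 0] t1(1) by (simp add: cbox_interval)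
  thus ?thesis using \<Phi>0 br_U[OF q h] by simp
qed

text \<open>On a function with finitely many weights, \<open>Ed p\<close> is a polynomial in the action of the
  torus element with entry \<open>2\<close> in position \<open>p\<close>.\<close>

lemma Ed_stable:
  assumes J: "is_ideal U J" and st: "\<And>t h. t \<in> torus n \<Longrightarrow> h \<in> J \<Longrightarrow> theta t h \<in> J"
    and h: "h \<in> J" and p: "p \<in> {1..n}"
  shows "Ed p h \<in> J"
proof -
  define t where "t = (\<lambda>i\<in>{1..n}. if i = p then 2 else 1 :: complex)"
  have t: "t \<in> torus n" by (auto simp: t_def torus_def)
  note A = automorphism_act[OF t]
  define w where "w a = (\<Sum>k=1..N. a k * \<nu> p k)" for a :: "nat \<Rightarrow> int"
  define z where "z m = (2 :: complex) powi (int l * m)" for m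
  have inj: "inj z"
  proof (rule injI)
    fix a c assume "z a = z c"
    hence "norm (z a) = norm (z c)" by simp
    hence "(2::real) powi (int l * a) = 2 powi (int l * c)" by (simp add: z_def norm_power_int)
    hence "int l * a = int l * c" using power_int_strict_increasing[of "int l * a" "int l * c" "2::real"]
        power_int_strict_increasing[of "int l * c" "int l * a" "2::real"] by (cases "int l * a" "int l * c" rule: linorder_cases) auto
    thus "a = c" using l_pos by simp
  qed
  have tsk: "ts t k = z (\<nu> p k)" for k
  proof -
    have "ts t k = (\<Prod>i=1..n. if i = p then z (\<nu> p k) else 1)"
      unfolding tscale_def by (intro prod.cong) (auto simp: t_def z_def)
    thus ?thesis using p by simp
  qed
  have lm: "lmon N (ts t) a = z (w a)" for a unfolding lmon_def tsk z_def w_def sum_distrib_left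
    by (subst prod_powi_sum[symmetric]) (simp_all add: power_int_mult[symmetric] ac_simps)
  have th: "(theta t ^^ j) (lmon N x a) = \<iota> (z (w a) ^ j) * lmon N x a" for j a
    by (induction j) (simp_all add: theta_lmon[OF t] lm aut_mult[OF A] aut_const[OF A] \<iota>_mult ac_simps del: \<iota>.hom_power)
  have Ed: "Ed p (lmon N x a) = \<iota> (of_int (w a)) * lmon N x a" for a
    unfolding Ed_def logder_lmon w_def \<iota>.hom_of_int by (simp only: of_int_sum of_int_mult)
  have hU: "h \<in> U" using h is_ideal_subset[OF J] by blast
  obtain M c where M: "finite M" "h = (\<Sum>a\<in>M. \<iota> (c a) * lmon N x a)"
    using Lau_UNIV_expand[OF U_Lau[OF hU]] by blast
  \<comment> \<open>Interpolation is possible because distinct weights have distinct eigenvalues: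
    the powers of 2 are distinct and \<open>l\<close> is positive.\<close>
  obtain P where P: "\<forall>m\<in>w ` M. poly P (z m) = of_int m"
    using interpolation[of "w ` M" z of_int] M(1) inj by (auto simp: inj_on_def inj_def)
  have thh: "(theta t ^^ j) h = (\<Sum>a\<in>M. \<iota> (c a * z (w a) ^ j) * lmon N x a)" for j
  proof -
    have 1: "(theta t ^^ j) (\<Sum>a\<in>M. g a) = (\<Sum>a\<in>M. (theta t ^^ j) (g a))" for g :: "(nat \<Rightarrow> int) \<Rightarrow> 'f"
      by (induction j) (simp_all add: aut_sum[OF A])
    have 2: "(theta t ^^ j) (\<iota> d * g) = \<iota> d * (theta t ^^ j) g" for d g
      by (induction j) (simp_all add: aut_mult[OF A] aut_const[OF A])
    show ?thesis unfolding M(2) 1 2 th \<iota>_mult mult.assoc ..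
  qed
  have "Ed p h = (\<Sum>a\<in>M. \<iota> (c a) * (\<iota> (of_int (w a)) * lmon N x a))"
    unfolding M(2) by (simp add: der_sum[OF derivation_Ed] der_scale[OF derivation_Ed] Ed)
  also have "\<dots> = (\<Sum>a\<in>M. \<Sum>j\<le>Polynomial.degree P. \<iota> (poly.coeff P j) * (\<iota> (c a * z (w a) ^ j) * lmon N x a))"
  proof (intro sum.cong refl)
    fix a assume "a \<in> M"
    hence "of_int (w a) = (\<Sum>j\<le>Polynomial.degree P. poly.coeff P j * z (w a) ^ j)" using P by (simp add: poly_altdef)
    hence "\<iota> (of_int (w a)) = (\<Sum>j\<le>Polynomial.degree P. \<iota> (poly.coeff P j * z (w a) ^ j))" by (simp only: \<iota>.hom_sum)
    thus "\<iota> (c a) * (\<iota> (of_int (w a)) * lmon N x a) =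
      (\<Sum>j\<le>Polynomial.degree P. \<iota> (poly.coeff P j) * (\<iota> (c a * z (w a) ^ j) * lmon N x a))"
      by (simp only: sum_distrib_left sum_distrib_right \<iota>_mult ac_simps)
  qed
  also have "\<dots> = (\<Sum>j\<le>Polynomial.degree P. \<iota> (poly.coeff P j) * (theta t ^^ j) h)"
    by (subst sum.swap) (simp only: thh sum_distrib_left)
  also have "\<dots> \<in> J"
  proof (intro is_ideal_sum[OF J] is_ideal_mult[OF J] U_const)
    show "(theta t ^^ j) h \<in> J" for j using h by (induction j) (auto intro: st[OF t])
  qed
  finally show ?thesis .
qed

definition reach :: "'f set \<Rightarrow> 'f set \<Rightarrow> bool" where
  "reach m m' \<longleftrightarrow> (\<exists>m1. hc m m1 \<and> (\<exists>t\<in>torus n. m' = theta t ` m1))"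

lemma theta_theta: "s \<in> torus n \<Longrightarrow> t \<in> torus n \<Longrightarrow> theta s ` theta t ` m = theta (tmult n s t) ` m"
  by (simp add: image_image act_act)

lemma theta_tinv: "t \<in> torus n \<Longrightarrow> theta (tinv n t) ` theta t ` m = m" by (simp add: image_image act_tinv)

lemma theta_tinv': "t \<in> torus n \<Longrightarrow> theta t ` theta (tinv n t) ` m = m" by (simp add: image_image act_tinv)

lemma reach_theta: "t \<in> torus n \<Longrightarrow> reach m (theta t ` m)" unfolding reach_def using hc_refl by blast

lemma reach_hc: assumes m: "hc m m'" shows "reach m m'"
proof -
  define e where "e = (\<lambda>i\<in>{1..n}. 1 :: complex)"
  have e: "e \<in> torus n" by (auto simp: e_def torus_def)
  have "tmult n e (tinv n e) = e" by (auto simp: e_def tmult_def tinv_def restrict_def)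
  hence "theta e ` m' = m'" using theta_theta[OF e tinv_torus[OF e], of m'] theta_tinv'[OF e, of m'] by simp
  thus ?thesis unfolding reach_def using m e by metis
qed

lemma reach_leaf: "m \<in> leaf \<Longrightarrow> reach m m' \<Longrightarrow> m' \<in> leaf"
  using hc_leaf_theta theta_leaf unfolding reach_def by blast

text \<open>The torus element between the two Hamiltonian paths is moved past the second one by
  translating that path back.\<close>

lemma reach_trans:
  assumes m: "m \<in> leaf" and 1: "reach m m'" and 2: "reach m' m''" shows "reach m m''"
proof -
  obtain m1 t where t: "hc m m1" "t \<in> torus n" "m' = theta t ` m1" using 1 unfolding reach_def by blast
  obtain m2 s where s: "hc m' m2" "s \<in> torus n" "m'' = theta s ` m2" using 2 unfolding reach_def by blast
  have "m' \<in> leaf" using reach_leaf m 1 by blast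
  hence "hc (theta (tinv n t) ` m') (theta (tinv n t) ` m2)"
    using hc_leaf_theta[OF s(1)] tinv_torus[OF t(2)] by blast
  hence "hc m1 (theta (tinv n t) ` m2)" using theta_tinv[OF t(2)] t(3) by simp
  hence "hc m (theta (tinv n t) ` m2)" using hc_trans t(1) by blast
  moreover have "m'' = theta (tmult n s t) ` theta (tinv n t) ` m2"
    using s(3) theta_theta[OF s(2) t(2)] theta_tinv'[OF t(2)] by metis
  ultimately show ?thesis unfolding reach_def using tmult_torus[OF s(2) t(2)] by blast
qed

lemma torus_point_reach:
  assumes m: "m \<in> leaf" shows "\<exists>m'\<in>leaf. reach m' m \<and> X \<notin> m'"
proof (rule ccontr)
  assume no: "\<not> (\<exists>m'\<in>leaf. reach m' m \<and> X \<notin> m')"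
  define J where "J = {h \<in> U. \<forall>m'\<in>leaf. reach m' m \<longrightarrow> h \<in> m'}"
  have J_I: "h \<in> J" if "h \<in> U" "\<And>m'. m' \<in> leaf \<Longrightarrow> reach m' m \<Longrightarrow> h \<in> m'" for h using that by (simp add: J_def)
  have J_U: "h \<in> U" if "h \<in> J" for h using that by (simp add: J_def)
  have J_D: "h \<in> m'" if "h \<in> J" "m' \<in> leaf" "reach m' m" for h m' using that by (simp add: J_def)
  have ideal: "is_ideal U m'" if "m' \<in> leaf" for m'
    using that max_spec_prime[OF subalg_U] leaf_iff by (auto simp: is_prime_def)
  have J: "is_ideal U J" unfolding is_ideal_def
  proof (intro conjI ballI)
    show "J \<subseteq> U" using J_U by blast
    show "0 \<in> J" by (rule J_I[OF U_0 is_ideal_0[OF ideal]])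
    fix f assume f: "f \<in> J"
    show "f + g \<in> J" if g: "g \<in> J" for g
      by (rule J_I[OF U_add[OF J_U[OF f] J_U[OF g]] is_ideal_add[OF ideal J_D[OF f] J_D[OF g]]])
    show "g * f \<in> J" if g: "g \<in> U" for g
      by (rule J_I[OF U_mult[OF g J_U[OF f]] is_ideal_mult[OF ideal J_D[OF f] g]])
  qed
  have Jth: "theta t h \<in> J" if t: "t \<in> torus n" and h: "h \<in> J" for t h
  proof (rule J_I[OF theta_U_subset[OF t J_U[OF h]]])
    fix m' assume m': "m' \<in> leaf" "reach m' m"
    let ?m = "theta (tinv n t) ` m'"
    have l: "?m \<in> leaf" by (rule theta_leaf[OF tinv_torus[OF t] m'(1)])
    have "reach ?m m'" using reach_theta[OF t, of ?m] by (simp only: theta_tinv'[OF t])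
    hence "h \<in> ?m" using J_D[OF h l reach_trans[OF l _ m'(2)]] by blast
    hence "theta t h \<in> theta t ` ?m" by (rule imageI)
    thus "theta t h \<in> m'" by (simp only: theta_tinv'[OF t])
  qed
  have Jbr: "br q h \<in> J" if h: "h \<in> J" and q: "q \<in> U" for h q
  proof (rule J_I[OF br_U[OF q J_U[OF h]]])
    fix m' assume m': "m' \<in> leaf" "reach m' m"
    hence l': "m' \<in> Y" "good (val m')" using leaf_iff by auto
    have "h \<in> m''" if l: "m'' \<in> leaf" and "hc m'' (kernel U (val m'))" for m''
    proof -
      have "reach m'' m'" using reach_hc[OF that(2)] kernel_val[OF l'(1)] by simp
      thus ?thesis by (rule J_D[OF h l reach_trans[OF l _ m'(2)]])
    qed
    hence "val m' (br q h) = 0" by (rule reachable_bracket[OF l'(2) q J_U[OF h]])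
    thus "br q h \<in> m'" using mem_val[OF l'(1) br_U[OF q J_U[OF h]]] by simp
  qed
  have mY: "m \<in> Y" "good (val m)" using m leaf_iff by auto
  have "J \<subseteq> kernel U (val m)" using J_D[OF _ m reach_hc[OF hc_refl]] kernel_val[OF mY(1)] by blast
  hence "J = {0}" by (rule invariant_ideal_zero[OF mY(2) J]) (fact Jbr, rule Ed_stable[OF J Jth])
  moreover have "X \<in> J" using no by (intro J_I[OF X_U]) blast
  ultimately show False using X_nz by simp
qed

end

section \<open>Transitivity on the points of the cluster torus\<close>

context cluster
begin

lemma hc_flow_x:
  assumes p: "\<forall>i\<in>{1..N}. p i \<noteq> 0" and j: "j \<in> {1..N}"
  shows "hc (kernel U (ev p)) (kernel U (ev (\<lambda>i. p i * exp (s * of_int (\<Lambda> j i)))))"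
proof -
  define w where "w i = s * of_int (\<Lambda> j i)" for i
  define \<Phi> where "\<Phi> t = ev (\<lambda>i. p i * exp (of_real t * w i))" for t :: real
  have q: "\<forall>i\<in>{1..N}. p i * exp (of_real t * w i) \<noteq> 0" for t :: real using p by simp
  have "traj (\<lambda>t. kernel U (\<Phi> t))"
  \<comment> \<open>The diagonal of \<Lambda> is zero, so \<open>x j\<close> keeps its value
    \<open>p j\<close> along its own flow. Dividing by it makes the motion of every coordinate
    exponential, with rates proportional to row \<open>j\<close> of \<Lambda>.\<close>
  proof (rule trajectory_flowI[OF x_in_U[OF j], where a = "s / p j"])
    fix t :: real
    show "good (\<Phi> t)" unfolding \<Phi>_def by (rule torus_point_good[OF point_ev_U[OF q] ev_X[OF q]])
    fix f assume f: "f \<in> U"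
    note P = point_ev[OF q[of t], folded \<Phi>_def]
    let ?g = "logder (\<lambda>i. of_int (\<Lambda> j i)) f"
    have g: "?g \<in> Lau UNIV"
    proof (rule der_preserves_Lau[OF derivation_logder, of _ "\<lambda>i. of_int (\<Lambda> j i)" "{}", unfolded cone_def, simplified])
      show "f \<in> Lau UNIV" by (rule U_Lau[OF f])
    qed (auto simp: logder_x intro: sub_of_int[OF subalg_L])
    have e1: "logder (\<lambda>i. \<iota> (w i)) f = \<iota> s * ?g"
      unfolding logder_eq_sum[of "\<lambda>i. \<iota> (w i)"] logder_eq_sum[of "\<lambda>i. of_int (\<Lambda> j i)"]
      by (simp add: w_def \<iota>_mult \<iota>.hom_of_int sum_distrib_left mult.assoc)
    have \<Lambda>0: "\<Lambda> j j = 0" using \<Lambda>_skew[OF j j] by simp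
    have xL: "x j \<in> Lau UNIV" using x_in_Lau[OF j] Lau_UNIV by blast
    have "\<Phi> t (x j) = p j" unfolding \<Phi>_def using ev_x[OF q j] by (simp add: w_def \<Lambda>0)
    hence "s / p j * \<Phi> t (br (x j) f) = s * \<Phi> t ?g"
      using p j by (simp add: br_x[OF j] pt_mult[OF subalg_L P xL g])
    also have "\<dots> = \<Phi> t (\<iota> s * ?g)" by (simp add: pt_mult[OF subalg_L P sub_const[OF subalg_L] g] pt_const[OF subalg_L P])
    finally show "((\<lambda>s. \<Phi> s f) has_vector_derivative s / p j * \<Phi> t (br (x j) f)) (at t within {0..1})"
      using ev_derivative[OF p U_Lau[OF f], of w t "{0..1}"] by (simp add: \<Phi>_def e1)
  qed
  from hc_trajectory[OF this] show ?thesis by (simp add: \<Phi>_def w_def)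
qed

lemma hc_flow_cluster:
  assumes p: "\<forall>i\<in>{1..N}. p i \<noteq> 0" and k: "k \<le> N"
  shows "hc (kernel U (ev p)) (kernel U (ev (\<lambda>i. p i * exp (\<Sum>j=1..k. s j * of_int (\<Lambda> j i)))))" using k
proof (induction k)
  case 0 show ?case by (simp add: hc_refl)
next
  case (Suc k)
  define q where "q i = p i * exp (\<Sum>j=1..k. s j * of_int (\<Lambda> j i))" for i
  have q: "\<forall>i\<in>{1..N}. q i \<noteq> 0" using p by (simp add: q_def)
  have "hc (kernel U (ev p)) (kernel U (ev q))"
    using Suc.IH Suc.prems unfolding q_def[abs_def] by (simp only: Suc_leD)
  moreover have "hc (kernel U (ev q)) (kernel U (ev (\<lambda>i. q i * exp (s (Suc k) * of_int (\<Lambda> (Suc k) i)))))"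
    by (rule hc_flow_x[OF q]) (use Suc in auto)
  moreover have "(\<lambda>i. q i * exp (s (Suc k) * of_int (\<Lambda> (Suc k) i))) =
     (\<lambda>i. p i * exp (\<Sum>j=1..Suc k. s j * of_int (\<Lambda> j i)))"
  proof
    fix i
    have "(\<Sum>j=1..Suc k. s j * of_int (\<Lambda> j i)) = (\<Sum>j=1..k. s j * of_int (\<Lambda> j i)) + s (Suc k) * of_int (\<Lambda> (Suc k) i)"
      by simp
    thus "q i * exp (s (Suc k) * of_int (\<Lambda> (Suc k) i)) = p i * exp (\<Sum>j=1..Suc k. s j * of_int (\<Lambda> j i))"
      by (simp only: q_def exp_add mult.assoc)
  qed
  ultimately show ?case using hc_trans by (simp only:)
qed

lemma spanning_complex:
  fixes z :: "nat \<Rightarrow> complex"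
  shows "\<exists>s s'. \<forall>k\<in>{1..N}. z k = (\<Sum>j=1..N. s j * of_int (\<Lambda> j k)) + (\<Sum>p=1..n. s' p * of_int (\<nu> p k))"
proof -
  obtain \<Delta> c c' where 1: "\<forall>y\<in>{1..N}. \<Delta> y \<noteq> 0 \<and> (\<forall>k\<in>{1..N}. (if k = y then \<Delta> y else 0) =
    (\<Sum>j=1..N. c y j * \<Lambda> j k) + (\<Sum>p=1..n. c' y p * \<nu> p k))" using spanning by metis
  define e where "e y = z y / of_int (\<Delta> y)" for y
  define s where "s j = (\<Sum>y=1..N. e y * of_int (c y j))" for j
  define s' where "s' p = (\<Sum>y=1..N. e y * of_int (c' y p))" for p
  have "z k = (\<Sum>j=1..N. s j * of_int (\<Lambda> j k)) + (\<Sum>p=1..n. s' p * of_int (\<nu> p k))" if k: "k \<in> {1..N}" for k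
  proof -
    have "z k = e k * of_int (\<Delta> k)" using 1 k by (simp add: e_def)
    also have "\<dots> = (\<Sum>y=1..N. if y = k then e k * of_int (\<Delta> k) else 0)" using k by simp
    also have "\<dots> = (\<Sum>y=1..N. e y * of_int (if k = y then \<Delta> y else 0))" by (intro sum.cong) auto
    also have "\<dots> = (\<Sum>y=1..N. e y * of_int ((\<Sum>j=1..N. c y j * \<Lambda> j k) + (\<Sum>p=1..n. c' y p * \<nu> p k)))"
    proof (intro sum.cong refl)
      fix y assume "y \<in> {1..N}"
      hence "(if k = y then \<Delta> y else 0) = (\<Sum>j=1..N. c y j * \<Lambda> j k) + (\<Sum>p=1..n. c' y p * \<nu> p k)"
        using 1 k by blast
      thus "e y * of_int (if k = y then \<Delta> y else 0) =
        e y * of_int ((\<Sum>j=1..N. c y j * \<Lambda> j k) + (\<Sum>p=1..n. c' y p * \<nu> p k))" by (simp only:)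
    qed
    also have "\<dots> = (\<Sum>y=1..N. \<Sum>j=1..N. e y * of_int (c y j) * of_int (\<Lambda> j k)) +
        (\<Sum>y=1..N. \<Sum>p=1..n. e y * of_int (c' y p) * of_int (\<nu> p k))"
      by (simp only: of_int_add of_int_sum of_int_mult distrib_left sum.distrib sum_distrib_left mult.assoc)
    also have "(\<Sum>y=1..N. \<Sum>j=1..N. e y * of_int (c y j) * of_int (\<Lambda> j k)) = (\<Sum>j=1..N. s j * of_int (\<Lambda> j k))"
      by (subst sum.swap) (simp only: s_def sum_distrib_right)
    also have "(\<Sum>y=1..N. \<Sum>p=1..n. e y * of_int (c' y p) * of_int (\<nu> p k)) = (\<Sum>p=1..n. s' p * of_int (\<nu> p k))"
      by (subst sum.swap) (simp only: s'_def sum_distrib_right)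
    finally show ?thesis .
  qed
  thus ?thesis by blast
qed

text \<open>The logarithms of the ratios of the coordinates are split by
  \<open>spanning_complex\<close> into a combination of rows of \<Lambda>, realized by the flows of
  the \<open>x j\<close>, and a combination of the \<nu> p, realized by the torus.\<close>

lemma reach_torus_points:
  assumes m: "m \<in> leaf" "X \<notin> m" and m': "m' \<in> leaf" "X \<notin> m'"
  shows "reach m m'"
proof -
  have Y: "m \<in> Y" "m' \<in> Y" using m m' leaf_iff by auto
  note P = point_val[OF Y(1)] and P' = point_val[OF Y(2)]
  have nz: "val m X \<noteq> 0" "val m' X \<noteq> 0" using mem_val[OF Y(1) X_U] mem_val[OF Y(2) X_U] m m' by auto
  define p where "p i = val m (x i)" for i
  define p' where "p' i = val m' (x i)" for i
  have p: "\<forall>i\<in>{1..N}. p i \<noteq> 0" "\<forall>i\<in>{1..N}. p' i \<noteq> 0"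
    using nz by (auto simp: pt_X[OF P] pt_X[OF P'] p_def p'_def)
  obtain s s' where s: "\<forall>k\<in>{1..N}. ln (p' k / p k) =
      (\<Sum>j=1..N. s j * of_int (\<Lambda> j k)) + (\<Sum>i=1..n. s' i * of_int (\<nu> i k))"
    using spanning_complex[of "\<lambda>k. ln (p' k / p k)"] by blast
  define q where "q i = p i * exp (\<Sum>j=1..N. s j * of_int (\<Lambda> j i))" for i
  have q: "\<forall>i\<in>{1..N}. q i \<noteq> 0" using p by (simp add: q_def)
  have "kernel U (ev p) = m"
  proof -
    have "kernel U (ev p) = kernel U (val m)"
      using torus_point_eq_ev[OF P nz(1)] by (auto simp: kernel_def p_def[abs_def])
    thus ?thesis using kernel_val[OF Y(1)] by simp
  qed
  hence hc: "hc m (kernel U (ev q))" using hc_flow_cluster[OF p(1), of N s] by (simp add: q_def[abs_def])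
  \<comment> \<open>The sign accounts for the torus acting on points through the inverse on
    functions, and the division by \<open>l\<close> for the exponent \<open>l\<close> in the
    action.\<close>
  define t where "t = (\<lambda>i\<in>{1..n}. exp (- s' i / of_nat l))"
  have t: "t \<in> torus n" by (auto simp: t_def torus_def)
  have t': "tinv n t \<in> torus n" by (rule tinv_torus[OF t])
  have ts: "tscale n \<nu> l (tinv n t) k = exp (\<Sum>i=1..n. s' i * of_int (\<nu> i k))" for k
  proof -
    have "tinv n t i powi (int l * \<nu> i k) = exp (s' i * of_int (\<nu> i k))" if i: "i \<in> {1..n}" for i
    proof -
      have "tinv n t i = exp (s' i / of_nat l)" using i by (simp add: tinv_def t_def exp_minus)
      hence "tinv n t i powi (int l * \<nu> i k) = exp (of_int (int l * \<nu> i k) * (s' i / of_nat l))"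
        by (simp only: exp_power_int)
      also have "of_int (int l * \<nu> i k) * (s' i / of_nat l) = s' i * of_int (\<nu> i k)" using l_pos by simp
      finally show ?thesis .
    qed
    thus ?thesis unfolding tscale_def by (simp add: exp_sum)
  qed
  define \<phi> where "\<phi> = (\<lambda>f. ev q (theta (tinv n t) f))"
  have \<phi>: "point U \<phi>" unfolding \<phi>_def by (rule point_theta[OF t' point_ev_U[OF q]])
  have \<phi>x: "p' k = \<phi> (x k)" if k: "k \<in> {1..N}" for k
  proof -
    note E = point_ev_U[OF q]
    have "\<phi> (x k) = tscale n \<nu> l (tinv n t) k * q k" unfolding \<phi>_def act_x[OF t' k]
      by (simp add: ptU_mult[OF E U_const x_in_U[OF k]] ptU_const[OF E] ev_x[OF q k])
    also have "\<dots> = p k * exp (ln (p' k / p k))" using s k by (simp add: ts q_def exp_add)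
    also have "\<dots> = p' k" using p k by simp
    finally show ?thesis by simp
  qed
  have "theta t ` kernel U (ev q) = kernel U \<phi>" unfolding \<phi>_def by (rule kernel_theta[OF t])
  also have "\<dots> = kernel U (val m')"
    using torus_point_unique[OF P' \<phi> nz(2)] \<phi>x by (auto simp: kernel_def p'_def)
  also have "\<dots> = m'" by (rule kernel_val[OF Y(2)])
  finally show ?thesis using hc t unfolding reach_def by blast
qed

lemma torus_orbit_eq_reach: "torus_orbit \<iota> N x n \<nu> l {m'. hc m m'} = {m'. reach m m'}"
  unfolding torus_orbit_def reach_def by auto

lemma main:
  "\<exists>S. symplectic_leaf \<iota> U br Y S \<and> zariski_open U (torus_orbit \<iota> N x n \<nu> l S) \<and>
     torus_orbit \<iota> N x n \<nu> l S = regular_part \<iota> U Y - (\<Union>i\<in>Ninv. zero_locus U (x i))"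
proof -
  obtain \<phi> where \<phi>: "point U \<phi>" "\<phi> X \<noteq> 0" using point_nonvanishing[OF fg_U X_U X_nz] by blast
  define m where "m = kernel U \<phi>"
  have m: "m \<in> leaf" using torus_point_good[OF \<phi>] by (auto simp: leaf_def m_def)
  have Xm: "X \<notin> m" using \<phi> by (simp add: m_def kernel_def)
  have "reach m m'" if m': "m' \<in> leaf" for m'
  proof -
    \<comment> \<open>The point \<open>m\<close> reaches every point of the cluster torus, in
      particular one from which \<open>m'\<close> can be reached.\<close>
    obtain m1 where m1: "m1 \<in> leaf" "reach m1 m'" "X \<notin> m1" using torus_point_reach[OF m'] by blast
    show ?thesis by (rule reach_trans[OF m reach_torus_points[OF m Xm m1(1,3)] m1(2)])
  qed
  hence orbit: "torus_orbit \<iota> N x n \<nu> l {m'. hc m m'} = leaf"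
    unfolding torus_orbit_eq_reach using reach_leaf[OF m] by blast
  have "m \<in> regular_part \<iota> U Y" using m unfolding leaf_eq by blast
  hence "symplectic_leaf \<iota> U br Y {m'. hc m m'}" by (rule symplectic_leaf.regular)
  thus ?thesis using orbit leaf_open leaf_eq by metis
qed

end

theorem theoremA:
  fixes \<iota> :: "complex \<Rightarrow> 'f::field"
    and N n l :: nat
    and ex Inv Ninv :: "nat set"
    and x :: "nat \<Rightarrow> 'f"
    and b \<Lambda> \<nu> :: "nat \<Rightarrow> nat \<Rightarrow> int"
  assumes "unital_ring_hom \<iota>"
    and "N > 0"
    and "ex \<subseteq> {1..N}"
    and "Inv \<union> Ninv = {1..N} - ex"
    and "Inv \<inter> Ninv = {}"
    and "is_seed \<iota> N ex (x, b)"
    and "finitely_generated_algebra \<iota> (upper_cluster_algebra \<iota> N ex Inv Ninv (x, b))"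
    and "compatible N ex b \<Lambda>"
    and "kernel_basis N ex b n \<nu>"
    and "l > 0"
  shows "let U = upper_cluster_algebra \<iota> N ex Inv Ninv (x, b);
             Y = max_spec U;
             br = gsv_bracket \<iota> N x \<Lambda>
         in \<exists>S. symplectic_leaf \<iota> U br Y S \<and>
                zariski_open U (torus_orbit \<iota> N x n \<nu> l S) \<and>
                torus_orbit \<iota> N x n \<nu> l S =
                  regular_part \<iota> U Y - (\<Union>i\<in>Ninv. zero_locus U (x i))"
proof -
  interpret cluster \<iota> N x b \<Lambda> ex Inv Ninv n \<nu> l
    by unfold_locales (use assms in \<open>simp_all add: is_seed_def\<close>)
  have "gsv_bracket \<iota> N x \<Lambda> = br" by (rule gsv_bracket_eq) (rule \<Lambda>_skew)
  thus ?thesis using main unfolding Let_def U_def by simp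
qed

end
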